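(* For integers $A,B$ with $B\neq 0$ and $A^2-4B\neq 0$, let $E_{A,B}/\mathbb{Q}$ be the elliptic curve $y^2=x^3+Ax^2+Bx$, let $\phi\colon E_{A,B}\to E'_{A,B}$ be the degree-two isogeny with kernel $\{O,(0,0)\}$, and let $\hat\phi\colon E'_{A,B}\to E_{A,B}$ be its dual. Define \[ t(A,B):=\mathrm{ord}_2\frac{|\mathrm{Sel}_\phi(E_{A,B}/\mathbb{Q})|}{|\mathrm{Sel}_{\hat\phi}(E'_{A,B}/\mathbb{Q})|}. \] Let \[ \mathcal{E}(X):=\{(A,B)\in\mathbb{Z}^2:\ |A|\le X,\ B^2\le X,\ B\neq 0,\ A^2-4B\neq 0,\ \text{and for every prime } p,\ p^4\mid B \Rightarrow p^2\nmid A\}. \] Then as $X\to\infty$ the values $t(A,B)$, $(A,B)\in\mathcal{E}(X)$, become normally distributed with mean $0$ and variance $2\log\log X$: for every $z\in\mathbb{R}$, \[ \lim_{X\to\infty}\frac{1}{\#\mathcal{E}(X)}\#\{(A,B)\in\mathcal{E}(X): t(A,B)\le z\sqrt{2\log\log X}\}=\frac{1}{\sqrt{2\pi}}\int_{-\infty}^z e^{-t^2/2}\,dt. \]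
   Context: For an elliptic curve $E/\mathbb{Q}$ with a rational isogeny $\phi\colon E\to E'$ with kernel $C$, the short exact sequence $0\to C\to E(\overline{\mathbb{Q}})\xrightarrow{\phi}E'(\overline{\mathbb{Q}})\to 0$ gives connecting (Kummer) maps $\delta_v\colon E'(\mathbb{Q}_v)/\phi(E(\mathbb{Q}_v))\to H^1(\mathbb{Q}_v,C)$ for each place $v$ of $\mathbb{Q}$. The $\phi$-Selmer group $\mathrm{Sel}_\phi(E/\mathbb{Q})$ is the subgroup of $H^1(\mathbb{Q},C)$ consisting of classes whose restriction to $H^1(\mathbb{Q}_v,C)$ lies in the image of $\delta_v$ for every place $v$. The $\hat\phi$-Selmer group $\mathrm{Sel}_{\hat\phi}(E'/\mathbb{Q})\subset H^1(\mathbb{Q},C')$, $C'=\ker\hat\phi=\phi(E[2])$, is defined in the same way with the roles of $(E,C,\phi)$ and $(E',C',\hat\phi)$ exchanged. Both are finite-dimensional $\mathbb{F}_2$-vector spaces. *)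

theory Defs
  imports
    "HOL-Analysis.Analysis"
    "HOL-Computational_Algebra.Primes"
    "HOL-Algebra.Bij"
    "HOL-Algebra.QuotRing"
    "HOL-Algebra.Algebraic_Closure"
    "HOL-Algebra.Algebraic_Closure_Type"
begin

section \<open>Places of the rationals and completions\<close>

definition rat_ord :: "nat \<Rightarrow> rat \<Rightarrow> int" where
  "rat_ord p x = int (multiplicity (int p) (fst (quotient_of x)))
               - int (multiplicity (int p) (snd (quotient_of x)))"

datatype place = Infinite_Place | Finite_Place nat

definition places :: "place set" where
  "places = insert Infinite_Place (Finite_Place ` {p. Factorial_Ring.prime p})"

fun place_abs :: "place \<Rightarrow> rat \<Rightarrow> rat" where
  "place_abs Infinite_Place x = \<bar>x\<bar>"
| "place_abs (Finite_Place p) x = (if x = 0 then 0 else of_nat p powi (- rat_ord p x))"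

definition cauchy_for :: "(rat \<Rightarrow> rat) \<Rightarrow> (nat \<Rightarrow> rat) \<Rightarrow> bool" where
  "cauchy_for f s \<longleftrightarrow> (\<forall>\<epsilon>>0. \<exists>N. \<forall>m\<ge>N. \<forall>n\<ge>N. f (s m - s n) < \<epsilon>)"

definition null_for :: "(rat \<Rightarrow> rat) \<Rightarrow> (nat \<Rightarrow> rat) \<Rightarrow> bool" where
  "null_for f s \<longleftrightarrow> (\<forall>\<epsilon>>0. \<exists>N. \<forall>n\<ge>N. f (s n) < \<epsilon>)"

definition cauchy_ring :: "(rat \<Rightarrow> rat) \<Rightarrow> (nat \<Rightarrow> rat) ring" where
  "cauchy_ring f =
    \<lparr>carrier = {s. cauchy_for f s},
     mult = (\<lambda>s t n. s n * t n), one = (\<lambda>n. 1),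
     zero = (\<lambda>n. 0), add = (\<lambda>s t n. s n + t n)\<rparr>"

text \<open>The completion \<open>\<rat>\<^sub>v\<close> is the ring of Cauchy sequences modulo the null sequences; the
  completion at the infinite place is the field of real numbers.\<close>

definition completion :: "place \<Rightarrow> (nat \<Rightarrow> rat) set ring" where
  "completion v = cauchy_ring (place_abs v) Quot {s. null_for (place_abs v) s}"

locale rat_abs =
  fixes f :: "rat \<Rightarrow> rat"
  assumes nonneg: "0 \<le> f x"
    and zero_iff: "f x = 0 \<longleftrightarrow> x = 0"
    and mult: "f (x * y) = f x * f y"
    and triangle: "f (x + y) \<le> f x + f y"
begin

lemma f_one: "f 1 = 1"
proof -
  have "f 1 * f 1 = f 1 * 1" using mult[of 1 1] by simp
  moreover have "f 1 \<noteq> 0" using zero_iff[of 1] by simp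
  ultimately show ?thesis by (metis mult_left_cancel)
qed

lemma f_minus: "f (- x) = f x"
proof -
  have "f (-1) * f (-1) = 1" using mult[of "-1" "-1"] f_one by simp
  then have "f (-1) = 1" using nonneg[of "-1"] by (simp add: square_eq_1_iff)
  then show ?thesis using mult[of "-1" x] by simp
qed

lemma f_inverse: "f (inverse x) = inverse (f x)"
proof (cases "x = 0")
  case True then show ?thesis using zero_iff[of 0] by simp
next
  case False
  then have "f x * f (inverse x) = 1" using mult[of x "inverse x"] f_one by simp
  then show ?thesis by (metis inverse_unique)
qed

lemma cauchy_const: "cauchy_for f (\<lambda>n. c)"
  using zero_iff[of 0] by (simp add: cauchy_for_def)

lemma null_cauchy:
  assumes "null_for f s" shows "cauchy_for f s"
  unfolding cauchy_for_def
proof (intro allI impI)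
  fix e :: rat assume "e > 0"
  then have "e/2 > 0" by simp
  then obtain N where N: "\<And>n. n \<ge> N \<Longrightarrow> f (s n) < e/2" using assms unfolding null_for_def by blast
  have "f (s m - s n) < e" if "m \<ge> N" "n \<ge> N" for m n
    using triangle[of "s m" "- s n"] f_minus[of "s n"] N[OF that(1)] N[OF that(2)] by simp
  then show "\<exists>N. \<forall>m\<ge>N. \<forall>n\<ge>N. f (s m - s n) < e" by blast
qed

lemma cauchy_add:
  assumes "cauchy_for f s" "cauchy_for f t" shows "cauchy_for f (\<lambda>n. s n + t n)"
  unfolding cauchy_for_def
proof (intro allI impI)
  fix e :: rat assume "e > 0"
  then have e: "e/2 > 0" by simp
  obtain M where M: "\<And>m n. m \<ge> M \<Longrightarrow> n \<ge> M \<Longrightarrow> f (s m - s n) < e/2"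
    using assms(1) e unfolding cauchy_for_def by blast
  obtain N where N: "\<And>m n. m \<ge> N \<Longrightarrow> n \<ge> N \<Longrightarrow> f (t m - t n) < e/2"
    using assms(2) e unfolding cauchy_for_def by blast
  have "f (s m + t m - (s n + t n)) < e" if "m \<ge> max M N" "n \<ge> max M N" for m n
    using triangle[of "s m - s n" "t m - t n"] M[of m n] N[of m n] that
    by (simp add: algebra_simps)
  then show "\<exists>N. \<forall>m\<ge>N. \<forall>n\<ge>N. f (s m + t m - (s n + t n)) < e" by blast
qed

lemma cauchy_uminus: "cauchy_for f s \<Longrightarrow> cauchy_for f (\<lambda>n. - s n)"
  unfolding cauchy_for_def using f_minus
  by (metis minus_diff_eq minus_diff_minus)

lemma cauchy_bounded:
  assumes "cauchy_for f s" obtains K N where "K > 0" "\<And>n. n \<ge> N \<Longrightarrow> f (s n) < K"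
proof -
  obtain N where N: "\<And>m n. m \<ge> N \<Longrightarrow> n \<ge> N \<Longrightarrow> f (s m - s n) < 1"
    using assms unfolding cauchy_for_def by (meson zero_less_one)
  have "f (s n) < f (s N) + 1" if "n \<ge> N" for n
    using triangle[of "s n - s N" "s N"] N[of n N] that by simp
  moreover have "f (s N) + 1 > 0" using nonneg[of "s N"] by simp
  ultimately show ?thesis using that by blast
qed

lemma cauchy_mult:
  assumes "cauchy_for f s" "cauchy_for f t" shows "cauchy_for f (\<lambda>n. s n * t n)"
  unfolding cauchy_for_def
proof (intro allI impI)
  fix e :: rat assume e: "e > 0"
  obtain K1 N1 where K1: "K1 > 0" "\<And>n. n \<ge> N1 \<Longrightarrow> f (s n) < K1" using cauchy_bounded[OF assms(1)] by blast
  obtain K2 N2 where K2: "K2 > 0" "\<And>n. n \<ge> N2 \<Longrightarrow> f (t n) < K2" using cauchy_bounded[OF assms(2)] by blast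
  have "e / (2*K2) > 0" using e K2 by simp
  then obtain M where M: "\<And>m n. m \<ge> M \<Longrightarrow> n \<ge> M \<Longrightarrow> f (s m - s n) < e / (2*K2)"
    using assms(1) unfolding cauchy_for_def by blast
  have "e / (2*K1) > 0" using e K1 by simp
  then obtain N where N: "\<And>m n. m \<ge> N \<Longrightarrow> n \<ge> N \<Longrightarrow> f (t m - t n) < e / (2*K1)"
    using assms(2) unfolding cauchy_for_def by blast
  let ?N = "Max {M,N,N1,N2}"
  have "f (s m * t m - s n * t n) < e" if "m \<ge> ?N" "n \<ge> ?N" for m n
  proof -
    have eq: "s m * t m - s n * t n = s m * (t m - t n) + (s m - s n) * t n" by (simp add: algebra_simps)
    have "f (s m * t m - s n * t n) \<le> f (s m) * f (t m - t n) + f (s m - s n) * f (t n)"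
      unfolding eq using triangle[of "s m * (t m - t n)" "(s m - s n) * t n"] by (simp add: mult)
    moreover have "f (s m) * f (t m - t n) < K1 * (e / (2*K1))"
      using that K1 N[of m n] nonneg by (intro mult_strict_mono) auto
    moreover have "f (s m - s n) * f (t n) < (e / (2*K2)) * K2"
      using that K2 M[of m n] nonneg e by (intro mult_strict_mono) auto
    ultimately show ?thesis using K1(1) K2(1) by simp
  qed
  then show "\<exists>N. \<forall>m\<ge>N. \<forall>n\<ge>N. f (s m * t m - s n * t n) < e" by blast
qed

lemma null_add:
  assumes "null_for f s" "null_for f t" shows "null_for f (\<lambda>n. s n + t n)"
  unfolding null_for_def
proof (intro allI impI)
  fix e :: rat assume "e > 0"
  then have e: "e/2 > 0" by simp
  obtain M where M: "\<And>n. n \<ge> M \<Longrightarrow> f (s n) < e/2" using assms(1) e unfolding null_for_def by blast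
  obtain N where N: "\<And>n. n \<ge> N \<Longrightarrow> f (t n) < e/2" using assms(2) e unfolding null_for_def by blast
  have "f (s n + t n) < e" if "n \<ge> max M N" for n
    using triangle[of "s n" "t n"] M[of n] N[of n] that by simp
  then show "\<exists>N. \<forall>n\<ge>N. f (s n + t n) < e" by blast
qed

lemma null_uminus: "null_for f s \<Longrightarrow> null_for f (\<lambda>n. - s n)"
  unfolding null_for_def by (simp add: f_minus)

lemma null_mult:
  assumes "null_for f s" "cauchy_for f t" shows "null_for f (\<lambda>n. t n * s n)"
  unfolding null_for_def
proof (intro allI impI)
  fix e :: rat assume e: "e > 0"
  obtain K N where K: "K > 0" "\<And>n. n \<ge> N \<Longrightarrow> f (t n) < K" using cauchy_bounded[OF assms(2)] by blast
  have "e / K > 0" using e K by simp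
  then obtain M where M: "\<And>n. n \<ge> M \<Longrightarrow> f (s n) < e / K" using assms(1) unfolding null_for_def by blast
  have "f (t n * s n) < e" if "n \<ge> max M N" for n
  proof -
    have "f (t n) * f (s n) < K * (e / K)"
      using that K M[of n] nonneg by (intro mult_strict_mono) auto
    then show ?thesis using K by (simp add: mult)
  qed
  then show "\<exists>N. \<forall>n\<ge>N. f (t n * s n) < e" by blast
qed

lemma not_null_away:
  assumes c: "cauchy_for f s" and "\<not> null_for f s"
  obtains d N where "d > 0" "\<And>n. n \<ge> N \<Longrightarrow> d < f (s n)"
proof -
  obtain e where e: "e > 0" and inf: "\<And>N. \<exists>n\<ge>N. e \<le> f (s n)"
    using assms(2) unfolding null_for_def by (meson not_less)
  have "e/2 > 0" using e by simp
  then obtain N where N: "\<And>m n. m \<ge> N \<Longrightarrow> n \<ge> N \<Longrightarrow> f (s m - s n) < e/2"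
    using c unfolding cauchy_for_def by blast
  obtain m where m: "m \<ge> N" "e \<le> f (s m)" using inf by blast
  have "e/2 < f (s n)" if "n \<ge> N" for n
    using triangle[of "s m - s n" "s n"] N[of m n] m that by simp
  then show ?thesis using that \<open>e/2 > 0\<close> by blast
qed

lemma cauchy_inverse:
  assumes c: "cauchy_for f s" and n: "\<not> null_for f s"
  shows "cauchy_for f (\<lambda>n. inverse (s n))"
  unfolding cauchy_for_def
proof (intro allI impI)
  fix e :: rat assume e: "e > 0"
  obtain d N where d: "d > 0" "\<And>n. n \<ge> N \<Longrightarrow> d < f (s n)" using not_null_away[OF assms] by blast
  have "e * d * d > 0" using e d by simp
  then obtain M where M: "\<And>m n. m \<ge> M \<Longrightarrow> n \<ge> M \<Longrightarrow> f (s m - s n) < e * d * d"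
    using c unfolding cauchy_for_def by blast
  have "f (inverse (s m) - inverse (s n)) < e" if "m \<ge> max M N" "n \<ge> max M N" for m n
  proof -
    have dm: "d < f (s m)" "d < f (s n)" using d that by auto
    then have nz: "s m \<noteq> 0" "s n \<noteq> 0" using d(1) zero_iff[of 0] by auto
    have "inverse (s m) - inverse (s n) = (s n - s m) * (inverse (s m) * inverse (s n))"
      using nz by (simp add: field_simps)
    then have eq: "f (inverse (s m) - inverse (s n)) = f (s n - s m) / (f (s m) * f (s n))"
      by (simp add: mult f_inverse divide_inverse)
    have "d * d < f (s m) * f (s n)" using dm d by (intro mult_strict_mono) auto
    then have "e * (d * d) < e * (f (s m) * f (s n))" using e by simp
    then have "f (s n - s m) < e * (f (s m) * f (s n))" using M[of n m] that by (simp add: mult.assoc)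
    moreover have "f (s m) * f (s n) > 0" using dm d(1) by simp
    ultimately show ?thesis unfolding eq by (simp add: field_simps)
  qed
  then show "\<exists>N. \<forall>m\<ge>N. \<forall>n\<ge>N. f (inverse (s m) - inverse (s n)) < e" by blast
qed

lemma cring_cauchy_ring: "cring (cauchy_ring f)"
proof (rule cringI)
  show "abelian_group (cauchy_ring f)"
  proof (rule abelian_groupI)
    fix s assume "s \<in> carrier (cauchy_ring f)"
    then show "\<exists>t\<in>carrier (cauchy_ring f). t \<oplus>\<^bsub>cauchy_ring f\<^esub> s = \<zero>\<^bsub>cauchy_ring f\<^esub>"
      by (intro bexI[of _ "\<lambda>n. - s n"]) (auto simp: cauchy_ring_def cauchy_uminus)
  qed (auto simp: cauchy_ring_def cauchy_add cauchy_const algebra_simps)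
  show "comm_monoid (cauchy_ring f)"
    by (rule comm_monoidI) (auto simp: cauchy_ring_def cauchy_mult cauchy_const algebra_simps)
qed (auto simp: cauchy_ring_def algebra_simps)

lemma maximalideal_null: "maximalideal {s. null_for f s} (cauchy_ring f)"
proof -
  interpret C: cring "cauchy_ring f" by (rule cring_cauchy_ring)
  let ?C = "cauchy_ring f" and ?N = "{s. null_for f s}"
  have ainv: "\<ominus>\<^bsub>?C\<^esub> s = (\<lambda>n. - s n)" if "s \<in> carrier ?C" for s
  proof (rule C.minus_equality)
    show "(\<lambda>n. - s n) \<oplus>\<^bsub>?C\<^esub> s = \<zero>\<^bsub>?C\<^esub>" by (simp add: cauchy_ring_def)
    show "(\<lambda>n. - s n) \<in> carrier ?C" using that by (simp add: cauchy_ring_def cauchy_uminus)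
  qed (fact that)
  have sub: "?N \<subseteq> carrier ?C" by (auto simp: cauchy_ring_def null_cauchy)
  have null0: "null_for f (\<lambda>n. 0)" using zero_iff[of 0] by (simp add: null_for_def)
  have "subgroup ?N (add_monoid ?C)"
  proof (rule C.add.subgroupI)
    show "?N \<subseteq> carrier ?C" by (rule sub)
    show "?N \<noteq> {}" using null0 by blast
    show "\<ominus>\<^bsub>?C\<^esub> s \<in> ?N" if "s \<in> ?N" for s
      using ainv[of s] sub that by (auto simp: null_uminus)
    show "s \<oplus>\<^bsub>?C\<^esub> t \<in> ?N" if "s \<in> ?N" "t \<in> ?N" for s t
      using that null_add by (simp add: cauchy_ring_def)
  qed
  then have id: "ideal ?N ?C"
  proof (rule idealI[OF C.ring_axioms])
    fix s t assume st: "s \<in> ?N" "t \<in> carrier ?C"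
    then show "t \<otimes>\<^bsub>?C\<^esub> s \<in> ?N" using null_mult by (simp add: cauchy_ring_def)
    then show "s \<otimes>\<^bsub>?C\<^esub> t \<in> ?N" using st C.m_comm[of s t] sub by auto
  qed
  show ?thesis
  proof (rule maximalidealI[OF id])
    have "\<not> null_for f (\<lambda>n. 1)" unfolding null_for_def using f_one
      by (metis less_irrefl order_refl zero_less_one)
    then show "carrier ?C \<noteq> ?N" using cauchy_const[of 1] by (auto simp: cauchy_ring_def)
  next
    fix J assume J: "ideal J ?C" "?N \<subseteq> J" "J \<subseteq> carrier ?C"
    interpret J: ideal J ?C by (rule J(1))
    show "J = ?N \<or> J = carrier ?C"
    proof (cases "J = ?N")
      case False
      then obtain s where s: "s \<in> J" "\<not> null_for f s" using J(2) by blast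
      then have cs: "cauchy_for f s" using J(3) by (auto simp: cauchy_ring_def)
      let ?t = "\<lambda>n. inverse (s n)"
      have t: "cauchy_for f ?t" by (rule cauchy_inverse[OF cs s(2)])
      obtain d N where d: "d > 0" "\<And>n. n \<ge> N \<Longrightarrow> d < f (s n)" using not_null_away[OF cs s(2)] by blast
      have "f (1 + - (?t n * s n)) = 0" if "n \<ge> N" for n
        using d(1) d(2)[OF that] zero_iff[of "s n"] zero_iff[of 0] by auto
      then have "null_for f (\<lambda>n. 1 + - (?t n * s n))"
        unfolding null_for_def by (metis)
      then have nJ: "(\<lambda>n. 1 + - (?t n * s n)) \<in> J" using J(2) by blast
      have "(\<lambda>n. ?t n * s n) \<in> J"
        using J.I_l_closed[OF s(1), of ?t] t by (simp add: cauchy_ring_def)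
      from J.a_closed[OF nJ this] have "\<one>\<^bsub>?C\<^esub> \<in> J" by (simp add: cauchy_ring_def)
      then show ?thesis using J.one_imp_carrier by blast
    qed simp
  qed
qed

lemma field_quotient: "field (cauchy_ring f Quot {s. null_for f s})"
  by (rule maximalideal.quotient_is_field[OF maximalideal_null cring_cauchy_ring])

end

lemma rat_ord_fraction:
  assumes "Factorial_Ring.prime p" "a \<noteq> 0" "b \<noteq> 0"
  shows "rat_ord p (of_int a / of_int b) = int (multiplicity (int p) a) - int (multiplicity (int p) b)"
proof -
  obtain n d where q: "quotient_of (of_int a / of_int b) = (n, d)" by fastforce
  have d: "d > 0" using quotient_of_denom_pos[OF q] .
  have "(of_int a :: rat) / of_int b = of_int n / of_int d" using quotient_of_div[OF q] .
  then have "(of_int (a * d) :: rat) = of_int (n * b)" using d assms by (simp add: field_simps)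
  then have eq: "a * d = n * b" by (simp only: of_int_eq_iff)
  then have n: "n \<noteq> 0" using assms d by auto
  have p: "prime_elem (int p)" using assms(1) by simp
  have "multiplicity (int p) a + multiplicity (int p) d = multiplicity (int p) n + multiplicity (int p) b"
    using prime_elem_multiplicity_mult_distrib[OF p, of a d]
      prime_elem_multiplicity_mult_distrib[OF p, of n b] eq assms d n by simp
  then show ?thesis unfolding rat_ord_def q by simp
qed

lemma rat_abs_place:
  assumes "v \<in> places" shows "rat_abs (place_abs v)"
proof (cases v)
  case Infinite_Place
  then show ?thesis by unfold_locales (auto simp: abs_mult)
next
  case (Finite_Place p)
  then have p: "Factorial_Ring.prime p" using assms by (auto simp: places_def)
  then have p1: "(1::rat) < of_nat p" using prime_gt_1_nat by auto
  have pe: "prime_elem (int p)" using p by simp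
  have repr: "\<exists>a b. b \<noteq> 0 \<and> x = of_int a / of_int b" for x :: rat
    by (metis quotient_of_div quotient_of_denom_pos surj_pair less_irrefl)
  show ?thesis unfolding Finite_Place
  proof
    fix x y :: rat
    show "0 \<le> place_abs (Finite_Place p) x" using p1 by simp
    show "place_abs (Finite_Place p) x = 0 \<longleftrightarrow> x = 0" using p1 by simp
    obtain a b where x: "b \<noteq> 0" "x = of_int a / of_int b" using repr by blast
    obtain c d where y: "d \<noteq> 0" "y = of_int c / of_int d" using repr by blast
    show "place_abs (Finite_Place p) (x * y)
        = place_abs (Finite_Place p) x * place_abs (Finite_Place p) y"
    proof (cases "x = 0 \<or> y = 0")
      case False
      then have nz: "a \<noteq> 0" "c \<noteq> 0" using x y by auto
      have "x * y = of_int (a * c) / of_int (b * d)" using x y by simp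
      then have "rat_ord p (x * y) = rat_ord p x + rat_ord p y"
        using nz x y rat_ord_fraction[OF p, of "a*c" "b*d"] rat_ord_fraction[OF p, of a b]
          rat_ord_fraction[OF p, of c d] prime_elem_multiplicity_mult_distrib[OF pe, of a c]
          prime_elem_multiplicity_mult_distrib[OF pe, of b d] by simp
      then show ?thesis using False p1 by (simp add: power_int_add[symmetric])
    qed auto
    have "place_abs (Finite_Place p) (x + y)
        \<le> max (place_abs (Finite_Place p) x) (place_abs (Finite_Place p) y)"
    proof (cases "x = 0 \<or> y = 0 \<or> x + y = 0")
      case True
      then show ?thesis using p1 by (auto simp: le_max_iff_disj)
    next
      case False
      let ?a = "a * d" and ?c = "c * b" and ?m = "b * d"
      have e: "x = of_int ?a / of_int ?m" "y = of_int ?c / of_int ?m"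
          "x + y = of_int (?a + ?c) / of_int ?m"
        using x y by (simp_all add: field_simps)
      have nz: "?a \<noteq> 0" "?c \<noteq> 0" "?m \<noteq> 0" using False x y by auto
      have nz3: "?a + ?c \<noteq> 0"
      proof
        assume "?a + ?c = 0"
        then have "x + y = 0" unfolding e(3) by (simp only: of_int_0 div_0)
        then show False using False by blast
      qed
      let ?k = "min (multiplicity (int p) ?a) (multiplicity (int p) ?c)"
      have "int p ^ ?k dvd ?a" "int p ^ ?k dvd ?c"
        by (meson multiplicity_dvd' min.cobounded1 min.cobounded2)+
      then have "int p ^ ?k dvd ?a + ?c" by (rule dvd_add)
      then have "?k \<le> multiplicity (int p) (?a + ?c)"
        using multiplicity_geI[of "?a + ?c" "int p" ?k] nz3 p prime_gt_1_nat[OF p] by auto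
      then have "min (rat_ord p x) (rat_ord p y) \<le> rat_ord p (x + y)"
        using rat_ord_fraction[OF p nz(1,3)] rat_ord_fraction[OF p nz(2,3)]
          rat_ord_fraction[OF p nz3 nz(3)] by (simp only: e(1)[symmetric] e(2)[symmetric] e(3)[symmetric])
      then have "- rat_ord p (x + y) \<le> - rat_ord p x \<or> - rat_ord p (x + y) \<le> - rat_ord p y" by linarith
      then show ?thesis using False p1 by (auto simp: le_max_iff_disj intro: power_int_increasing)
    qed
    moreover have "0 \<le> place_abs (Finite_Place p) x" "0 \<le> place_abs (Finite_Place p) y"
      using p1 by simp_all
    ultimately show "place_abs (Finite_Place p) (x + y)
        \<le> place_abs (Finite_Place p) x + place_abs (Finite_Place p) y" by linarith
  qed
qed

lemma field_completion: "v \<in> places \<Longrightarrow> field (completion v)"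
  unfolding completion_def by (intro rat_abs.field_quotient rat_abs_place)


section \<open>The algebraic closures of the rationals and of the completions\<close>

abbreviation Q_ring :: "rat ring" where
  "Q_ring \<equiv> ring_of_type_algebra"

definition Qbar :: "((rat list \<times> nat) multiset \<Rightarrow> rat) ring" where
  "Qbar = field.alg_closure Q_ring"

definition Q_in_Qbar :: "((rat list \<times> nat) multiset \<Rightarrow> rat) set" where
  "Q_in_Qbar = ring.indexed_const Q_ring ` carrier Q_ring"

type_synonym local_element = "((nat \<Rightarrow> rat) set list \<times> nat) multiset \<Rightarrow> (nat \<Rightarrow> rat) set"

definition Qvbar :: "place \<Rightarrow> local_element ring" where
  "Qvbar v = field.alg_closure (completion v)"

definition Qv_in_Qvbar :: "place \<Rightarrow> local_element set" where
  "Qv_in_Qvbar v = ring.indexed_const (completion v) ` carrier (completion v)"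

lemma algebraic_closure_Qbar: "algebraic_closure Qbar Q_in_Qbar"
  unfolding Qbar_def Q_in_Qbar_def by (rule field.alg_closureE(1)) auto

lemma algebraic_closure_Qvbar: "v \<in> places \<Longrightarrow> algebraic_closure (Qvbar v) (Qv_in_Qvbar v)"
  unfolding Qvbar_def Qv_in_Qvbar_def by (rule field.alg_closureE(1)) (rule field_completion)

text \<open>A chosen embedding of the algebraic closures; the restriction maps on cohomology below do
  not depend on the choice.\<close>

definition closure_embedding ::
    "place \<Rightarrow> ((rat list \<times> nat) multiset \<Rightarrow> rat) \<Rightarrow> local_element" where
  "closure_embedding v = (SOME h. h \<in> ring_hom Qbar (Qvbar v))"


section \<open>The elliptic curves and the two isogenies\<close>

datatype 'a point = Infinity | Affine 'a 'a

context field
begin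

abbreviation of_integer :: "int \<Rightarrow> 'a" where
  "of_integer k \<equiv> [k] \<cdot> \<one>"

abbreviation quotient :: "'a \<Rightarrow> 'a \<Rightarrow> 'a" (infixl \<open>\<oslash>\<close> 70) where
  "x \<oslash> y \<equiv> x \<otimes> inv y"

definition on_curve :: "int \<Rightarrow> int \<Rightarrow> 'a \<Rightarrow> 'a \<Rightarrow> bool" where
  "on_curve A B x y \<longleftrightarrow>
     y [^] (2::nat) = x [^] (3::nat) \<oplus> of_integer A \<otimes> x [^] (2::nat) \<oplus> of_integer B \<otimes> x"

definition slope :: "int \<Rightarrow> int \<Rightarrow> 'a \<Rightarrow> 'a \<Rightarrow> 'a \<Rightarrow> 'a \<Rightarrow> 'a" where
  "slope A B x1 y1 x2 y2 =
     (if x1 = x2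
      then (of_integer 3 \<otimes> x1 [^] (2::nat) \<oplus> of_integer (2 * A) \<otimes> x1 \<oplus> of_integer B)
             \<oslash> (of_integer 2 \<otimes> y1)
      else (y2 \<ominus> y1) \<oslash> (x2 \<ominus> x1))"

fun point_add :: "int \<Rightarrow> int \<Rightarrow> 'a point \<Rightarrow> 'a point \<Rightarrow> 'a point" where
  "point_add A B Infinity Q = Q"
| "point_add A B P Infinity = P"
| "point_add A B (Affine x1 y1) (Affine x2 y2) =
     (if x1 = x2 \<and> y2 = \<ominus> y1 then Infinity
      else let m = slope A B x1 y1 x2 y2;
               x3 = m [^] (2::nat) \<ominus> of_integer A \<ominus> x1 \<ominus> x2
           in Affine x3 (m \<otimes> (x1 \<ominus> x3) \<ominus> y1))"

text \<open>\<open>E\<^sub>A\<^sub>,\<^sub>B\<close> over the given field, with the chord--tangent group law.\<close>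

definition curve :: "int \<Rightarrow> int \<Rightarrow> 'a point monoid" where
  "curve A B =
    \<lparr>carrier = insert Infinity
       {Affine x y | x y. x \<in> carrier R \<and> y \<in> carrier R \<and> on_curve A B x y},
     mult = point_add A B, one = Infinity\<rparr>"

text \<open>The isogeny \<open>\<phi>\<close> from \<open>E\<^sub>A\<^sub>,\<^sub>B\<close> to \<open>E'\<^sub>A\<^sub>,\<^sub>B : y\<^sup>2 = x\<^sup>3 - 2Ax\<^sup>2 + (A\<^sup>2 - 4B)x\<close> with kernel
  \<open>{O, (0,0)}\<close>, and its dual, which satisfies \<open>\<phi>_dual \<circ> \<phi> = [2]\<close>. A point with \<open>x = 0\<close>
  is the point \<open>(0,0)\<close>.\<close>

fun phi :: "int \<Rightarrow> int \<Rightarrow> 'a point \<Rightarrow> 'a point" where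
  "phi A B Infinity = Infinity"
| "phi A B (Affine x y) =
     (if x = \<zero> then Infinity
      else Affine (y [^] (2::nat) \<oslash> x [^] (2::nat))
                  ((y \<otimes> (of_integer B \<ominus> x [^] (2::nat))) \<oslash> x [^] (2::nat)))"

fun phi_dual :: "int \<Rightarrow> int \<Rightarrow> 'a point \<Rightarrow> 'a point" where
  "phi_dual A B Infinity = Infinity"
| "phi_dual A B (Affine x y) =
     (if x = \<zero> then Infinity
      else Affine (y [^] (2::nat) \<oslash> (of_integer 4 \<otimes> x [^] (2::nat)))
                  ((y \<otimes> (of_integer (A\<^sup>2 - 4 * B) \<ominus> x [^] (2::nat)))
                     \<oslash> (of_integer 8 \<otimes> x [^] (2::nat))))"

lemma kernel_phi: "kernel (curve A B) (curve A' B') (phi A B) = {Infinity, Affine \<zero> \<zero>}"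
  and kernel_phi_dual:
    "kernel (curve A B) (curve A' B') (phi_dual A' B') = {Infinity, Affine \<zero> \<zero>}"
proof -
  have 0: "\<zero> [^] (n::nat) = \<zero>" if "n > 0" for n
    using that by (simp add: nat_pow_zero)
  have z: "y = \<zero>" if "y \<in> carrier R" "on_curve A B \<zero> y" for y
  proof -
    have "y [^] (2::nat) = \<zero>" using that(2) 0 unfolding on_curve_def by simp
    then have "y \<otimes> y = \<zero>" using that(1) by (simp add: numeral_2_eq_2)
    then show ?thesis using integral[of y y] that(1) by blast
  qed
  have on: "on_curve A B \<zero> \<zero>" using 0 unfolding on_curve_def by simp
  show "kernel (curve A B) (curve A' B') (phi A B) = {Infinity, Affine \<zero> \<zero>}"
    unfolding kernel_def curve_def by (auto split: if_splits dest: z intro: on)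
  show "kernel (curve A B) (curve A' B') (phi_dual A' B') = {Infinity, Affine \<zero> \<zero>}"
    unfolding kernel_def curve_def by (auto split: if_splits dest: z intro: on)
qed

end


section \<open>Galois cohomology and Selmer groups\<close>

definition galois_group :: "('a, 'm) ring_scheme \<Rightarrow> 'a set \<Rightarrow> ('a \<Rightarrow> 'a) monoid" where
  "galois_group L K = (BijGroup (carrier L))
     \<lparr>carrier := {\<sigma> \<in> Bij (carrier L) \<inter> ring_hom L L. \<forall>x\<in>K. \<sigma> x = x}\<rparr>"

text \<open>Below \<open>M\<close> is a group of points over \<open>L\<close> on which the Galois group of \<open>L\<close> over \<open>K\<close> acts by
  \<open>map_point\<close>, that is, coordinatewise. Cochains are extensional functions, and continuity is with
  respect to the Krull topology and the discrete topology on \<open>M\<close>.\<close>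

definition krull_continuous :: "('a, 'm) ring_scheme \<Rightarrow> 'a set \<Rightarrow> (('a \<Rightarrow> 'a) \<Rightarrow> 'b) \<Rightarrow> bool" where
  "krull_continuous L K c \<longleftrightarrow>
     (\<forall>\<sigma>\<in>carrier (galois_group L K). \<exists>S. finite S \<and> S \<subseteq> carrier L \<and>
        (\<forall>\<tau>\<in>carrier (galois_group L K). (\<forall>x\<in>S. \<tau> x = \<sigma> x) \<longrightarrow> c \<tau> = c \<sigma>))"

definition cocycles ::
    "('a, 'm) ring_scheme \<Rightarrow> 'a set \<Rightarrow> 'a point monoid \<Rightarrow> (('a \<Rightarrow> 'a) \<Rightarrow> 'a point) monoid" where
  "cocycles L K M =
    (let G = galois_group L K in
     \<lparr>carrier = {c \<in> carrier G \<rightarrow>\<^sub>E carrier M. krull_continuous L K c \<and>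
        (\<forall>\<sigma>\<in>carrier G. \<forall>\<tau>\<in>carrier G. c (\<sigma> \<otimes>\<^bsub>G\<^esub> \<tau>) = c \<sigma> \<otimes>\<^bsub>M\<^esub> map_point \<sigma> (c \<tau>))},
      mult = (\<lambda>c d. \<lambda>\<sigma>\<in>carrier G. c \<sigma> \<otimes>\<^bsub>M\<^esub> d \<sigma>),
      one = (\<lambda>\<sigma>\<in>carrier G. \<one>\<^bsub>M\<^esub>)\<rparr>)"

definition principal_cocycle ::
    "('a, 'm) ring_scheme \<Rightarrow> 'a set \<Rightarrow> 'a point monoid \<Rightarrow> 'a point \<Rightarrow> ('a \<Rightarrow> 'a) \<Rightarrow> 'a point" where
  "principal_cocycle L K M P =
     (\<lambda>\<sigma>\<in>carrier (galois_group L K). map_point \<sigma> P \<otimes>\<^bsub>M\<^esub> inv\<^bsub>M\<^esub> P)"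

definition coboundaries ::
    "('a, 'm) ring_scheme \<Rightarrow> 'a set \<Rightarrow> 'a point monoid \<Rightarrow> (('a \<Rightarrow> 'a) \<Rightarrow> 'a point) set" where
  "coboundaries L K M = principal_cocycle L K M ` carrier M"

definition H1 ::
    "('a, 'm) ring_scheme \<Rightarrow> 'a set \<Rightarrow> 'a point monoid \<Rightarrow> (('a \<Rightarrow> 'a) \<Rightarrow> 'a point) set monoid" where
  "H1 L K M = cocycles L K M Mod coboundaries L K M"

definition H1_class ::
    "('a, 'm) ring_scheme \<Rightarrow> 'a set \<Rightarrow> 'a point monoid \<Rightarrow> (('a \<Rightarrow> 'a) \<Rightarrow> 'a point)
      \<Rightarrow> (('a \<Rightarrow> 'a) \<Rightarrow> 'a point) set" where
  "H1_class L K M c = coboundaries L K M #>\<^bsub>cocycles L K M\<^esub> c"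

text \<open>The kernel of \<open>h : E \<rightarrow> E'\<close> as a subgroup of the group \<open>E\<close> of points over \<open>L\<close>.\<close>

definition isogeny_kernel :: "'a point monoid \<Rightarrow> 'a point monoid \<Rightarrow> ('a point \<Rightarrow> 'a point) \<Rightarrow> 'a point monoid"
  where "isogeny_kernel E E' h = E\<lparr>carrier := kernel E E' h\<rparr>"

definition rational_points :: "'a set \<Rightarrow> 'a point monoid \<Rightarrow> 'a point set" where
  "rational_points K E = {P \<in> carrier E. set_point P \<subseteq> K}"

text \<open>The connecting map on \<open>E'(K)\<close>: the class of \<open>\<sigma> \<mapsto> \<sigma>(Q) - Q\<close>, where \<open>h(Q) = P\<close>. It factors
  through \<open>E'(K)/h(E(K))\<close>, so has the same image as the induced map on this quotient.\<close>

definition kummer_map ::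
    "('a, 'm) ring_scheme \<Rightarrow> 'a set \<Rightarrow> 'a point monoid \<Rightarrow> 'a point monoid \<Rightarrow> ('a point \<Rightarrow> 'a point)
      \<Rightarrow> 'a point \<Rightarrow> (('a \<Rightarrow> 'a) \<Rightarrow> 'a point) set" where
  "kummer_map L K E E' h P =
     H1_class L K (isogeny_kernel E E' h)
       (principal_cocycle L K E (SOME Q. Q \<in> carrier E \<and> h Q = P))"

text \<open>Restriction along an embedding \<open>j : L \<rightarrow> L'\<close>: an automorphism \<open>\<sigma>\<close> of \<open>L'\<close> restricts to
  \<open>j\<^sup>-\<^sup>1 \<circ> \<sigma> \<circ> j\<close>. On classes, the union runs over all representing cocycles, which all yield the
  same coset.\<close>

definition restrict_aut ::
    "('a, 'm) ring_scheme \<Rightarrow> ('a \<Rightarrow> 'b) \<Rightarrow> ('b \<Rightarrow> 'b) \<Rightarrow> 'a \<Rightarrow> 'a" where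
  "restrict_aut L j \<sigma> = (\<lambda>x\<in>carrier L. inv_into (carrier L) j (\<sigma> (j x)))"

definition H1_restrict ::
    "('a, 'm) ring_scheme \<Rightarrow> ('b, 'n) ring_scheme \<Rightarrow> 'b set \<Rightarrow> 'b point monoid \<Rightarrow> ('a \<Rightarrow> 'b)
      \<Rightarrow> (('a \<Rightarrow> 'a) \<Rightarrow> 'a point) set \<Rightarrow> (('b \<Rightarrow> 'b) \<Rightarrow> 'b point) set" where
  "H1_restrict L L' K' M' j \<xi> =
     (\<Union>c\<in>\<xi>. H1_class L' K' M'
        (\<lambda>\<sigma>\<in>carrier (galois_group L' K'). map_point j (c (restrict_aut L j \<sigma>))))"

text \<open>The Selmer group of an isogeny, given by its map \<open>h\<close> on points \<open>E \<rightarrow> E'\<close> over \<open>Qbar\<close> and its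
  maps \<open>hv v\<close> on points \<open>Ev v \<rightarrow> Ev' v\<close> over each \<open>Qvbar v\<close>.\<close>

definition selmer_group where
  "selmer_group E E' h Ev Ev' hv =
     {\<xi> \<in> carrier (H1 Qbar Q_in_Qbar (isogeny_kernel E E' h)).
        \<forall>v\<in>places.
          H1_restrict Qbar (Qvbar v) (Qv_in_Qvbar v) (isogeny_kernel (Ev v) (Ev' v) (hv v))
            (closure_embedding v) \<xi>
          \<in> kummer_map (Qvbar v) (Qv_in_Qvbar v) (Ev v) (Ev' v) (hv v)
              ` rational_points (Qv_in_Qvbar v) (Ev' v)}"

definition Sel_phi where
  "Sel_phi A B =
     selmer_group
       (field.curve Qbar A B) (field.curve Qbar (- 2 * A) (A\<^sup>2 - 4 * B)) (field.phi Qbar A B)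
       (\<lambda>v. field.curve (Qvbar v) A B) (\<lambda>v. field.curve (Qvbar v) (- 2 * A) (A\<^sup>2 - 4 * B))
       (\<lambda>v. field.phi (Qvbar v) A B)"

definition Sel_phi_dual where
  "Sel_phi_dual A B =
     selmer_group
       (field.curve Qbar (- 2 * A) (A\<^sup>2 - 4 * B)) (field.curve Qbar A B) (field.phi_dual Qbar A B)
       (\<lambda>v. field.curve (Qvbar v) (- 2 * A) (A\<^sup>2 - 4 * B)) (\<lambda>v. field.curve (Qvbar v) A B)
       (\<lambda>v. field.phi_dual (Qvbar v) A B)"

definition selmer_ratio_ord :: "int \<Rightarrow> int \<Rightarrow> int" where
  "selmer_ratio_ord A B =
     rat_ord 2 (of_nat (card (Sel_phi A B)) / of_nat (card (Sel_phi_dual A B)))"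

definition curve_family :: "real \<Rightarrow> (int \<times> int) set" where
  "curve_family x =
     {(A, B). real_of_int \<bar>A\<bar> \<le> x \<and> real_of_int (B\<^sup>2) \<le> x \<and> B \<noteq> 0 \<and> A\<^sup>2 - 4 * B \<noteq> 0 \<and>
        (\<forall>p::int. Factorial_Ring.prime p \<longrightarrow> p ^ 4 dvd B \<longrightarrow> \<not> p\<^sup>2 dvd A)}"

end

theory Submission
  imports
    Defs
    "HOL-Decision_Procs.Algebra_Aux"
    "HOL-Algebra.Chinese_Remainder"
    "HOL-Number_Theory.Number_Theory"
    "HOL-Computational_Algebra.Nth_Powers"
    "HOL-Probability.Probability"
    "HOL-Real_Asymp.Real_Asymp"
begin

text \<open>By Kummer theory and 2-descent both Selmer groups consist of squarefree \<open>d\<close> with locally soluble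
homogeneous spaces. At all but a few exceptional primes the local conditions are: \<open>d\<close> is a unit,
arbitrary at \<open>p | B\<close> and a square at \<open>p | A\<^sup>2 - 4B\<close> (roles exchanged for the dual). Double counting the
pairs in the kernel of the Legendre symbol matrix shows that \<open>t(A,B)\<close> is the number of odd primes dividing
\<open>A\<^sup>2 - 4B\<close> minus that of odd primes dividing \<open>B\<close>, up to a constant and the number of exceptional primes,
which has bounded mean. The difference obeys an Erdos-Kac law: for medium primes its moments agree with those of
independent variables taking the values \<open>1, -1\<close> with probability about \<open>1/p\<close> each, whose characteristic functions
converge to that of the normal law (Levy); the other primes contribute \<open>o(sqrt (ln ln X))\<close> in mean.\<close>

text \<open>No global duality theorem enters. Once conditions of bounded index are discarded, the
  two Selmer groups are the kernels of a matrix of Legendre symbols and of its transpose, so only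
  the numbers of rows and columns survive in the ratio. Quadratic reciprocity makes the two matrices
  transposes of each other, and a sign twist absorbs the reciprocity factor. The local conditions at
  2, at infinity and at exceptional primes are only bounded in index. On the analytic side
  \<open>B\<close> has a range of length about sqrt X only, so averages of functions of period M
  carry a relative error of order M / sqrt X. Moments of fixed order therefore confine the main
  argument to primes up to x^(1 / ln ln x): every fixed power of this bound is below sqrt x, while
  the sum of 1 / p up to it is still asymptotic to ln ln x. The minimality condition at all primes
  has no period; it is imposed for p <= w only, the pairs lost being of density O(w^(-3)), and w is
  fixed before X grows.\<close>

hide_const (open) Divisibility.prime

abbreviation ring_two (\<open>\<two>\<index>\<close>) where
 "\<two>\<^bsub>R\<^esub> \<equiv> \<one>\<^bsub>R\<^esub> \<oplus>\<^bsub>R\<^esub> \<one>\<^bsub>R\<^esub>"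

abbreviation null :: "place \<Rightarrow> (nat \<Rightarrow> rat) \<Rightarrow> bool" where "null v \<equiv> null_for (place_abs v)"
abbreviation cauchy :: "place \<Rightarrow> (nat \<Rightarrow> rat) \<Rightarrow> bool" where "cauchy v \<equiv> cauchy_for (place_abs v)"

section \<open>Extending homomorphisms from an algebraic extension into an algebraically closed
  field\<close>

lemma RDirProd_cring:
 assumes "cring R" "cring S" shows "cring (RDirProd R S)"
proof -
 interpret R: cring R by fact
 interpret S: cring S by fact
 interpret P: ring "RDirProd R S" by (rule RDirProd_ring) unfold_locales
 show ?thesis by unfold_locales (auto simp: RDirProd_def DirProd_def monoid.defs R.m_comm S.m_comm)
qed

lemma RDirProd_simps [simp]:
 "carrier (RDirProd R S) = carrier R \<times> carrier S"
 "(x, y)\<otimes>\<^bsub>RDirProd R S\<^esub>(x', y') = (x\<otimes>\<^bsub>R\<^esub>x', y\<otimes>\<^bsub>S\<^esub>y')"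
 "(x, y)\<oplus>\<^bsub>RDirProd R S\<^esub>(x', y') = (x\<oplus>\<^bsub>R\<^esub>x', y\<oplus>\<^bsub>S\<^esub>y')"
 "\<one>\<^bsub>RDirProd R S\<^esub> = (\<one>\<^bsub>R\<^esub>, \<one>\<^bsub>S\<^esub>)"
 "\<zero>\<^bsub>RDirProd R S\<^esub> = (\<zero>\<^bsub>R\<^esub>, \<zero>\<^bsub>S\<^esub>)"
 by (auto simp: RDirProd_def DirProd_def monoid.defs)

lemma RDirProd_fst_snd:
 "fst (u\<otimes>\<^bsub>RDirProd R S\<^esub>v) = fst u\<otimes>\<^bsub>R\<^esub>fst v" "snd (u\<otimes>\<^bsub>RDirProd R S\<^esub>v) = snd u\<otimes>\<^bsub>S\<^esub>snd v"
 "fst (u\<oplus>\<^bsub>RDirProd R S\<^esub>v) = fst u\<oplus>\<^bsub>R\<^esub>fst v" "snd (u\<oplus>\<^bsub>RDirProd R S\<^esub>v) = snd u\<oplus>\<^bsub>S\<^esub>snd v"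
 by (cases u; cases v; simp)+

text \<open>A partial homomorphism from \<open>L\<close> to \<open>M\<close> is represented by its graph, a subring \<open>G\<close> of
 \<open>L \<times> M\<close> that meets \<open>0 \<times> M\<close> trivially; for such graphs, unions of chains are unproblematic.\<close>

locale hom_extension =
 L: field L + K: subfield K L + M: algebraically_closed M
 for L :: "('a, 'm) ring_scheme" (structure) and K and M :: "('b, 'n) ring_scheme" +
 fixes h
 assumes alg: "x\<in>carrier L ==> (L.algebraic over K) x"
  and h: "h\<in>ring_hom (L\<lparr>carrier := K\<rparr>) M"
begin

definition P where "P = RDirProd L M"

sublocale P: cring P unfolding P_def by (rule RDirProd_cring) unfold_locales

sublocale fst: ring_hom_ring P L fst by (intro ring_hom_ringI2 P.ring_axioms L.ring_axioms ring_hom_memI)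
  (auto simp: P_def RDirProd_fst_snd)

sublocale snd: ring_hom_ring P M snd by (intro ring_hom_ringI2 P.ring_axioms M.ring_axioms ring_hom_memI)
  (auto simp: P_def RDirProd_fst_snd)

definition base where "base = (\<lambda>k. (k, h k)) ` K"

text \<open>The last condition makes the subring the graph of a function: the difference of two
  pairs with equal first components has first component zero.\<close>

definition good where
 "good G \<longleftrightarrow> subring G P & base \<subseteq> G & (\<forall>u\<in>G. fst u = \<zero> --> u = \<zero>\<^bsub>P\<^esub>)"

lemma goodD:
 assumes "good G"
 shows "subring G P" "G \<subseteq> carrier P" "k\<in>K ==> (k, h k)\<in>G"
  and "u\<in>G ==> v\<in>G ==> fst u = fst v ==> u = v"
proof -
 show 1: "subring G P" "k\<in>K ==> (k, h k)\<in>G" using assms by (auto simp: good_def base_def)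
 show 2: "G \<subseteq> carrier P" by (rule subringE(1)[OF 1(1)])
 assume uv: "u\<in>G" "v\<in>G" "fst u = fst v"
 have "u\<ominus>\<^bsub>P\<^esub>v\<in>G" using uv subringE(5,7)[OF 1(1)] by (simp add: a_minus_def)
 moreover have "fst (u\<ominus>\<^bsub>P\<^esub>v) = \<zero>" using uv 2 by (simp add: a_minus_def L.r_neg subsetD[OF 2])
 ultimately have "u\<ominus>\<^bsub>P\<^esub>v = \<zero>\<^bsub>P\<^esub>" using assms by (auto simp: good_def)
 then show "u = v" using uv(1,2) subsetD[OF 2] P.r_right_minus_eq by blast
qed

lemma h_closed: "k\<in>K ==> h k\<in>carrier M" using h by (auto simp: ring_hom_def)

lemma base_poly:
 assumes p: "p\<in>carrier (K[X])" and G: "good G"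
 shows "map (\<lambda>k. (k, h k)) p\<in>carrier (G[X]\<^bsub>P\<^esub>)" "map fst (map (\<lambda>k. (k, h k)) p) = p"
proof -
 have "set p \<subseteq> K" "p ~= [] ==> hd p ~= \<zero>" using p by (auto simp: univ_poly_carrier[symmetric] polynomial_def)
 then show "map (\<lambda>k. (k, h k)) p\<in>carrier (G[X]\<^bsub>P\<^esub>)"
  using goodD(3)[OF G] by (auto simp: univ_poly_carrier[symmetric] polynomial_def hd_map P_def)
qed (simp add: comp_def)

text \<open>The element \<open>fst u\<close> is algebraic over \<open>K\<close>, so its inverse is
  p(\<open>fst u\<close>) for some p over \<open>K\<close>. Evaluating the lift of p at
  \<open>u\<close> stays inside \<open>G\<close> and produces a pair with that first component;
  hence a good graph is automatically a field.\<close>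

lemma good_inverse:
 assumes G: "good G" and u: "u\<in>G" "fst u ~= \<zero>"
 shows "\<exists>v\<in>G. u\<otimes>\<^bsub>P\<^esub>v = \<one>\<^bsub>P\<^esub>"
proof -
 have uP: "u\<in>carrier P" using goodD(2)[OF G] u by auto
 have x: "fst u\<in>carrier L" using uP by (auto simp: P_def)
 have sf: "subfield (L.simple_extension K (fst u)) L" using L.simple_extension_is_subfield[OF K.subfield_axioms x] alg[OF x] by simp
 have xin: "fst u\<in>L.simple_extension K (fst u)" by (rule L.simple_extension_mem[OF subfieldE(1)[OF K.subfield_axioms] x])
 have "inv (fst u)\<in>L.simple_extension K (fst u)" using L.subfield_m_inv(1)[OF sf] xin u(2) by auto
 then obtain p where p: "p\<in>carrier (K[X])" "L.eval p (fst u) = inv (fst u)"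
  using L.simple_extension_as_eval_img[OF subfieldE(3)[OF K.subfield_axioms] x] by auto
 let ?q = "map (\<lambda>k. (k, h k)) p"
 have q: "?q\<in>carrier (G[X]\<^bsub>P\<^esub>)" "map fst ?q = p" using base_poly[OF p(1) G] by auto
 have qs: "set ?q \<subseteq> G" using q(1) by (auto simp: univ_poly_carrier[symmetric] polynomial_def)
 have v: "P.eval ?q u\<in>G" using ring.eval_in_carrier[OF P.subring_is_ring[OF goodD(1)[OF G]], of ?q u] qs u
   P.eval_consistent[OF goodD(1)[OF G]] by simp
 have "fst (P.eval ?q u) = inv (fst u)" using fst.eval_hom'[OF uP, of ?q] qs goodD(2)[OF G] q(2) p(2) by simp
 then have "fst (u\<otimes>\<^bsub>P\<^esub>P.eval ?q u) = fst \<one>\<^bsub>P\<^esub>"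
  using u(2) x L.r_inv[of "fst u"] by (simp add: P_def RDirProd_fst_snd L.field_Units)
 then have "u\<otimes>\<^bsub>P\<^esub>P.eval ?q u = \<one>\<^bsub>P\<^esub>"
  using goodD(4)[OF G, of "u\<otimes>\<^bsub>P\<^esub>P.eval ?q u" "\<one>\<^bsub>P\<^esub>"] subringE(3,6)[OF goodD(1)[OF G]] u v by blast
 then show ?thesis using v by blast
qed

lemma good_field:
 assumes G: "good G" shows "field (P\<lparr>carrier := G\<rparr>)"
proof -
 have sub: "subring G P" by (rule goodD(1)[OF G])
 interpret R: ring "P\<lparr>carrier := G\<rparr>" by (rule P.subring_is_ring[OF sub])
 have "cring (P\<lparr>carrier := G\<rparr>)" using P.subcring_iff[OF goodD(2)[OF G]] P.subcringI'[OF sub] by blast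
 then interpret R: cring "P\<lparr>carrier := G\<rparr>" .
 show ?thesis
 proof (rule R.cring_fieldI2)
  show "\<zero>\<^bsub>P\<lparr>carrier := G\<rparr>\<^esub> ~= \<one>\<^bsub>P\<lparr>carrier := G\<rparr>\<^esub>" by (simp add: P_def)
  fix u assume u: "u\<in>carrier (P\<lparr>carrier := G\<rparr>)" "u ~= \<zero>\<^bsub>P\<lparr>carrier := G\<rparr>\<^esub>"
  then have "fst u ~= \<zero>" using G by (auto simp: good_def)
  then show "\<exists>v\<in>carrier (P\<lparr>carrier := G\<rparr>). u \<otimes>\<^bsub>P\<lparr>carrier := G\<rparr>\<^esub> v = \<one>\<^bsub>P\<lparr>carrier := G\<rparr>\<^esub>"
   using good_inverse[OF G, of u] u by simp
 qed
qed

text \<open>A minimal polynomial of \<open>x\<close> over the projection of \<open>G\<close>, kept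
  with coefficients in \<open>G\<close> itself so that it can be evaluated in both
  components.\<close>

definition minimal_at where
 "minimal_at G p x \<longleftrightarrow> p\<in>carrier (G[X]\<^bsub>P\<^esub>) & p ~= [] & L.eval (map fst p) x = \<zero> \<and>
   (\<forall>q\<in>carrier (G[X]\<^bsub>P\<^esub>). q ~= [] --> L.eval (map fst q) x = \<zero> --> length p <= length q)"

lemma minimal_ex:
 assumes G: "good G" and x: "x\<in>carrier L"
 shows "\<exists>p. minimal_at G p x"
proof -
 obtain p where p: "p\<in>carrier (K[X])" "p ~= []" "L.eval p x = \<zero>"
  using L.algebraicE[OF subfieldE(1)[OF K.subfield_axioms] x alg[OF x]] by blast
 let ?Q = "\<lambda>q. q\<in>carrier (G[X]\<^bsub>P\<^esub>) & q ~= [] & L.eval (map fst q) x = \<zero>"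
 have "?Q (map (\<lambda>k. (k, h k)) p)" using base_poly[OF p(1) G] p by simp
 from ex_has_least_nat[of ?Q, OF this, of length] show ?thesis unfolding minimal_at_def by blast
qed

text \<open>The new graph consists of the values at (x, b) of polynomials over the field
  \<open>G\<close>. It is still a graph: division by \<open>p\<close>, which vanishes at (x, b),
  replaces a polynomial vanishing at \<open>x\<close> by a remainder of smaller degree vanishing at
  \<open>x\<close>, and that remainder is zero by minimality.\<close>

lemma good_extend:
 assumes G: "good G" and x: "x\<in>carrier L" and p: "minimal_at G p x"
  and b: "b\<in>carrier M" "M.eval (map snd p) b = \<zero>\<^bsub>M\<^esub>"
 shows "\<exists>G'. good G' & G \<subseteq> G' & (x, b)\<in>G'"
proof -
 let ?w = "(x, b)"
 have w: "?w\<in>carrier P" using x b by (simp add: P_def)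
 have sub: "subring G P" by (rule goodD(1)[OF G])
 interpret F: field "P\<lparr>carrier := G\<rparr>" by (rule good_field[OF G])
 have Fpoly: "univ_poly (P\<lparr>carrier := G\<rparr>) = univ_poly P" by (rule P.univ_poly_consistent[OF sub])
 have pin: "p\<in>carrier (G[X]\<^bsub>P\<^esub>)" "p ~= []" using p by (auto simp: minimal_at_def)
 have setG: "set q \<subseteq> carrier P" if "q\<in>carrier (G[X]\<^bsub>P\<^esub>)" for q
  using that goodD(2)[OF G] by (auto simp: univ_poly_carrier[symmetric] polynomial_def)
 have fe: "fst (P.eval q ?w) = L.eval (map fst q) x" and se: "snd (P.eval q ?w) = M.eval (map snd q) b"
  if "q\<in>carrier (G[X]\<^bsub>P\<^esub>)" for q using fst.eval_hom'[OF w setG[OF that]] snd.eval_hom'[OF w setG[OF that]] by simp_all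
 have p0: "P.eval p ?w = \<zero>\<^bsub>P\<^esub>" using fe[OF pin(1)] se[OF pin(1)] p b by (simp add: prod_eq_iff minimal_at_def P_def)
 have key: "P.eval q ?w = \<zero>\<^bsub>P\<^esub>" if q: "q\<in>carrier (G[X]\<^bsub>P\<^esub>)" and q0: "fst (P.eval q ?w) = \<zero>" for q
 proof -
  obtain s r where sr: "s\<in>carrier (G[X]\<^bsub>P\<^esub>)" "r\<in>carrier (G[X]\<^bsub>P\<^esub>)"
   "q = (p \<otimes>\<^bsub>G[X]\<^bsub>P\<^esub>\<^esub> s) \<oplus>\<^bsub>G[X]\<^bsub>P\<^esub>\<^esub> r" "r = [] \<or> length r - 1 < length p - 1"
   using F.field_long_division_theorem_shell[OF F.carrier_is_subfield, of q p] q pin by (auto simp: Fpoly univ_poly_zero)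
  have ps: "P.poly_mult p s\<in>carrier (G[X]\<^bsub>P\<^esub>)"
  proof -
   interpret U: ring "G[X]\<^bsub>P\<^esub>" using F.univ_poly_is_ring[OF F.carrier_is_subring] by (simp add: Fpoly)
   show ?thesis using U.m_closed[OF pin(1) sr(1)] by (simp add: univ_poly_mult)
  qed
  have "P.eval q ?w = P.eval p ?w\<otimes>\<^bsub>P\<^esub>P.eval s ?w\<oplus>\<^bsub>P\<^esub>P.eval r ?w"
   using P.eval_poly_add[OF setG[OF ps] setG[OF sr(2)] w] P.eval_poly_mult[OF setG[OF pin(1)] setG[OF sr(1)] w]
   by (simp add: sr(3) univ_poly_mult univ_poly_add)
  also have "\<dots> = P.eval r ?w" using p0 P.eval_in_carrier[OF setG[OF sr(1)] w] P.eval_in_carrier[OF setG[OF sr(2)] w] by simp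
  finally have e: "P.eval q ?w = P.eval r ?w" .
  have "r = []"
  proof (rule ccontr)
   assume "r ~= []"
   then have "length r < length p" using sr(4) by auto
   moreover have "length p <= length r" using p sr(2) \<open>r ~= []\<close> e q0 fe[OF sr(2)] by (auto simp: minimal_at_def)
   ultimately show False by simp
  qed
  then show ?thesis using e by simp
 qed
 define G' where "G' = (\<lambda>q. P.eval q ?w) ` carrier (G[X]\<^bsub>P\<^esub>)"
 have im: "G' = P.simple_extension G ?w" unfolding G'_def using P.simple_extension_as_eval_img[OF goodD(2)[OF G] w] by simp
 have GG': "G \<subseteq> G'" "?w\<in>G'"
  unfolding im using P.simple_extension_incl[OF goodD(2)[OF G] w] P.simple_extension_mem[OF sub w] by auto
 have "subring G' P"
 proof (rule P.subringI)
  interpret U: ring "G[X]\<^bsub>P\<^esub>" using F.univ_poly_is_ring[OF F.carrier_is_subring] by (simp add: Fpoly)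
  show G'P: "G' \<subseteq> carrier P" unfolding G'_def using P.eval_in_carrier[OF setG w] by blast
  show "\<one>\<^bsub>P\<^esub>\<in>G'" using GG' subringE(3)[OF sub] by auto
  have mult: "u\<otimes>\<^bsub>P\<^esub>v\<in>G'" if uv: "u\<in>G'" "v\<in>G'" for u v
  proof -
   obtain q where q: "u = P.eval q ?w" "q\<in>carrier (G[X]\<^bsub>P\<^esub>)" using uv(1) unfolding G'_def image_iff by blast
   obtain r where r: "v = P.eval r ?w" "r\<in>carrier (G[X]\<^bsub>P\<^esub>)" using uv(2) unfolding G'_def image_iff by blast
   note qr = q(2) q(1) r(2) r(1)
   show ?thesis unfolding G'_def using P.eval_poly_mult[OF setG[OF qr(1)] setG[OF qr(3)] w] U.m_closed[OF qr(1,3)] qr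
    by (intro image_eqI[of _ _ "P.poly_mult q r"]) (simp_all add: univ_poly_mult)
  qed
  then show "\<And>u v. u\<in>G' ==> v\<in>G' ==> u\<otimes>\<^bsub>P\<^esub>v\<in>G'" .
  show "u\<oplus>\<^bsub>P\<^esub>v\<in>G'" if uv: "u\<in>G'" "v\<in>G'" for u v
  proof -
   obtain q where q: "u = P.eval q ?w" "q\<in>carrier (G[X]\<^bsub>P\<^esub>)" using uv(1) unfolding G'_def image_iff by blast
   obtain r where r: "v = P.eval r ?w" "r\<in>carrier (G[X]\<^bsub>P\<^esub>)" using uv(2) unfolding G'_def image_iff by blast
   note qr = q(2) q(1) r(2) r(1)
   show ?thesis unfolding G'_def using P.eval_poly_add[OF setG[OF qr(1)] setG[OF qr(3)] w] U.a_closed[OF qr(1,3)] qr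
    by (intro image_eqI[of _ _ "P.poly_add q r"]) (simp_all add: univ_poly_add)
  qed
  show "\<ominus>\<^bsub>P\<^esub> u\<in>G'" if "u\<in>G'" for u
  proof -
   have "\<ominus>\<^bsub>P\<^esub> \<one>\<^bsub>P\<^esub>\<in>G'" using subsetD[OF GG'(1) subringE(5)[OF sub subringE(3)[OF sub]]] .
   then have "\<ominus>\<^bsub>P\<^esub> \<one>\<^bsub>P\<^esub>\<otimes>\<^bsub>P\<^esub>u\<in>G'" using that mult by blast
   moreover have "u\<in>carrier P" using G'P that by blast
   ultimately show ?thesis by (simp add: P.l_minus)
  qed
 qed
 moreover have "base \<subseteq> G'" using GG'(1) G by (auto simp: good_def)
 moreover have "\<forall>u\<in>G'. fst u = \<zero> --> u = \<zero>\<^bsub>P\<^esub>" using key by (auto simp: G'_def)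
 ultimately have "good G'" by (simp add: good_def)
 then show ?thesis using GG' by blast
qed

text \<open>The leading coefficient is invertible in \<open>G\<close>, so its second component is
  nonzero and the degree does not drop under \<open>snd\<close>. The degree is positive because a
  nonzero constant does not vanish at \<open>x\<close>.\<close>

lemma minimal_root:
 assumes G: "good G" and x: "x\<in>carrier L" and p: "minimal_at G p x"
 shows "map snd p\<in>carrier (poly_ring M)" "length (map snd p) >= 2"
  "\<exists>b\<in>carrier M. M.eval (map snd p) b = \<zero>\<^bsub>M\<^esub>"
proof -
 have pin: "p\<in>carrier (G[X]\<^bsub>P\<^esub>)" "p ~= []" using p by (auto simp: minimal_at_def)
 have sG: "set p \<subseteq> G" "hd p ~= \<zero>\<^bsub>P\<^esub>" using pin by (auto simp: univ_poly_carrier[symmetric] polynomial_def)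
 then have hG: "hd p\<in>G" using pin by auto
 then have f: "fst (hd p) ~= \<zero>" using G sG by (auto simp: good_def)
 then obtain v where v: "v\<in>G" "hd p\<otimes>\<^bsub>P\<^esub>v = \<one>\<^bsub>P\<^esub>" using good_inverse[OF G hG] by blast
 have "snd (hd p)\<otimes>\<^bsub>M\<^esub>snd v = \<one>\<^bsub>M\<^esub>" using arg_cong[OF v(2), of snd] by (simp add: P_def RDirProd_fst_snd)
 moreover have "snd v\<in>carrier M" using v(1) goodD(2)[OF G] by (auto simp: P_def)
 ultimately have "snd (hd p) ~= \<zero>\<^bsub>M\<^esub>" by auto
 moreover have "set (map snd p) \<subseteq> carrier M" using sG goodD(2)[OF G] by (auto simp: P_def)
 ultimately show mp: "map snd p\<in>carrier (poly_ring M)" using pin by (auto simp: univ_poly_carrier[symmetric] polynomial_def hd_map)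
 show l: "length (map snd p) >= 2"
 proof (rule ccontr)
  assume "~ ?thesis"
  then have "length p < 2" by simp
  then obtain c where c: "p = [c]" using pin(2) by (cases p) auto
  have "L.eval (map fst p) x = fst c" using c hG goodD(2)[OF G] x by (auto simp: P_def)
  then show False using p f c by (auto simp: minimal_at_def)
 qed
 have "M.splitted (map snd p)" by (rule M.roots_over_carrier[OF mp])
 then have "M.roots (map snd p) ~= {#}" using l by (auto simp: M.splitted_def)
 then obtain b where "b \<in># M.roots (map snd p)" by blast
 then show "\<exists>b\<in>carrier M. M.eval (map snd p) b = \<zero>\<^bsub>M\<^esub>"
  using M.roots_mem_iff_is_root[OF mp] by (auto simp: M.is_root_def)
qed

lemma good_base: "good base"
proof -
 have "ring_hom_ring (L\<lparr>carrier := K\<rparr>) P (\<lambda>k. (k, h k))" using h subfieldE(3)[OF K.subfield_axioms] h_closed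
  by (intro ring_hom_ringI2 L.subring_is_ring subfieldE(1) K.subfield_axioms P.ring_axioms ring_hom_memI)
   (auto simp: P_def ring_hom_def)
 then interpret B: ring_hom_ring "L\<lparr>carrier := K\<rparr>" P "\<lambda>k. (k, h k)" .
 have "subring base P" using B.img_is_subring[OF B.R.carrier_is_subring] by (simp add: base_def)
 moreover have "h \<zero> = \<zero>\<^bsub>M\<^esub>" using B.hom_zero by (simp add: P_def)
 ultimately show ?thesis by (auto simp: good_def base_def P_def)
qed

lemma good_Union:
 assumes C: "C ~= {}" "\<And>G. G\<in>C ==> good G" "\<And>G G'. G\<in>C ==> G'\<in>C ==> G \<subseteq> G' \<or> G' \<subseteq> G"
 shows "good (\<Union>C)"
proof -
 have two: "\<exists>G\<in>C. u\<in>G & v\<in>G" if "u\<in>\<Union>C" "v\<in>\<Union>C" for u v using that C(3) by blast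
 obtain G0 where G0: "G0\<in>C" using C(1) by blast
 have "subring (\<Union>C) P"
 proof (rule P.subringI)
  show "\<Union>C \<subseteq> carrier P" using goodD(2)[OF C(2)] by (rule Union_least)
  show "\<one>\<^bsub>P\<^esub>\<in>\<Union>C" using subringE(3)[OF goodD(1)[OF C(2)[OF G0]]] G0 by (rule UnionI[rotated])
 next
  fix u assume "u\<in>\<Union>C"
  then obtain G where "G\<in>C" "u\<in>G" by blast
  note G = this and s = goodD(1)[OF C(2)[OF this(1)]]
  show "\<ominus>\<^bsub>P\<^esub> u\<in>\<Union>C" by (rule UnionI[OF G(1) subringE(5)[OF s G(2)]])
 next
  fix u v assume "u\<in>\<Union>C" "v\<in>\<Union>C"
  then obtain G where "G\<in>C" "u\<in>G" "v\<in>G" using two by blast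
  note G = this and s = goodD(1)[OF C(2)[OF this(1)]]
  show "u\<otimes>\<^bsub>P\<^esub>v\<in>\<Union>C" by (rule UnionI[OF G(1) subringE(6)[OF s G(2,3)]])
  show "u\<oplus>\<^bsub>P\<^esub>v\<in>\<Union>C" by (rule UnionI[OF G(1) subringE(7)[OF s G(2,3)]])
 qed
 moreover have "base \<subseteq> \<Union>C" using C(1,2) unfolding good_def by blast
 moreover have "\<forall>u\<in>\<Union>C. fst u = \<zero> --> u = \<zero>\<^bsub>P\<^esub>" using C(2) unfolding good_def by blast
 ultimately show ?thesis unfolding good_def by blast
qed

text \<open>Zorn's lemma: a maximal good graph is total, since \<open>good_extend\<close> could
  otherwise adjoin an element together with a root of its minimal polynomial. Starting from an
  arbitrary good graph, not just \<open>base\<close>, allows the image of one further element to be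
  prescribed.\<close>

theorem extend:
 assumes G0: "good G0"
 shows "\<exists>g\<in>ring_hom L M. \<forall>u\<in>G0. g (fst u) = snd u"
proof -
 let ?A = "{G. good G & G0 \<subseteq> G}"
 have "\<exists>G\<in>?A. \<forall>G'\<in>?A. G \<subseteq> G' --> G' = G"
 proof (rule subset_Zorn_nonempty)
  show "?A ~= {}" using G0 by blast
  fix C assume C: "C ~= {}" "subset.chain ?A C"
  then have C': "C \<subseteq> ?A" "\<And>G G'. G\<in>C ==> G'\<in>C ==> G \<subseteq> G' \<or> G' \<subseteq> G"
   unfolding subset_chain_def by blast+
  have "good (\<Union>C)" by (rule good_Union[OF C(1) _ C'(2)]) (use C'(1) in blast)
  moreover have "G0 \<subseteq> \<Union>C" using C(1) C'(1) by blast
  ultimately show "\<Union>C \<in> ?A" by blast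
 qed
 then obtain G where G: "G \<in> ?A" and mx0: "\<forall>G'\<in>?A. G \<subseteq> G' --> G' = G" by (rule bexE) (rule that)
 have G: "good G" "G0 \<subseteq> G" using G by simp_all
 have mx: "G' = G" if "good G'" "G \<subseteq> G'" for G' using bspec[OF mx0, of G'] that G(2) by simp
 have dom: "\<exists>y. (x, y)\<in>G" if x: "x\<in>carrier L" for x
 proof -
  obtain p where p: "minimal_at G p x" using minimal_ex[OF G(1) x] by blast
  obtain b where b: "b\<in>carrier M" "M.eval (map snd p) b = \<zero>\<^bsub>M\<^esub>" using minimal_root(3)[OF G(1) x p] by blast
  obtain G' where G': "good G'" "G \<subseteq> G'" "(x, b)\<in>G'" using good_extend[OF G(1) x p b] by blast
  then have "G' = G" using mx[OF G'(1,2)] by simp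
  then show ?thesis using G'(3) by blast
 qed
 define g where "g x = (SOME y. (x, y)\<in>G)" for x
 have g: "(x, g x)\<in>G" if "x\<in>carrier L" for x unfolding g_def using dom[OF that] by (rule someI_ex)
 have un: "y = g x" if "(x, y)\<in>G" for x y
 proof -
  have "x\<in>carrier L" using that goodD(2)[OF G(1)] by (auto simp: P_def)
  then show ?thesis using goodD(4)[OF G(1) that g[of x]] by simp
 qed
 note s = goodD(1)[OF G(1)]
 have "g\<in>ring_hom L M"
 proof (rule ring_hom_memI)
  show "g x\<in>carrier M" if "x\<in>carrier L" for x using g[OF that] goodD(2)[OF G(1)] by (auto simp: P_def)
  show "g (x\<otimes>y) = g x\<otimes>\<^bsub>M\<^esub>g y" if "x\<in>carrier L" "y\<in>carrier L" for x y
   using un[of "x\<otimes>y" "g x\<otimes>\<^bsub>M\<^esub>g y"] subringE(6)[OF s g[OF that(1)] g[OF that(2)]] by (simp add: P_def)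
  show "g (x\<oplus>y) = g x\<oplus>\<^bsub>M\<^esub>g y" if "x\<in>carrier L" "y\<in>carrier L" for x y
   using un[of "x\<oplus>y" "g x\<oplus>\<^bsub>M\<^esub>g y"] subringE(7)[OF s g[OF that(1)] g[OF that(2)]] by (simp add: P_def)
  show "g \<one> = \<one>\<^bsub>M\<^esub>" using un[of \<one> "\<one>\<^bsub>M\<^esub>"] subringE(3)[OF s] by (simp add: P_def)
 qed
 moreover have "\<forall>u\<in>G0. g (fst u) = snd u" using un G(2) by force
 ultimately show ?thesis by blast
qed

end

section \<open>Galois theory of an algebraic closure in characteristic zero\<close>

locale galois_closure = algebraic_closure L K for L (structure) and K +
 assumes char_zero: "n > 0 ==> [(n::nat)] \<cdot> \<one> ~= \<zero>"
begin

abbreviation gal where "gal \<equiv> carrier (galois_group L K)"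

lemma K_sub: "K \<subseteq> carrier L" by (rule subfieldE(3)[OF subfield_axioms])
lemma K_carrier: "k\<in>K ==> k\<in>carrier L" using K_sub by blast
lemma K_subring: "subring K L" by (rule subfieldE(1)[OF subfield_axioms])

lemma gal_iff:
 "g1\<in>gal \<longleftrightarrow> g1\<in>extensional (carrier L) & bij_betw g1 (carrier L) (carrier L) \<and>
   g1\<in>ring_hom L L & (\<forall>x\<in>K. g1 x = x)"
 by (auto simp: galois_group_def Bij_def)

lemma gal_hom: "g1\<in>gal ==> ring_hom_cring L L g1"
 by (intro ring_hom_cring.intro ring_hom_cring_axioms.intro cring_axioms) (simp add: gal_iff)

lemma gal_closed: "g1\<in>gal ==> x\<in>carrier L ==> g1 x\<in>carrier L" by (auto simp: gal_iff bij_betw_def)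

lemma gal_inj: "g1\<in>gal ==> x\<in>carrier L ==> y\<in>carrier L ==> g1 x = g1 y \<longleftrightarrow> x = y"
 by (auto simp: gal_iff bij_betw_def inj_on_def)

lemma gal_fix: "g1\<in>gal ==> x\<in>K ==> g1 x = x" by (simp add: gal_iff)

lemma gal_mult: "g1\<in>gal ==> g2\<in>gal ==> g1\<otimes>\<^bsub>galois_group L K\<^esub>g2 = compose (carrier L) g1 g2"
 by (simp add: galois_group_def BijGroup_def)

lemma gal_compose:
 assumes "g1\<in>gal" "g2\<in>gal" shows "compose (carrier L) g1 g2\<in>gal"
proof -
 have "compose (carrier L) g1 g2\<in>ring_hom L L" using assms ring_hom_memE[of g1 L L] ring_hom_memE[of g2 L L]
  by (intro ring_hom_memI) (auto simp: compose_def gal_iff)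
 then show ?thesis using assms K_sub bij_betw_compose[of g2 "carrier L" "carrier L" g1 "carrier L"]
  by (auto simp: gal_iff compose_extensional) (auto simp: compose_def subset_iff)
qed

lemma gal_one: "(\<lambda>x\<in>carrier L. x)\<in>gal" using K_sub by (auto simp: gal_iff bij_betw_def inj_on_def ring_hom_def)

lemma eval_K_hom:
 assumes g: "g\<in>ring_hom L L" "\<forall>x\<in>K. g x = x" and p: "p\<in>carrier (K[X])" and x: "x\<in>carrier L"
 shows "g (eval p x) = eval p (g x)"
proof -
 interpret g: ring_hom_ring L L g by (intro ring_hom_ringI2 ring_axioms g(1))
 have s: "set p \<subseteq> K" using p by (auto simp: univ_poly_carrier[symmetric] polynomial_def)
 then have "map g p = p" using g(2) by (intro map_idI) auto
 then show ?thesis using g.eval_hom'[OF x] s K_sub by auto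
qed

text \<open>The roots of a polynomial over \<open>K\<close> that vanishes at \<open>x\<close> form
  such a set. It serves both for surjectivity of endomorphisms and for the finiteness of
  orbits.\<close>

lemma finite_conjugates:
 assumes x: "x\<in>carrier L"
 shows "\<exists>F. finite F & F \<subseteq> carrier L & x\<in>F & (\<forall>g\<in>ring_hom L L. (\<forall>k\<in>K. g k = k) --> (\<forall>y\<in>F. g y\<in>F))"
proof -
 obtain p where p: "p\<in>carrier (K[X])" "p ~= []" "eval p x = \<zero>"
  using algebraicE[OF K_subring x algebraic_extension[OF x]] by blast
 let ?F = "{y. is_root p y}"
 have "finite ?F" by (rule finite_number_of_roots[OF carrier_polynomial_shell[OF K_subring p(1)]])
 moreover have "g y \<in> ?F" if g: "g\<in>ring_hom L L" "\<forall>k\<in>K. g k = k" and y: "y \<in> ?F" for g y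
 proof -
  have y': "y\<in>carrier L" "eval p y = \<zero>" using y by (auto simp: is_root_def)
  have "eval p (g y) = g \<zero>" using eval_K_hom[OF g p(1) y'(1)] y'(2) by simp
  also have "g \<zero> = \<zero>" using g(2) subringE(2)[OF K_subring] by simp
  finally show ?thesis using ring_hom_memE(1)[OF g(1) y'(1)] p(2) by (simp add: is_root_def)
 qed
 ultimately show ?thesis using p x by (intro exI[of _ ?F]) (auto simp: is_root_def)
qed

text \<open>An injective endomorphism permutes the finite stable set around each element, hence is
  surjective. Restricting to the carrier makes the map extensional, as membership in
  \<open>galois_group\<close> demands.\<close>

lemma restrict_hom_gal:
 assumes g: "g\<in>ring_hom L L" "\<forall>k\<in>K. g k = k"
 shows "restrict g (carrier L)\<in>gal"
proof -
 have inj: "inj_on g (carrier L)" by (rule non_trivial_field_hom_is_inj[OF g(1) field_axioms field_axioms])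
 have "x\<in>g ` carrier L" if x: "x\<in>carrier L" for x
 proof -
  obtain F where F: "finite F" "F \<subseteq> carrier L" "x\<in>F" "\<And>y. y\<in>F ==> g y\<in>F"
   using finite_conjugates[OF x] g by blast
  have "inj_on g F" using inj F(2) by (rule inj_on_subset)
  then have "g ` F = F" using F by (intro endo_inj_surj) auto
  then show ?thesis using F by blast
 qed
 moreover have "g ` carrier L \<subseteq> carrier L" using ring_hom_memE(1)[OF g(1)] by blast
 ultimately have "g ` carrier L = carrier L" by blast
 then have b: "bij_betw g (carrier L) (carrier L)" using inj by (simp add: bij_betw_def)
 moreover have "restrict g (carrier L)\<in>ring_hom L L" using ring_hom_memE[OF g(1)] by (intro ring_hom_memI) auto
 ultimately show ?thesis using g(2) K_sub by (auto simp: gal_iff cong: bij_betw_cong)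
qed

lemma coeff_mult_linear:
 assumes s: "set s \<subseteq> carrier L" and x: "x\<in>carrier L"
 shows "coeff (poly_mult [\<one>,\<ominus>x] s) (Suc i) = coeff s i\<ominus>x\<otimes>coeff s (Suc i)"
  and "coeff (poly_mult [\<one>,\<ominus>x] s) 0 =\<ominus>(x\<otimes>coeff s 0)"
proof -
 have c: "set (map ((\<otimes>) \<one>) s @ [\<zero>]) \<subseteq> carrier L" "set (map ((\<otimes>) (\<ominus> x)) s) \<subseteq> carrier L"
  using s x by auto
 have m1: "map ((\<otimes>) \<one>) s = s" using s by (intro map_idI) auto
 have pm: "coeff (poly_mult [\<ominus> x] s) j =\<ominus>x\<otimes>coeff s j" for j
  using poly_add_coeff[OF c(2), of "[]"] scalar_coeff[of "\<ominus> x" s] x s coeff_in_carrier[OF s] by simp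
 have pmc: "set (poly_mult [\<ominus> x] s) \<subseteq> carrier L" using poly_mult_in_carrier[of "[\<ominus> x]" s] x s by simp
 have "coeff (poly_mult [\<one>,\<ominus>x] s) j = coeff (s @ [\<zero>]) j\<oplus>\<ominus> x\<otimes>coeff s j" for j
  using poly_add_coeff[OF c(1) pmc] pm m1 by simp
 moreover have "coeff (s @ [\<zero>]) 0 = \<zero>" "coeff (s @ [\<zero>]) (Suc i) = coeff s i" using s by (induct s) auto
 ultimately show "coeff (poly_mult [\<one>,\<ominus>x] s) (Suc i) = coeff s i\<ominus>x\<otimes>coeff s (Suc i)"
  and "coeff (poly_mult [\<one>,\<ominus>x] s) 0 =\<ominus>(x\<otimes>coeff s 0)"
  using x coeff_in_carrier[OF s] by (simp_all add: a_minus_def l_minus)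
qed

text \<open>Such a polynomial is hd p (X - x)^(n+1), and its second coefficient exhibits
  \<open>x\<close> multiplied by n + 1, which is invertible in characteristic zero. This takes the
  place of separability in \<open>gal_moves\<close>.\<close>

lemma coeff_single_root:
 assumes "p\<in>carrier (poly_ring L)" "degree p = Suc n" "\<And>y. is_root p y ==> y = x" "x\<in>carrier L"
 shows "coeff p n =\<ominus>([Suc n] \<cdot> (hd p\<otimes>x))" using assms(1-3)
proof (induction n arbitrary: p)
 case (0 p)
 have pc: "set p \<subseteq> carrier L" "p ~= []" "hd p ~= \<zero>" using 0(1,2) by (auto simp: univ_poly_carrier[symmetric] polynomial_def)
 then obtain a b where p: "p = [a, b]" using 0(2) by (cases p; cases "tl p") (auto simp: length_Suc_conv)
 have "splitted p" using roots_over_carrier[OF 0(1)] .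
 then have "roots p ~= {#}" using 0(2) by (auto simp: splitted_def)
 then obtain y where "is_root p y" using roots_mem_iff_is_root[OF 0(1)] by blast
 then have "is_root p x" using 0(3) by blast
 then have "a\<otimes>x\<oplus>b = \<zero>" using p pc assms(4) by (simp add: is_root_def)
 then show ?case using p pc assms(4) by (simp add: add.inv_equality[of b] a_comm)
next
 case (Suc n p)
 have pc: "set p \<subseteq> carrier L" "p ~= []" "hd p ~= \<zero>" using Suc(2,3) by (auto simp: univ_poly_carrier[symmetric] polynomial_def)
 interpret UP: domain "poly_ring L" by (rule univ_poly_is_domain[OF carrier_is_subring])
 have "splitted p" using roots_over_carrier[OF Suc(2)] .
 then have "roots p ~= {#}" using Suc(3) by (auto simp: splitted_def)
 then obtain y where y: "y\<in>carrier L" "y \<in># roots p" "[\<one>,\<ominus>y] \<in> carrier (poly_ring L)" "[\<one>,\<ominus>y] pdivides p"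
  using not_empty_rootsE[OF Suc(2)] by metis
 have yx: "y = x" using y(2) roots_mem_iff_is_root[OF Suc(2)] Suc(4) by blast
 obtain s where s: "s\<in>carrier (poly_ring L)" "p = [\<one>,\<ominus>x]\<otimes>\<^bsub>poly_ring L\<^esub>s"
  using y(4) unfolding yx pdivides_def by blast
 have sn: "s ~= []"
 proof
  assume "s = []" then have "p = []" using s(2) UP.r_null[OF y(3)] by (simp add: yx univ_poly_zero)
  then show False using pc by simp
 qed
 have pm: "p = poly_mult [\<one>,\<ominus>x] s" using s(2) by (simp add: univ_poly_mult)
 have "degree p = degree [\<one>,\<ominus>x] + degree s"
  using poly_mult_degree_eq[OF carrier_is_subring, of "[\<one>,\<ominus>x]" s] y(3) s(1) sn by (simp add: pm univ_poly_carrier yx)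
 then have ds: "degree s = Suc n" using Suc(3) by simp
 have rs: "roots p = add_mset x (roots s)" using poly_mult_degree_one_monic_imp_same_roots[OF assms(4) s(1) sn] s(2) by simp
 have sr: "z = x" if "is_root s z" for z using that rs roots_mem_iff_is_root[OF s(1)] roots_mem_iff_is_root[OF Suc(2)] Suc(4)[of z] by auto
 have sc: "set s \<subseteq> carrier L" using s(1) by (auto simp: univ_poly_carrier[symmetric] polynomial_def)
 have ih: "coeff s n =\<ominus>([Suc n] \<cdot> (hd s\<otimes>x))" by (rule Suc(1)[OF s(1) ds sr])
 have lead: "coeff s (Suc n) = hd s" using lead_coeff_simp[OF sn] ds by simp
 have cz: "coeff s (Suc (Suc n)) = \<zero>" using coeff_degree[of s "Suc (Suc n)"] ds by simp
 have hs: "hd s\<in>carrier L" using sc sn by auto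
 have "hd p = coeff p (Suc (Suc n))" using lead_coeff_simp[OF pc(2)] Suc(3) by simp
 also have "\<dots> = hd s" unfolding pm using coeff_mult_linear(1)[OF sc assms(4)] lead cz hs assms(4) by (simp add: a_minus_def)
 finally have hp: "hd p = hd s" .
 have "coeff p (Suc n) =\<ominus>([Suc n] \<cdot> (hd s\<otimes>x))\<ominus>x\<otimes>hd s"
  unfolding pm using coeff_mult_linear(1)[OF sc assms(4)] ih lead by simp
 also have "\<dots> =\<ominus>([Suc (Suc n)] \<cdot> (hd p\<otimes>x))"
  using hs assms(4) unfolding hp by (simp add: a_minus_def minus_add m_comm a_comm)
 finally show ?case .
qed

text \<open>If \<open>x\<close> were the only root of its minimal polynomial over \<open>K\<close>,
  the second coefficient would put \<open>x\<close> into \<open>K\<close>. Another root b yields a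
  good graph containing (x, b), which \<open>extend\<close> turns into an automorphism taking
  \<open>x\<close> to b.\<close>

theorem gal_moves:
 assumes x: "x\<in>carrier L" "x\<notin>K"
 shows "\<exists>g1\<in>gal. g1 x ~= x"
proof -
 interpret E: hom_extension L K L "\<lambda>x. x" by unfold_locales (use algebraic_extension K_sub in "auto simp: ring_hom_def")
 obtain p where p: "E.minimal_at E.base p x" using E.minimal_ex[OF E.good_base x(1)] by blast
 let ?q = "map snd p"
 have q: "?q\<in>carrier (poly_ring L)" "length ?q >= 2" by (rule E.minimal_root[OF E.good_base x(1) p])+
 have pb: "set p \<subseteq> E.base" using p by (auto simp: E.minimal_at_def univ_poly_carrier[symmetric] polynomial_def)
 \<comment> \<open>The base map is the identity of \<open>K\<close>, so all coefficients are
   diagonal pairs (k, k) and both projections of \<open>p\<close> are the same polynomial over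
   \<open>K\<close>.\<close>
 then have fs: "map fst p = ?q" and qK: "set ?q \<subseteq> K" by (auto simp: E.base_def)
 obtain n where n: "degree ?q = Suc n" using q(2) by (cases "length ?q - 1") auto
 have "\<exists>b. is_root ?q b & b ~= x"
 proof (rule ccontr)
  assume "~ ?thesis"
  then have "coeff ?q n =\<ominus>([Suc n] \<cdot> (hd ?q\<otimes>x))" by (intro coeff_single_root[OF q(1) n _ x(1)]) blast
  moreover have qn: "?q ~= []" using q(2) by auto
  have hq: "hd ?q\<in>K" "hd ?q ~= \<zero>" using qK qn q(1) hd_in_set[OF qn] by (auto simp: univ_poly_carrier[symmetric] polynomial_def)
  let ?m = "[Suc n] \<cdot> \<one>"
  have mK: "[m] \<cdot> \<one>\<in>K" for m :: nat using subringE(2,3,7)[OF K_subring] by (induction m) simp_all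
  have "[Suc n] \<cdot> (hd ?q\<otimes>x) = (?m\<otimes>hd ?q)\<otimes>x"
   using hq x K_carrier add_pow_ldistr[of \<one> "hd ?q\<otimes>x" "Suc n"] by (simp add: m_assoc del: add.nat_pow_Suc)
  moreover have "coeff ?q n\<in>K"
  proof -
   have "length ?q = Suc (Suc n)" using n q(2) by arith
   then show ?thesis using subsetD[OF qK nth_mem[of 1 ?q]] coeff_nth[of n ?q] by simp
  qed
  ultimately have "\<ominus> ((?m\<otimes>hd ?q)\<otimes>x)\<in>K" by simp
  then have "\<ominus> (\<ominus> ((?m\<otimes>hd ?q)\<otimes>x))\<in>K" using subringE(5)[OF K_subring] by blast
  then have e: "(?m\<otimes>hd ?q)\<otimes>x\<in>K" using x(1) hq mK[of "Suc n"] K_carrier by (simp del: add.nat_pow_Suc)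
  let ?c = "?m\<otimes>hd ?q"
  have c: "?c\<in>K" "?c ~= \<zero>"
   using mK[of "Suc n"] hq subringE(6)[OF K_subring] char_zero[of "Suc n"] integral[of ?m "hd ?q"] K_carrier
   by (auto simp del: add.nat_pow_Suc)
  then have ic: "inv ?c\<in>K" using subfield_m_inv(1)[OF subfield_axioms, of ?c] by blast
  have "inv ?c\<otimes>(?c\<otimes>x)\<in>K" using subringE(6)[OF K_subring ic e] .
  moreover have "inv ?c\<otimes>(?c\<otimes>x) = x"
   using c x(1) K_carrier field_Units by (simp add: m_assoc[symmetric] l_inv del: add.nat_pow_Suc)
  ultimately show False using x(2) by simp
 qed
 then obtain b where b: "b\<in>carrier L" "eval ?q b = \<zero>" "b ~= x" by (auto simp: is_root_def)
 obtain G where G: "E.good G" "E.base \<subseteq> G" "(x, b)\<in>G" using E.good_extend[OF E.good_base x(1) p b(1,2)] by blast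
 obtain g where g: "g\<in>ring_hom L L" "\<And>u. u\<in>G ==> g (fst u) = snd u" using E.extend[OF G(1)] by blast
 have "\<forall>k\<in>K. g k = k"
 proof
  fix k assume "k\<in>K" then show "g k = k" using g(2)[of "(k, k)"] G(2) by (auto simp: E.base_def)
 qed
 then have "restrict g (carrier L)\<in>gal" by (rule restrict_hom_gal[OF g(1)])
 moreover have "restrict g (carrier L) x ~= x" using g(2)[OF G(3)] b(3) x(1) by simp
 ultimately show ?thesis by blast
qed

corollary fixed_field:
 assumes "x\<in>carrier L" "\<And>g1. g1\<in>gal ==> g1 x = x" shows "x\<in>K" using gal_moves assms by blast

text \<open>Dedekind's independence of characters, for functions on a set \<open>S\<close> extended multiplicatively
 to words.\<close>

lemma dedekind:
 assumes "finite R" "r1\<in>R" "a r1 ~= \<zero>" "\<And>r. r\<in>R ==> a r\<in>carrier L"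
  "\<And>r s. r\<in>R ==> s\<in>S ==> r s\<in>carrier L"
  "\<And>r r'. r\<in>R ==> r'\<in>R ==> r ~= r' ==> \<exists>s\<in>S. r s ~= r' s"
 shows "\<exists>ws\<in>lists S. (\<Oplus>r\<in>R. a r\<otimes>foldr (\<lambda>s y. r s\<otimes>y) ws \<one>) ~= \<zero>" using assms
proof (induction "card R" arbitrary: R r1 a)
 case 0 then show ?case by auto
next
 case (Suc n R r1 a)
 have fc: "foldr (\<lambda>s y. r s\<otimes>y) ws \<one>\<in>carrier L" if "ws\<in>lists S" "r\<in>R" for ws r
  using that by (induction ws) (use Suc.prems(5) in auto)
 show ?case
 proof (cases "R = {r1}")
  case True
  then show ?thesis using Suc.prems(3,4) by (intro bexI[of _ "[]"]) auto
 next
  case False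
  then obtain r0 where r0: "r0\<in>R" "r0 ~= r1" using Suc.prems(2) by blast
  obtain s where s: "s\<in>S" "r1 s ~= r0 s" using Suc.prems(6)[OF Suc.prems(2) r0(1)] r0(2) by blast
  let ?R = "R - {r0}"
  \<comment> \<open>Classical elimination: the sum at \<open>s # ws\<close> minus
    \<open>r0 s\<close> times the sum at \<open>ws\<close> loses the term of \<open>r0\<close> and
    multiplies the coefficient of every other r by r(s) - r0(s), which is nonzero for
    \<open>r1\<close>.\<close>
  let ?a = "\<lambda>r. a r\<otimes>(r s\<ominus>r0 s)"
  let ?m = "\<lambda>ws r. foldr (\<lambda>s y. r s\<otimes>y) ws \<one>"
  have "\<exists>ws\<in>lists S. (\<Oplus>r\<in>?R. ?a r\<otimes>?m ws r) ~= \<zero>"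
  proof (rule Suc.hyps(1))
   show "n = card ?R" using Suc.hyps(2) Suc.prems(1) r0(1) by simp
   show "?a r1 ~= \<zero>" using Suc.prems(2-5) s r0 integral[of "a r1" "r1 s\<ominus>r0 s"] r_right_minus_eq[of "r1 s" "r0 s"] by auto
   show "finite ?R" "r1 \<in> ?R" using Suc.prems(1,2) r0 by simp_all
   show "?a r\<in>carrier L" if "r \<in> ?R" for r using that Suc.prems(4,5) s(1) r0(1) by simp
   show "r t\<in>carrier L" if "r \<in> ?R" "t\<in>S" for r t using that Suc.prems(5) by simp
   show "\<exists>t\<in>S. r t ~= r' t" if "r \<in> ?R" "r' \<in> ?R" "r ~= r'" for r r' using that Suc.prems(6) by simp
  qed
  then obtain ws where ws: "ws\<in>lists S" "(\<Oplus>r\<in>?R. ?a r\<otimes>?m ws r) ~= \<zero>" by blast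
  let ?F = "\<lambda>ws. \<Oplus>r\<in>R. a r\<otimes>?m ws r"
  have cc: "a r\<otimes>?m ws r\<in>carrier L" "a r\<otimes>?m (s # ws) r\<in>carrier L"
   "r0 s\<otimes>(a r\<otimes>?m ws r)\<in>carrier L" if "r\<in>R" for r using that Suc.prems(4,5) s r0 fc[OF ws(1) that] by auto
  have "?F (s # ws)\<ominus>r0 s\<otimes>?F ws = (\<Oplus>r\<in>R. a r\<otimes>?m (s # ws) r)\<oplus>(\<Oplus>r\<in>R.\<ominus>(r0 s\<otimes>(a r\<otimes>?m ws r)))"
  proof -
   have "r0 s\<otimes>?F ws = (\<Oplus>r\<in>R. r0 s\<otimes>(a r\<otimes>?m ws r))"
    by (rule finsum_rdistr) (use Suc.prems(1,5) r0 s cc in auto)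
   moreover have "\<ominus> (\<Oplus>r\<in>R. r0 s\<otimes>(a r\<otimes>?m ws r)) = (\<Oplus>r\<in>R.\<ominus>(r0 s\<otimes>(a r\<otimes>?m ws r)))"
   proof -
    have "ring_hom_cring L L (\<lambda>x. x)" by (intro ring_hom_cring.intro ring_hom_cring_axioms.intro cring_axioms) (simp add: ring_hom_def)
    have "\<ominus> \<one>\<otimes>(\<Oplus>r\<in>R. r0 s\<otimes>(a r\<otimes>?m ws r)) = (\<Oplus>r\<in>R.\<ominus>\<one>\<otimes>(r0 s\<otimes>(a r\<otimes>?m ws r)))"
     by (rule finsum_rdistr) (use Suc.prems(1) cc in auto)
    moreover have "(\<Oplus>r\<in>R.\<ominus>\<one>\<otimes>(r0 s\<otimes>(a r\<otimes>?m ws r))) = (\<Oplus>r\<in>R.\<ominus>(r0 s\<otimes>(a r\<otimes>?m ws r)))"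
     by (rule finsum_cong') (use cc in "auto simp: l_minus")
    moreover have "(\<Oplus>r\<in>R. r0 s\<otimes>(a r\<otimes>?m ws r))\<in>carrier L" by (rule finsum_closed) (use cc in auto)
    ultimately show ?thesis by (simp add: l_minus)
   qed
   ultimately show ?thesis by (simp add: a_minus_def)
  qed
  also have "\<dots> = (\<Oplus>r\<in>R. a r\<otimes>?m (s # ws) r\<oplus>\<ominus> (r0 s\<otimes>(a r\<otimes>?m ws r)))"
   by (rule finsum_addf[symmetric]) (use cc in auto)
  also have "\<dots> = (\<Oplus>r\<in>R. ?a r\<otimes>?m ws r)"
  proof (rule finsum_cong')
   fix r assume r: "r\<in>R"
   have l: "a'\<otimes>(x\<otimes>m)\<oplus>\<ominus> (y\<otimes>(a'\<otimes>m)) = a'\<otimes>(x\<ominus>y)\<otimes>m"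
    if "a'\<in>carrier L" "x\<in>carrier L" "y\<in>carrier L" "m\<in>carrier L" for a' x y m
   proof -
    have "a'\<otimes>(x\<ominus>y)\<otimes>m = a'\<otimes>x\<otimes>m\<oplus>\<ominus> (a'\<otimes>y\<otimes>m)"
     using that by (simp add: a_minus_def l_distr r_distr l_minus r_minus)
    moreover have "a'\<otimes>y\<otimes>m = y\<otimes>(a'\<otimes>m)" using that by (simp add: m_lcomm m_assoc)
    ultimately show ?thesis using that by (simp add: m_assoc)
   qed
   note c = Suc.prems(4)[OF r] Suc.prems(5)[OF r s(1)] Suc.prems(5)[OF r0(1) s(1)] fc[OF ws(1) r]
   have "a r\<otimes>(r s\<otimes>?m ws r)\<oplus>\<ominus> (r0 s\<otimes>(a r\<otimes>?m ws r)) = ?a r\<otimes>?m ws r"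
    using c l by simp
   then show "a r\<otimes>?m (s # ws) r\<oplus>\<ominus> (r0 s\<otimes>(a r\<otimes>?m ws r)) = ?a r\<otimes>?m ws r" by simp
  next
   show "(\<lambda>r. ?a r\<otimes>?m ws r)\<in>R \<rightarrow> carrier L" using Suc.prems(4,5) s r0 fc[OF ws(1)] by auto
  qed simp
  also have "\<dots> = (\<Oplus>r\<in>insert r0 ?R. ?a r\<otimes>?m ws r)" using r0(1) by (simp add: insert_absorb)
  also have "\<dots> = ?a r0\<otimes>?m ws r0\<oplus>(\<Oplus>r\<in>?R. ?a r\<otimes>?m ws r)"
   by (rule finsum_insert) (use Suc.prems(1,4,5) s r0 fc[OF ws(1)] in auto)
  also have "\<dots> = (\<Oplus>r\<in>?R. ?a r\<otimes>?m ws r)"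
  proof -
   have "(\<Oplus>r\<in>?R. ?a r\<otimes>?m ws r)\<in>carrier L" by (rule finsum_closed) (use Suc.prems(4,5) s r0 fc[OF ws(1)] in auto)
   moreover have "r0 s\<ominus>r0 s = \<zero>" using Suc.prems(5)[OF r0(1) s(1)] by (simp add: a_minus_def r_neg)
   ultimately show ?thesis using Suc.prems(4)[OF r0(1)] fc[OF ws(1) r0(1)] by simp
  qed
  finally have "?F (s # ws)\<ominus>r0 s\<otimes>?F ws ~= \<zero>" using ws(2) by simp
  then have "?F (s # ws) ~= \<zero> \<or> ?F ws ~= \<zero>" using Suc.prems(5)[OF r0(1) s(1)] by (auto simp: a_minus_def)
  moreover have "s # ws\<in>lists S" using ws(1) s(1) by simp
  ultimately show ?thesis using ws(1) by (elim disjE) (rule bexI, assumption+)+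
 qed
qed

end

section \<open>Kummer theory for a kernel of order two\<close>

abbreviation two_torsion :: "('a, 'm) ring_scheme => 'a point" where
 "two_torsion L \<equiv> Affine \<zero>\<^bsub>L\<^esub> \<zero>\<^bsub>L\<^esub>"

context galois_closure
begin

lemma two_nonzero: "\<one>\<oplus>\<one> ~= \<zero>" using char_zero[of 2] by (simp add: numeral_2_eq_2)

lemma double_zero: "x\<in>carrier L ==> x\<oplus>x = \<zero> ==> x = \<zero>"
 using two_nonzero integral[of "\<one>\<oplus>\<one>" x] by (simp add: l_distr)

lemma neg_ne: "x\<in>carrier L ==> x ~= \<zero> \<Longrightarrow>\<ominus>x ~= x" using double_zero[of x] r_neg[of x] by auto

lemma square_eq: "x\<in>carrier L ==> y\<in>carrier L ==> x\<otimes>x = y\<otimes>y ==> x = y \<or> x =\<ominus>y"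
proof -
 assume c: "x\<in>carrier L" "y\<in>carrier L" and e: "x\<otimes>x = y\<otimes>y"
 have "(x\<ominus>y)\<otimes>(x\<oplus>y) = x\<otimes>x\<ominus>y\<otimes>y" using c by Ring.algebra
 also have "\<dots> = \<zero>" using c e by (simp add: a_minus_def r_neg)
 finally have "x\<ominus>y = \<zero> \<or> x\<oplus>y = \<zero>" using c integral[of "x\<ominus>y" "x\<oplus>y"] by simp
 then show ?thesis
 proof
  assume "x\<ominus>y = \<zero>" then show ?thesis using c by simp
 next
  assume "x\<oplus>y = \<zero>" then show ?thesis using c minus_equality[of x y] by (simp add: minus_equality)
 qed
qed

lemma gal_hom_simps:
 assumes "g1\<in>gal" "x\<in>carrier L" "y\<in>carrier L"
 shows "g1 (x\<otimes>y) = g1 x\<otimes>g1 y" "g1 (x\<oplus>y) = g1 x\<oplus>g1 y" "g1 (\<ominus> x) =\<ominus>g1 x"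
  "g1 (x\<ominus>y) = g1 x\<ominus>g1 y" "g1 \<one> = \<one>" "g1 \<zero> = \<zero>"
proof -
 interpret h: ring_hom_cring L L g1 by (rule gal_hom[OF assms(1)])
 show "g1 (x\<otimes>y) = g1 x\<otimes>g1 y" "g1 (x\<oplus>y) = g1 x\<oplus>g1 y" "g1 (\<ominus> x) =\<ominus>g1 x"
  "g1 (x\<ominus>y) = g1 x\<ominus>g1 y" "g1 \<one> = \<one>" "g1 \<zero> = \<zero>" using assms by (simp_all add: a_minus_def)
qed

text \<open>Hilbert 90 for a sign character \<open>e\<close>, by the Lagrange resolvent, the sum of
  e(g) g(m). Continuity lets the sum run over the finitely many restrictions of automorphisms to
  \<open>S\<close>, and Dedekind's lemma supplies a monomial m in elements of \<open>S\<close> for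
  which it is nonzero.\<close>

theorem kummer_generator:
 assumes e: "\<And>g1. g1\<in>gal ==> e g1 = \<one> \<or> e g1 =\<ominus>\<one>"
  and mult: "\<And>g1 g2. g1\<in>gal ==> g2\<in>gal ==> e (compose (carrier L) g1 g2) = e g1\<otimes>e g2"
  and S: "finite S" "S \<subseteq> carrier L" "\<And>g1. g1\<in>gal ==> (\<forall>x\<in>S. g1 x = x) ==> e g1 = \<one>"
 shows "\<exists>be\<in>carrier L. be ~= \<zero> & (\<forall>g1\<in>gal. g1 be = e g1\<otimes>be)"
proof -
 have ec: "e g1\<in>carrier L" "e g1\<otimes>e g1 = \<one>" "g2\<in>gal ==> g2 (e g1) = e g1" if "g1\<in>gal" for g1 g2
  using e[OF that] gal_hom_simps[of g2 \<one> \<one>] by (auto simp: l_minus)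
 \<comment> \<open>The character factors through restriction to \<open>S\<close>: the inverse of
   \<open>g1\<close> followed after \<open>g2\<close> fixes \<open>S\<close> pointwise, so
   \<open>e\<close> is one there, and its values are their own inverses.\<close>
 have same: "e g1 = e g2" if gt: "g1\<in>gal" "g2\<in>gal" and ag: "\<And>x. x\<in>S ==> g1 x = g2 x" for g1 g2
 proof -
  have b: "bij_betw g1 (carrier L) (carrier L)" using gt(1) by (simp add: gal_iff)
  have im: "g1 ` carrier L = carrier L" and inj: "inj_on g1 (carrier L)" using b by (simp_all add: bij_betw_def)
  define i where "i = inv_into (carrier L) g1"
  have ic: "i y\<in>carrier L" if "y\<in>carrier L" for y unfolding i_def using that by (intro inv_into_into) (simp add: im)
  have ri: "g1 (i y) = y" if "y\<in>carrier L" for y unfolding i_def using that by (intro f_inv_into_f) (simp add: im)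
  have ii: "i x = y" if "x\<in>carrier L" "y\<in>carrier L" "x = g1 y" for x y
   unfolding i_def that(3) by (rule inv_into_f_f[OF inj that(2)])
  let ?i = "restrict i (carrier L)"
  have li: "?i (g1 x) = x" if "x\<in>carrier L" for x using ii[OF gal_closed[OF gt(1) that] that] gal_closed[OF gt(1) that] by simp
  have "i\<in>ring_hom L L"
  proof (rule ring_hom_memI)
   fix x y assume xy: "x\<in>carrier L" "y\<in>carrier L"
   show "i x\<in>carrier L" using ic xy by simp
   show "i (x\<otimes>y) = i x\<otimes>i y" using gal_hom_simps(1)[OF gt(1) ic[OF xy(1)] ic[OF xy(2)]] ri xy ic by (intro ii) auto
   show "i (x\<oplus>y) = i x\<oplus>i y" using gal_hom_simps(2)[OF gt(1) ic[OF xy(1)] ic[OF xy(2)]] ri xy ic by (intro ii) auto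
  next
   show "i \<one> = \<one>" using gal_hom_simps(5)[OF gt(1), of \<one> \<one>] by (intro ii) auto
  qed
  moreover have "\<forall>k\<in>K. i k = k"
  proof
   fix k assume k: "k\<in>K"
   show "i k = k" using gal_fix[OF gt(1) k] K_carrier[OF k] by (intro ii) auto
  qed
  ultimately have i: "?i\<in>gal" by (rule restrict_hom_gal)
  let ?c = "compose (carrier L) ?i g2"
  have c: "?c\<in>gal" by (rule gal_compose[OF i gt(2)])
  have "\<forall>x\<in>S. ?c x = x"
  proof
   fix x assume x: "x\<in>S"
   then have "x\<in>carrier L" using S(2) by blast
   then show "?c x = x" using ag[OF x] li[of x] by (simp add: compose_def)
  qed
  then have "e ?c = \<one>" by (rule S(3)[OF c])
  then have 1: "e ?i\<otimes>e g2 = \<one>" using mult[OF i gt(2)] by simp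
  have "compose (carrier L) ?i g1 = (\<lambda>x\<in>carrier L. x)" using li by (auto simp: compose_def fun_eq_iff)
  then have "e (compose (carrier L) ?i g1) = \<one>" using S(3)[OF gal_one] S(2) by (auto simp: subset_iff)
  then have 2: "e ?i\<otimes>e g1 = \<one>" using mult[OF i gt(1)] by simp
  have l: "y = x" if "x\<in>carrier L" "y\<in>carrier L" "x\<otimes>x = \<one>" "x\<otimes>y = \<one>" for x y
   using that m_assoc[of x x y] by simp
  show ?thesis using l[OF ec(1)[OF i] ec(1)[OF gt(1)] ec(2)[OF i] 2] l[OF ec(1)[OF i] ec(1)[OF gt(2)] ec(2)[OF i] 1] by simp
 qed
 let ?R = "(\<lambda>g1. restrict g1 S) ` gal"
 define rep where "rep r = (SOME g1. g1\<in>gal & restrict g1 S = r)" for r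
 have rep: "rep r\<in>gal" "restrict (rep r) S = r" if "r \<in> ?R" for r
 proof -
  have "\<exists>g1. g1\<in>gal & restrict g1 S = r" using that by auto
  then have "rep r\<in>gal & restrict (rep r) S = r" unfolding rep_def by (rule someI_ex)
  then show "rep r\<in>gal" "restrict (rep r) S = r" by simp_all
 qed
 have repS: "rep r s = r s" if "r \<in> ?R" "s\<in>S" for r s using fun_cong[OF rep(2)[OF that(1)], of s] that(2) by simp
 have rc: "r s\<in>carrier L" if "r \<in> ?R" "s\<in>S" for r s using that S(2) by (auto simp: gal_closed subset_iff)
 have finR: "finite ?R"
 proof -
  have "\<forall>x\<in>S. \<exists>F. finite F & (\<forall>g1\<in>gal. g1 x\<in>F)"
  proof
   fix x assume "x\<in>S"
   then have "x\<in>carrier L" using S(2) by blast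
   then obtain F where F: "finite F" "x\<in>F" "\<forall>g\<in>ring_hom L L. (\<forall>k\<in>K. g k = k) --> (\<forall>y\<in>F. g y\<in>F)"
    using finite_conjugates by metis
   have "\<forall>g1\<in>gal. g1 x\<in>F"
   proof
    fix g1 assume "g1\<in>gal"
    then show "g1 x\<in>F" using F(2,3) by (simp add: gal_iff)
   qed
   then show "\<exists>F. finite F & (\<forall>g1\<in>gal. g1 x\<in>F)" using F(1) by blast
  qed
  then obtain F where F: "\<And>x. x\<in>S ==> finite (F x)" "\<And>x g1. x\<in>S ==> g1\<in>gal ==> g1 x\<in>F x" by metis
  have "?R \<subseteq> PiE S F" using F(2) by auto
  then show ?thesis by (rule finite_subset[OF _ finite_PiE[OF S(1) F(1)]])
 qed
 let ?m = "\<lambda>ws r. foldr (\<lambda>s y. r s\<otimes>y) ws \<one>"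
 have Rext: "r s = undefined" if "r \<in> ?R" "s\<notin>S" for r s using that by auto
 have Req: "r = r'" if "r \<in> ?R" "r' \<in> ?R" "\<And>s. s\<in>S ==> r s = r' s" for r r'
 proof
  fix s show "r s = r' s" using that(3)[of s] Rext[OF that(1), of s] Rext[OF that(2), of s] by (cases "s\<in>S") simp_all
 qed
 let ?r1 = "restrict (\<lambda>x\<in>carrier L. x) S"
 have r1: "?r1 \<in> ?R" by (rule imageI[OF gal_one])
 have er1: "e (rep ?r1) ~= \<zero>"
 proof
  assume "e (rep ?r1) = \<zero>"
  then show False using ec(2)[OF rep(1)[OF r1]] by simp
 qed
 have "\<exists>ws\<in>lists S. (\<Oplus>r\<in>?R. e (rep r)\<otimes>?m ws r) ~= \<zero>"
 proof (rule dedekind[where a = "\<lambda>r. e (rep r)" and R = ?R and ?r1.0 = ?r1 and S = S, OF finR r1 er1])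
  show "e (rep r)\<in>carrier L" if "r \<in> ?R" for r by (rule ec(1)[OF rep(1)[OF that]])
  show "r s\<in>carrier L" if "r \<in> ?R" "s\<in>S" for r s by (rule rc[OF that])
  show "\<exists>s\<in>S. r s ~= r' s" if "r \<in> ?R" "r' \<in> ?R" "r ~= r'" for r r' using Req[OF that(1,2)] that(3) by metis
 qed
 then obtain ws where ws: "ws\<in>lists S" "(\<Oplus>r\<in>?R. e (rep r)\<otimes>?m ws r) ~= \<zero>" by blast
 have wsS: "set ws \<subseteq> S" using ws(1) by (simp add: lists_eq_set)
 have mc: "?m ws r\<in>carrier L" if "\<And>s. s\<in>S ==> r s\<in>carrier L" for r using wsS that by (induction ws) auto
 let ?be = "\<Oplus>r\<in>?R. e (rep r)\<otimes>?m ws r"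
 have tc: "e (rep r)\<otimes>?m ws r\<in>carrier L" if "r \<in> ?R" for r using ec(1)[OF rep(1)[OF that]] mc[OF rc[OF that]] by simp
 have bc: "?be\<in>carrier L" by (rule finsum_closed) (use tc in blast)
 have "g1 ?be = e g1\<otimes>?be" if g1: "g1\<in>gal" for g1
 proof -
  interpret h: ring_hom_cring L L g1 by (rule gal_hom[OF g1])
  \<comment> \<open>Left multiplication by \<open>g1\<close> on restrictions to \<open>S\<close>. It
    permutes \<open>?R\<close>, so applying \<open>g1\<close> reindexes the resolvent and brings out
    the factor e(g1).\<close>
  define f where "f r = restrict (compose (carrier L) g1 (rep r)) S" for r
  have fR: "f r \<in> ?R" if "r \<in> ?R" for r unfolding f_def by (rule imageI[OF gal_compose[OF g1 rep(1)[OF that]]])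
  have fs: "f r s = g1 (r s)" if "r \<in> ?R" "s\<in>S" for r s using that repS[OF that] S(2) by (auto simp: f_def compose_def)
  have inj: "inj_on f ?R"
  proof (rule inj_onI)
   fix r r' assume r: "r \<in> ?R" "r' \<in> ?R" "f r = f r'"
   have "r s = r' s" if "s\<in>S" for s
    using fs[OF r(1) that] fs[OF r(2) that] r(3) gal_inj[OF g1 rc[OF r(1) that] rc[OF r(2) that]] by simp
   then show "r = r'" by (rule Req[OF r(1,2)])
  qed
  have im: "f ` ?R = ?R" using fR by (intro endo_inj_surj finR inj) blast
  have trm: "g1 (e (rep r)\<otimes>?m ws r) = e g1\<otimes>(e (rep (f r))\<otimes>?m ws (f r))" if r: "r \<in> ?R" for r
  proof -
   have m: "g1 (?m ws r) = ?m ws (f r)" using wsS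
   proof (induction ws)
    case (Cons s ws)
    have "foldr (\<lambda>s y. r s\<otimes>y) ws \<one>\<in>carrier L" using Cons(2) rc[OF r] by (induction ws) auto
    then show ?case using Cons rc[OF r] fs[OF r] by simp
   qed simp
   have "e (rep (f r)) = e (compose (carrier L) g1 (rep r))"
   proof (rule same[OF rep(1)[OF fR[OF r]] gal_compose[OF g1 rep(1)[OF r]]])
    fix s assume s: "s\<in>S"
    show "rep (f r) s = compose (carrier L) g1 (rep r) s" using repS[OF fR[OF r] s] s by (simp add: f_def)
   qed
   also have "\<dots> = e g1\<otimes>e (rep r)" by (rule mult[OF g1 rep(1)[OF r]])
   finally have "e g1\<otimes>e (rep (f r)) = e (rep r)" using ec[OF g1] ec[OF rep(1)[OF r]] by (simp add: m_assoc[symmetric])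
   then show ?thesis
    using m ec(1)[OF rep(1)[OF r]] ec(3)[OF rep(1)[OF r] g1] ec(1)[OF rep(1)[OF fR[OF r]]] ec(1)[OF g1] mc[OF rc[OF r]] mc[OF rc[OF fR[OF r]]] g1
    by (simp add: m_assoc[symmetric])
  qed
  have "g1 ?be = (\<Oplus>r\<in>?R. g1 (e (rep r)\<otimes>?m ws r))"
   using h.hom_finsum[of "\<lambda>r. e (rep r)\<otimes>?m ws r" ?R] tc by (simp add: comp_def Pi_def)
  also have "\<dots> = (\<Oplus>r\<in>?R. e g1\<otimes>(e (rep (f r))\<otimes>?m ws (f r)))"
   by (rule finsum_cong') (use trm tc[OF fR] ec(1)[OF g1] in auto)
  also have "\<dots> = e g1\<otimes>(\<Oplus>r\<in>?R. e (rep (f r))\<otimes>?m ws (f r))"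
   by (rule finsum_rdistr[symmetric]) (use finR tc[OF fR] ec(1)[OF g1] in auto)
  also have "(\<Oplus>r\<in>?R. e (rep (f r))\<otimes>?m ws (f r)) = (\<Oplus>r\<in>f ` ?R. e (rep r)\<otimes>?m ws r)"
   by (rule add.finprod_reindex[symmetric]) (use inj im tc in auto)
  finally show ?thesis unfolding im .
 qed
 then show ?thesis using bc ws(2) by blast
qed

text \<open>The cocycle g(u) / u with -1 read as (0,0). It is meant for \<open>u\<close> whose
  square lies in \<open>K\<close>, where g(u) can only be u or -u.\<close>

definition kum :: "'a => ('a => 'a) => 'a point" where
 "kum u = (\<lambda>g1\<in>gal. if g1 u = u then Infinity else two_torsion L)"

lemma gal_root:
 assumes "g1\<in>gal" "u\<in>carrier L" "u\<otimes>u\<in>K"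
 shows "g1 u = u \<or> g1 u =\<ominus>u"
 using square_eq[of "g1 u" u] gal_hom_simps(1)[OF assms(1,2,2)] gal_fix[OF assms(1,3)] gal_closed[OF assms(1,2)] assms(2) by simp

text \<open>Equal cocycles mean that every automorphism changes the signs of \<open>u\<close> and
  \<open>w\<close> together, that is, fixes their product. This is the injectivity of the Kummer map
  on square classes of \<open>K\<close>.\<close>

lemma kum_eq_iff:
 assumes u: "u\<in>carrier L" "u ~= \<zero>" "u\<otimes>u\<in>K" and w: "w\<in>carrier L" "w ~= \<zero>" "w\<otimes>w\<in>K"
 shows "kum u = kum w \<longleftrightarrow> u\<otimes>w\<in>K"
proof
 assume e: "kum u = kum w"
 show "u\<otimes>w\<in>K"
 proof (rule fixed_field)
  fix g1 assume g1: "g1\<in>gal"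
  have "(g1 u = u) = (g1 w = w)" using fun_cong[OF e, of g1] g1 by (auto simp: kum_def split: if_splits)
  then have "g1 u = u & g1 w = w \<or> g1 u =\<ominus>u & g1 w =\<ominus>w" using gal_root[OF g1 u(1,3)] gal_root[OF g1 w(1,3)] by auto
  then show "g1 (u\<otimes>w) = u\<otimes>w" using u w gal_hom_simps(1)[OF g1 u(1) w(1)] by (auto simp: l_minus r_minus)
 qed (use u w in simp)
next
 assume k: "u\<otimes>w\<in>K"
 have "(g1 u = u) = (g1 w = w)" if g1: "g1\<in>gal" for g1
 proof -
  have e: "g1 u\<otimes>g1 w = u\<otimes>w" using gal_hom_simps(1)[OF g1 u(1) w(1)] gal_fix[OF g1 k] by simp
  have "u\<otimes>w ~= \<zero>" using u w integral by blast
  then have ne: "\<ominus> (u\<otimes>w) ~= u\<otimes>w" using u w by (intro neg_ne) auto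
  then show ?thesis using gal_root[OF g1 u(1,3)] gal_root[OF g1 w(1,3)] e u w neg_ne[of u] neg_ne[of w] by (auto simp: l_minus r_minus)
 qed
 then show "kum u = kum w" by (auto simp: kum_def fun_eq_iff)
qed

end

text \<open>For the kernel \<open>{O, (0,0)}\<close>, all coboundaries are trivial, so that the classes in \<open>H\<^sup>1\<close> are
 singletons.\<close>

locale two_kernel = galois_closure +
 fixes M :: "'a point monoid" and a b :: int
 assumes M_carrier: "carrier M = {Infinity, two_torsion L}"
  and M_mult: "monoid.mult M = point_add a b" and M_one: "one M = Infinity"
begin

lemma M_simps:
 "Infinity\<otimes>\<^bsub>M\<^esub>x = x" "x\<otimes>\<^bsub>M\<^esub>Infinity = x" "two_torsion L\<otimes>\<^bsub>M\<^esub>two_torsion L = Infinity"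
proof -
 show "x\<otimes>\<^bsub>M\<^esub>Infinity = x" unfolding M_mult by (cases x) auto
qed (simp_all add: M_mult)

lemma map_point_M: "g1\<in>gal ==> x\<in>carrier M ==> map_point g1 x = x"
 using gal_hom_simps(6)[of g1 \<one> \<one>] by (auto simp: M_carrier)

lemma H1_class_eq: "c\<in>extensional gal ==> H1_class L K M c = {c}"
proof -
 assume c: "c\<in>extensional gal"
 have inv: "inv\<^bsub>M\<^esub> x = x" if "x\<in>carrier M" for x unfolding m_inv_def using that
  by (intro the_equality) (auto simp: M_carrier M_one M_simps)
 have sq: "x\<otimes>\<^bsub>M\<^esub>x = Infinity" if "x\<in>carrier M" for x using that by (auto simp: M_carrier M_simps)
 have "principal_cocycle L K M x = (\<lambda>g1\<in>gal. Infinity)" if "x\<in>carrier M" for x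
  unfolding principal_cocycle_def by (rule restrict_ext) (simp add: map_point_M that inv sq)
 then have "coboundaries L K M = {\<lambda>g1\<in>gal. Infinity}" by (auto simp: coboundaries_def M_carrier)
 moreover have "(\<lambda>g1\<in>gal. Infinity)\<otimes>\<^bsub>cocycles L K M\<^esub>c = c"
  using c by (auto simp: cocycles_def Let_def M_simps fun_eq_iff extensional_def)
 ultimately show ?thesis by (simp add: H1_class_def r_coset_def)
qed

lemma cocycles_extensional: "c\<in>carrier (cocycles L K M) ==> c\<in>extensional gal" by (auto simp: cocycles_def Let_def PiE_def)

lemma H1_carrier: "carrier (H1 L K M) = (\<lambda>c. {c}) ` carrier (cocycles L K M)" unfolding H1_def carrier_FactGroup
 by (rule image_cong) (auto simp: H1_class_eq[unfolded H1_class_def] cocycles_extensional)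

text \<open>The action on the kernel is trivial, so a cocycle is a continuous character into a group
  of order two, and \<open>kummer_generator\<close> produces a square root on which automorphisms
  act by that sign.\<close>

lemma cocycle_iff:
 "c\<in>carrier (cocycles L K M) \<longleftrightarrow> (\<exists>u\<in>carrier L. u ~= \<zero> & u\<otimes>u\<in>K & c = kum u)"
proof
 assume c: "c\<in>carrier (cocycles L K M)"
 then have ce: "c\<in>gal \<rightarrow>\<^sub>E carrier M" and kc: "krull_continuous L K c"
  and cm: "\<And>g1 g2. g1\<in>gal ==> g2\<in>gal ==> c (g1\<otimes>\<^bsub>galois_group L K\<^esub>g2) = c g1\<otimes>\<^bsub>M\<^esub>map_point g1 (c g2)"
  by (auto simp: cocycles_def Let_def)
 have cv: "c g1 = Infinity \<or> c g1 = two_torsion L" if "g1\<in>gal" for g1 using PiE_mem[OF ce that] by (auto simp: M_carrier)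
 have cm': "c (compose (carrier L) g1 g2) = c g1\<otimes>\<^bsub>M\<^esub>c g2" if "g1\<in>gal" "g2\<in>gal" for g1 g2
  using cm[OF that] gal_mult[OF that] map_point_M[OF that(1) PiE_mem[OF ce that(2)]] by simp
 define e where "e g1 = (if c g1 = Infinity then \<one> else\<ominus>\<one>)" for g1
 let ?id = "\<lambda>x\<in>carrier L. x"
 have cid: "c ?id = Infinity" using cm'[OF gal_one gal_one] cv[OF gal_one] by (auto simp: M_simps)
 obtain S where S: "finite S" "S \<subseteq> carrier L" "\<And>g2. g2\<in>gal ==> (\<forall>x\<in>S. g2 x = ?id x) ==> c g2 = c ?id"
  using kc gal_one unfolding krull_continuous_def by metis
 have "\<exists>be\<in>carrier L. be ~= \<zero> & (\<forall>g1\<in>gal. g1 be = e g1\<otimes>be)"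
 proof (rule kummer_generator[OF _ _ S(1,2)])
  show "e g1 = \<one> \<or> e g1 =\<ominus>\<one>" for g1 by (simp add: e_def)
  show "e (compose (carrier L) g1 g2) = e g1\<otimes>e g2" if "g1\<in>gal" "g2\<in>gal" for g1 g2
   using cv[OF that(1)] cv[OF that(2)] by (auto simp: e_def cm'[OF that] M_simps l_minus)
  show "e g1 = \<one>" if "g1\<in>gal" "\<forall>x\<in>S. g1 x = x" for g1
   using S(3)[OF that(1)] that(2) S(2) cid by (auto simp: e_def subset_iff)
 qed
 then obtain be where be: "be\<in>carrier L" "be ~= \<zero>" "\<And>g1. g1\<in>gal ==> g1 be = e g1\<otimes>be" by blast
 have e2: "g1 be = be \<longleftrightarrow> c g1 = Infinity" if "g1\<in>gal" for g1
  using be(3)[OF that] neg_ne[OF be(1,2)] be(1) by (auto simp: e_def l_minus)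
 have "be\<otimes>be\<in>K"
 proof (rule fixed_field)
  fix g1 assume g1: "g1\<in>gal"
  show "g1 (be\<otimes>be) = be\<otimes>be" using gal_hom_simps(1)[OF g1 be(1,1)] be(3)[OF g1] be(1) by (auto simp: e_def l_minus r_minus)
 qed (use be in simp)
 moreover have "c = kum be"
 proof
  fix g1 show "c g1 = kum be g1" using e2[of g1] cv[of g1] PiE_arb[OF ce, of g1] by (auto simp: kum_def)
 qed
 ultimately show "\<exists>u\<in>carrier L. u ~= \<zero> & u\<otimes>u\<in>K & c = kum u" using be by blast
next
 assume "\<exists>u\<in>carrier L. u ~= \<zero> & u\<otimes>u\<in>K & c = kum u"
 then obtain u where u: "u\<in>carrier L" "u ~= \<zero>" "u\<otimes>u\<in>K" and c: "c = kum u" by blast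
 have "c\<in>gal \<rightarrow>\<^sub>E carrier M" by (auto simp: c kum_def M_carrier)
 moreover have "krull_continuous L K c" unfolding krull_continuous_def using u(1) by (intro ballI exI[of _ "{u}"]) (auto simp: c kum_def)
 moreover have "c (g1\<otimes>\<^bsub>galois_group L K\<^esub>g2) = c g1\<otimes>\<^bsub>M\<^esub>map_point g1 (c g2)"
  if g1: "g1\<in>gal" and g2: "g2\<in>gal" for g1 g2
 proof -
  have "c g2\<in>carrier M" using g2 by (simp add: c kum_def M_carrier)
  then have "map_point g1 (c g2) = c g2" by (rule map_point_M[OF g1])
  moreover have "compose (carrier L) g1 g2 u = g1 (g2 u)" using u by (simp add: compose_def)
  moreover have "g1 (\<ominus> u) =\<ominus>g1 u" using gal_hom_simps(3)[OF g1 u(1) u(1)] .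
  ultimately show ?thesis using gal_root[OF g1 u(1,3)] gal_root[OF g2 u(1,3)] neg_ne[OF u(1,2)] gal_compose[OF g1 g2] g1 g2 u(1)
   by (auto simp: c kum_def gal_mult M_simps)
 qed
 ultimately show "c\<in>carrier (cocycles L K M)" by (simp add: cocycles_def Let_def)
qed

end

section \<open>The isogenies of degree two and their connecting maps\<close>

context ring
begin

lemma int_embed:
 "[(i + j :: int)] \<cdot> \<one> = [i] \<cdot> \<one>\<oplus>[j] \<cdot> \<one>" "[(i * j :: int)] \<cdot> \<one> = ([i] \<cdot> \<one>)\<otimes>([j] \<cdot> \<one>)"
 "[(1 :: int)] \<cdot> \<one> = \<one>" "[(- i :: int)] \<cdot> \<one> =\<ominus>([i] \<cdot> \<one>)" "[(0::int)] \<cdot> \<one> = \<zero>"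
 "[(i - j :: int)] \<cdot> \<one> = [i] \<cdot> \<one>\<ominus>[j] \<cdot> \<one>"
proof -
 show a: "[(i + j :: int)] \<cdot> \<one> = [i] \<cdot> \<one>\<oplus>[j] \<cdot> \<one>" for i j by (simp add: add.int_pow_mult)
 show "[(1 :: int)] \<cdot> \<one> = \<one>" by (simp add: add.int_pow_1)
 show m: "[(- i :: int)] \<cdot> \<one> =\<ominus>([i] \<cdot> \<one>)" for i by (simp add: add.int_pow_neg)
 show "[(0::int)] \<cdot> \<one> = \<zero>" by (simp add: add_pow_def int_pow_def2)
 show "[(i - j :: int)] \<cdot> \<one> = [i] \<cdot> \<one>\<ominus>[j] \<cdot> \<one>" using a[of i "- j"] m[of j] by (simp add: a_minus_def)
 have "([i] \<cdot> \<one>)\<otimes>([j] \<cdot> \<one>) = [i] \<cdot> ([j] \<cdot> \<one>)"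
  using add_pow_ldistr_int[of \<one> "[j] \<cdot> \<one>" i] by simp
 also have "\<dots> = [(j * i)] \<cdot> \<one>" by (simp add: add.int_pow_pow)
 finally show "[(i * j :: int)] \<cdot> \<one> = ([i] \<cdot> \<one>)\<otimes>([j] \<cdot> \<one>)" by (simp add: mult.commute)
qed

lemma int_numerals:
 "[(2::int)] \<cdot> \<one> = \<one>\<oplus>\<one>" "[(3::int)] \<cdot> \<one> = \<one>\<oplus>\<one>\<oplus>\<one>" "[(4::int)] \<cdot> \<one> = \<two>\<otimes>\<two>"
 using int_embed(1)[of 1 1] int_embed(1)[of 2 1] int_embed(1)[of 2 2] by (simp_all add: int_embed(3) l_distr r_distr a_assoc)

end

text \<open>Here \<open>x\<close> and \<open>z\<close> play the first coordinates of a point and of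
  its translate by (0,0), so that x z stands for the coefficient B. The identities take a factor x^2
  out of the curve equation, evaluate the tangent slope when x = z, and express (x + z)^2 - 4 x z as
  a square.\<close>

lemma (in cring) curve_ids:
 assumes c: "x\<in>carrier R" "A\<in>carrier R" "z\<in>carrier R"
 shows "x\<otimes>(x\<otimes>x\<oplus>A\<otimes>x\<oplus>x\<otimes>z) = x\<otimes>(x\<otimes>(x\<oplus>A\<oplus>z))"
  and "(x\<oplus>A\<oplus>z)\<ominus>A\<ominus>z\<ominus>x = \<zero>"
  and "(x\<oplus>A\<oplus>z)\<ominus>A = x\<oplus>z"
  and "\<two>\<otimes>((z\<oplus>A\<oplus>z)\<otimes>z) = (\<one>\<oplus>\<one>\<oplus>\<one>)\<otimes>(z\<otimes>z)\<oplus>(\<two>\<otimes>A)\<otimes>z\<oplus>z\<otimes>z"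
  and "\<ominus> (x\<oplus>z)\<otimes>\<ominus> (x\<oplus>z)\<ominus>\<two>\<otimes>\<two>\<otimes>(x\<otimes>z) = (z\<ominus>x)\<otimes>(z\<ominus>x)"
  and "l\<in>carrier R ==> l\<otimes>(A\<otimes>z)\<otimes>x = A\<otimes>(z\<otimes>(l\<otimes>x))"
proof -
 show "x\<otimes>(x\<otimes>x\<oplus>A\<otimes>x\<oplus>x\<otimes>z) = x\<otimes>(x\<otimes>(x\<oplus>A\<oplus>z))" using c by Ring.algebra
 show "(x\<oplus>A\<oplus>z)\<ominus>A\<ominus>z\<ominus>x = \<zero>" using c by Ring.algebra
 show "(x\<oplus>A\<oplus>z)\<ominus>A = x\<oplus>z" using c by Ring.algebra
 show "\<two>\<otimes>((z\<oplus>A\<oplus>z)\<otimes>z) = (\<one>\<oplus>\<one>\<oplus>\<one>)\<otimes>(z\<otimes>z)\<oplus>(\<two>\<otimes>A)\<otimes>z\<oplus>z\<otimes>z" using c by Ring.algebra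
 have "\<ominus> (x\<oplus>z)\<otimes>\<ominus> (x\<oplus>z)\<ominus>\<two>\<otimes>\<two>\<otimes>(x\<otimes>z)\<ominus>(z\<ominus>x)\<otimes>(z\<ominus>x) = \<zero>" using c by Ring.algebra
 then show "\<ominus> (x\<oplus>z)\<otimes>\<ominus> (x\<oplus>z)\<ominus>\<two>\<otimes>\<two>\<otimes>(x\<otimes>z) = (z\<ominus>x)\<otimes>(z\<ominus>x)"
  using c r_right_minus_eq by simp
 show "l\<in>carrier R ==> l\<otimes>(A\<otimes>z)\<otimes>x = A\<otimes>(z\<otimes>(l\<otimes>x))" using c by (simp add: m_ac)
qed

lemma (in field) divI:
 assumes "s\<in>carrier R" "t\<in>carrier R" "z\<in>carrier R" "t ~= \<zero>" "z\<otimes>t = s"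
 shows "s\<otimes>inv t = z" using assms by (auto simp: m_assoc field_Units)

lemma (in field) cancel_left:
 assumes "t\<in>carrier R" "x\<in>carrier R" "y\<in>carrier R" "t ~= \<zero>" "t\<otimes>x = t\<otimes>y"
 shows "x = y" using assms m_lcancel by blast

lemma (in monoid) square: "x\<in>carrier G ==> x [^] (2::nat) = x\<otimes>x"
 "x\<in>carrier G ==> x [^] (3::nat) = x\<otimes>x\<otimes>x" by (simp_all add: numeral_2_eq_2 numeral_3_eq_3)

lemma (in algebraically_closed) quadratic_root:
 assumes "p\<in>carrier L" "q\<in>carrier L"
 shows "\<exists>x\<in>carrier L. x\<otimes>x\<oplus>p\<otimes>x\<oplus>q = \<zero>"
proof -
 have P: "[\<one>, p, q] \<in> carrier (poly_ring L)" using assms by (auto simp: univ_poly_carrier[symmetric] polynomial_def)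
 have "splitted [\<one>, p, q]" by (rule roots_over_carrier[OF P])
 then have "roots [\<one>, p, q] ~= {#}" by (auto simp: splitted_def)
 then obtain x where "is_root [\<one>, p, q] x" using roots_mem_iff_is_root[OF P] by blast
 then show ?thesis using assms by (intro bexI[of _ x]) (auto simp: is_root_def square a_assoc)
qed

text \<open>Both isogenies at once: \<open>l\<close> is 1 for \<open>phi\<close> and 2 for
  \<open>phi_dual\<close>. The target has coefficients -2a / l^2 and (a^2 - 4b) / l^4, and the
  divisions by l^2 and l^3 in the two coordinates account for the 4 and the 8 in
  \<open>phi_dual\<close>.\<close>

locale two_isogeny = galois_closure L K for L (structure) and K +
 fixes a b a' b' :: int and l :: 'a and h :: "'a point => 'a point"
 assumes l: "l\<in>K" "l ~= \<zero>"
  and rel1: "l\<otimes>l\<otimes>([a'] \<cdot> \<one>)\<oplus>(\<one> \<oplus> \<one>)\<otimes>([a] \<cdot> \<one>) = \<zero>"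
  and rel2: "l\<otimes>l\<otimes>(l\<otimes>l)\<otimes>([b'] \<cdot> \<one>) = ([a] \<cdot> \<one>)\<otimes>([a] \<cdot> \<one>)\<ominus>(\<one> \<oplus> \<one>)\<otimes>(\<one> \<oplus> \<one>)\<otimes>([b] \<cdot> \<one>)"
  and b: "[b] \<cdot> \<one> ~= \<zero>" "[b'] \<cdot> \<one> ~= \<zero>"
  and h_Inf: "h Infinity = Infinity" and h_zero: "h (Affine \<zero> y) = Infinity"
  and h_aff: "x\<in>carrier L ==> y\<in>carrier L ==> x ~= \<zero> ==> h (Affine x y) =
   Affine ((y\<otimes>y)\<otimes>inv (l\<otimes>l\<otimes>(x\<otimes>x))) ((y\<otimes>([b] \<cdot> \<one>\<ominus>x\<otimes>x))\<otimes>inv (l\<otimes>l\<otimes>l\<otimes>(x\<otimes>x)))"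
begin

abbreviation "al \<equiv> [a] \<cdot> \<one>"
abbreviation "be \<equiv> [b] \<cdot> \<one>"
abbreviation "al' \<equiv> [a'] \<cdot> \<one>"
abbreviation "be' \<equiv> [b'] \<cdot> \<one>"
abbreviation "E \<equiv> curve a b"
abbreviation "E' \<equiv> curve a' b'"

lemma int_K: "[(k::int)] \<cdot> \<one>\<in>K"
proof -
 have n: "[(n::nat)] \<cdot> \<one>\<in>K" for n using subringE(2,3,7)[OF K_subring] by (induction n) simp_all
 show ?thesis
 proof (cases "k >= 0")
  case True
  then obtain n where "k = int n" by (metis nonneg_int_cases)
  then show ?thesis using n[of n] by (simp add: add_pow_def int_pow_int)
 next
  case False
  then obtain n where "k = - int n" by (metis nonpos_int_cases linorder_le_cases)
  then have "[k] \<cdot> \<one> =\<ominus>([int n] \<cdot> \<one>)" using int_embed(4)[of "int n"] by simp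
  moreover have "[int n] \<cdot> \<one>\<in>K" using n[of n] by (simp add: add_pow_def int_pow_int)
  ultimately show ?thesis using subringE(5)[OF K_subring] by simp
 qed
qed

lemma K_ops: "x\<in>K ==> y\<in>K ==> x\<oplus>y\<in>K" "x\<in>K ==> y\<in>K ==> x\<otimes>y\<in>K"
 "x\<in>K \<Longrightarrow>\<ominus>x\<in>K" "x\<in>K ==> y\<in>K ==> x\<ominus>y\<in>K" "\<one>\<in>K" "\<zero>\<in>K"
 using subringE[OF K_subring] by (auto simp: a_minus_def)

lemma lc: "l\<in>carrier L" using l K_carrier by blast

lemma on_curve_iff:
 assumes "x\<in>carrier L" "y\<in>carrier L"
 shows "on_curve A B x y \<longleftrightarrow> y\<otimes>y = x\<otimes>(x\<otimes>x\<oplus>([A] \<cdot> \<one>)\<otimes>x\<oplus>[B] \<cdot> \<one>)"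
proof -
 have "x\<otimes>(x\<otimes>x\<oplus>([A] \<cdot> \<one>)\<otimes>x\<oplus>[B] \<cdot> \<one>) = x\<otimes>x\<otimes>x\<oplus>([A] \<cdot> \<one>)\<otimes>(x\<otimes>x)\<oplus>([B] \<cdot> \<one>)\<otimes>x"
  using assms by (simp add: r_distr m_ac)
 then show ?thesis unfolding on_curve_def using assms by (simp add: square)
qed

lemma curve_carrier: "carrier (curve A B) = insert Infinity
  {Affine x y | x y. x\<in>carrier L & y\<in>carrier L & y\<otimes>y = x\<otimes>(x\<otimes>x\<oplus>([A] \<cdot> \<one>)\<otimes>x\<oplus>[B] \<cdot> \<one>)}"
 unfolding curve_def by (auto simp: on_curve_iff)

lemma zero_square: "y\<in>carrier L ==> y\<otimes>y = \<zero> ==> y = \<zero>" using integral[of y y] by blast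

lemma kernel_h: "kernel E E' h = {Infinity, two_torsion L}"
proof -
 have "h P = Infinity \<longleftrightarrow> P = Infinity \<or> P = two_torsion L" if P: "P\<in>carrier E" for P
 proof (cases P)
  case (Affine x y)
  then have xy: "x\<in>carrier L" "y\<in>carrier L" "y\<otimes>y = x\<otimes>(x\<otimes>x\<oplus>al\<otimes>x\<oplus>be)"
   using P by (auto simp: curve_carrier)
  show ?thesis
  proof (cases "x = \<zero>")
   case True
   then have "y\<otimes>y = \<zero>" using xy by simp
   then have "y = \<zero>" by (rule zero_square[OF xy(2)])
   then show ?thesis using Affine True h_zero by simp
  qed (use Affine xy h_aff in simp)
 qed (simp add: h_Inf)
 moreover have "Infinity\<in>carrier E" "two_torsion L\<in>carrier E" by (auto simp: curve_carrier)
 ultimately show ?thesis unfolding kernel_def by (auto simp: curve_def)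
qed

sublocale ker: two_kernel L K "isogeny_kernel E E' h" a b by unfold_locales (auto simp: isogeny_kernel_def kernel_h, auto simp: curve_def)

lemma inv_affine:
 assumes "x\<in>carrier L" "y\<in>carrier L" "Affine x y\<in>carrier E"
 shows "inv\<^bsub>E\<^esub> (Affine x y) = Affine x (\<ominus> y)"
proof -
 have c: "Affine x (\<ominus> y)\<in>carrier E" using assms by (auto simp: curve_carrier l_minus r_minus)
 have u: "Q = Affine x (\<ominus> y)" if "Q\<in>carrier E" "point_add a b (Affine x y) Q = Infinity" for Q
  using that by (cases Q) (auto simp: Let_def split: if_splits)
 show ?thesis unfolding m_inv_def
 proof (rule the_equality)
  show "Affine x (\<ominus> y)\<in>carrier E & Affine x y\<otimes>\<^bsub>E\<^esub>Affine x (\<ominus> y) = \<one>\<^bsub>E\<^esub> & Affine x (\<ominus> y)\<otimes>\<^bsub>E\<^esub>Affine x y = \<one>\<^bsub>E\<^esub>"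
   using c assms by (simp add: curve_def)
 next
  fix Q assume "Q\<in>carrier E & Affine x y\<otimes>\<^bsub>E\<^esub>Q = \<one>\<^bsub>E\<^esub> & Q\<otimes>\<^bsub>E\<^esub>Affine x y = \<one>\<^bsub>E\<^esub>"
  then show "Q = Affine x (\<ominus> y)" using u[of Q] by (simp add: curve_def)
 qed
qed

lemma inv_Inf: "inv\<^bsub>E\<^esub> Infinity = Infinity" unfolding m_inv_def by (rule the_equality) (auto simp: curve_def)

text \<open>The conjugate of \<open>Q = (x, twx)\<close> differs from \<open>Q\<close> by the translation by \<open>(0,0)\<close>, which maps \<open>x\<close>
 to \<open>z = be/x\<close>.\<close>

lemma add_translate:
 assumes c: "x\<in>carrier L" "z\<in>carrier L" "t\<in>carrier L"
  and xz: "x\<otimes>z = be" and tt: "t\<otimes>t = x\<oplus>al\<oplus>z" and ne: "t ~= \<zero> \<or> x ~= z"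
 shows "point_add a b (Affine z (\<ominus> (t\<otimes>z))) (Affine x (\<ominus> (t\<otimes>x))) = two_torsion L"
proof -
 have x0: "x ~= \<zero>" "z ~= \<zero>" using xz b c by auto
 have ac: "al\<in>carrier L" "be\<in>carrier L" by auto
 have n: "~ (z = x \<and>\<ominus>(t\<otimes>x) =\<ominus>(\<ominus> (t\<otimes>z)))"
 proof
  assume e: "z = x \<and>\<ominus>(t\<otimes>x) =\<ominus>(\<ominus> (t\<otimes>z))"
  then have "t\<otimes>x = \<zero>" using neg_ne[of "t\<otimes>x"] c by auto
  then have "t = \<zero>" using integral[of t x] x0 c by blast
  then show False using ne e by blast
 qed
 \<comment> \<open>Both summands lie on the line through (0,0) of slope -t; for x = z the tangent
   formula has to return the same slope.\<close>
 have m: "slope a b z (\<ominus> (t\<otimes>z)) x (\<ominus> (t\<otimes>x)) =\<ominus>t"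
 proof (cases "z = x")
  case False
  have "x\<ominus>z ~= \<zero>" using False c by auto
  moreover have "\<ominus> t\<otimes>(x\<ominus>z) =\<ominus>(t\<otimes>x)\<ominus>\<ominus> (t\<otimes>z)"
   using c by (simp add: a_minus_def r_distr l_minus r_minus)
  ultimately show ?thesis unfolding slope_def using False c by (simp add: divI)
 next
  case True
  have t0: "t ~= \<zero>" using ne True by simp
  let ?d = "\<two>\<otimes>\<ominus> (t\<otimes>z)"
  have d0: "?d ~= \<zero>"
  proof
   assume "?d = \<zero>"
   then have "\<ominus> (t\<otimes>z) = \<zero>" using integral[of "\<one>\<oplus>\<one>" "\<ominus> (t\<otimes>z)"] two_nonzero c by auto
   then have "t\<otimes>z =\<ominus>\<zero>" using minus_minus[of "t\<otimes>z"] c by simp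
   then have "t\<otimes>z = \<zero>" by simp
   then show False using integral[of t z] t0 x0 c by blast
  qed
  have "\<ominus> t\<otimes>?d = \<two>\<otimes>(t\<otimes>t\<otimes>z)" using c by (simp add: l_minus r_minus m_ac)
  also have "\<dots> = \<two>\<otimes>((z\<oplus>al\<oplus>z)\<otimes>z)" unfolding tt using True by simp
  also have "\<dots> = (\<one>\<oplus>\<one>\<oplus>\<one>)\<otimes>(z\<otimes>z)\<oplus>(\<two>\<otimes>al)\<otimes>z\<oplus>z\<otimes>z"
   by (rule curve_ids(4)[OF c(2) ac(1) c(2)])
  also have "\<dots> = (\<one>\<oplus>\<one>\<oplus>\<one>)\<otimes>(z\<otimes>z)\<oplus>(\<two>\<otimes>al)\<otimes>z\<oplus>be" using xz True by simp
  finally have e: "\<ominus> t\<otimes>?d = \<dots>" .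
  have "((\<one>\<oplus>\<one>\<oplus>\<one>)\<otimes>(z\<otimes>z)\<oplus>(\<two>\<otimes>al)\<otimes>z\<oplus>be)\<otimes>inv ?d =\<ominus>t"
   by (rule divI[OF _ _ _ d0 e]) (use c ac in auto)
  then show ?thesis unfolding slope_def using True c by (simp add: int_numerals int_embed square)
 qed
 have x3: "(\<ominus> t) [^] (2::nat)\<ominus>al\<ominus>z\<ominus>x = \<zero>"
 proof -
  have "(\<ominus> t) [^] (2::nat) = x\<oplus>al\<oplus>z" using c tt by (simp add: square l_minus r_minus)
  moreover have "(x\<oplus>al\<oplus>z)\<ominus>al\<ominus>z\<ominus>x = \<zero>" by (rule curve_ids(2)[OF c(1) ac(1) c(2)])
  ultimately show ?thesis by simp
 qed
 have y3: "\<ominus> t\<otimes>(z\<ominus>\<zero>)\<ominus>\<ominus> (t\<otimes>z) = \<zero>"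
  using c by (simp add: a_minus_def l_minus r_minus l_neg)
 show ?thesis using n m x3 y3 by (simp add: Let_def)
qed

text \<open>Put z = b / x and w = y / (l x). Then p = w^2, x + z = l^2 p - a and w (z - x) = l^2 q,
  so an automorphism either fixes w and x, or negates w and exchanges x and z, and then it moves the
  point Q by (0,0). The cocycle is therefore that of w, a square root of p. If w = 0, the sign is
  carried by (z - x) / l^2, a square root of b'.\<close>

lemma cocycle_of_affine:
 assumes Q: "x\<in>carrier L" "y\<in>carrier L" "x ~= \<zero>" "Affine x y\<in>carrier E"
  and P: "h (Affine x y) = Affine p q" "p\<in>K" "q\<in>K"
 shows "\<exists>u\<in>carrier L. u ~= \<zero> & (p ~= \<zero> & u\<otimes>u = p \<or> p = \<zero> & u\<otimes>u = be') \<and>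
  principal_cocycle L K E (Affine x y) = kum u"
proof -
 have ac: "al\<in>carrier L" "be\<in>carrier L" by auto
 have cu: "y\<otimes>y = x\<otimes>(x\<otimes>x\<oplus>al\<otimes>x\<oplus>be)" using Q(4) by (auto simp: curve_carrier)
 define z where "z = be\<otimes>inv x"
 have ix: "inv x\<in>carrier L" "x\<otimes>inv x = \<one>" using Q by (auto simp: field_Units)
 have z: "z\<in>carrier L" "x\<otimes>z = be" using ix Q(1) by (auto simp: z_def m_lcomm[of x be])
 have lx: "l\<otimes>x ~= \<zero>" using integral[of l x] l lc Q by blast
 define w where "w = y\<otimes>inv (l\<otimes>x)"
 have w: "w\<in>carrier L" "l\<otimes>w\<otimes>x = y"
 proof -
  have "inv (l\<otimes>x)\<in>carrier L" "inv (l\<otimes>x)\<otimes>(l\<otimes>x) = \<one>" using lx lc Q by (auto simp: field_Units)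
  then show "w\<in>carrier L" "l\<otimes>w\<otimes>x = y" using Q lc curve_ids(6)[OF Q(1) Q(2) _ lc, of "inv (l\<otimes>x)"]
   by (simp_all add: w_def)
 qed
 let ?t = "l\<otimes>w"
 have tc: "?t\<in>carrier L" using lc w by simp
 have tt: "?t\<otimes>?t = x\<oplus>al\<oplus>z"
 proof -
  have "x\<otimes>(x\<otimes>(?t\<otimes>?t)) = y\<otimes>y" unfolding w(2)[symmetric] using w(1) lc Q(1) by (simp add: m_ac)
  also have "\<dots> = x\<otimes>(x\<otimes>(x\<oplus>al\<oplus>z))" unfolding cu z(2)[symmetric]
   by (rule curve_ids(1)[OF Q(1) ac(1) z(1)])
  finally have "x\<otimes>(?t\<otimes>?t) = x\<otimes>(x\<oplus>al\<oplus>z)" using Q(1,3) tc z(1) ac by - (rule cancel_left[of x]; (assumption | simp))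
  then show ?thesis using Q(1,3) tc z(1) ac by - (rule cancel_left[of x]; (assumption | simp))
 qed
 have ll: "l\<otimes>l\<otimes>(x\<otimes>x) ~= \<zero>" "l\<otimes>l\<otimes>l\<otimes>(x\<otimes>x) ~= \<zero>"
  using lc Q(1,3) l(2) by (simp_all add: integral_iff)
 have pq: "p = (y\<otimes>y)\<otimes>inv (l\<otimes>l\<otimes>(x\<otimes>x))" "q = (y\<otimes>(be\<ominus>x\<otimes>x))\<otimes>inv (l\<otimes>l\<otimes>l\<otimes>(x\<otimes>x))"
  using P(1) h_aff[OF Q(1-3)] by simp_all
 have pw: "p = w\<otimes>w"
 proof -
  have "w\<otimes>w\<otimes>(l\<otimes>l\<otimes>(x\<otimes>x)) = y\<otimes>y" unfolding w(2)[symmetric] using w(1) lc Q(1) by (simp add: m_ac)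
  then show ?thesis unfolding pq by (intro divI) (use ll lc Q(1,2) w(1) in simp_all)
 qed
 have qw: "l\<otimes>l\<otimes>q = w\<otimes>(z\<ominus>x)"
 proof -
  have qc: "q\<in>carrier L" using P(3) K_carrier by blast
  have "q\<otimes>(l\<otimes>l\<otimes>l\<otimes>(x\<otimes>x)) = y\<otimes>(be\<ominus>x\<otimes>x)"
   unfolding pq using ll lc Q ac by (simp add: m_assoc field_Units)
  also have "be\<ominus>x\<otimes>x = x\<otimes>(z\<ominus>x)" using z Q(1) by (simp add: a_minus_def r_distr r_minus)
  also have "y\<otimes>(x\<otimes>(z\<ominus>x)) = w\<otimes>(z\<ominus>x)\<otimes>(l\<otimes>(x\<otimes>x))"
   unfolding w(2)[symmetric] using w(1) lc Q(1) z(1) by (simp add: m_ac)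
  finally have "(l\<otimes>(x\<otimes>x))\<otimes>(l\<otimes>l\<otimes>q) = (l\<otimes>(x\<otimes>x))\<otimes>(w\<otimes>(z\<ominus>x))"
   using qc lc Q(1) w z by (simp add: m_ac)
  moreover have "l\<otimes>(x\<otimes>x) ~= \<zero>" using lc Q(1,3) l(2) by (simp add: integral_iff)
  ultimately show ?thesis using qc lc Q(1) w z by - (rule cancel_left[of "l\<otimes>(x\<otimes>x)"]; (assumption | simp))
 qed
 have S: "x\<oplus>z\<in>K"
 proof -
  have "l\<otimes>l\<otimes>p\<ominus>al\<in>K" using P(2) l int_K K_ops by metis
  moreover have "l\<otimes>l\<otimes>p = x\<oplus>al\<oplus>z" using tt w lc by (simp add: pw m_ac)
  moreover have "(x\<oplus>al\<oplus>z)\<ominus>al = x\<oplus>z" by (rule curve_ids(3)[OF Q(1) ac(1) z(1)])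
  ultimately show ?thesis by simp
 qed
 have V: "w\<otimes>(z\<ominus>x)\<in>K" using qw P(3) l K_ops by metis
 let ?D = "z\<ominus>x"
 have Dc: "?D\<in>carrier L" using z Q by simp
 have D2: "?D\<otimes>?D = l\<otimes>l\<otimes>(l\<otimes>l)\<otimes>be'" if "w = \<zero>"
 proof -
  have "x\<oplus>al\<oplus>z = \<zero>" using tt that lc by simp
  then have "al =\<ominus>(x\<oplus>z)" using Q(1) z ac by (intro minus_equality[symmetric]) (auto simp: a_ac)
  moreover have "\<ominus> (x\<oplus>z)\<otimes>\<ominus> (x\<oplus>z)\<ominus>\<two>\<otimes>\<two>\<otimes>(x\<otimes>z) = ?D\<otimes>?D"
   by (rule curve_ids(5)[OF Q(1) Q(1) z(1)])
  ultimately show ?thesis unfolding rel2 z(2) by simp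
 qed
 \<comment> \<open>As 2 is invertible, sum and difference determine both members of a pair; this
   converts the action on x + z and z - x into an action on x.\<close>
 have half: "x1 = x2" if "x1\<in>carrier L" "x2\<in>carrier L" "z1\<in>carrier L" "z2\<in>carrier L"
  "x1\<oplus>z1 = x2\<oplus>z2" "z1\<ominus>x1 = z2\<ominus>x2" for x1 x2 z1 z2
 proof -
  have "\<two>\<otimes>x1 = (x1\<oplus>z1)\<ominus>(z1\<ominus>x1)" using that(1-4) by Ring.algebra
  also have "\<dots> = (x2\<oplus>z2)\<ominus>(z2\<ominus>x2)" using that by simp
  also have "\<dots> = \<two>\<otimes>x2" using that(1-4) by Ring.algebra
  finally show ?thesis using two_nonzero that by - (rule cancel_left[of "\<one>\<oplus>\<one>"]; (assumption | simp))
 qed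
 have ll4: "l\<otimes>l\<otimes>(l\<otimes>l) ~= \<zero>" using lc l(2) by (simp add: integral_iff)
 define u where "u = (if w = \<zero> then ?D\<otimes>inv (l\<otimes>l) else w)"
 have ll0: "l\<otimes>l ~= \<zero>" using lc l(2) by (simp add: integral_iff)
 have ll1: "l\<otimes>l ~= \<zero>" "inv (l\<otimes>l)\<in>carrier L" "l\<otimes>l\<otimes>inv (l\<otimes>l) = \<one>" "l\<otimes>l\<in>K"
  using lc ll0 K_ops(2)[OF l(1) l(1)] by (simp_all add: field_Units)
 have uD: "u\<otimes>(l\<otimes>l) = ?D" if "w = \<zero>" using that ll1 lc Dc by (simp add: u_def m_assoc field_Units)
 have D0: "?D ~= \<zero>" if "w = \<zero>"
 proof
  assume "?D = \<zero>"
  then have "l\<otimes>l\<otimes>(l\<otimes>l)\<otimes>be' = \<zero>" using D2[OF that] by simp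
  then show False using ll1 b lc integral[of "l\<otimes>l\<otimes>(l\<otimes>l)" be'] integral[of "l\<otimes>l" "l\<otimes>l"] by auto
 qed
 have uc: "u\<in>carrier L" using w Dc ll1 by (simp add: u_def)
 have u0: "u ~= \<zero>" using uD D0 lc by (cases "w = \<zero>") (auto simp: u_def)
 have uu: "p ~= \<zero> & u\<otimes>u = p \<or> p = \<zero> & u\<otimes>u = be'"
 proof (cases "w = \<zero>")
  case True
  have "(l\<otimes>l\<otimes>(l\<otimes>l))\<otimes>(u\<otimes>u) = (u\<otimes>(l\<otimes>l))\<otimes>(u\<otimes>(l\<otimes>l))" using uc lc by (simp add: m_ac)
  also have "\<dots> = (l\<otimes>l\<otimes>(l\<otimes>l))\<otimes>be'" using uD[OF True] D2[OF True] by simp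
  finally have "u\<otimes>u = be'" using uc lc ll4 by - (rule cancel_left[of "l\<otimes>l\<otimes>(l\<otimes>l)"]; (assumption | simp))
  then show ?thesis using True pw by simp
 next
  case False
  then show ?thesis using pw w integral[of w w] by (auto simp: u_def)
 qed
 have uK: "u\<otimes>u\<in>K" using uu P(2) int_K by auto
 have "principal_cocycle L K E (Affine x y) = kum u"
 proof
  fix g1
  show "principal_cocycle L K E (Affine x y) g1 = kum u g1"
  proof (cases "g1\<in>gal")
   case g1: True
   note hs = gal_hom_simps[OF g1]
   have c: "g1 x\<in>carrier L" "g1 z\<in>carrier L" "g1 w\<in>carrier L" "g1 y\<in>carrier L" using gal_closed[OF g1] Q z w by auto
   have fS: "g1 x\<oplus>g1 z = x\<oplus>z" using gal_fix[OF g1 S] hs(2)[OF Q(1) z(1)] by simp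
   have fV: "g1 w\<otimes>(g1 z\<ominus>g1 x) = w\<otimes>(z\<ominus>x)"
    using gal_fix[OF g1 V] hs(1)[OF w(1) Dc] hs(4)[OF z(1) Q(1)] by simp
   have fy: "g1 y = l\<otimes>g1 w\<otimes>g1 x"
    using w(2) hs(1)[OF _ Q(1), of "l\<otimes>w"] hs(1)[OF lc w(1)] gal_fix[OF g1 l(1)] lc w by auto
   have inv: "inv\<^bsub>E\<^esub> (Affine x y) = Affine x (\<ominus> y)" by (rule inv_affine[OF Q(1,2,4)])
   have pc: "principal_cocycle L K E (Affine x y) g1 = point_add a b (Affine (g1 x) (g1 y)) (Affine x (\<ominus> y))"
    unfolding principal_cocycle_def inv using g1 by (simp add: curve_def)
   have ru: "g1 u = u \<or> g1 u =\<ominus>u" by (rule gal_root[OF g1 uc uK])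
   have fuD: "w = \<zero> ==> g1 u\<otimes>(l\<otimes>l) = g1 z\<ominus>g1 x"
    using uD hs(1)[OF uc, of "l\<otimes>l"] gal_fix[OF g1 ll1(4)] lc hs(4)[OF z(1) Q(1)] by auto
   show ?thesis
   proof (cases "g1 u = u")
    case True
    have wf: "g1 w = w" using True hs(6)[OF Q(1) Q(1)] by (cases "w = \<zero>") (auto simp: u_def)
    have "g1 z\<ominus>g1 x = z\<ominus>x"
    proof (cases "w = \<zero>")
     case w0: True
     then show ?thesis using fuD uD True by simp
    next
     case False
     then show ?thesis using fV wf c w z Q by - (rule cancel_left[of w]; (assumption | simp))
    qed
    then have xf: "g1 x = x" using half[OF c(1) Q(1) c(2) z(1) fS] by simp
    then have "g1 y = y" using fy wf w(2) by simp
    then show ?thesis using pc xf True g1 Q by (simp add: kum_def)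
   next
    case False
    then have m: "g1 u =\<ominus>u" using ru by simp
    have wf: "g1 w =\<ominus>w" using m hs(6)[OF Q(1) Q(1)] by (cases "w = \<zero>") (auto simp: u_def)
    have nD: "\<ominus> (z\<ominus>x) = x\<ominus>z" using z(1) Q(1) by (simp add: a_minus_def minus_add a_comm)
    have "g1 z\<ominus>g1 x = x\<ominus>z"
    proof (cases "w = \<zero>")
     case w0: True
     then have "g1 z\<ominus>g1 x =\<ominus>u\<otimes>(l\<otimes>l)" using fuD m by simp
     also have "\<dots> =\<ominus>(z\<ominus>x)" using uD[OF w0] uc lc by (simp add: l_minus)
     finally show ?thesis by (simp add: nD)
    next
     case F: False
     have "w\<otimes>(g1 z\<ominus>g1 x) =\<ominus>(g1 w\<otimes>(g1 z\<ominus>g1 x))" using wf w c by (simp add: l_minus)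
     also have "\<dots> = w\<otimes>\<ominus> (z\<ominus>x)" using fV w Dc by (simp add: r_minus)
     finally show ?thesis using F c w z Q nD by - (rule cancel_left[of w]; (assumption | simp))
    qed
    then have xf: "g1 x = z" using half[OF c(1) z(1) c(2) Q(1)] fS z Q by (simp add: a_comm)
    have yf: "g1 y =\<ominus>(?t\<otimes>z)" using fy wf xf lc w z by (simp add: l_minus r_minus)
    \<comment> \<open>Excludes that the translated point is Q itself with second coordinate zero,
      the case in which the sum in \<open>add_translate\<close> would be O.\<close>
    have ne: "?t ~= \<zero> \<or> x ~= z"
    proof (cases "w = \<zero>")
     case True
     then show ?thesis using D0 z Q by (auto simp: a_minus_def r_neg)
    next
     case F: False then show ?thesis using integral[of l w] l lc w by auto
    qed
    have "point_add a b (Affine (g1 x) (g1 y)) (Affine x (\<ominus> y)) = two_torsion L"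
     using add_translate[OF Q(1) z(1) tc z(2) tt ne] unfolding xf yf w(2) .
    then show ?thesis using pc False g1 by (simp add: kum_def)
   qed
  qed (simp add: principal_cocycle_def kum_def)
 qed
 then show ?thesis using uc u0 uu by blast
qed

end

lemma (in cring) square_of_difference:
 assumes "u\<in>carrier R" "a\<in>carrier R" "b\<in>carrier R"
 shows "(u\<ominus>a)\<otimes>(u\<ominus>a)\<ominus>(u\<otimes>u\<ominus>\<two>\<otimes>a\<otimes>u\<oplus>(a\<otimes>a\<ominus>b))\<ominus>b = \<zero>"
 using assms by Ring.algebra

context two_isogeny
begin

text \<open>The first coordinates of points of \<open>E'\<close> over \<open>K\<close>, where O
  counts as 1 and (0,0) as \<open>be'\<close>. Passage to square classes happens where the predicate
  is applied.\<close>

definition cls :: "'a => bool" where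
 "cls e \<longleftrightarrow> e = \<one> \<or> e = be' \<or> (\<exists>y\<in>K. y\<otimes>y = e\<otimes>(e\<otimes>e\<oplus>al'\<otimes>e\<oplus>be'))"

text \<open>With l^2 p - a as the sum and \<open>V\<close> as the difference of the sought x and z,
  the identity says that their product is b.\<close>

lemma preimage_identity:
 assumes c: "p\<in>carrier L" "q\<in>carrier L" "w\<in>carrier L" "w ~= \<zero>" "p = w\<otimes>w"
  and pq: "q\<otimes>q = p\<otimes>(p\<otimes>p\<oplus>al'\<otimes>p\<oplus>be')"
  and V: "V\<in>carrier L" "V\<otimes>w = l\<otimes>l\<otimes>q"
 shows "(l\<otimes>l\<otimes>p\<ominus>al)\<otimes>(l\<otimes>l\<otimes>p\<ominus>al)\<ominus>V\<otimes>V = \<two>\<otimes>\<two>\<otimes>be"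
proof -
 define A where "A = al" define B where "B = be" define A' where "A' = al'" define B' where "B' = be'"
 define m where "m = l\<otimes>l"
 have cc: "A\<in>carrier L" "B\<in>carrier L" "A'\<in>carrier L" "B'\<in>carrier L" "m\<in>carrier L"
  using lc by (simp_all add: A_def B_def A'_def B'_def m_def)
 have p0: "p ~= \<zero>" using c by (simp add: integral_iff)
 have r1: "m\<otimes>A'\<oplus>\<two>\<otimes>A = \<zero>" using rel1 by (simp add: A_def A'_def m_def)
 have r2: "m\<otimes>m\<otimes>B' = A\<otimes>A\<ominus>\<two>\<otimes>\<two>\<otimes>B" using rel2 by (simp add: A_def B_def B'_def m_def)
 have r1': "m\<otimes>A' =\<ominus>(\<two>\<otimes>A)" using r1 cc by (intro minus_equality[symmetric]) auto
 have "p\<otimes>(V\<otimes>V) = (V\<otimes>w)\<otimes>(V\<otimes>w)" unfolding c(5) using c(3) V(1) by (simp add: m_ac)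
 also have "\<dots> = (m\<otimes>m)\<otimes>(q\<otimes>q)" unfolding V(2) m_def using c(2) lc by (simp add: m_ac)
 also have "\<dots> = p\<otimes>(m\<otimes>m\<otimes>(p\<otimes>p)\<oplus>m\<otimes>(m\<otimes>A')\<otimes>p\<oplus>m\<otimes>m\<otimes>B')"
  unfolding pq A'_def[symmetric] B'_def[symmetric] using c(1) cc by (simp add: r_distr m_ac)
 finally have "p\<otimes>(V\<otimes>V) = p\<otimes>(m\<otimes>m\<otimes>(p\<otimes>p)\<oplus>m\<otimes>(m\<otimes>A')\<otimes>p\<oplus>m\<otimes>m\<otimes>B')" .
 then have VV: "V\<otimes>V = m\<otimes>m\<otimes>(p\<otimes>p)\<oplus>m\<otimes>(m\<otimes>A')\<otimes>p\<oplus>m\<otimes>m\<otimes>B'"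
  using p0 c(1) V(1) cc by - (rule cancel_left[of p]; (assumption | simp))
 have "(m\<otimes>p\<ominus>A)\<otimes>(m\<otimes>p\<ominus>A)\<ominus>(m\<otimes>m\<otimes>(p\<otimes>p)\<oplus>m\<otimes>\<ominus> (\<two>\<otimes>A)\<otimes>p\<oplus>(A\<otimes>A\<ominus>\<two>\<otimes>\<two>\<otimes>B))
  \<ominus>\<two>\<otimes>\<two>\<otimes>B = \<zero>"
  (is "?l = _")
 proof -
  have "?l = (m\<otimes>p\<ominus>A)\<otimes>(m\<otimes>p\<ominus>A)\<ominus>((m\<otimes>p)\<otimes>(m\<otimes>p)\<ominus>\<two>\<otimes>A\<otimes>(m\<otimes>p)\<oplus>(A\<otimes>A\<ominus>\<two>\<otimes>\<two>\<otimes>B))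
   \<ominus>\<two>\<otimes>\<two>\<otimes>B"
   using cc c(1) by (simp add: a_minus_def r_minus l_minus m_ac)
  also have "\<dots> = \<zero>" using cc c(1) by (intro square_of_difference) simp_all
  finally show ?thesis .
 qed
 then have "(m\<otimes>p\<ominus>A)\<otimes>(m\<otimes>p\<ominus>A)\<ominus>V\<otimes>V\<ominus>\<two>\<otimes>\<two>\<otimes>B = \<zero>"
  unfolding VV r1' r2 .
 then show ?thesis using cc c(1) V(1) r_right_minus_eq by (simp add: A_def B_def m_def)
qed

lemma half_identities:
 assumes "s\<in>carrier L" "v\<in>carrier L" "i\<in>carrier L" "i\<otimes>\<two> = \<one>"
 shows "((s\<ominus>v)\<otimes>i)\<oplus>((s\<oplus>v)\<otimes>i) = s" "((s\<oplus>v)\<otimes>i)\<ominus>((s\<ominus>v)\<otimes>i) = v"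
  "((s\<ominus>v)\<otimes>i)\<otimes>((s\<oplus>v)\<otimes>i) = (s\<otimes>s\<ominus>v\<otimes>v)\<otimes>(i\<otimes>i)"
proof -
 have "((s\<ominus>v)\<otimes>i)\<oplus>((s\<oplus>v)\<otimes>i)\<ominus>s\<otimes>(i\<otimes>\<two>) = \<zero>" using assms(1-3) by Ring.algebra
 then show "((s\<ominus>v)\<otimes>i)\<oplus>((s\<oplus>v)\<otimes>i) = s" using assms r_right_minus_eq by simp
 have "((s\<oplus>v)\<otimes>i)\<ominus>((s\<ominus>v)\<otimes>i)\<ominus>v\<otimes>(i\<otimes>\<two>) = \<zero>" using assms(1-3) by Ring.algebra
 then show "((s\<oplus>v)\<otimes>i)\<ominus>((s\<ominus>v)\<otimes>i) = v" using assms r_right_minus_eq by simp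
 have "((s\<ominus>v)\<otimes>i)\<otimes>((s\<oplus>v)\<otimes>i)\<ominus>(s\<otimes>s\<ominus>v\<otimes>v)\<otimes>(i\<otimes>i) = \<zero>" using assms(1-3) by Ring.algebra
 then show "((s\<ominus>v)\<otimes>i)\<otimes>((s\<oplus>v)\<otimes>i) = (s\<otimes>s\<ominus>v\<otimes>v)\<otimes>(i\<otimes>i)" using assms r_right_minus_eq by simp
qed

text \<open>The numbers x and z are recovered from their sum l^2 p - a and difference l^2 q / w,
  where w is a square root of p. For p = 0, a root of x^2 + a x + b gives a point of order two lying
  over (0,0).\<close>

lemma preimage:
 assumes P: "P\<in>carrier E'"
 shows "\<exists>Q\<in>carrier E. h Q = P"
proof (cases P)
 case Infinity
 then show ?thesis using h_Inf by (intro bexI[of _ Infinity]) (auto simp: curve_carrier)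
next
 case (Affine p q)
 have c: "p\<in>carrier L" "q\<in>carrier L" and pq: "q\<otimes>q = p\<otimes>(p\<otimes>p\<oplus>al'\<otimes>p\<oplus>be')"
  using P Affine by (auto simp: curve_carrier)
 show ?thesis
 proof (cases "p = \<zero>")
  case True
  have "q\<otimes>q = \<zero>" using pq True by simp
  then have q: "q = \<zero>" by (rule zero_square[OF c(2)])
  obtain x where x: "x\<in>carrier L" "x\<otimes>x\<oplus>al\<otimes>x\<oplus>be = \<zero>" using quadratic_root[of al be] by auto
  have x0: "x ~= \<zero>" using x b by auto
  have "Affine x \<zero>\<in>carrier E" using x by (auto simp: curve_carrier)
  moreover have "inv (l\<otimes>l\<otimes>(x\<otimes>x))\<in>carrier L" "inv (l\<otimes>l\<otimes>l\<otimes>(x\<otimes>x))\<in>carrier L"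
   using x(1) x0 lc l(2) by (simp_all add: field_Units integral_iff)
  then have "h (Affine x \<zero>) = P" using h_aff[OF x(1) zero_closed x0] Affine True q x(1) by simp
  ultimately show ?thesis by blast
 next
  case False
  obtain w where w: "w\<in>carrier L" "w\<otimes>w\<oplus>\<zero>\<otimes>w\<oplus>\<ominus> p = \<zero>" using quadratic_root[of \<zero> "\<ominus> p"] c by auto
  then have ww: "p = w\<otimes>w" using c minus_equality[of "w\<otimes>w" "\<ominus> p"] by simp
  have w0: "w ~= \<zero>" using ww False by auto
  have iw: "inv w\<in>carrier L" "inv w\<otimes>w = \<one>" using w(1) w0 by (simp_all add: field_Units)
  define V where "V = l\<otimes>l\<otimes>q\<otimes>inv w"
  have V: "V\<in>carrier L" "V\<otimes>w = l\<otimes>l\<otimes>q" using iw lc c w(1) by (simp_all add: V_def m_assoc)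
  define S where "S = l\<otimes>l\<otimes>p\<ominus>al"
  have S: "S\<in>carrier L" using lc c by (simp add: S_def)
  have SV: "S\<otimes>S\<ominus>V\<otimes>V = \<two>\<otimes>\<two>\<otimes>be"
   unfolding S_def by (rule preimage_identity[OF c w(1) w0 ww pq V])
  define i where "i = inv \<two>"
  have i: "i\<in>carrier L" "i\<otimes>\<two> = \<one>" using two_nonzero by (simp_all add: i_def field_Units)
  define x where "x = (S\<ominus>V)\<otimes>i"
  define z where "z = (S\<oplus>V)\<otimes>i"
  have xz: "x\<in>carrier L" "z\<in>carrier L" using S V i by (simp_all add: x_def z_def)
  have s: "x\<oplus>z = S" "z\<ominus>x = V" unfolding x_def z_def using half_identities(1,2)[OF S V(1) i] by simp_all
  have "x\<otimes>z = \<two>\<otimes>\<two>\<otimes>be\<otimes>(i\<otimes>i)"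
   unfolding x_def z_def using half_identities(3)[OF S V(1) i] SV by simp
  also have "\<dots> = (i\<otimes>\<two>)\<otimes>(i\<otimes>\<two>)\<otimes>be" using i(1) by (simp add: m_ac del: l_distr r_distr)
  finally have m: "x\<otimes>z = be" using i by simp
  have x0: "x ~= \<zero>" using m b xz by auto
  define y where "y = l\<otimes>w\<otimes>x"
  have yc: "y\<in>carrier L" using lc w xz by (simp add: y_def)
  have "S\<oplus>al = l\<otimes>l\<otimes>p" unfolding S_def using lc c by (simp add: a_minus_def a_assoc l_neg)
  then have "l\<otimes>l\<otimes>p = (x\<oplus>z)\<oplus>al" by (simp add: s(1))
  then have llp: "l\<otimes>l\<otimes>p = x\<oplus>al\<oplus>z" using xz by (simp add: a_ac)
  have "y\<otimes>y = x\<otimes>(x\<otimes>(l\<otimes>l\<otimes>p))" unfolding y_def ww using lc w(1) xz by (simp add: m_ac)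
  also have "\<dots> = x\<otimes>(x\<otimes>x\<oplus>al\<otimes>x\<oplus>be)" unfolding llp m[symmetric]
   by (rule curve_ids(1)[symmetric]) (use xz in auto)
  finally have "Affine x y\<in>carrier E" using xz yc by (auto simp: curve_carrier)
  moreover have "h (Affine x y) = P"
  proof -
   have n: "l\<otimes>l\<otimes>(x\<otimes>x) ~= \<zero>" "l\<otimes>l\<otimes>l\<otimes>(x\<otimes>x) ~= \<zero>"
    using lc xz x0 l(2) by (simp_all add: integral_iff)
   have "p\<otimes>(l\<otimes>l\<otimes>(x\<otimes>x)) = y\<otimes>y" unfolding y_def ww using lc w(1) xz by (simp add: m_ac)
   then have 1: "(y\<otimes>y)\<otimes>inv (l\<otimes>l\<otimes>(x\<otimes>x)) = p" by (intro divI) (use n c lc xz yc in simp_all)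
   have "be\<ominus>x\<otimes>x = x\<otimes>V" unfolding m[symmetric] s(2)[symmetric] using xz by (simp add: a_minus_def r_distr r_minus)
   then have "y\<otimes>(be\<ominus>x\<otimes>x) = l\<otimes>(x\<otimes>x)\<otimes>(V\<otimes>w)" unfolding y_def using lc w(1) xz V(1) by (simp add: m_ac)
   also have "\<dots> = q\<otimes>(l\<otimes>l\<otimes>l\<otimes>(x\<otimes>x))" unfolding V(2) using lc xz c by (simp add: m_ac)
   finally have "q\<otimes>(l\<otimes>l\<otimes>l\<otimes>(x\<otimes>x)) = y\<otimes>(be\<ominus>x\<otimes>x)" by simp
   then have 2: "(y\<otimes>(be\<ominus>x\<otimes>x))\<otimes>inv (l\<otimes>l\<otimes>l\<otimes>(x\<otimes>x)) = q"
    by (intro divI) (use n c lc xz yc in simp_all)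
   show ?thesis using h_aff[OF xz(1) yc x0] 1 2 Affine by simp
  qed
  ultimately show ?thesis by blast
 qed
qed

lemma rational_pointsD: "P\<in>rational_points K E' ==> P\<in>carrier E'"
 "Affine p q\<in>rational_points K E' ==> p\<in>K & q\<in>K" by (auto simp: rational_points_def)

lemma rational_points_affineI: "e\<in>K ==> y\<in>K ==> y\<otimes>y = e\<otimes>(e\<otimes>e\<oplus>al'\<otimes>e\<oplus>be')
 ==> Affine e y\<in>rational_points K E'"
 using K_carrier by (auto simp: rational_points_def curve_carrier)

lemma kum_sign: "u\<in>carrier L ==> u ~= \<zero> ==> u\<otimes>u\<in>K ==> v\<in>carrier L ==> v\<otimes>v = u\<otimes>u ==> kum v = kum u"
proof -
 assume u: "u\<in>carrier L" "u ~= \<zero>" "u\<otimes>u\<in>K" and v: "v\<in>carrier L" "v\<otimes>v = u\<otimes>u"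
 have vu: "v = u \<or> v =\<ominus>u" by (rule square_eq[OF v(1) u(1) v(2)])
 have "u\<otimes>u ~= \<zero>" using u by (simp add: integral_iff)
 then have v0: "v ~= \<zero>" using v(2) by auto
 have "v\<otimes>u\<in>K" using vu K_ops(3)[OF u(3)] u by (auto simp: l_minus)
 then show ?thesis using kum_eq_iff[OF v(1) v0 _ u] v(2) u(3) by simp
qed

text \<open>The preimage in \<open>kummer_map\<close> is arbitrary, but
  \<open>cocycle_of_affine\<close> evaluates the cocycle of any preimage of an affine point. Over O
  the preimage lies in the kernel, and its cocycle is trivial, the one of the square root 1 of
  1.\<close>

lemma kummer_map_point:
 assumes P: "P\<in>rational_points K E'"
 shows "\<exists>u\<in>carrier L. u ~= \<zero> & u\<otimes>u\<in>K & cls (u\<otimes>u) & kummer_map L K E E' h P = {kum u} \<and>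
  (P = Infinity --> u\<otimes>u = \<one>) & (\<forall>p q. P = Affine p q --> u\<otimes>u = (if p = \<zero> then be' else p))"
proof -
 define Q where "Q = (SOME Q. Q\<in>carrier E & h Q = P)"
 have "\<exists>Q. Q\<in>carrier E & h Q = P" using preimage[OF rational_pointsD(1)[OF P]] by blast
 then have Q: "Q\<in>carrier E & h Q = P" unfolding Q_def by (rule someI_ex)
 have km: "kummer_map L K E E' h P = {principal_cocycle L K E Q}" unfolding kummer_map_def Q_def[symmetric]
  by (rule ker.H1_class_eq) (simp add: principal_cocycle_def)
 show ?thesis
 proof (cases P)
  case Infinity
  then have "Q\<in>kernel E E' h" using Q by (simp add: kernel_def) (simp add: curve_def)
  then have Q2: "Q = Infinity \<or> Q = two_torsion L" by (simp add: kernel_h)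
  have one: "g1 \<one> = \<one>" "g1 \<zero> = \<zero>" if "g1\<in>gal" for g1 using gal_hom_simps(5,6)[OF that, of \<one> \<one>] by auto
  have "principal_cocycle L K E Q = kum \<one>" using Q2
  proof
   assume "Q = Infinity"
   moreover have "Infinity\<otimes>\<^bsub>E\<^esub>Infinity = Infinity" by (simp add: curve_def)
   ultimately show ?thesis by (auto simp: principal_cocycle_def kum_def inv_Inf one)
  next
   assume Q': "Q = two_torsion L"
   have "inv\<^bsub>E\<^esub> (two_torsion L) = two_torsion L" using inv_affine[of \<zero> \<zero>] Q Q' by simp
   then show ?thesis unfolding Q' by (auto simp: principal_cocycle_def kum_def one curve_def)
  qed
  then show ?thesis using km Infinity K_ops by (intro bexI[of _ \<one>]) (auto simp: cls_def)
 next
  case (Affine p q)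
  have pqK: "p\<in>K" "q\<in>K" using rational_pointsD(2) P Affine by auto
  have "Q ~= Infinity" using Q h_Inf Affine by auto
  then obtain x y where xy: "Q = Affine x y" by (cases Q) auto
  have c: "x\<in>carrier L" "y\<in>carrier L" using Q xy by (auto simp: curve_carrier)
  have x0: "x ~= \<zero>" using Q xy Affine h_zero by auto
  obtain u where u: "u\<in>carrier L" "u ~= \<zero>" "p ~= \<zero> & u\<otimes>u = p \<or> p = \<zero> & u\<otimes>u = be'"
   "principal_cocycle L K E (Affine x y) = kum u" using cocycle_of_affine[OF c x0 _ _ pqK] Q xy Affine by auto
  have "q\<otimes>q = p\<otimes>(p\<otimes>p\<oplus>al'\<otimes>p\<oplus>be')"
   using rational_pointsD(1)[OF P] Affine by (auto simp: curve_carrier)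
  then have "cls (u\<otimes>u)" using u(3) pqK by (auto simp: cls_def)
  moreover have "u\<otimes>u\<in>K" using u(3) pqK int_K by auto
  ultimately show ?thesis using u km xy Affine by (intro bexI[of _ u]) auto
 qed
qed

theorem kummer_image:
 "kummer_map L K E E' h ` rational_points K E' = {{kum u} | u. u\<in>carrier L & u ~= \<zero> & u\<otimes>u\<in>K & cls (u\<otimes>u)}"
proof
 show "kummer_map L K E E' h ` rational_points K E' \<subseteq> {{kum u} | u. u\<in>carrier L & u ~= \<zero> & u\<otimes>u\<in>K & cls (u\<otimes>u)}"
  using kummer_map_point by blast
next
 have "{kum u} \<in> kummer_map L K E E' h ` rational_points K E'"
  if u: "u\<in>carrier L" "u ~= \<zero>" "u\<otimes>u\<in>K" "cls (u\<otimes>u)" for u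
 proof -
  have u2: "u\<otimes>u ~= \<zero>" using u by (simp add: integral_iff)
  have "\<exists>P\<in>rational_points K E'. (P = Infinity & u\<otimes>u = \<one>) \<or> (\<exists>p q. P = Affine p q & u\<otimes>u = (if p = \<zero> then be' else p))"
   using u(4) unfolding cls_def
  proof (elim disjE bexE)
   assume "u\<otimes>u = \<one>"
   then show ?thesis by (intro bexI[of _ Infinity]) (auto simp: rational_points_def curve_carrier)
  next
   assume "u\<otimes>u = be'"
   then show ?thesis using rational_points_affineI[of \<zero> \<zero>] K_ops by (intro bexI[of _ "Affine \<zero> \<zero>"]) auto
  next
   fix y assume y: "y\<in>K" "y\<otimes>y = u\<otimes>u\<otimes>(u\<otimes>u\<otimes>(u\<otimes>u)\<oplus>al'\<otimes>(u\<otimes>u)\<oplus>be')"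
   then show ?thesis using rational_points_affineI[OF u(3) y] u2 by (intro bexI[of _ "Affine (u\<otimes>u) y"]) auto
  qed
  then obtain P where P: "P\<in>rational_points K E'"
   "(P = Infinity & u\<otimes>u = \<one>) \<or> (\<exists>p q. P = Affine p q & u\<otimes>u = (if p = \<zero> then be' else p))" by blast
  obtain v where v: "v\<in>carrier L" "kummer_map L K E E' h P = {kum v}"
   "P = Infinity --> v\<otimes>v = \<one>" "\<forall>p q. P = Affine p q --> v\<otimes>v = (if p = \<zero> then be' else p)"
   using kummer_map_point[OF P(1)] by metis
  have "v\<otimes>v = u\<otimes>u" using P(2) v(3,4) by auto
  then have "kum v = kum u" by (rule kum_sign[OF u(1-3) v(1)])
  then show ?thesis using v(2) P(1) by (metis imageI)
 qed
 then show "{{kum u} | u. u\<in>carrier L & u ~= \<zero> & u\<otimes>u\<in>K & cls (u\<otimes>u)} \<subseteq> kummer_map L K E E' h ` rational_points K E'"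
  by blast
qed

end

lemma (in galois_closure) quot_simps:
 assumes "x\<in>carrier L" "y\<in>carrier L" "x ~= \<zero>"
 shows "phi A B (Affine x y) = Affine ((y\<otimes>y)\<otimes>inv (\<one>\<otimes>\<one>\<otimes>(x\<otimes>x))) ((y\<otimes>([B] \<cdot> \<one>\<ominus>x\<otimes>x))\<otimes>inv (\<one>\<otimes>\<one>\<otimes>\<one>\<otimes>(x\<otimes>x)))"
  "phi_dual A B (Affine x y) = Affine ((y\<otimes>y)\<otimes>inv (\<two>\<otimes>\<two>\<otimes>(x\<otimes>x)))
   ((y\<otimes>([(A\<^sup>2 - 4 * B)] \<cdot> \<one>\<ominus>x\<otimes>x))\<otimes>inv (\<two>\<otimes>\<two>\<otimes>\<two>\<otimes>(x\<otimes>x)))"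
proof -
 have "[(8::int)] \<cdot> \<one> = \<two>\<otimes>\<two>\<otimes>\<two>" using int_embed(2)[of 4 2] by (simp add: int_numerals)
 then show "phi A B (Affine x y) = Affine ((y\<otimes>y)\<otimes>inv (\<one>\<otimes>\<one>\<otimes>(x\<otimes>x))) ((y\<otimes>([B] \<cdot> \<one>\<ominus>x\<otimes>x))\<otimes>inv (\<one>\<otimes>\<one>\<otimes>\<one>\<otimes>(x\<otimes>x)))"
  "phi_dual A B (Affine x y) = Affine ((y\<otimes>y)\<otimes>inv (\<two>\<otimes>\<two>\<otimes>(x\<otimes>x)))
   ((y\<otimes>([(A\<^sup>2 - 4 * B)] \<cdot> \<one>\<ominus>x\<otimes>x))\<otimes>inv (\<two>\<otimes>\<two>\<otimes>\<two>\<otimes>(x\<otimes>x)))"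
  using assms by (simp_all add: square int_numerals)
qed

lemma (in galois_closure) int_nonzero: "(k::int) ~= 0 ==> [k] \<cdot> \<one> ~= \<zero>"
proof -
 assume k: "k ~= 0"
 have n: "[int n] \<cdot> \<one> ~= \<zero>" if "n > 0" for n using char_zero[OF that] by (simp add: add_pow_def int_pow_int)
 show ?thesis
 proof (cases "k > 0")
  case True then show ?thesis using n[of "nat k"] by simp
 next
  case False
  then have "\<ominus> ([k] \<cdot> \<one>) ~= \<zero>" using n[of "nat (- k)"] k int_embed(4)[of k] by simp
  then show ?thesis by auto
 qed
qed

lemma (in galois_closure) two_isogeny_phi:
 assumes "B ~= 0" "A\<^sup>2 - 4 * B ~= 0"
 shows "two_isogeny L K A B (- 2 * A) (A\<^sup>2 - 4 * B) \<one> (phi A B)"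
proof
 show "\<one>\<in>K" using subringE(3)[OF K_subring] .
 show "\<one>\<otimes>\<one>\<otimes>([(- 2 * A)] \<cdot> \<one>)\<oplus>\<two>\<otimes>([A] \<cdot> \<one>) = \<zero>"
  using int_embed(2)[of "-2" A] int_embed(4)[of 2] by (simp add: int_numerals l_minus l_neg)
 show "\<one>\<otimes>\<one>\<otimes>(\<one>\<otimes>\<one>)\<otimes>([(A\<^sup>2 - 4 * B)] \<cdot> \<one>) = ([A] \<cdot> \<one>)\<otimes>([A] \<cdot> \<one>)\<ominus>\<two>\<otimes>\<two>\<otimes>([B] \<cdot> \<one>)"
  by (simp add: int_embed(2,6) int_numerals monoid_mult_class.power2_eq_square)
qed (use assms quot_simps(1) in "auto simp: int_nonzero")

lemma (in galois_closure) two_isogeny_phi_dual: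
 assumes "B ~= 0" "A\<^sup>2 - 4 * B ~= 0"
 shows "two_isogeny L K (- 2 * A) (A\<^sup>2 - 4 * B) A B \<two> (phi_dual A B)"
proof
 show "\<one>\<oplus>\<one>\<in>K" using subringE(3,7)[OF K_subring] by blast
 have a: "[(- 2 * A)] \<cdot> \<one> =\<ominus>(\<two>\<otimes>([A] \<cdot> \<one>))"
  using int_embed(2)[of "-2" A] int_embed(4)[of 2] by (simp add: int_numerals l_minus)
 show "\<two>\<otimes>\<two>\<otimes>([A] \<cdot> \<one>)\<oplus>\<two>\<otimes>([(- 2 * A)] \<cdot> \<one>) = \<zero>"
  unfolding a by (simp add: r_minus m_assoc r_neg)
 have e: "[(A\<^sup>2 - 4 * B)] \<cdot> \<one> = ([A] \<cdot> \<one>)\<otimes>([A] \<cdot> \<one>)\<ominus>\<two>\<otimes>\<two>\<otimes>([B] \<cdot> \<one>)"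
  by (simp add: int_embed(2,6) int_numerals monoid_mult_class.power2_eq_square)
 have "t\<otimes>t\<otimes>(t\<otimes>t)\<otimes>y =\<ominus>(t\<otimes>x)\<otimes>\<ominus> (t\<otimes>x)\<ominus>t\<otimes>t\<otimes>(x\<otimes>x\<ominus>t\<otimes>t\<otimes>y)"
  if "t\<in>carrier L" "x\<in>carrier L" "y\<in>carrier L" for t x y
 proof -
  have "\<ominus> (t\<otimes>x)\<otimes>\<ominus> (t\<otimes>x)\<ominus>t\<otimes>t\<otimes>(x\<otimes>x\<ominus>t\<otimes>t\<otimes>y)\<ominus>t\<otimes>t\<otimes>(t\<otimes>t)\<otimes>y = \<zero>"
   using that by Ring.algebra
  then show ?thesis using that r_right_minus_eq by simp
 qed
 from this[of "\<one>\<oplus>\<one>" "[A] \<cdot> \<one>" "[B] \<cdot> \<one>"]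
 show "\<two>\<otimes>\<two>\<otimes>(\<two>\<otimes>\<two>)\<otimes>([B] \<cdot> \<one>) = ([(- 2 * A)] \<cdot> \<one>)\<otimes>([(- 2 * A)] \<cdot> \<one>)\<ominus>\<two>\<otimes>\<two>\<otimes>([(A\<^sup>2 - 4 * B)] \<cdot> \<one>)"
  unfolding a e by simp
qed (use assms quot_simps(2) two_nonzero in "auto simp: int_nonzero")

lemma (in cring) square_regroup:
 assumes "q\<in>carrier R" "i\<in>carrier R" "w\<in>carrier R" "x\<in>carrier R"
 shows "q\<otimes>((i\<otimes>(w\<otimes>x))\<otimes>(i\<otimes>(w\<otimes>x))) = (q\<otimes>i)\<otimes>(i\<otimes>(w\<otimes>w))\<otimes>(x\<otimes>x)"
 using assms by (simp add: m_ac)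

section \<open>The rationals and their completions inside the algebraic closures\<close>

lemma Q_ring_simps [simp]:
 "carrier Q_ring = UNIV" "x\<otimes>\<^bsub>Q_ring\<^esub>y = x * y" "x\<oplus>\<^bsub>Q_ring\<^esub>y = x + y" "\<one>\<^bsub>Q_ring\<^esub> = 1" "\<zero>\<^bsub>Q_ring\<^esub> = 0"
 by (simp_all add: ring_of_type_algebra_def)

lemma field_Q_ring: "field Q_ring" by (rule field_from_type_algebra)

locale rational_hom = field F for F (structure) + fixes h assumes h: "h\<in>ring_hom Q_ring F"
begin

sublocale hom: ring_hom_ring Q_ring F h by (intro ring_hom_ringI2 h ring_axioms field.is_ring[OF field_Q_ring])

lemma h_closed: "h q\<in>carrier F" using h by (simp add: ring_hom_def)

lemma h_ops: "h (x * y) = h x\<otimes>h y" "h (x + y) = h x\<oplus>h y" "h 1 = \<one>" "h 0 = \<zero>"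
 using hom.hom_mult[of x y] hom.hom_add[of x y] hom.hom_one hom.hom_zero by simp_all

lemma h_inj: "h x = h y \<longleftrightarrow> x = y"
 using non_trivial_field_hom_is_inj[OF h field_Q_ring field_axioms] by (auto simp: inj_on_def)

lemma h_nat: "h (of_nat n) = [n] \<cdot> \<one>" by (induction n) (simp_all add: h_ops a_comm h_closed)

lemma h_minus: "h (- x) =\<ominus>h x" using h_ops(2)[of "- x" x] h_closed by (intro minus_equality[symmetric]) (auto simp: h_ops)

lemma h_int: "h (of_int k) = [k] \<cdot> \<one>"
proof -
 have n: "h (of_int (int n)) = [int n] \<cdot> \<one>" for n using h_nat[of n] by (simp add: add_pow_def int_pow_int)
 show ?thesis
 proof (cases k rule: int_cases2)
  case (nonneg n) then show ?thesis using n by simp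
 next
  case (nonpos n)
  then show ?thesis using n[of n] int_embed(4)[of "int n"] h_minus[of "of_int (int n)"] by simp
 qed
qed

lemma char_zero_of_hom: "n > 0 ==> [(n::nat)] \<cdot> \<one> ~= \<zero>" using h_inj[of "of_nat n" 0] by (simp add: h_nat h_ops)

end

lemma rational_hom_unique:
 assumes "rational_hom F h" "rational_hom F h'" shows "h q = h' q"
proof -
 interpret h: rational_hom F h by fact
 interpret h': rational_hom F h' by fact
 obtain m n where q: "q = of_int m / of_int n" "n ~= 0" by (metis quotient_of_div quotient_of_denom_pos surj_pair less_irrefl)
 have nz: "h (of_int n) ~= \<zero>\<^bsub>F\<^esub>" using h.h_inj[of "of_int n" 0] q(2) h.h_ops(4) by simp
 have "h q\<otimes>\<^bsub>F\<^esub>h (of_int n) = h (of_int m)" using h.h_ops(1)[of q "of_int n"] q by simp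
 moreover have "h' q\<otimes>\<^bsub>F\<^esub>h (of_int n) = h (of_int m)"
  using h'.h_ops(1)[of q "of_int n"] q by (simp add: h.h_int h'.h_int)
 ultimately show ?thesis using h.m_rcancel[OF nz h.h_closed h.h_closed[of q] h'.h_closed[of q]] by simp
qed

text \<open>The image in \<open>Qvbar v\<close> of the element of the completion represented by a
  Cauchy sequence. Statements over the completion thereby become statements about rational sequences
  modulo null sequences.\<close>

definition cauchy_point :: "place => (nat => rat) => local_element" where
 "cauchy_point v s = ring.indexed_const (completion v)
   ({s. null v s} +>\<^bsub>cauchy_ring (place_abs v)\<^esub> s)"

context
 fixes v assumes v: "v\<in>places"
begin

interpretation A: rat_abs "place_abs v" by (rule rat_abs_place[OF v])
interpretation C: cring "cauchy_ring (place_abs v)" by (rule A.cring_cauchy_ring)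
interpretation N: maximalideal "{s. null v s}" "cauchy_ring (place_abs v)" by (rule A.maximalideal_null)
interpretation F: field "completion v" by (rule field_completion[OF v])
interpretation L: algebraic_closure "Qvbar v" "Qv_in_Qvbar v" by (rule algebraic_closure_Qvbar[OF v])

lemma cauchy_point_hom: "cauchy_point v\<in>ring_hom (cauchy_ring (place_abs v)) (Qvbar v)"
proof -
 have "(\<lambda>s. {s. null v s} +>\<^bsub>cauchy_ring (place_abs v)\<^esub> s)\<in>ring_hom (cauchy_ring (place_abs v)) (completion v)"
  unfolding completion_def by (rule N.rcos_ring_hom)
 moreover have "ring.indexed_const (completion v)\<in>ring_hom (completion v) (Qvbar v)" unfolding Qvbar_def by (rule F.alg_closureE(2))
 ultimately have "ring.indexed_const (completion v) \<circ> (\<lambda>s. {s. null v s} +>\<^bsub>cauchy_ring (place_abs v)\<^esub> s)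
  \<in> ring_hom (cauchy_ring (place_abs v)) (Qvbar v)" by (rule ring_hom_trans)
 then show ?thesis by (simp add: cauchy_point_def[abs_def] comp_def)
qed

interpretation P: ring_hom_ring "cauchy_ring (place_abs v)" "Qvbar v" "cauchy_point v"
 by (intro ring_hom_ringI2 C.ring_axioms L.ring_axioms cauchy_point_hom)

lemma cauchy_point_range: "Qv_in_Qvbar v = cauchy_point v ` {s. cauchy v s}"
proof -
 have "carrier (completion v) = (\<lambda>s. {s. null v s} +>\<^bsub>cauchy_ring (place_abs v)\<^esub> s) ` carrier (cauchy_ring (place_abs v))"
  unfolding completion_def FactRing_def A_RCOSETS_def' by auto
 then show ?thesis unfolding Qv_in_Qvbar_def by (auto simp: cauchy_point_def image_image cauchy_ring_def)
qed

lemma cauchy_point_zero_iff: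
 assumes s: "cauchy v s"
 shows "cauchy_point v s = \<zero>\<^bsub>Qvbar v\<^esub> \<longleftrightarrow> null v s"
proof -
 have h: "ring.indexed_const (completion v)\<in>ring_hom (completion v) (Qvbar v)" unfolding Qvbar_def by (rule F.alg_closureE(2))
 interpret I: ring_hom_ring "completion v" "Qvbar v" "ring.indexed_const (completion v)"
  by (intro ring_hom_ringI2 F.ring_axioms L.ring_axioms h)
 let ?N = "{s. null v s}" and ?C = "cauchy_ring (place_abs v)"
 have sc: "s\<in>carrier ?C" using s by (simp add: cauchy_ring_def)
 have c: "?N +>\<^bsub>?C\<^esub> s\<in>carrier (completion v)" unfolding completion_def FactRing_def A_RCOSETS_def' using sc by auto
 have "cauchy_point v s = \<zero>\<^bsub>Qvbar v\<^esub> \<longleftrightarrow> ?N +>\<^bsub>?C\<^esub> s = \<zero>\<^bsub>completion v\<^esub>"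
  using F.indexed_const_inj_on c I.hom_zero unfolding cauchy_point_def inj_on_def by (metis F.zero_closed)
 also have "\<zero>\<^bsub>completion v\<^esub> = ?N" by (simp add: completion_def FactRing_def)
 also have "?N +>\<^bsub>?C\<^esub> s = ?N \<longleftrightarrow> s \<in> ?N"
  using N.rcos_const_imp_mem[OF sc] N.a_rcos_const[of s] by blast
 finally show ?thesis by simp
qed

lemma cauchy_point_ops:
 assumes "cauchy v s" "cauchy v t"
 shows "cauchy_point v s\<otimes>\<^bsub>Qvbar v\<^esub>cauchy_point v t = cauchy_point v (\<lambda>n. s n * t n)"
  "cauchy_point v s\<oplus>\<^bsub>Qvbar v\<^esub>cauchy_point v t = cauchy_point v (\<lambda>n. s n + t n)"
  "cauchy_point v s\<in>carrier (Qvbar v)"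
  "\<one>\<^bsub>Qvbar v\<^esub> = cauchy_point v (\<lambda>n. 1)"
 using P.hom_mult[of s t] P.hom_add[of s t] P.hom_closed[of s] P.hom_one assms by (simp_all add: cauchy_ring_def)

lemma cauchy_point_eq_iff:
 assumes s: "cauchy v s" and t: "cauchy v t"
 shows "cauchy_point v s = cauchy_point v t \<longleftrightarrow> null v (\<lambda>n. s n - t n)"
proof -
 have d: "cauchy v (\<lambda>n. s n - t n)" using A.cauchy_add[OF s A.cauchy_uminus[OF t]] by simp
 have c: "cauchy_point v (\<lambda>n. s n - t n)\<in>carrier (Qvbar v)" "cauchy_point v t\<in>carrier (Qvbar v)"
  using cauchy_point_ops(3)[OF d t] cauchy_point_ops(3)[OF t s] by auto
 have "cauchy_point v s = cauchy_point v (\<lambda>n. s n - t n)\<oplus>\<^bsub>Qvbar v\<^esub>cauchy_point v t"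
  using cauchy_point_ops(2)[OF d t] by simp
 then have "cauchy_point v s = cauchy_point v t \<longleftrightarrow> cauchy_point v (\<lambda>n. s n - t n) = \<zero>\<^bsub>Qvbar v\<^esub>"
  using L.add.right_cancel[OF c(2) c(1) L.zero_closed] c by simp
 then show ?thesis using cauchy_point_zero_iff[OF d] by simp
qed

lemma rational_hom_local: "rational_hom (Qvbar v) (\<lambda>q. cauchy_point v (\<lambda>n. q))"
proof
 have c: "cauchy v (\<lambda>n. q)" for q by (rule A.cauchy_const)
 show "(\<lambda>q. cauchy_point v (\<lambda>n. q))\<in>ring_hom Q_ring (Qvbar v)"
  using cauchy_point_ops[OF c c] by (intro ring_hom_memI) auto
qed

lemma galois_closure_local: "galois_closure (Qvbar v) (Qv_in_Qvbar v)"
proof -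
 interpret R: rational_hom "Qvbar v" "\<lambda>q. cauchy_point v (\<lambda>n. q)" by (rule rational_hom_local)
 show ?thesis by unfold_locales (use R.char_zero_of_hom in auto)
qed

end

section \<open>The Selmer groups as sets of square classes\<close>

abbreviation qbar :: "rat => (rat list \<times> nat) multiset => rat" where
 "qbar \<equiv> ring.indexed_const Q_ring"

lemma rational_hom_global: "rational_hom Qbar qbar"
proof -
 interpret Q: field Q_ring by (rule field_Q_ring)
 interpret L: algebraic_closure Qbar Q_in_Qbar by (rule algebraic_closure_Qbar)
 show ?thesis by unfold_locales (use Q.alg_closureE(2) in "simp add: Qbar_def")
qed

lemma Q_in_Qbar_eq: "Q_in_Qbar = range qbar" by (simp add: Q_in_Qbar_def)

text \<open>Solubility over \<open>\<rat>\<^sub>v\<close> of the homogeneous space attached to \<open>d\<close>: the class of \<open>d\<close> is the class of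
 the \<open>x\<close>-coordinate of a rational point of \<open>y\<^sup>2 = x\<^sup>3 + ax\<^sup>2 + bx\<close>, where \<open>O\<close> and \<open>(0,0)\<close> have the
 classes of \<open>1\<close> and \<open>b\<close>.\<close>

definition locsol :: "place => int => int => rat => bool" where
 "locsol v a b d \<longleftrightarrow> (\<exists>s. cauchy v s & ~ null v s \<and>
   (null v (\<lambda>n. d * (s n * s n) - 1) \<or> null v (\<lambda>n. d * (s n * s n) - of_int b) \<or>
   (\<exists>t. cauchy v t & null v (\<lambda>n. t n * t n -
     d * (s n * s n) * (d * (s n * s n) * (d * (s n * s n)) + of_int a * (d * (s n * s n)) + of_int b)))))"

lemma cls_rational:
 assumes v: "v\<in>places" and I: "two_isogeny (Qvbar v) (Qv_in_Qvbar v) a b a' b' l h"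
  and s: "cauchy v s"
 shows "two_isogeny.cls (Qvbar v) (Qv_in_Qvbar v) a' b' (cauchy_point v s) \<longleftrightarrow>
   null v (\<lambda>n. s n - 1) \<or> null v (\<lambda>n. s n - of_int b') \<or>
   (\<exists>t. cauchy v t & null v (\<lambda>n. t n * t n -
     s n * (s n * s n + of_int a' * s n + of_int b')))"
proof -
 interpret I: two_isogeny "Qvbar v" "Qv_in_Qvbar v" a b a' b' l h by (rule I)
 interpret A: rat_abs "place_abs v" by (rule rat_abs_place[OF v])
 interpret R: rational_hom "Qvbar v" "\<lambda>q. cauchy_point v (\<lambda>n. q)" by (rule rational_hom_local[OF v])
 note ops = cauchy_point_ops[OF v]
 have 1: "\<one>\<^bsub>Qvbar v\<^esub> = cauchy_point v (\<lambda>n. 1)" using R.h_ops(3) by simp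
 have i: "[k] \<cdot>\<^bsub>Qvbar v\<^esub> \<one>\<^bsub>Qvbar v\<^esub> = cauchy_point v (\<lambda>n. of_int k)" for k using R.h_int[of k] by simp
 have e: "cauchy_point v s\<otimes>\<^bsub>Qvbar v\<^esub>(cauchy_point v s\<otimes>\<^bsub>Qvbar v\<^esub>cauchy_point v s\<oplus>\<^bsub>Qvbar v\<^esub>I.al'\<otimes>\<^bsub>Qvbar v\<^esub>cauchy_point v s\<oplus>\<^bsub>Qvbar v\<^esub>I.be')
  = cauchy_point v (\<lambda>n. s n * (s n * s n + of_int a' * s n + of_int b'))"
  unfolding i by (simp add: ops A.cauchy_const A.cauchy_add A.cauchy_mult s)
 have ce: "cauchy v (\<lambda>n. s n * (s n * s n + of_int a' * s n + of_int b'))" by (intro A.cauchy_const A.cauchy_add A.cauchy_mult s)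
 have "(\<exists>y\<in>Qv_in_Qvbar v. y\<otimes>\<^bsub>Qvbar v\<^esub>y = cauchy_point v (\<lambda>n. s n * (s n * s n + of_int a' * s n + of_int b'))) \<longleftrightarrow>
  (\<exists>t. cauchy v t & null v (\<lambda>n. t n * t n -
     s n * (s n * s n + of_int a' * s n + of_int b')))"
  unfolding cauchy_point_range[OF v] using cauchy_point_eq_iff[OF v A.cauchy_mult ce] ops(1) by auto
 then show ?thesis unfolding I.cls_def e unfolding i unfolding 1 by (simp add: cauchy_point_eq_iff[OF v s A.cauchy_const])
qed

lemma galois_closure_global: "galois_closure Qbar Q_in_Qbar"
proof -
 interpret L: algebraic_closure Qbar Q_in_Qbar by (rule algebraic_closure_Qbar)
 interpret R: rational_hom Qbar qbar by (rule rational_hom_global)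
 show ?thesis by unfold_locales (use R.char_zero_of_hom in auto)
qed

context
begin

interpretation G: galois_closure Qbar Q_in_Qbar by (rule galois_closure_global)

interpretation GQ: rational_hom Qbar qbar by (rule rational_hom_global)

text \<open>The embedding of the rationals into the completion extends to the algebraic closure
  because the target is algebraically closed; so the choice in \<open>closure_embedding\<close> is a
  choice among existing homomorphisms.\<close>

lemma closure_embedding_hom:
 assumes v: "v\<in>places" shows "closure_embedding v\<in>ring_hom Qbar (Qvbar v)"
proof -
 interpret V: galois_closure "Qvbar v" "Qv_in_Qvbar v" by (rule galois_closure_local[OF v])
 interpret R: rational_hom "Qvbar v" "\<lambda>q. cauchy_point v (\<lambda>n. q)" by (rule rational_hom_local[OF v])
 let ?h = "\<lambda>x. cauchy_point v (\<lambda>n. inv_into UNIV qbar x)"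
 have inj: "inj qbar" using GQ.h_inj by (auto simp: inj_def)
 have hq: "?h (qbar q) = cauchy_point v (\<lambda>n. q)" for q by (simp add: inv_f_f[OF inj])
 have "?h\<in>ring_hom (Qbar\<lparr>carrier := Q_in_Qbar\<rparr>) (Qvbar v)"
 proof (rule ring_hom_memI)
  show "?h \<one>\<^bsub>Qbar\<lparr>carrier := Q_in_Qbar\<rparr>\<^esub> = \<one>\<^bsub>Qvbar v\<^esub>" using hq[of 1] R.h_ops(3) by (simp add: GQ.h_ops)
 qed (use R.h_closed R.h_ops hq in "auto simp: Q_in_Qbar_eq simp flip: GQ.h_ops")
 then interpret E: hom_extension Qbar Q_in_Qbar "Qvbar v" ?h by unfold_locales (use G.algebraic_extension in auto)
 have "\<exists>h. h\<in>ring_hom Qbar (Qvbar v)" using E.extend[OF E.good_base] by blast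
 then show ?thesis unfolding closure_embedding_def by (rule someI_ex)
qed

context
 fixes v assumes v: "v\<in>places"
begin

interpretation V: galois_closure "Qvbar v" "Qv_in_Qvbar v" by (rule galois_closure_local[OF v])
interpretation R: rational_hom "Qvbar v" "\<lambda>q. cauchy_point v (\<lambda>n. q)" by (rule rational_hom_local[OF v])

abbreviation "j \<equiv> closure_embedding v"

interpretation J: ring_hom_ring Qbar "Qvbar v" j by (intro ring_hom_ringI2 G.ring_axioms V.ring_axioms closure_embedding_hom[OF v])

lemma j_qbar: "j (qbar q) = cauchy_point v (\<lambda>n. q)"
proof -
 have "(\<lambda>q. j (qbar q))\<in>ring_hom Q_ring (Qvbar v)"
  using ring_hom_trans[OF GQ.h closure_embedding_hom[OF v]] by (simp add: comp_def)
 then have "rational_hom (Qvbar v) (\<lambda>q. j (qbar q))" by unfold_locales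
 then show ?thesis using rational_hom_unique[OF _ rational_hom_local[OF v], of "\<lambda>q. j (qbar q)"] by simp
qed

lemma qv_in: "cauchy_point v (\<lambda>n. q)\<in>Qv_in_Qvbar v"
 using rat_abs.cauchy_const[OF rat_abs_place[OF v]] by (auto simp: cauchy_point_range[OF v])

lemma j_inj: "x\<in>carrier Qbar ==> y\<in>carrier Qbar ==> j x = j y \<longleftrightarrow> x = y"
 using non_trivial_field_hom_is_inj[OF closure_embedding_hom[OF v] G.field_axioms V.field_axioms] by (auto simp: inj_on_def)

text \<open>A polynomial over \<open>Qbar\<close> splits there, so all roots of its image come from
  \<open>Qbar\<close>; the induction removes one linear factor at a time.\<close>

lemma root_in_image:
 assumes "p\<in>carrier (poly_ring Qbar)" "p ~= []" "z\<in>carrier (Qvbar v)" "V.eval (map j p) z = \<zero>\<^bsub>Qvbar v\<^esub>"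
 shows "z\<in>j ` carrier Qbar" using assms(1,2,4)
proof (induction "length p" arbitrary: p rule: less_induct)
 case (less p)
 have pc: "set p \<subseteq> carrier Qbar" "hd p ~= \<zero>\<^bsub>Qbar\<^esub>" using less(2,3) by (auto simp: univ_poly_carrier[symmetric] polynomial_def)
 show ?case
 proof (cases "length p <= 1")
  case True
  then obtain c where p: "p = [c]" using less(3) by (cases p) auto
  then have c: "c\<in>carrier Qbar" "c ~= \<zero>\<^bsub>Qbar\<^esub>" using pc by auto
  have "j c = \<zero>\<^bsub>Qvbar v\<^esub>" using less(4) p assms(3) c by simp
  then have "j c = j \<zero>\<^bsub>Qbar\<^esub>" by simp
  then show ?thesis using c j_inj[of c "\<zero>\<^bsub>Qbar\<^esub>"] by simp
 next
  case False
  interpret UP: domain "poly_ring Qbar" by (rule G.univ_poly_is_domain[OF G.carrier_is_subring])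
  have "G.splitted p" using G.roots_over_carrier[OF less(2)] .
  then have "G.roots p ~= {#}" using False by (auto simp: G.splitted_def)
  then obtain r where r: "r\<in>carrier Qbar" "[\<one>\<^bsub>Qbar\<^esub>,\<ominus>\<^bsub>Qbar\<^esub>r] \<in> carrier (poly_ring Qbar)"
   "[\<one>\<^bsub>Qbar\<^esub>,\<ominus>\<^bsub>Qbar\<^esub>r] pdivides\<^bsub>Qbar\<^esub> p"
   using G.not_empty_rootsE[OF less(2)] by metis
  then obtain q where q: "q\<in>carrier (poly_ring Qbar)" "p = [\<one>\<^bsub>Qbar\<^esub>,\<ominus>\<^bsub>Qbar\<^esub>r]\<otimes>\<^bsub>poly_ring Qbar\<^esub>q"
   unfolding pdivides_def by blast
  have qn: "q ~= []"
  proof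
   assume "q = []" then have "p = []" using q(2) UP.r_null[OF r(2)] by (simp add: univ_poly_zero)
   then show False using less(3) by simp
  qed
  have pm: "p = G.poly_mult [\<one>\<^bsub>Qbar\<^esub>,\<ominus>\<^bsub>Qbar\<^esub>r] q" using q(2) by (simp add: univ_poly_mult)
  have qc: "set q \<subseteq> carrier Qbar" using q(1) by (auto simp: univ_poly_carrier[symmetric] polynomial_def)
  have "degree p = degree [\<one>\<^bsub>Qbar\<^esub>,\<ominus>\<^bsub>Qbar\<^esub>r] + degree q"
   using G.poly_mult_degree_eq[OF G.carrier_is_subring, of "[\<one>\<^bsub>Qbar\<^esub>,\<ominus>\<^bsub>Qbar\<^esub>r]" q] r(2) q(1) qn
   by (simp add: pm univ_poly_carrier)
  then have len: "length q < length p" using False by (simp add: Suc_diff_le)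
  have rc: "set [\<one>\<^bsub>Qbar\<^esub>,\<ominus>\<^bsub>Qbar\<^esub>r] \<subseteq> carrier Qbar" using r(1) by simp
  have mc: "set (map j q) \<subseteq> carrier (Qvbar v)" "set (map j [\<one>\<^bsub>Qbar\<^esub>,\<ominus>\<^bsub>Qbar\<^esub>r]) \<subseteq> carrier (Qvbar v)"
   "set (map j p) \<subseteq> carrier (Qvbar v)" using qc rc pc(1) by auto
  have "V.eval (map j p) z = V.eval (V.normalize (map j p)) z" using V.eval_normalize[OF mc(3) assms(3)] by simp
  also have "V.normalize (map j p) = V.poly_mult (map j [\<one>\<^bsub>Qbar\<^esub>,\<ominus>\<^bsub>Qbar\<^esub>r]) (map j q)"
   unfolding pm by (rule J.poly_mult_hom'[OF rc qc])
  also have "V.eval \<dots> z = V.eval (map j [\<one>\<^bsub>Qbar\<^esub>,\<ominus>\<^bsub>Qbar\<^esub>r]) z\<otimes>\<^bsub>Qvbar v\<^esub>V.eval (map j q) z"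
   by (rule V.eval_poly_mult[OF mc(2,1) assms(3)])
  finally have "V.eval (map j [\<one>\<^bsub>Qbar\<^esub>,\<ominus>\<^bsub>Qbar\<^esub>r]) z = \<zero>\<^bsub>Qvbar v\<^esub> \<or> V.eval (map j q) z = \<zero>\<^bsub>Qvbar v\<^esub>"
   using less(4) V.integral V.eval_in_carrier[OF mc(1) assms(3)] V.eval_in_carrier[OF mc(2) assms(3)] by metis
  then show ?thesis
  proof
   assume "V.eval (map j [\<one>\<^bsub>Qbar\<^esub>,\<ominus>\<^bsub>Qbar\<^esub>r]) z = \<zero>\<^bsub>Qvbar v\<^esub>"
   then have "z\<oplus>\<^bsub>Qvbar v\<^esub>\<ominus>\<^bsub>Qvbar v\<^esub> j r = \<zero>\<^bsub>Qvbar v\<^esub>" using assms(3) r(1) by simp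
   then have "z = j r" using assms(3) r(1) V.r_right_minus_eq[of z "j r"] by (simp add: a_minus_def)
   then show ?thesis using r(1) by blast
  qed (rule less(1)[OF len q(1) qn])
 qed
qed

text \<open>An element of \<open>Qbar\<close> is a root of a rational polynomial, whose coefficients
  \<open>g1\<close> fixes, so its conjugate is again a root. This makes the use of
  \<open>inv_into\<close> in \<open>restrict_aut\<close> legitimate.\<close>

lemma gal_image:
 assumes g1: "g1\<in>V.gal" and x: "x\<in>carrier Qbar"
 shows "g1 (j x)\<in>j ` carrier Qbar"
proof -
 obtain p where p: "p\<in>carrier (Q_in_Qbar[X]\<^bsub>Qbar\<^esub>)" "p ~= []" "G.eval p x = \<zero>\<^bsub>Qbar\<^esub>"
  using G.algebraicE[OF G.K_subring x G.algebraic_extension[OF x]] by blast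
 have pc: "p\<in>carrier (poly_ring Qbar)" by (rule G.carrier_polynomial_shell[OF G.K_subring p(1)])
 have ps: "set p \<subseteq> Q_in_Qbar" "set p \<subseteq> carrier Qbar"
  using p(1) G.K_sub by (auto simp: univ_poly_carrier[symmetric] polynomial_def)
 interpret h: ring_hom_ring "Qvbar v" "Qvbar v" g1 by (intro ring_hom_ringI2 V.ring_axioms) (use g1 in "simp add: V.gal_iff")
 have "map g1 (map j p) = map j p" using ps(1) V.gal_fix[OF g1 qv_in] by (auto simp: Q_in_Qbar_eq j_qbar)
 moreover have "g1 (V.eval (map j p) (j x)) = V.eval (map g1 (map j p)) (g1 (j x))" by (rule h.eval_hom') (use ps(2) x in auto)
 ultimately have "V.eval (map j p) (g1 (j x)) = g1 (V.eval (map j p) (j x))" by (simp only:)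
 also have "V.eval (map j p) (j x) = j (G.eval p x)" using J.eval_hom'[OF x ps(2)] by simp
 finally have "V.eval (map j p) (g1 (j x)) = \<zero>\<^bsub>Qvbar v\<^esub>" using p(3) by simp
 then show ?thesis using root_in_image[OF pc p(2)] V.gal_closed[OF g1] x by simp
qed

lemma restrict_aut_gal:
 assumes g1: "g1\<in>V.gal"
 shows "restrict_aut Qbar j g1\<in>G.gal" "x\<in>carrier Qbar ==> j (restrict_aut Qbar j g1 x) = g1 (j x)"
proof -
 define g where "g x = inv_into (carrier Qbar) j (g1 (j x))" for x
 have jg: "j (g x) = g1 (j x)" "g x\<in>carrier Qbar" if "x\<in>carrier Qbar" for x
  using f_inv_into_f[OF gal_image[OF g1 that]] inv_into_into[OF gal_image[OF g1 that]] by (simp_all add: g_def)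
 have gI: "g x = y" if "x\<in>carrier Qbar" "y\<in>carrier Qbar" "j y = g1 (j x)" for x y using jg[OF that(1)] that j_inj by metis
 note hs = V.gal_hom_simps[OF g1]
 have "g\<in>ring_hom Qbar Qbar"
 proof (rule ring_hom_memI)
  fix x y assume xy: "x\<in>carrier Qbar" "y\<in>carrier Qbar"
  show "g x\<in>carrier Qbar" using jg xy by simp
  show "g (x\<otimes>\<^bsub>Qbar\<^esub>y) = g x\<otimes>\<^bsub>Qbar\<^esub>g y" using xy jg hs(1)[of "j x" "j y"] by (intro gI) simp_all
  show "g (x\<oplus>\<^bsub>Qbar\<^esub>y) = g x\<oplus>\<^bsub>Qbar\<^esub>g y" using xy jg hs(2)[of "j x" "j y"] by (intro gI) simp_all
 next
  show "g \<one>\<^bsub>Qbar\<^esub> = \<one>\<^bsub>Qbar\<^esub>" using hs(5)[of "\<one>\<^bsub>Qvbar v\<^esub>" "\<one>\<^bsub>Qvbar v\<^esub>"] by (intro gI) simp_all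
 qed
 moreover have "\<forall>k\<in>Q_in_Qbar. g k = k"
 proof
  fix k assume k: "k\<in>Q_in_Qbar"
  then show "g k = k" using V.gal_fix[OF g1 qv_in] G.K_carrier[OF k] by (intro gI) (auto simp: Q_in_Qbar_eq j_qbar)
 qed
 ultimately have "restrict g (carrier Qbar)\<in>G.gal" by (rule G.restrict_hom_gal)
 moreover have e: "restrict_aut Qbar j g1 = restrict g (carrier Qbar)"  by (rule ext) (simp add: restrict_aut_def g_def restrict_def)
 ultimately show "restrict_aut Qbar j g1\<in>G.gal" by simp
 show "x\<in>carrier Qbar ==> j (restrict_aut Qbar j g1 x) = g1 (j x)" using jg by (simp add: e)
qed

text \<open>The restricted automorphism fixes \<open>u\<close> exactly when the local one fixes the
  image of \<open>u\<close>. The union in \<open>H1_restrict\<close> has a single term, classes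
  being singletons.\<close>

lemma H1_restrict_kum:
 assumes Mv: "two_kernel (Qvbar v) (Qv_in_Qvbar v) Mv a b" and u: "u\<in>carrier Qbar"
 shows "H1_restrict Qbar (Qvbar v) (Qv_in_Qvbar v) Mv j {G.kum u} = {V.kum (j u)}"
proof -
 interpret Mv: two_kernel "Qvbar v" "Qv_in_Qvbar v" Mv a b by (rule Mv)
 have "map_point j (G.kum u (restrict_aut Qbar j g1)) = V.kum (j u) g1" if g1: "g1\<in>V.gal" for g1
 proof -
  have "restrict_aut Qbar j g1 u = u \<longleftrightarrow> g1 (j u) = j u"
   using restrict_aut_gal[OF g1] u j_inj[of "restrict_aut Qbar j g1 u" u] G.gal_closed by auto
  then show ?thesis using restrict_aut_gal(1)[OF g1] g1 by (simp add: G.kum_def V.kum_def)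
 qed
 then have "(\<lambda>g1\<in>V.gal. map_point j (G.kum u (restrict_aut Qbar j g1))) = V.kum (j u)" by (auto simp: fun_eq_iff V.kum_def)
 then show ?thesis unfolding H1_restrict_def by (simp add: Mv.H1_class_eq V.kum_def)
qed

end

text \<open>Every global class is the cocycle of a square root u of a nonzero rational q. At a place
  it restricts to the cocycle of the image of u, and by \<open>kummer_image\<close> it satisfies the
  local condition exactly when q times some nonzero local square belongs to \<open>cls\<close>,
  which is what \<open>locsol\<close> spells out in sequences.\<close>

theorem selmer_group_eq:
 assumes g: "two_isogeny Qbar Q_in_Qbar a b a' b' l h"
  and loc: "\<And>v. v\<in>places ==> two_isogeny (Qvbar v) (Qv_in_Qvbar v) a b a' b' (lv v) (hv v)"
 shows "selmer_group (field.curve Qbar a b) (field.curve Qbar a' b') h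
   (\<lambda>v. field.curve (Qvbar v) a b) (\<lambda>v. field.curve (Qvbar v) a' b') hv =
  {{G.kum u} | u q. u\<in>carrier Qbar & q ~= 0 & u\<otimes>\<^bsub>Qbar\<^esub>u = qbar q & (\<forall>v\<in>places. locsol v a' b' q)}"
proof -
 interpret I: two_isogeny Qbar Q_in_Qbar a b a' b' l h by (rule g)
 have key: "H1_restrict Qbar (Qvbar v) (Qv_in_Qvbar v) (isogeny_kernel (field.curve (Qvbar v) a b) (field.curve (Qvbar v) a' b') (hv v)) (closure_embedding v) {G.kum u}
   \<in> kummer_map (Qvbar v) (Qv_in_Qvbar v) (field.curve (Qvbar v) a b) (field.curve (Qvbar v) a' b') (hv v) ` rational_points (Qv_in_Qvbar v) (field.curve (Qvbar v) a' b')
   \<longleftrightarrow> locsol v a' b' q"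
  if v: "v\<in>places" and u: "u\<in>carrier Qbar" "q ~= 0" "u\<otimes>\<^bsub>Qbar\<^esub>u = qbar q" for v u q
 proof -
  interpret V: two_isogeny "Qvbar v" "Qv_in_Qvbar v" a b a' b' "lv v" "hv v" by (rule loc[OF v])
  interpret A: rat_abs "place_abs v" by (rule rat_abs_place[OF v])
  interpret R: rational_hom "Qvbar v" "\<lambda>q. cauchy_point v (\<lambda>n. q)" by (rule rational_hom_local[OF v])
  interpret J: ring_hom_ring Qbar "Qvbar v" "closure_embedding v"
   by (intro ring_hom_ringI2 G.ring_axioms V.ring_axioms closure_embedding_hom[OF v])
  let ?w = "closure_embedding v u" and ?Q = "cauchy_point v (\<lambda>n. q)"
  have w: "?w\<in>carrier (Qvbar v)" "?w\<otimes>\<^bsub>Qvbar v\<^esub>?w = ?Q" using u J.hom_mult[OF u(1) u(1)] j_qbar[OF v] by simp_all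
  have Qnz: "?Q ~= \<zero>\<^bsub>Qvbar v\<^esub>" using R.h_inj[of q 0] u(2) R.h_ops(4) by simp
  have w0: "?w ~= \<zero>\<^bsub>Qvbar v\<^esub>" using w Qnz by auto
  have QK: "?Q\<in>Qv_in_Qvbar v" by (rule qv_in[OF v])
  have Qc: "?Q\<in>carrier (Qvbar v)" by (rule R.h_closed)
  have iQ: "inv\<^bsub>Qvbar v\<^esub> ?Q\<in>Qv_in_Qvbar v" "inv\<^bsub>Qvbar v\<^esub> ?Q\<in>carrier (Qvbar v)" "?Q\<otimes>\<^bsub>Qvbar v\<^esub>inv\<^bsub>Qvbar v\<^esub> ?Q = \<one>\<^bsub>Qvbar v\<^esub>"
   using V.subfield_m_inv(1)[OF V.subfield_axioms, of ?Q] QK Qnz Qc by (auto simp: V.field_Units)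
  have cond: "(\<exists>x. x\<in>carrier (Qvbar v) & x ~= \<zero>\<^bsub>Qvbar v\<^esub> & x\<otimes>\<^bsub>Qvbar v\<^esub>x\<in>Qv_in_Qvbar v & V.cls (x\<otimes>\<^bsub>Qvbar v\<^esub>x) & V.kum ?w = V.kum x)
   \<longleftrightarrow> (\<exists>z\<in>Qv_in_Qvbar v. z ~= \<zero>\<^bsub>Qvbar v\<^esub> & V.cls (?Q\<otimes>\<^bsub>Qvbar v\<^esub>(z\<otimes>\<^bsub>Qvbar v\<^esub>z)))" (is "?l = ?r")
  proof
   assume ?l
   then obtain x where x: "x\<in>carrier (Qvbar v)" "x ~= \<zero>\<^bsub>Qvbar v\<^esub>" "x\<otimes>\<^bsub>Qvbar v\<^esub>x\<in>Qv_in_Qvbar v"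
    "V.cls (x\<otimes>\<^bsub>Qvbar v\<^esub>x)" "V.kum ?w = V.kum x" by blast
   have wx: "?w\<otimes>\<^bsub>Qvbar v\<^esub>x\<in>Qv_in_Qvbar v" using V.kum_eq_iff[OF w(1) w0 _ x(1-3)] w(2) QK x(5) by simp
   \<comment> \<open>This is x / w, written with the inverse of Q = w^2 so that it visibly lies in
     the completion; then Q z^2 = x^2.\<close>
   let ?z = "inv\<^bsub>Qvbar v\<^esub> ?Q\<otimes>\<^bsub>Qvbar v\<^esub>(?w\<otimes>\<^bsub>Qvbar v\<^esub>x)"
   have z: "?z\<in>Qv_in_Qvbar v" using V.K_ops(2)[OF iQ(1) wx] .
   have "?Q\<otimes>\<^bsub>Qvbar v\<^esub>(?z\<otimes>\<^bsub>Qvbar v\<^esub>?z) = (?Q\<otimes>\<^bsub>Qvbar v\<^esub>inv\<^bsub>Qvbar v\<^esub> ?Q)\<otimes>\<^bsub>Qvbar v\<^esub>(inv\<^bsub>Qvbar v\<^esub> ?Q\<otimes>\<^bsub>Qvbar v\<^esub>(?w\<otimes>\<^bsub>Qvbar v\<^esub>?w))\<otimes>\<^bsub>Qvbar v\<^esub>(x\<otimes>\<^bsub>Qvbar v\<^esub>x)"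
    by (rule V.square_regroup[OF Qc iQ(2) w(1) x(1)])
   also have "\<dots> = x\<otimes>\<^bsub>Qvbar v\<^esub>x" unfolding w(2) iQ(3) V.m_comm[OF iQ(2) Qc] using x(1) by simp
   finally have zz: "?Q\<otimes>\<^bsub>Qvbar v\<^esub>(?z\<otimes>\<^bsub>Qvbar v\<^esub>?z) = x\<otimes>\<^bsub>Qvbar v\<^esub>x" .
   have "?z ~= \<zero>\<^bsub>Qvbar v\<^esub>"
   proof
    assume "?z = \<zero>\<^bsub>Qvbar v\<^esub>"
    then have "x\<otimes>\<^bsub>Qvbar v\<^esub>x = \<zero>\<^bsub>Qvbar v\<^esub>" using zz Qc by simp
    then show False using x(1,2) by (simp add: V.integral_iff)
   qed
   then show ?r using z zz x(4) by metis
  next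
   assume ?r
   then obtain z where z: "z\<in>Qv_in_Qvbar v" "z ~= \<zero>\<^bsub>Qvbar v\<^esub>" "V.cls (?Q\<otimes>\<^bsub>Qvbar v\<^esub>(z\<otimes>\<^bsub>Qvbar v\<^esub>z))" by blast
   have zc: "z\<in>carrier (Qvbar v)" by (rule V.K_carrier[OF z(1)])
   let ?x = "?w\<otimes>\<^bsub>Qvbar v\<^esub>z"
   have x: "?x\<in>carrier (Qvbar v)" "?x ~= \<zero>\<^bsub>Qvbar v\<^esub>" using w w0 z zc by (simp_all add: V.integral_iff)
   have xx: "?x\<otimes>\<^bsub>Qvbar v\<^esub>?x = ?Q\<otimes>\<^bsub>Qvbar v\<^esub>(z\<otimes>\<^bsub>Qvbar v\<^esub>z)"
    unfolding w(2)[symmetric] using w(1) zc by (simp add: V.m_ac)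
   have xK: "?x\<otimes>\<^bsub>Qvbar v\<^esub>?x\<in>Qv_in_Qvbar v" unfolding xx using V.K_ops(2) QK z(1) by blast
   have "?w\<otimes>\<^bsub>Qvbar v\<^esub>?x = ?Q\<otimes>\<^bsub>Qvbar v\<^esub>z" unfolding w(2)[symmetric] using w(1) zc by (simp add: V.m_assoc)
   then have "?w\<otimes>\<^bsub>Qvbar v\<^esub>?x\<in>Qv_in_Qvbar v" using V.K_ops(2)[OF QK z(1)] by simp
   then have "V.kum ?w = V.kum ?x" using V.kum_eq_iff[OF w(1) w0 _ x xK] w(2) QK by simp
   then show ?l using x xK xx z(3) by metis
  qed
  have tr: "(\<exists>z\<in>Qv_in_Qvbar v. z ~= \<zero>\<^bsub>Qvbar v\<^esub> & V.cls (?Q\<otimes>\<^bsub>Qvbar v\<^esub>(z\<otimes>\<^bsub>Qvbar v\<^esub>z))) \<longleftrightarrow> locsol v a' b' q"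
  proof -
   have e: "?Q\<otimes>\<^bsub>Qvbar v\<^esub>(cauchy_point v s\<otimes>\<^bsub>Qvbar v\<^esub>cauchy_point v s) = cauchy_point v (\<lambda>n. q * (s n * s n))"
    "cauchy v (\<lambda>n. q * (s n * s n))" if "cauchy v s" for s
    using that by (simp_all add: cauchy_point_ops[OF v] A.cauchy_mult A.cauchy_const)
   have "(\<exists>z\<in>Qv_in_Qvbar v. z ~= \<zero>\<^bsub>Qvbar v\<^esub> & V.cls (?Q\<otimes>\<^bsub>Qvbar v\<^esub>(z\<otimes>\<^bsub>Qvbar v\<^esub>z))) \<longleftrightarrow>
    (\<exists>s. cauchy v s & cauchy_point v s ~= \<zero>\<^bsub>Qvbar v\<^esub> & V.cls (?Q\<otimes>\<^bsub>Qvbar v\<^esub>(cauchy_point v s\<otimes>\<^bsub>Qvbar v\<^esub>cauchy_point v s)))"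
    unfolding cauchy_point_range[OF v] by blast
   also have "\<dots> \<longleftrightarrow> locsol v a' b' q" unfolding locsol_def by (rule ex_cong1, intro conj_cong refl)
     (simp_all only: cauchy_point_zero_iff[OF v] e(1) cls_rational[OF v V.two_isogeny_axioms e(2)])
   finally show ?thesis .
  qed
  have H: "H1_restrict Qbar (Qvbar v) (Qv_in_Qvbar v) (isogeny_kernel (field.curve (Qvbar v) a b) (field.curve (Qvbar v) a' b') (hv v)) (closure_embedding v) {G.kum u} = {V.kum ?w}"
   by (rule H1_restrict_kum[OF v V.ker.two_kernel_axioms u(1)])
  show ?thesis unfolding H V.kummer_image tr[symmetric] cond[symmetric] by auto
 qed
 have H1: "carrier (H1 Qbar Q_in_Qbar (isogeny_kernel (field.curve Qbar a b) (field.curve Qbar a' b') h)) =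
  {{G.kum u} | u q. u\<in>carrier Qbar & q ~= 0 & u\<otimes>\<^bsub>Qbar\<^esub>u = qbar q}"
 proof -
  have e: "(u ~= \<zero>\<^bsub>Qbar\<^esub> & u\<otimes>\<^bsub>Qbar\<^esub>u\<in>Q_in_Qbar) \<longleftrightarrow> (\<exists>q. q ~= 0 & u\<otimes>\<^bsub>Qbar\<^esub>u = qbar q)" if u: "u\<in>carrier Qbar" for u
  proof
   assume u': "u ~= \<zero>\<^bsub>Qbar\<^esub> & u\<otimes>\<^bsub>Qbar\<^esub>u\<in>Q_in_Qbar"
   then obtain q where q: "u\<otimes>\<^bsub>Qbar\<^esub>u = qbar q" unfolding Q_in_Qbar_eq by blast
   have "u\<otimes>\<^bsub>Qbar\<^esub>u ~= \<zero>\<^bsub>Qbar\<^esub>" using G.integral[of u u] u u' by blast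
   then have "q ~= 0" using q GQ.h_ops(4) by metis
   then show "\<exists>q. q ~= 0 & u\<otimes>\<^bsub>Qbar\<^esub>u = qbar q" using q by blast
  next
   assume "\<exists>q. q ~= 0 & u\<otimes>\<^bsub>Qbar\<^esub>u = qbar q"
   then obtain q where q: "q ~= 0" "u\<otimes>\<^bsub>Qbar\<^esub>u = qbar q" by blast
   have "qbar q ~= \<zero>\<^bsub>Qbar\<^esub>" using GQ.h_inj[of q 0] q(1) GQ.h_ops(4) by simp
   then have "u ~= \<zero>\<^bsub>Qbar\<^esub>" using q(2) u by auto
   then show "u ~= \<zero>\<^bsub>Qbar\<^esub> & u\<otimes>\<^bsub>Qbar\<^esub>u\<in>Q_in_Qbar" using q(2) unfolding Q_in_Qbar_eq by simp
  qed
  have "carrier (cocycles Qbar Q_in_Qbar (isogeny_kernel (field.curve Qbar a b) (field.curve Qbar a' b') h)) =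
   {G.kum u | u. u\<in>carrier Qbar & (u ~= \<zero>\<^bsub>Qbar\<^esub> & u\<otimes>\<^bsub>Qbar\<^esub>u\<in>Q_in_Qbar)}"
   using I.ker.cocycle_iff by blast
  also have "\<dots> = {G.kum u | u q. u\<in>carrier Qbar & q ~= 0 & u\<otimes>\<^bsub>Qbar\<^esub>u = qbar q}" using e by blast
  finally show ?thesis unfolding I.ker.H1_carrier by blast
 qed
 show ?thesis unfolding selmer_group_def H1 using key by auto
qed

text \<open>Representatives of the square classes of nonzero rationals: a set stands for the product
  of its elements, and symmetric difference for multiplication of classes.\<close>

definition sqf_sets :: "int set set" where
 "sqf_sets = {D. finite D & D \<subseteq> insert (- 1) {p. prime p}}"

text \<open>A set corresponds to the cocycle of a square root of its product, and two such cocycles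
  agree exactly when the product of the radicands is a rational square. \<open>S\<close> stands for
  any condition that depends on the square class only.\<close>

lemma card_selmer_group_aux:
 assumes inj: "\<And>D D' t. D\<in>sqf_sets ==> D'\<in>sqf_sets ==> of_int (\<Prod>D * \<Prod>D') = (t * t :: rat) ==> D = D'"
  and surj: "\<And>q. (q::rat) ~= 0 ==> \<exists>D\<in>sqf_sets. \<exists>t. t ~= 0 & q = of_int (\<Prod>D) * (t * t)"
  and nz: "\<And>D. D\<in>sqf_sets ==> \<Prod>D ~= 0"
  and inv: "\<And>q t. t ~= 0 ==> S (q * (t * t)) \<longleftrightarrow> S q"
 shows "card {{G.kum u} | u q. u\<in>carrier Qbar & q ~= 0 & u\<otimes>\<^bsub>Qbar\<^esub>u = qbar q & S q} =
  card {D\<in>sqf_sets. S (of_int (\<Prod>D))}"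
proof -
 define r where "r q = (SOME u. u\<in>carrier Qbar & u\<otimes>\<^bsub>Qbar\<^esub>u = qbar q)" for q
 have r: "r q\<in>carrier Qbar" "r q\<otimes>\<^bsub>Qbar\<^esub>r q = qbar q" for q
 proof -
  obtain u where u: "u\<in>carrier Qbar" "u\<otimes>\<^bsub>Qbar\<^esub>u\<oplus>\<^bsub>Qbar\<^esub>\<zero>\<^bsub>Qbar\<^esub>\<otimes>\<^bsub>Qbar\<^esub>u\<oplus>\<^bsub>Qbar\<^esub>\<ominus>\<^bsub>Qbar\<^esub> qbar q = \<zero>\<^bsub>Qbar\<^esub>"
   using G.quadratic_root[of "\<zero>\<^bsub>Qbar\<^esub>" "\<ominus>\<^bsub>Qbar\<^esub> qbar q"] GQ.h_closed[of q] by auto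
  then have "u\<otimes>\<^bsub>Qbar\<^esub>u\<ominus>\<^bsub>Qbar\<^esub>qbar q = \<zero>\<^bsub>Qbar\<^esub>" by (simp add: a_minus_def)
  then have "u\<otimes>\<^bsub>Qbar\<^esub>u = qbar q" using u(1) GQ.h_closed[of q] G.r_right_minus_eq by simp
  then have "\<exists>u. u\<in>carrier Qbar & u\<otimes>\<^bsub>Qbar\<^esub>u = qbar q" using u(1) by blast
  then have "r q\<in>carrier Qbar & r q\<otimes>\<^bsub>Qbar\<^esub>r q = qbar q" unfolding r_def by (rule someI_ex)
  then show "r q\<in>carrier Qbar" "r q\<otimes>\<^bsub>Qbar\<^esub>r q = qbar q" by simp_all
 qed
 have qnz: "qbar q ~= \<zero>\<^bsub>Qbar\<^esub>" if "q ~= 0" for q using GQ.h_inj[of q 0] that GQ.h_ops(4) by simp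
 have keq: "G.kum u = G.kum u' \<longleftrightarrow> (\<exists>t. q * q' = t * t)"
  if u: "u\<in>carrier Qbar" "q ~= 0" "u\<otimes>\<^bsub>Qbar\<^esub>u = qbar q" and u': "u'\<in>carrier Qbar" "q' ~= 0" "u'\<otimes>\<^bsub>Qbar\<^esub>u' = qbar q'" for u q u' q'
 proof -
  have nz: "u ~= \<zero>\<^bsub>Qbar\<^esub>" "u' ~= \<zero>\<^bsub>Qbar\<^esub>"
   using qnz[OF u(2)] qnz[OF u'(2)] unfolding u(3)[symmetric] u'(3)[symmetric] by auto
  have uu: "(u\<otimes>\<^bsub>Qbar\<^esub>u')\<otimes>\<^bsub>Qbar\<^esub>(u\<otimes>\<^bsub>Qbar\<^esub>u') = qbar (q * q')"
   unfolding GQ.h_ops(1) u(3)[symmetric] u'(3)[symmetric] using u(1) u'(1) by (simp add: G.m_ac)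
  have "G.kum u = G.kum u' \<longleftrightarrow> u\<otimes>\<^bsub>Qbar\<^esub>u'\<in>Q_in_Qbar"
   by (rule G.kum_eq_iff) (use u u' nz in "auto simp: Q_in_Qbar_eq")
  also have "\<dots> \<longleftrightarrow> (\<exists>t. q * q' = t * t)"
  proof
   assume "u\<otimes>\<^bsub>Qbar\<^esub>u'\<in>Q_in_Qbar"
   then obtain t where t: "u\<otimes>\<^bsub>Qbar\<^esub>u' = qbar t" unfolding Q_in_Qbar_eq by blast
   have "qbar (q * q') = qbar (t * t)" using uu unfolding t GQ.h_ops(1)[of t t] by simp
   then show "\<exists>t. q * q' = t * t" using GQ.h_inj by blast
  next
   assume "\<exists>t. q * q' = t * t"
   then obtain t where "q * q' = t * t" by blast
   then have "(u\<otimes>\<^bsub>Qbar\<^esub>u')\<otimes>\<^bsub>Qbar\<^esub>(u\<otimes>\<^bsub>Qbar\<^esub>u') = qbar t\<otimes>\<^bsub>Qbar\<^esub>qbar t" using uu GQ.h_ops(1) by simp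
   then have "u\<otimes>\<^bsub>Qbar\<^esub>u' = qbar t \<or> u\<otimes>\<^bsub>Qbar\<^esub>u' =\<ominus>\<^bsub>Qbar\<^esub>qbar t"
    using G.square_eq[of "u\<otimes>\<^bsub>Qbar\<^esub>u'" "qbar t"] u(1) u'(1) GQ.h_closed[of t] by simp
   then show "u\<otimes>\<^bsub>Qbar\<^esub>u'\<in>Q_in_Qbar" unfolding Q_in_Qbar_eq GQ.h_minus[symmetric] by blast
  qed
  finally show ?thesis .
 qed
 let ?f = "\<lambda>D. {G.kum (r (of_int (\<Prod>D)))}"
 have "bij_betw ?f {D\<in>sqf_sets. S (of_int (\<Prod>D))} {{G.kum u} | u q. u\<in>carrier Qbar & q ~= 0 & u\<otimes>\<^bsub>Qbar\<^esub>u = qbar q & S q}"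
  (is "bij_betw _ ?A ?B")
 proof (rule bij_betw_imageI)
  show "inj_on ?f ?A"
  proof (rule inj_onI)
   fix D D' assume D: "D \<in> ?A" "D' \<in> ?A" "?f D = ?f D'"
   have "\<exists>t. of_int (\<Prod>D) * of_int (\<Prod>D') = (t * t :: rat)"
    using D keq[OF r(1) _ r(2) r(1) _ r(2), of "of_int (\<Prod>D)" "of_int (\<Prod>D')"] nz[of D] nz[of D'] by (simp del: of_int_prod)
   then show "D = D'" using inj[of D D'] D(1,2) by (auto simp del: of_int_prod)
  qed
  show "?f ` ?A = ?B"
  proof
   show "?f ` ?A \<subseteq> ?B"
   proof
    fix \<xi> assume "\<xi> \<in> ?f ` ?A"
    then obtain D where D: "D\<in>sqf_sets" "S (of_int (\<Prod>D))" "\<xi> = ?f D" by blast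
    have "of_int (\<Prod>D) ~= (0::rat)" using nz[OF D(1)] by (simp del: of_int_prod)
    then show "\<xi> \<in> ?B" using D r by blast
   qed
   show "?B \<subseteq> ?f ` ?A"
   proof
    fix \<xi> assume "\<xi> \<in> ?B"
    then obtain u q where u: "u\<in>carrier Qbar" "q ~= 0" "u\<otimes>\<^bsub>Qbar\<^esub>u = qbar q" "S q" "\<xi> = {G.kum u}" by blast
    obtain D t where D: "D\<in>sqf_sets" "t ~= 0" "q = of_int (\<Prod>D) * (t * t)" using surj[OF u(2)] by blast
    have S: "S (of_int (\<Prod>D))" using u(4) inv[OF D(2)] D(3) by simp
    have e: "q * of_int (\<Prod>D) = (of_int (\<Prod>D) * t) * (of_int (\<Prod>D) * t)" using D(3) by (simp add: ac_simps)
    have "G.kum u = G.kum (r (of_int (\<Prod>D)))"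
     using keq[OF u(1-3) r(1) _ r(2), of "of_int (\<Prod>D)"] nz[OF D(1)] e by (auto simp del: of_int_prod)
    then show "\<xi> \<in> ?f ` ?A" using u(5) D(1) S by blast
   qed
  qed
 qed
 then show ?thesis by (simp add: bij_betw_same_card)
qed

end

lemma sqf_sets_prod:
 assumes D: "D\<in>sqf_sets"
 shows "\<Prod>D ~= 0" "prime p ==> multiplicity p (\<Prod>D) = (if p\<in>D then 1 else 0)"
  "\<Prod>D < 0 \<longleftrightarrow> - 1\<in>D"
proof -
 have fin: "finite D" and sub: "D \<subseteq> insert (- 1) {p. prime p}" using D by (auto simp: sqf_sets_def)
 have z: "0\<notin>D" using sub by auto
 then show nz: "\<Prod>D ~= 0" using fin by simp
 show "multiplicity p (\<Prod>D) = (if p\<in>D then 1 else 0)" if p: "prime p"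
 proof -
  have "multiplicity p (\<Prod>x\<in>D. x) = (\<Sum>x\<in>D. multiplicity p x)"
   by (rule prime_elem_multiplicity_prod_distrib) (use p z fin in auto)
  also have "\<dots> = (\<Sum>x\<in>D. if x = p then 1 else 0)"
  proof (rule sum.cong[OF refl])
   fix x assume "x\<in>D"
   then have "x = - 1 \<or> prime x" using sub by auto
   then show "multiplicity p x = (if x = p then 1 else 0)"
    using p prime_multiplicity_other[of p x] by (auto simp: multiplicity_unit_right)
  qed
  also have "\<dots> = (if p\<in>D then 1 else 0)" using fin by simp
  finally show ?thesis by simp
 qed
 have pos: "0 < \<Prod>(D - {- 1})" by (rule prod_pos) (use sub in "auto simp: prime_gt_0_int")
 show "\<Prod>D < 0 \<longleftrightarrow> - 1\<in>D"
 proof (cases "- 1\<in>D")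
  case True
  then have "\<Prod>D = - \<Prod>(D - {- 1})" using prod.remove[OF fin True, of "\<lambda>x. x"] by simp
  then show ?thesis using True pos by simp
 next
  case False
  then show ?thesis using pos by (simp add: not_less)
 qed
qed

lemma sqf_sets_inj:
 assumes D: "D\<in>sqf_sets" "D'\<in>sqf_sets" and t: "of_int (\<Prod>D * \<Prod>D') = (t * t :: rat)"
 shows "D = D'"
proof -
 obtain m n where mn: "t = of_int m / of_int n" "n ~= 0" by (metis quotient_of_div quotient_of_denom_pos surj_pair less_irrefl)
 have "(of_int (\<Prod>D * \<Prod>D' * (n * n)) :: rat) = of_int (m * m)" using t mn by (simp add: field_simps del: of_int_prod)
 then have e: "\<Prod>D * \<Prod>D' * (n * n) = m * m" by (simp only: of_int_eq_iff)
 note nz = sqf_sets_prod(1)[OF D(1)] sqf_sets_prod(1)[OF D(2)]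
 have m0: "m ~= 0" using e nz mn(2) by auto
 have "p\<in>D \<longleftrightarrow> p\<in>D'" if p: "prime p" for p
 proof -
  have pe: "prime_elem p" by (rule prime_imp_prime_elem[OF p])
  have "multiplicity p (\<Prod>D) + multiplicity p (\<Prod>D') + 2 * multiplicity p n = 2 * multiplicity p m"
   using arg_cong[OF e, of "multiplicity p"] nz mn(2) m0 by (simp add: prime_elem_multiplicity_mult_distrib[OF pe])
  then have "even (multiplicity p (\<Prod>D) + multiplicity p (\<Prod>D'))" by presburger
  then show ?thesis using sqf_sets_prod(2)[OF D(1) p] sqf_sets_prod(2)[OF D(2) p] by (auto split: if_splits)
 qed
 moreover have "- 1\<in>D \<longleftrightarrow> - 1\<in>D'"
 proof -
  have "\<Prod>D * \<Prod>D' * (n * n) > 0" unfolding e using m0 by (auto simp: zero_less_mult_iff linorder_neq_iff)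
  then have "\<Prod>D * \<Prod>D' > 0" using mn(2) by (auto simp: zero_less_mult_iff)
  then show ?thesis unfolding sqf_sets_prod(3)[OF D(1), symmetric] sqf_sets_prod(3)[OF D(2), symmetric] by (auto simp: zero_less_mult_iff)
 qed
 ultimately show ?thesis using D by (auto simp: sqf_sets_def)
qed

text \<open>The fraction a / b has the class of n = a b. Collecting the primes of odd exponent in n
  and its sign makes n times the product of the set a positive integer with even exponents, hence a
  square.\<close>

lemma sqf_sets_surj:
 assumes "(q::rat) ~= 0"
 shows "\<exists>D\<in>sqf_sets. \<exists>t. t ~= 0 & q = of_int (\<Prod>D) * (t * t)"
proof -
 obtain a b where ab: "q = of_int a / of_int b" "b ~= 0" by (metis quotient_of_div quotient_of_denom_pos surj_pair less_irrefl)
 define n where "n = a * b"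
 have a: "a ~= 0" using assms ab by auto
 then have n: "n ~= 0" using ab by (simp add: n_def)
 define D where "D = {p. prime p & odd (multiplicity p n)} \<union> (if n < 0 then {- 1} else {})"
 have "{p. prime p & odd (multiplicity p n)} \<subseteq> prime_factors n"
  using n by (auto simp: prime_factors_multiplicity intro!: Nat.gr0I)
 then have "finite {p. prime p & odd (multiplicity p n)}" by (rule finite_subset) simp
 then have D: "D\<in>sqf_sets" by (auto simp: sqf_sets_def D_def)
 have m1: "~ prime (- 1 :: int)" using prime_ge_0_int[of "- 1"] by auto
 have "is_nth_power 2 (normalize (n * \<Prod>D))"
 proof (subst is_nth_power_conv_multiplicity, simp, intro allI impI)
  fix p :: int assume p: "prime p"
  then have pe: "prime_elem p" by (rule prime_imp_prime_elem)
  have "multiplicity p (n * \<Prod>D) = multiplicity p n + (if p\<in>D then 1 else 0)"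
   using prime_elem_multiplicity_mult_distrib[OF pe n sqf_sets_prod(1)[OF D]] sqf_sets_prod(2)[OF D p] by simp
  then show "2 dvd multiplicity p (n * \<Prod>D)" using p m1 by (auto simp: D_def split: if_splits)
 qed
 then obtain k where k: "normalize (n * \<Prod>D) = k ^ 2" by (auto simp: is_nth_power_def)
 have "n * \<Prod>D > 0" using n sqf_sets_prod(1)[OF D] sqf_sets_prod(3)[OF D] m1
  by (auto simp: zero_less_mult_iff D_def not_less linorder_neq_iff split: if_splits)
 then have k': "n * \<Prod>D = k * k" using k by (simp add: power2_eq_square)
 have k0: "k ~= 0" using k' n sqf_sets_prod(1)[OF D] by auto
 define t :: rat where "t = of_int k / (of_int b * of_int (\<Prod>D))"
 have P: "(of_int (\<Prod>D) :: rat) ~= 0" using sqf_sets_prod(1)[OF D] by (simp del: of_int_prod)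
 have "(of_int (n * \<Prod>D) :: rat) = of_int (k * k)" using k' by simp
 then have kk: "(of_int k * of_int k :: rat) = of_int a * of_int b * of_int (\<Prod>D)" by (simp add: n_def del: of_int_prod)
 have "of_int (\<Prod>D) * (t * t) = of_int (\<Prod>D) * (of_int k * of_int k) / (of_int b * of_int b * (of_int (\<Prod>D) * of_int (\<Prod>D)))"
  by (simp add: t_def del: of_int_prod)
 also have "\<dots> = q" unfolding kk ab(1) using P ab(2) by (simp add: field_simps del: of_int_prod)
 finally have "q = of_int (\<Prod>D) * (t * t)" by simp
 moreover have "t ~= 0" using k0 ab(2) P by (simp add: t_def del: of_int_prod)
 ultimately show ?thesis using D by blast
qed

lemma locsol_times_square:
 assumes v: "v\<in>places" and c: "c ~= 0"
 shows "locsol v a b (q * (c * c)) \<longleftrightarrow> locsol v a b q"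
proof -
 interpret A: rat_abs "place_abs v" by (rule rat_abs_place[OF v])
 have imp: "locsol v a b q" if l: "locsol v a b (q * (c * c))" and c: "c ~= 0" for q c
 proof -
  obtain s where s: "cauchy v s" "~ null v s"
   and alt: "null v (\<lambda>n. (q * (c * c)) * (s n * s n) - 1) \<or> null v (\<lambda>n. (q * (c * c)) * (s n * s n) - of_int b) \<or>
   (\<exists>t. cauchy v t & null v (\<lambda>n. t n * t n -
     (q * (c * c)) * (s n * s n) * ((q * (c * c)) * (s n * s n) * ((q * (c * c)) * (s n * s n)) + of_int a * ((q * (c * c)) * (s n * s n)) + of_int b)))"
   using l unfolding locsol_def by blast
  have e: "q * ((c * s n) * (c * s n)) = (q * (c * c)) * (s n * s n)" for n by (simp add: ac_simps)
  have 1: "cauchy v (\<lambda>n. c * s n)" by (intro A.cauchy_mult A.cauchy_const s)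
  have "~ null v (\<lambda>n. c * s n)"
  proof
   assume "null v (\<lambda>n. c * s n)"
   from A.null_mult[OF this A.cauchy_const[of "1 / c"]] show False using s(2) c by simp
  qed
  then show ?thesis unfolding locsol_def using 1 alt by (intro exI[of _ "\<lambda>n. c * s n"]) (simp add: e)
 qed
 have "locsol v a b (q * (c * c))" if "locsol v a b q" by (rule imp[of _ "1 / c"]) (use that c in "simp_all add: field_simps")
 then show ?thesis using imp[OF _ c] by blast
qed

text \<open>Selmer group of the isogeny whose target is y^2 = x (x^2 + a x + b), as square classes.
  Hence \<open>sel A B\<close> belongs to the dual isogeny, whose target is the original
  curve.\<close>

definition sel :: "int => int => int set set" where
 "sel a b = {D\<in>sqf_sets. \<forall>v\<in>places. locsol v a b (of_int (\<Prod>D))}"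

theorem card_Sel:
 assumes "B ~= 0" "A\<^sup>2 - 4 * B ~= 0"
 shows "card (Sel_phi A B) = card (sel (- 2 * A) (A\<^sup>2 - 4 * B))"
  and "card (Sel_phi_dual A B) = card (sel A B)"
proof -
 interpret G: galois_closure Qbar Q_in_Qbar by (rule galois_closure_global)
 have c: "card {{G.kum u} | u q. u\<in>carrier Qbar & q ~= 0 & u\<otimes>\<^bsub>Qbar\<^esub>u = qbar q & (\<forall>v\<in>places. locsol v a b q)} = card (sel a b)" for a b
  unfolding sel_def by (rule card_selmer_group_aux[OF sqf_sets_inj sqf_sets_surj sqf_sets_prod(1)]) (auto simp: locsol_times_square)
 show "card (Sel_phi A B) = card (sel (- 2 * A) (A\<^sup>2 - 4 * B))" unfolding Sel_phi_def
  by (subst selmer_group_eq[OF G.two_isogeny_phi[OF assms] galois_closure.two_isogeny_phi[OF galois_closure_local assms]], assumption, rule c)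
 show "card (Sel_phi_dual A B) = card (sel A B)" unfolding Sel_phi_dual_def
  by (subst selmer_group_eq[OF G.two_isogeny_phi_dual[OF assms] galois_closure.two_isogeny_phi_dual[OF galois_closure_local assms]], assumption, rule c)
qed

section \<open>Closure of the soluble classes under multiplication\<close>

lemma (in cring) chord_identity_parts:
 assumes "x\<in>carrier R" "t\<in>carrier R" "m\<in>carrier R" "c\<in>carrier R" "A\<in>carrier R" "B\<in>carrier R" "w\<in>carrier R"
 shows "(m\<otimes>t\<oplus>c)\<otimes>(m\<otimes>t\<oplus>c)\<ominus>(m\<otimes>x\<oplus>c)\<otimes>(m\<otimes>x\<oplus>c)\<ominus>(t\<ominus>x)\<otimes>(m\<otimes>m\<otimes>(x\<oplus>t)\<oplus>\<two>\<otimes>m\<otimes>c) = \<zero>"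
  and "t\<otimes>(t\<otimes>t\<oplus>A\<otimes>t\<oplus>B)\<ominus>x\<otimes>(x\<otimes>x\<oplus>A\<otimes>x\<oplus>B)\<ominus>(t\<ominus>x)\<otimes>((x\<otimes>x\<oplus>x\<otimes>t\<oplus>t\<otimes>t)\<oplus>A\<otimes>(x\<oplus>t)\<oplus>B) = \<zero>"
  and "A\<otimes>(x\<oplus>w)\<ominus>A\<otimes>(x\<oplus>t)\<ominus>(w\<ominus>t)\<otimes>A = \<zero>"
  and "(x\<otimes>x\<oplus>x\<otimes>w\<oplus>w\<otimes>w)\<ominus>(x\<otimes>x\<oplus>x\<otimes>t\<oplus>t\<otimes>t)\<ominus>(w\<ominus>t)\<otimes>(x\<oplus>t\<oplus>w) = \<zero>"
  and "(m\<otimes>x\<oplus>c)\<otimes>(m\<otimes>x\<oplus>c)\<ominus>x\<otimes>(m\<otimes>m\<otimes>(x\<oplus>t)\<oplus>\<two>\<otimes>m\<otimes>c)\<ominus>(c\<otimes>c\<ominus>x\<otimes>t\<otimes>(m\<otimes>m)) = \<zero>"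
  and "x\<otimes>(x\<otimes>x\<oplus>A\<otimes>x\<oplus>B)\<ominus>x\<otimes>((x\<otimes>x\<oplus>x\<otimes>t\<oplus>t\<otimes>t)\<oplus>A\<otimes>(x\<oplus>t)\<oplus>B)\<oplus>x\<otimes>t\<otimes>(A\<oplus>x\<oplus>t) = \<zero>"
  and "x\<otimes>x\<oplus>x\<otimes>t\<oplus>t\<otimes>t\<ominus>(x\<oplus>t)\<otimes>(x\<oplus>t)\<oplus>x\<otimes>t = \<zero>"
 using assms by (Ring.algebra)+

lemma (in cring) regroup_differences:
 assumes "p\<in>carrier R" "q\<in>carrier R" "r\<in>carrier R" "s\<in>carrier R" "d\<in>carrier R" "u\<in>carrier R" "v\<in>carrier R"
  "a\<in>carrier R" "b\<in>carrier R" "e\<in>carrier R" "f\<in>carrier R" "g\<in>carrier R"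
 shows "p\<ominus>q\<ominus>(r\<ominus>s)\<ominus>d\<otimes>(u\<oplus>v\<ominus>a\<ominus>b\<ominus>e) = (p\<ominus>r\<ominus>d\<otimes>(u\<oplus>v))\<ominus>(q\<ominus>s\<ominus>d\<otimes>(a\<oplus>b\<oplus>e))"
  and "(p\<oplus>e\<ominus>q\<ominus>r\<ominus>f)\<ominus>(s\<oplus>e\<ominus>u\<ominus>v\<ominus>f)\<ominus>d\<otimes>(g\<ominus>a\<ominus>b) = (p\<ominus>s\<ominus>d\<otimes>g)\<ominus>(q\<ominus>u\<ominus>d\<otimes>b)\<ominus>(r\<ominus>v\<ominus>d\<otimes>a)"
  and "p\<ominus>s\<ominus>d\<otimes>(u\<oplus>v\<ominus>q\<ominus>r\<ominus>b)\<ominus>(a\<ominus>e\<otimes>(f\<ominus>g))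
   = (p\<ominus>d\<otimes>(u\<oplus>v)\<ominus>(a\<ominus>e\<otimes>f))\<ominus>(s\<ominus>d\<otimes>(q\<oplus>r\<oplus>b)\<oplus>e\<otimes>g)"
  and "(u\<otimes>s\<ominus>q\<ominus>a\<otimes>s\<ominus>b)\<ominus>(u\<ominus>a\<ominus>d)\<otimes>s\<ominus>(e\<ominus>b) =\<ominus>(q\<ominus>d\<otimes>s\<oplus>e)"
  and "p\<ominus>a\<ominus>b = p\<ominus>(a\<oplus>b)" using assms by (Ring.algebra)+

text \<open>Newton's divided differences of D(w) = (m w + c)^2 - w (w^2 + A w + B) at the nodes x
  and t: the first and second difference, the interpolation formula at w = 0 and, for c = 0, the
  value of the first difference.\<close>

lemma (in cring) chord_identities:
 assumes c: "x\<in>carrier R" "t\<in>carrier R" "m\<in>carrier R" "c\<in>carrier R" "A\<in>carrier R" "B\<in>carrier R" "w\<in>carrier R"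
 shows "(m\<otimes>t\<oplus>c)\<otimes>(m\<otimes>t\<oplus>c)\<ominus>t\<otimes>(t\<otimes>t\<oplus>A\<otimes>t\<oplus>B)
   \<ominus>((m\<otimes>x\<oplus>c)\<otimes>(m\<otimes>x\<oplus>c)\<ominus>x\<otimes>(x\<otimes>x\<oplus>A\<otimes>x\<oplus>B))
   \<ominus>(t\<ominus>x)\<otimes>(m\<otimes>m\<otimes>(x\<oplus>t)\<oplus>\<two>\<otimes>m\<otimes>c\<ominus>(x\<otimes>x\<oplus>x\<otimes>t\<oplus>t\<otimes>t)\<ominus>A\<otimes>(x\<oplus>t)\<ominus>B) = \<zero>" (is ?g0)
  and "(m\<otimes>m\<otimes>(x\<oplus>w)\<oplus>\<two>\<otimes>m\<otimes>c\<ominus>(x\<otimes>x\<oplus>x\<otimes>w\<oplus>w\<otimes>w)\<ominus>A\<otimes>(x\<oplus>w)\<ominus>B)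
   \<ominus>(m\<otimes>m\<otimes>(x\<oplus>t)\<oplus>\<two>\<otimes>m\<otimes>c\<ominus>(x\<otimes>x\<oplus>x\<otimes>t\<oplus>t\<otimes>t)\<ominus>A\<otimes>(x\<oplus>t)\<ominus>B)
   \<ominus>(w\<ominus>t)\<otimes>(m\<otimes>m\<ominus>A\<ominus>x\<ominus>t\<ominus>w) = \<zero>" (is ?g1)
  and "((m\<otimes>x\<oplus>c)\<otimes>(m\<otimes>x\<oplus>c)\<ominus>x\<otimes>(x\<otimes>x\<oplus>A\<otimes>x\<oplus>B))
   \<ominus>x\<otimes>(m\<otimes>m\<otimes>(x\<oplus>t)\<oplus>\<two>\<otimes>m\<otimes>c\<ominus>(x\<otimes>x\<oplus>x\<otimes>t\<oplus>t\<otimes>t)\<ominus>A\<otimes>(x\<oplus>t)\<ominus>B)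
   \<ominus>(c\<otimes>c\<ominus>x\<otimes>t\<otimes>(m\<otimes>m\<ominus>A\<ominus>x\<ominus>t)) = \<zero>" (is ?g2)
  and "(m\<otimes>m\<otimes>(x\<oplus>t)\<oplus>\<two>\<otimes>m\<otimes>\<zero>\<ominus>(x\<otimes>x\<oplus>x\<otimes>t\<oplus>t\<otimes>t)\<ominus>A\<otimes>(x\<oplus>t)\<ominus>B)
   \<ominus>(m\<otimes>m\<ominus>A\<ominus>x\<ominus>t)\<otimes>(x\<oplus>t)\<ominus>(x\<otimes>t\<ominus>B) = \<zero>" (is ?g3)
  and "m\<otimes>m\<ominus>A\<ominus>x\<ominus>t\<ominus>(m\<otimes>m\<ominus>A\<ominus>x\<ominus>t) = \<zero>" (is ?g4)
proof -
 note P = chord_identity_parts[OF c]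
 have sub: "y\<ominus>p\<ominus>q = y\<ominus>(p\<oplus>q)" if "y\<in>carrier R" "p\<in>carrier R" "q\<in>carrier R" for y p q
  using regroup_differences(5)[of y y y y y y y p q y y y] that by simp
 have mm: "m\<otimes>m\<in>carrier R" using c by simp
 have s2: "m\<otimes>m\<ominus>A\<ominus>x\<ominus>t = m\<otimes>m\<ominus>(A\<oplus>x\<oplus>t)" "m\<otimes>m\<ominus>A\<ominus>x\<ominus>t\<ominus>w = m\<otimes>m\<ominus>A\<ominus>(x\<oplus>t\<oplus>w)"
  "m\<otimes>m\<ominus>A\<ominus>x\<ominus>t = m\<otimes>m\<ominus>A\<ominus>(x\<oplus>t)"
  using c by (simp_all only: sub m_closed minus_closed a_closed a_assoc)
 show ?g0
  by (rule trans[OF regroup_differences(1)[where f=x and g=x]], (simp only: c m_closed a_closed minus_closed one_closed)+) (simp only: P, simp)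
 show ?g1 unfolding s2(2) by (rule trans[OF regroup_differences(2)], (simp only: c m_closed a_closed minus_closed one_closed)+)
   (simp only: P chord_identity_parts(3)[OF c(1-4) mm c(6,7)], simp)
 show ?g2
  unfolding s2(1) by (rule trans[OF regroup_differences(3)], (simp only: c m_closed a_closed minus_closed one_closed)+) (simp only: P, simp)
 have z: "m\<otimes>m\<otimes>(x\<oplus>t)\<oplus>\<two>\<otimes>m\<otimes>\<zero> = m\<otimes>m\<otimes>(x\<oplus>t)" using c by simp
 show ?g3
  unfolding s2(3) z by (rule trans[OF regroup_differences(4)[where p=x and r=x and v=x and f=x and g=x]], (simp only: c m_closed a_closed minus_closed one_closed)+) (simp only: P, simp)
 show ?g4 using c by (simp add: a_minus_def r_neg)
qed

context field
begin

text \<open>Here r is the third intersection of the line y = m x + c with the curve. The constant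
  term of the cubic gives c^2 = x t r, so the three first coordinates multiply to a square. If r =
  0, the line passes through (0,0) and the other two multiply to B.\<close>

lemma third_point:
 assumes c: "x\<in>carrier R" "t\<in>carrier R" "m\<in>carrier R" "c\<in>carrier R" "A\<in>carrier R" "B\<in>carrier R"
  and xt: "x ~= t"
  and px: "(m\<otimes>x\<oplus>c)\<otimes>(m\<otimes>x\<oplus>c) = x\<otimes>(x\<otimes>x\<oplus>A\<otimes>x\<oplus>B)"
  and pt: "(m\<otimes>t\<oplus>c)\<otimes>(m\<otimes>t\<oplus>c) = t\<otimes>(t\<otimes>t\<oplus>A\<otimes>t\<oplus>B)"
 defines "r \<equiv> m\<otimes>m\<ominus>A\<ominus>x\<ominus>t"
 shows "c\<otimes>c = x\<otimes>t\<otimes>r" "(m\<otimes>r\<oplus>c)\<otimes>(m\<otimes>r\<oplus>c) = r\<otimes>(r\<otimes>r\<oplus>A\<otimes>r\<oplus>B)"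
  "r = \<zero> ==> x\<otimes>t = B"
proof -
 define k where "k w = m\<otimes>m\<otimes>(x\<oplus>w)\<oplus>\<two>\<otimes>m\<otimes>c\<ominus>(x\<otimes>x\<oplus>x\<otimes>w\<oplus>w\<otimes>w)\<ominus>A\<otimes>(x\<oplus>w)\<ominus>B" for w
 define D where "D w = (m\<otimes>w\<oplus>c)\<otimes>(m\<otimes>w\<oplus>c)\<ominus>w\<otimes>(w\<otimes>w\<oplus>A\<otimes>w\<oplus>B)" for w
 have kc: "k w\<in>carrier R" "D w\<in>carrier R" if "w\<in>carrier R" for w using that c by (simp_all add: k_def D_def)
 have rc: "r\<in>carrier R" using c by (simp add: r_def)
 have D0: "D x = \<zero>" "D t = \<zero>" using px pt c by (simp_all add: D_def a_minus_def r_neg)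
 have i1: "D w\<ominus>D x\<ominus>(w\<ominus>x)\<otimes>k w = \<zero>" if "w\<in>carrier R" for w
  unfolding D_def k_def by (rule chord_identities(1)[OF c(1) that c(3-6) c(1)])
 have i2: "k r\<ominus>k t\<ominus>(r\<ominus>t)\<otimes>(m\<otimes>m\<ominus>A\<ominus>x\<ominus>t\<ominus>r) = \<zero>"
  unfolding k_def by (rule chord_identities(2)[OF c(1-6) rc])
 have i3: "D x\<ominus>x\<otimes>k t\<ominus>(c\<otimes>c\<ominus>x\<otimes>t\<otimes>r) = \<zero>"
  unfolding D_def k_def r_def by (rule chord_identities(3)[OF c(1-6) c(1)])
 have "(t\<ominus>x)\<otimes>k t = \<zero>" using i1[OF c(2)] D0 kc[OF c(2)] c by (simp add: a_minus_def)
 moreover have "t\<ominus>x ~= \<zero>" using xt c by auto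
 ultimately have kt: "k t = \<zero>" using integral[of "t\<ominus>x" "k t"] kc[OF c(2)] c by auto
 show cc: "c\<otimes>c = x\<otimes>t\<otimes>r"
  using i3 D0 kt c rc by (simp add: a_minus_def) (metis a_minus_def m_closed minus_minus minus_zero r_right_minus_eq a_inv_closed a_closed)
 have "m\<otimes>m\<ominus>A\<ominus>x\<ominus>t\<ominus>r = \<zero>" unfolding r_def by (rule chord_identities(5)[OF c(1-6) c(1)])
 then have kr: "k r = \<zero>" using i2 kt kc[OF rc] rc c by (simp add: a_minus_def)
 have "D r = \<zero>" using i1[OF rc] D0 kr kc[OF rc] rc c by (simp add: a_minus_def)
 then show "(m\<otimes>r\<oplus>c)\<otimes>(m\<otimes>r\<oplus>c) = r\<otimes>(r\<otimes>r\<oplus>A\<otimes>r\<oplus>B)"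
  using rc c r_right_minus_eq by (simp add: D_def)
 assume r0: "r = \<zero>"
 have "c\<otimes>c = \<zero>" using cc r0 c by simp
 then have c0: "c = \<zero>" using integral[of c c] c by blast
 have "k t\<ominus>r\<otimes>(x\<oplus>t)\<ominus>(x\<otimes>t\<ominus>B) = \<zero>"
  unfolding k_def r_def c0 by (rule chord_identities(4)[OF c(1-6) c(1)])
 then have "x\<otimes>t\<ominus>B = \<zero>" unfolding kt r0 using c by (simp add: a_minus_def)
 then show "x\<otimes>t = B" using c r_right_minus_eq by simp
qed

text \<open>The condition \<open>locsol\<close> read over an arbitrary field, so that the chord
  construction can be carried out algebraically.\<close>

definition soluble where
 "soluble A B d \<longleftrightarrow> (\<exists>z\<in>carrier R. z ~= \<zero> & (d\<otimes>(z\<otimes>z) = \<one> \<or> d\<otimes>(z\<otimes>z) = B \<or>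
   (\<exists>y\<in>carrier R. y\<otimes>y = (d\<otimes>(z\<otimes>z))\<otimes>((d\<otimes>(z\<otimes>z))\<otimes>(d\<otimes>(z\<otimes>z))\<oplus>A\<otimes>(d\<otimes>(z\<otimes>z))\<oplus>B))))"

lemma solubleI:
 assumes "z\<in>carrier R" "z ~= \<zero>" "d\<otimes>(z\<otimes>z) = e"
  "e = \<one> \<or> e = B \<or> (\<exists>y\<in>carrier R. y\<otimes>y = e\<otimes>(e\<otimes>e\<oplus>A\<otimes>e\<oplus>B))"
 shows "soluble A B d" unfolding soluble_def using assms by blast

text \<open>First coordinates multiply along chords modulo squares: the third point on the chord
  through points over e and e' has the class of e e'. The class 1 of O is neutral, equal first
  coordinates multiply to a square, and adding (0,0) replaces t by B / t, which has the class of B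
  t.\<close>

lemma soluble_mult:
 assumes c: "A\<in>carrier R" "B\<in>carrier R" "B ~= \<zero>" "d\<in>carrier R" "d'\<in>carrier R" "d ~= \<zero>" "d' ~= \<zero>"
  and s: "soluble A B d" "soluble A B d'"
 shows "soluble A B (d\<otimes>d')"
proof -
 let ?F = "\<lambda>e. e\<otimes>(e\<otimes>e\<oplus>A\<otimes>e\<oplus>B)"
 obtain z where z: "z\<in>carrier R" "z ~= \<zero>" "d\<otimes>(z\<otimes>z) = \<one> \<or> d\<otimes>(z\<otimes>z) = B \<or> (\<exists>y\<in>carrier R. y\<otimes>y = ?F (d\<otimes>(z\<otimes>z)))"
  using s(1) unfolding soluble_def by blast
 obtain z' where z': "z'\<in>carrier R" "z' ~= \<zero>" "d'\<otimes>(z'\<otimes>z') = \<one> \<or> d'\<otimes>(z'\<otimes>z') = B \<or> (\<exists>y\<in>carrier R. y\<otimes>y = ?F (d'\<otimes>(z'\<otimes>z')))"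
  using s(2) unfolding soluble_def by blast
 define e where "e = d\<otimes>(z\<otimes>z)"
 define e' where "e' = d'\<otimes>(z'\<otimes>z')"
 have ec: "e\<in>carrier R" "e'\<in>carrier R" "e ~= \<zero>" "e' ~= \<zero>" using c z z' by (simp_all add: e_def e'_def integral_iff)
 have prod: "(d\<otimes>d')\<otimes>((z\<otimes>z'\<otimes>w)\<otimes>(z\<otimes>z'\<otimes>w)) = (e\<otimes>e')\<otimes>(w\<otimes>w)" if "w\<in>carrier R" for w
  unfolding e_def e'_def using that c z(1) z'(1) by (simp add: m_ac)
 have fin: "soluble A B (d\<otimes>d')"
  if w: "w\<in>carrier R" "w ~= \<zero>" "(e\<otimes>e')\<otimes>(w\<otimes>w) = f" "f = \<one> \<or> f = B \<or> (\<exists>y\<in>carrier R. y\<otimes>y = ?F f)" for w f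
  by (rule solubleI[of "z\<otimes>z'\<otimes>w" _ f]) (use w z z' prod[OF w(1)] in "simp_all add: integral_iff")
 have ie: "inv e\<in>carrier R" "inv e ~= \<zero>" "e\<otimes>inv e = \<one>" if "e\<in>carrier R" "e ~= \<zero>" for e
 proof -
  show 1: "inv e\<in>carrier R" "e\<otimes>inv e = \<one>" using that by (simp_all add: field_Units)
  show "inv e ~= \<zero>"
  proof
   assume "inv e = \<zero>"
   then have "e\<otimes>\<zero> = \<one>" using 1(2) by simp
   then show False using that(1) by simp
  qed
 qed
 \<comment> \<open>Translation by (0,0): from (t, y) to the first coordinate B / t, with second
   coordinate B y / t^2 up to sign.\<close>
 have half: "soluble A B (d\<otimes>d')" if h: "x = B" "(\<exists>y\<in>carrier R. y\<otimes>y = ?F t)" "x\<otimes>t = e\<otimes>e'" "t\<in>carrier R" "t ~= \<zero>" for x t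
 proof -
  obtain y where y: "y\<in>carrier R" "y\<otimes>y = ?F t" using h(2) by blast
  define i where "i = inv t"
  have i: "i\<in>carrier R" "i ~= \<zero>" "t\<otimes>i = \<one>" using ie[OF h(4,5)] by (simp_all add: i_def)
  have r1: "(B\<otimes>t)\<otimes>(i\<otimes>i) = (B\<otimes>i)\<otimes>(t\<otimes>i)" using c i(1) h(4) by (simp add: m_ac)
  have 1: "(e\<otimes>e')\<otimes>(i\<otimes>i) = B\<otimes>i" unfolding h(3)[symmetric] h(1) r1 i(3) using c i by simp
  have "(B\<otimes>y\<otimes>(i\<otimes>i))\<otimes>(B\<otimes>y\<otimes>(i\<otimes>i)) = (B\<otimes>B\<otimes>(i\<otimes>i)\<otimes>(i\<otimes>i))\<otimes>(y\<otimes>y)"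
   using c y(1) i by (simp add: m_ac)
  also have "\<dots> = (B\<otimes>B\<otimes>i)\<otimes>((t\<otimes>i)\<otimes>((t\<otimes>i)\<otimes>(t\<otimes>i)\<oplus>A\<otimes>i\<otimes>(t\<otimes>i)\<oplus>B\<otimes>(i\<otimes>i)))"
   unfolding y(2) using c i(1) h(4) by (simp add: r_distr m_ac)
  also have "\<dots> = ?F (B\<otimes>i)" unfolding i(3) using c i(1) by (simp add: r_distr m_ac a_ac)
  finally have 2: "(B\<otimes>y\<otimes>(i\<otimes>i))\<otimes>(B\<otimes>y\<otimes>(i\<otimes>i)) = ?F (B\<otimes>i)" .
  show ?thesis by (rule fin[OF i(1,2) 1]) (use 2 c y(1) i(1) in "auto intro!: disjI2")
 qed
 consider "e = \<one>" | "e' = \<one>" | "e = B" "e' = B" | "e = B" "\<exists>y\<in>carrier R. y\<otimes>y = ?F e'"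
  | "e' = B" "\<exists>y\<in>carrier R. y\<otimes>y = ?F e" | "\<exists>y\<in>carrier R. y\<otimes>y = ?F e" "\<exists>y\<in>carrier R. y\<otimes>y = ?F e'"
  using z(3) z'(3) unfolding e_def[symmetric] e'_def[symmetric] by blast
 then show ?thesis
 proof cases
  case 1
  then show ?thesis using fin[of \<one> e'] z'(3) ec unfolding e'_def[symmetric] by simp
 next
  case 2
  then show ?thesis using fin[of \<one> e] z(3) ec unfolding e_def[symmetric] by simp
 next
  case 3
  define i where "i = inv B"
  have i: "i\<in>carrier R" "i ~= \<zero>" "B\<otimes>i = \<one>" using ie[OF c(2,3)] by (simp_all add: i_def)
  have "(B\<otimes>B)\<otimes>(i\<otimes>i) = (B\<otimes>i)\<otimes>(B\<otimes>i)" using c i by (simp add: m_ac)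
  then show ?thesis using fin[OF i(1,2), of \<one>] 3 i(3) by simp
 next
  case 4
  then show ?thesis using half[of e e'] ec by simp
 next
  case 5
  then show ?thesis using half[of e' e] ec m_comm by simp
 next
  case 6
  then obtain y y' where y: "y\<in>carrier R" "y\<otimes>y = ?F e" "y'\<in>carrier R" "y'\<otimes>y' = ?F e'" by blast
  show ?thesis
  proof (cases "e = e'")
   case True
   define i where "i = inv e"
   have i: "i\<in>carrier R" "i ~= \<zero>" "e\<otimes>i = \<one>" using ie[OF ec(1,3)] by (simp_all add: i_def)
   have "(e\<otimes>e)\<otimes>(i\<otimes>i) = (e\<otimes>i)\<otimes>(e\<otimes>i)" using ec i by (simp add: m_ac)
   then show ?thesis using fin[OF i(1,2), of \<one>] True i(3) by simp
  next
   case False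
   define g where "g = inv (e'\<ominus>e)"
   have ne: "e'\<ominus>e ~= \<zero>" using False ec by auto
   have g: "g\<in>carrier R" "(e'\<ominus>e)\<otimes>g = \<one>" using ie[OF _ ne] ec by (simp_all add: g_def)
   define m where "m = (y'\<ominus>y)\<otimes>g"
   define k where "k = y\<ominus>m\<otimes>e"
   have mk: "m\<in>carrier R" "k\<in>carrier R" using y g ec by (simp_all add: m_def k_def)
   have me: "m\<otimes>e\<oplus>k = y" using mk ec y by (simp add: k_def a_minus_def a_lcomm[of "m\<otimes>e"] r_neg)
   have "m\<otimes>(e'\<ominus>e) = (y'\<ominus>y)\<otimes>((e'\<ominus>e)\<otimes>g)" unfolding m_def using y g(1) ec by (simp add: m_ac)
   then have me2: "m\<otimes>(e'\<ominus>e) = y'\<ominus>y" using g(2) y by simp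
   have "m\<otimes>e'\<oplus>k = m\<otimes>(e'\<ominus>e)\<oplus>(m\<otimes>e\<oplus>k)"
    using mk ec by (simp add: a_minus_def r_distr r_minus a_assoc) (simp add: r_neg1)
   also have "\<dots> = y'" unfolding me me2 using y by (simp add: a_minus_def a_assoc l_neg)
   finally have me': "m\<otimes>e'\<oplus>k = y'" .
   note tp = third_point[OF ec(1,2) mk c(1,2) False, unfolded me me', OF y(2,4)]
   define r where "r = m\<otimes>m\<ominus>A\<ominus>e\<ominus>e'"
   have rc: "r\<in>carrier R" using mk c ec by (simp add: r_def)
   show ?thesis
   proof (cases "r = \<zero>")
    case True
    then have "e\<otimes>e' = B" using tp(3) by (simp add: r_def)
    then show ?thesis using fin[of \<one> B] c by simp
   next
    case r0: False
    have kk: "k\<otimes>k = e\<otimes>e'\<otimes>r" using tp(1) by (simp add: r_def)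
    have k0: "k ~= \<zero>"
    proof
     assume "k = \<zero>" then have "e\<otimes>e'\<otimes>r = \<zero>" using kk by simp
     then show False using ec rc r0 by (simp add: integral_iff)
    qed
    \<comment> \<open>Since k^2 = e e' r, multiplying e e' by the square of k / (e e') gives
      r.\<close>
    define i where "i = inv (e\<otimes>e')"
    have ee: "e\<otimes>e'\<in>carrier R" "e\<otimes>e' ~= \<zero>" using ec by (simp_all add: integral_iff)
    have i: "i\<in>carrier R" "i ~= \<zero>" "(e\<otimes>e')\<otimes>i = \<one>" using ie[OF ee] by (simp_all add: i_def)
    have "(e\<otimes>e')\<otimes>((k\<otimes>i)\<otimes>(k\<otimes>i)) = ((e\<otimes>e')\<otimes>i)\<otimes>(i\<otimes>(k\<otimes>k))"
     using ee(1) i(1) mk(2) by (simp only: m_ac m_closed)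
    also have "\<dots> = ((e\<otimes>e')\<otimes>i)\<otimes>(((e\<otimes>e')\<otimes>i)\<otimes>r)" unfolding kk using ee(1) i(1) rc by (simp only: m_ac m_closed)
    also have "\<dots> = r" unfolding i(3) using rc by simp
    finally have 1: "(e\<otimes>e')\<otimes>((k\<otimes>i)\<otimes>(k\<otimes>i)) = r" .
    show ?thesis
     by (rule fin[OF _ _ 1]) (use tp(2) i mk k0 rc in \<open>auto simp: integral_iff r_def[symmetric] intro!: disjI2 bexI[of _ "m\<otimes>r\<oplus>k"]\<close>)
   qed
  qed
 qed
qed

end

text \<open>\<open>soluble_mult\<close> applied to the completion, viewed as a subfield of its
  algebraic closure; the rest is the dictionary between elements and Cauchy sequences.\<close>

lemma locsol_mult:
 assumes v: "v\<in>places" and ab: "b ~= 0" "a\<^sup>2 - 4 * b ~= 0" and q: "q ~= 0" "q' ~= 0"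
  and l: "locsol v a b q" "locsol v a b q'"
 shows "locsol v a b (q * q')"
proof -
 interpret V: galois_closure "Qvbar v" "Qv_in_Qvbar v" by (rule galois_closure_local[OF v])
 have ti: "two_isogeny (Qvbar v) (Qv_in_Qvbar v) (- 2 * a) (a\<^sup>2 - 4 * b) a b (\<one>\<^bsub>Qvbar v\<^esub>\<oplus>\<^bsub>Qvbar v\<^esub>\<one>\<^bsub>Qvbar v\<^esub>) (field.phi_dual (Qvbar v) a b)"
  by (rule V.two_isogeny_phi_dual[OF ab])
 interpret I: two_isogeny "Qvbar v" "Qv_in_Qvbar v" "- 2 * a" "a\<^sup>2 - 4 * b" a b "\<one>\<^bsub>Qvbar v\<^esub>\<oplus>\<^bsub>Qvbar v\<^esub>\<one>\<^bsub>Qvbar v\<^esub>" "field.phi_dual (Qvbar v) a b"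
  by (rule ti)
 interpret A: rat_abs "place_abs v" by (rule rat_abs_place[OF v])
 interpret R: rational_hom "Qvbar v" "\<lambda>q. cauchy_point v (\<lambda>n. q)" by (rule rational_hom_local[OF v])
 interpret K: field "Qvbar v\<lparr>carrier := Qv_in_Qvbar v\<rparr>" by (rule V.subfield_iff(2)[OF V.subfield_axioms])
 let ?Q = "\<lambda>q. cauchy_point v (\<lambda>n. q)"
 have tr: "K.soluble I.al' I.be' (?Q q) \<longleftrightarrow> locsol v a b q" for q
 proof -
  have e: "?Q q\<otimes>\<^bsub>Qvbar v\<^esub>(cauchy_point v s\<otimes>\<^bsub>Qvbar v\<^esub>cauchy_point v s) = cauchy_point v (\<lambda>n. q * (s n * s n))"
    "cauchy v (\<lambda>n. q * (s n * s n))" if "cauchy v s" for s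
   using that by (simp_all add: cauchy_point_ops[OF v] A.cauchy_mult A.cauchy_const)
  have "K.soluble I.al' I.be' (?Q q) \<longleftrightarrow> (\<exists>z\<in>Qv_in_Qvbar v. z ~= \<zero>\<^bsub>Qvbar v\<^esub> & I.cls (?Q q\<otimes>\<^bsub>Qvbar v\<^esub>(z\<otimes>\<^bsub>Qvbar v\<^esub>z)))"
   unfolding K.soluble_def I.cls_def by simp
  also have "\<dots> \<longleftrightarrow>
    (\<exists>s. cauchy v s & cauchy_point v s ~= \<zero>\<^bsub>Qvbar v\<^esub> & I.cls (?Q q\<otimes>\<^bsub>Qvbar v\<^esub>(cauchy_point v s\<otimes>\<^bsub>Qvbar v\<^esub>cauchy_point v s)))"
   unfolding cauchy_point_range[OF v] by blast
  also have "\<dots> \<longleftrightarrow> locsol v a b q" unfolding locsol_def by (rule ex_cong1, intro conj_cong refl)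
    (simp_all only: cauchy_point_zero_iff[OF v] e(1) cls_rational[OF v ti e(2)])
  finally show ?thesis .
 qed
 have nz: "?Q q ~= \<zero>\<^bsub>Qvbar v\<^esub>" if "q ~= 0" for q using R.h_inj[of q 0] that R.h_ops(4) by simp
 have "K.soluble I.al' I.be' (?Q q \<otimes>\<^bsub>Qvbar v\<lparr>carrier := Qv_in_Qvbar v\<rparr>\<^esub> ?Q q')"
  by (rule K.soluble_mult) (use I.int_K I.b(2) qv_in[OF v] nz[OF q(1)] nz[OF q(2)] l tr in simp_all)
 then show ?thesis using tr[of "q * q'"] R.h_ops(1)[of q q'] by simp
qed

section \<open>Hensel lifting and square roots in the completions\<close>

lemma poly_taylor: "\<exists>c. poly f (x + h) = poly f x + poly (pderiv f) x * h + c * h ^ 2" for f :: "int poly"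
proof (induction f)
 case (pCons a f)
 then obtain c where c: "poly f (x + h) = poly f x + poly (pderiv f) x * h + c * h ^ 2" by blast
 have "poly (pCons a f) (x + h) = a + (x + h) * poly f (x + h)" by simp
 also have "\<dots> = poly (pCons a f) x + poly (pderiv (pCons a f)) x * h + (x * c + poly (pderiv f) x + c * h) * h ^ 2"
  unfolding c by (simp add: pderiv_pCons algebra_simps power2_eq_square power3_eq_cube)
 finally have "poly (pCons a f) (x + h) = poly (pCons a f) x + poly (pderiv (pCons a f)) x * h + (x * c + poly (pderiv f) x + c * h) * h ^ 2" .
 then show ?case by blast
qed simp

lemma poly_diff_dvd: "(x - y) dvd (poly f x - poly f y)" for f :: "int poly"
proof (induction f)
 case (pCons a f)
 have "poly (pCons a f) x - poly (pCons a f) y = x * (poly f x - poly f y) + (x - y) * poly f y" by (simp add: algebra_simps)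
 then show ?case using pCons by simp
qed simp

lemma hensel_step:
 fixes f :: "int poly"
 assumes p: "prime p" and x: "p ^ Suc n dvd poly f x" "~ p dvd poly (pderiv f) x"
 shows "\<exists>y. p ^ Suc (Suc n) dvd poly f y & p ^ Suc n dvd y - x"
proof -
 obtain k where k: "poly f x = p ^ Suc n * k" using x(1) by (elim dvdE)
 have "coprime (poly (pderiv f) x) p" using p x(2) by (simp add: prime_imp_coprime coprime_commute)
 then obtain t where t: "[poly (pderiv f) x * t = - k] (mod p)"
  using cong_solve_coprime_int[of "poly (pderiv f) x" p] cong_scalar_right[of _ 1 p "- k"]
  by (metis (no_types, opaque_lifting) cong_scalar_right mult.assoc mult_1)
 obtain c where c: "poly f (x + p ^ Suc n * t) = poly f x + poly (pderiv f) x * (p ^ Suc n * t) + c * (p ^ Suc n * t) ^ 2"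
  using poly_taylor by blast
 have "p dvd k + poly (pderiv f) x * t" using t by (simp add: cong_iff_dvd_diff) (metis add.commute)
 then have "p ^ Suc n * p dvd p ^ Suc n * (k + poly (pderiv f) x * t)" by (rule mult_dvd_mono[OF dvd_refl])
 moreover have "p ^ Suc n * p dvd c * (p ^ Suc n * t) ^ 2" by (simp add: power2_eq_square) 
 ultimately have "p ^ Suc n * p dvd poly f (x + p ^ Suc n * t)"
  unfolding c k by (simp only: distrib_left mult.left_commute[of "poly (pderiv f) x"] mult.assoc dvd_add)
 then show ?thesis by (intro exI[of _ "x + p ^ Suc n * t"]) (simp add: mult.commute)
qed

text \<open>The approximations are kept as a sequence whose consecutive terms agree modulo p^(n+1),
  the form in which \<open>padic_cauchy\<close> recognises a p-adic number.\<close>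

lemma hensel:
 fixes f :: "int poly"
 assumes p: "prime p" and x0: "p dvd poly f x0" "~ p dvd poly (pderiv f) x0"
 shows "\<exists>x::nat => int. x 0 = x0 & (\<forall>n. p ^ Suc n dvd poly f (x n) & p ^ Suc n dvd x (Suc n) - x n)"
proof -
 define Q where "Q n x \<longleftrightarrow> p ^ Suc n dvd poly f x & ~ p dvd poly (pderiv f) x & (n = 0 --> x = x0)" for n x
 have "\<exists>x. \<forall>n. Q n (x n) & p ^ Suc n dvd x (Suc n) - x n"
 proof (rule dependent_nat_choice)
  show "\<exists>x. Q 0 x" using x0 by (auto simp: Q_def)
  fix x n assume "Q n x"
  then have x: "p ^ Suc n dvd poly f x" "~ p dvd poly (pderiv f) x" by (auto simp: Q_def)
  obtain y where y: "p ^ Suc (Suc n) dvd poly f y" "p ^ Suc n dvd y - x" using hensel_step[OF p x] by blast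
  have "p dvd y - x" using y(2) dvd_trans[of p "p ^ Suc n"] by simp
  then have "p dvd poly (pderiv f) y - poly (pderiv f) x" using poly_diff_dvd dvd_trans by blast
  then have "~ p dvd poly (pderiv f) y" using x(2) by (metis dvd_diff_commute dvd_diff_right_iff diff_add_cancel dvd_add_right_iff)
  then show "\<exists>y. Q (Suc n) y & p ^ Suc n dvd y - x" using y by (auto simp: Q_def)
 qed
 then show ?thesis by (auto simp: Q_def)
qed

abbreviation padic :: "nat => rat => rat" where "padic p \<equiv> place_abs (Finite_Place p)"

context
 fixes p :: nat assumes p: "prime p"
begin

lemma place: "Finite_Place p\<in>places" using p by (simp add: places_def)

interpretation A: rat_abs "padic p" by (rule rat_abs_place[OF place])

lemma padic_int: "z ~= 0 ==> padic p (of_int z) = 1 / of_nat p ^ multiplicity (int p) z"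
 using rat_ord_fraction[OF p, of z 1] by (simp add: power_int_minus inverse_eq_divide)

lemma padic_int_le_iff: "padic p (of_int z) <= 1 / of_nat p ^ k \<longleftrightarrow> int p ^ k dvd z"
proof (cases "z = 0")
 case False
 have p1: "(1::rat) < of_nat p" using prime_gt_1_nat[OF p] by simp
 have "padic p (of_int z) <= 1 / of_nat p ^ k \<longleftrightarrow> (of_nat p :: rat) ^ k <= of_nat p ^ multiplicity (int p) z"
  unfolding padic_int[OF False] using p1 by (simp add: field_simps)
 also have "\<dots> \<longleftrightarrow> k <= multiplicity (int p) z" using p1 by (simp add: power_increasing_iff)
 also have "\<dots> \<longleftrightarrow> int p ^ k dvd z"
  using False p prime_gt_1_nat[OF p] by (intro power_dvd_iff_le_multiplicity[symmetric]) auto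
 finally show ?thesis .
qed simp

lemma padic_int_le_1: "padic p (of_int z) <= 1" using padic_int_le_iff[of z 0] by simp

lemma pow_small: assumes "(e::rat) > 0" shows "\<exists>k. 1 / of_nat p ^ k < e"
proof -
 obtain k where k: "1 / e < of_nat k" using reals_Archimedean2 by blast
 have "k < p ^ k" using prime_gt_1_nat[OF p] by (simp add: less_exp power_gt_expt)
 then have "(of_nat k :: rat) < of_nat (p ^ k)" by (simp only: of_nat_less_iff)
 then have "1 / e < of_nat p ^ k" using k unfolding of_nat_power by (rule less_trans[rotated])
 moreover have "(0::rat) < of_nat p ^ k" using prime_gt_0_nat[OF p] by simp
 ultimately show ?thesis using assms by (intro exI[of _ k]) (simp add: field_simps)
qed

lemma padic_null:
 assumes "\<And>n. int p ^ Suc n dvd z n" shows "null_for (padic p) (\<lambda>n. of_int (z n))" unfolding null_for_def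
proof (intro allI impI)
 fix e :: rat assume "e > 0"
 then obtain k where k: "1 / of_nat p ^ k < e" using pow_small by blast
 have "padic p (of_int (z n)) < e" if "n >= k" for n
 proof -
  have "int p ^ k dvd int p ^ Suc n" using that by (intro le_imp_power_dvd) simp
  then have "int p ^ k dvd z n" using assms[of n] by (rule dvd_trans)
  then have "padic p (of_int (z n)) <= 1 / of_nat p ^ k" by (simp only: padic_int_le_iff)
  then show ?thesis using k by (rule le_less_trans)
 qed
 then show "\<exists>N. \<forall>n\<ge>N. padic p (of_int (z n)) < e" by blast
qed

lemma padic_cauchy:
 assumes "\<And>n. int p ^ Suc n dvd x (Suc n) - x n" shows "cauchy_for (padic p) (\<lambda>n. of_int (x n))" unfolding cauchy_for_def
proof (intro allI impI)
 fix e :: rat assume "e > 0"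
 then obtain k where k: "1 / of_nat p ^ k < e" using pow_small by blast
 have d: "int p ^ k dvd x (k + i) - x k" for i
 proof (induction i)
  case (Suc i)
  have "int p ^ k dvd int p ^ Suc (k + i)" by (rule le_imp_power_dvd) simp
  then have "int p ^ k dvd x (Suc (k + i)) - x (k + i)" using assms dvd_trans by blast
  then show ?case using dvd_add[OF _ Suc] by fastforce
 qed simp
 have "padic p (of_int (x m) - of_int (x n)) < e" if "m >= k" "n >= k" for m n
 proof -
  have "int p ^ k dvd (x m - x k) - (x n - x k)" using dvd_diff[OF d[of "m - k"] d[of "n - k"]] that by (simp only: le_add_diff_inverse)
  moreover have "x m - x k - (x n - x k) = x m - x n" by simp
  ultimately have "int p ^ k dvd x m - x n" by (simp only:)
  then have "padic p (of_int (x m - x n)) <= 1 / of_nat p ^ k" by (simp only: padic_int_le_iff)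
  then show ?thesis using k unfolding of_int_diff by (rule le_less_trans)
 qed
 then show "\<exists>N. \<forall>m\<ge>N. \<forall>n\<ge>N. padic p (of_int (x m) - of_int (x n)) < e" by blast
qed

lemma hensel_padic:
 fixes f :: "int poly"
 assumes "int p dvd poly f x0" "~ int p dvd poly (pderiv f) x0"
 shows "\<exists>x::nat => int. cauchy_for (padic p) (\<lambda>n. of_int (x n)) & null_for (padic p) (\<lambda>n. of_int (poly f (x n))) \<and>
  (\<forall>n. int p dvd x n - x0)"
proof -
 have p': "prime (int p)" using p by simp
 obtain x where x: "x 0 = x0" "\<And>n. int p ^ Suc n dvd poly f (x n)" "\<And>n. int p ^ Suc n dvd x (Suc n) - x n"
  using hensel[OF p' assms] by blast
 have "int p dvd x n - x0" for n
 proof (induction n)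
  case (Suc n)
  have "int p dvd x (Suc n) - x n" using x(3)[of n] dvd_trans[of "int p" "int p ^ Suc n"] by simp
  then show ?case using dvd_add[OF _ Suc] by fastforce
 qed (simp add: x)
 then show ?thesis using padic_cauchy[OF x(3)] padic_null[OF x(2)] by blast
qed

lemma padic_sqrt_odd:
 assumes "odd p" "~ int p dvd u" "int p dvd t * t - u"
 shows "\<exists>x. cauchy_for (padic p) x & null_for (padic p) (\<lambda>n. x n * x n - of_int u)"
proof -
 have "~ int p dvd t" using assms(2,3) by (metis dvd_mult2 dvd_diffD1 dvd_diff_commute dvd_diff_right_iff)
 moreover have "~ int p dvd 2" using assms(1) p by (metis dvd_refl int_dvd_int_iff of_nat_numeral primes_dvd_imp_eq two_is_prime_nat)
 ultimately have "~ int p dvd 2 * t" using p by (simp add: prime_dvd_mult_iff)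
 then have d: "~ int p dvd poly (pderiv [:- u, 0, 1:]) t" by (simp add: pderiv_pCons mult.commute)
 have "int p dvd poly [:- u, 0, 1:] t" using assms(3) by (simp add: algebra_simps)
 from hensel_padic[OF this d] obtain x where "cauchy_for (padic p) (\<lambda>n. of_int (x n))"
  "null_for (padic p) (\<lambda>n. of_int (poly [:- u, 0, 1:] (x n)))" by blast
 then show ?thesis by (intro exI[of _ "\<lambda>n. of_int (x n)"]) (simp add: algebra_simps)
qed

text \<open>The derivative of X^2 - u is even. Writing u = 8k + 1 and X = 2Y + 1 turns the equation
  into Y^2 + Y - 2k = 0, whose derivative at 0 is odd.\<close>

lemma padic_sqrt_two:
 assumes "p = 2" "8 dvd u - 1"
 shows "\<exists>x. cauchy_for (padic p) x & null_for (padic p) (\<lambda>n. x n * x n - of_int u)"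
proof -
 obtain k where k: "u = 8 * k + 1" using assms(2) by (metis dvdE diff_eq_eq)
 have d: "~ int p dvd poly (pderiv [:- 2 * k, 1, 1:]) 0" by (simp add: pderiv_pCons assms(1))
 have "int p dvd poly [:- 2 * k, 1, 1:] 0" by (simp add: assms(1))
 from hensel_padic[OF this d] obtain x where x: "cauchy_for (padic p) (\<lambda>n. of_int (x n))"
  "null_for (padic p) (\<lambda>n. of_int (poly [:- 2 * k, 1, 1:] (x n)))" by blast
 let ?y = "\<lambda>n. 2 * of_int (x n) + 1 :: rat"
 have "cauchy_for (padic p) ?y" by (intro A.cauchy_add A.cauchy_mult A.cauchy_const x)
 moreover have "null_for (padic p) (\<lambda>n. 4 * of_int (poly [:- 2 * k, 1, 1:] (x n)))" by (rule A.null_mult[OF x(2) A.cauchy_const])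
 then have "null_for (padic p) (\<lambda>n. ?y n * ?y n - of_int u)" by (simp add: k algebra_simps)
 ultimately show ?thesis by blast
qed

end

lemma real_sqrt_cauchy:
 assumes "(u::int) > 0"
 shows "\<exists>x. cauchy Infinite_Place x & null Infinite_Place (\<lambda>n. x n * x n - of_int u)"
proof -
 define s where "s = sqrt (of_int u)"
 have "\<forall>n. \<exists>q. s < of_rat q & of_rat q < s + inverse (real (Suc n))" using of_rat_dense by simp
 then obtain x where x: "\<And>n. s < of_rat (x n)" "\<And>n. of_rat (x n) < s + inverse (real (Suc n))" by metis
 have lim: "(\<lambda>n. of_rat (x n)) \<longlonglongrightarrow> s"
  by (rule tendsto_sandwich[OF always_eventually always_eventually tendsto_const LIMSEQ_inverse_real_of_nat_add])
   (use x in "auto intro: less_imp_le")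
 have "cauchy Infinite_Place x" unfolding cauchy_for_def
 proof (intro allI impI)
  fix e :: rat assume "e > 0"
  then show "\<exists>N. \<forall>m\<ge>N. \<forall>n\<ge>N. place_abs Infinite_Place (x m - x n) < e"
   using CauchyD[OF LIMSEQ_imp_Cauchy[OF lim], of "of_rat e"] by (simp add: of_rat_less flip: of_rat_diff)
 qed
 moreover have "(\<lambda>n. of_rat (x n) * of_rat (x n) - of_int u) \<longlonglongrightarrow> s * s - of_int u" by (intro tendsto_intros lim)
 then have lim0: "(\<lambda>n. real_of_rat (x n * x n - of_int u)) \<longlonglongrightarrow> 0"
  using assms by (simp add: s_def of_rat_diff of_rat_mult)
 have "null Infinite_Place (\<lambda>n. x n * x n - of_int u)" unfolding null_for_def
 proof (intro allI impI)
  fix e :: rat assume "e > 0"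
  then show "\<exists>N. \<forall>n\<ge>N. place_abs Infinite_Place (x n * x n - of_int u) < e"
   using LIMSEQ_D[OF lim0, of "of_rat e"] by (simp add: of_rat_less)
 qed
 ultimately show ?thesis by blast
qed

section \<open>Sufficient conditions for local solubility\<close>

context
 fixes v assumes v: "v\<in>places"
begin

interpretation A: rat_abs "place_abs v" by (rule rat_abs_place[OF v])

lemma not_null_sqrt:
 assumes "cauchy v x" "null v (\<lambda>n. x n * x n - c)" "c ~= 0"
 shows "~ null v x"
proof
 assume n: "null v x"
 have "null v (\<lambda>n. x n * x n + - (x n * x n - c))" by (intro A.null_add A.null_uminus A.null_mult assms n)
 then have "null v (\<lambda>n. c)" by simp
 moreover have "place_abs v c > 0" using A.nonneg[of c] A.zero_iff[of c] assms(3) by linarith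
 ultimately show False unfolding null_for_def by (metis less_irrefl order_refl)
qed

text \<open>If x^2 = c d, then s = x / d satisfies d s^2 = c: the class of O for c = 1, that of
  (0,0) for c = b.\<close>

lemma locsol_square:
 assumes x: "cauchy v x" "null v (\<lambda>n. x n * x n - c * d)" and cd: "c = 1 \<or> c = of_int b" "c ~= 0" "d ~= 0"
 shows "locsol v a b d"
proof -
 let ?s = "\<lambda>n. 1 / d * x n"
 have s: "cauchy v ?s" by (intro A.cauchy_mult A.cauchy_const x)
 have nn: "~ null v x" by (rule not_null_sqrt[OF x]) (use cd in simp)
 have "~ null v ?s"
 proof
  assume "null v ?s"
  from A.null_mult[OF this A.cauchy_const[of d]] show False using nn cd(3) by simp
 qed
 moreover have "null v (\<lambda>n. 1 / d * (x n * x n - c * d))" by (rule A.null_mult[OF x(2) A.cauchy_const])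
 then have "null v (\<lambda>n. d * (?s n * ?s n) - c)" using cd(3) by (simp add: field_simps)
 ultimately show ?thesis unfolding locsol_def using s cd(1) by blast
qed

text \<open>Multiplying the equation by m^2 gives a point with first coordinate d m^2 and second
  coordinate N m.\<close>

lemma locsol_quartic:
 assumes m: "cauchy v m" "~ null v m" and N: "cauchy v N"
  and e: "null v (\<lambda>n. N n * N n - d * (d * d * (m n * m n * (m n * m n)) + of_int a * d * (m n * m n) + of_int b))"
 shows "locsol v a b d"
proof -
 let ?t = "\<lambda>n. N n * m n"
 have t: "cauchy v ?t" by (intro A.cauchy_mult m N)
 have "null v (\<lambda>n. m n * m n * (N n * N n - d * (d * d * (m n * m n * (m n * m n)) + of_int a * d * (m n * m n) + of_int b)))"
  by (intro A.null_mult e A.cauchy_mult m)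
 then have "null v (\<lambda>n. ?t n * ?t n - d * (m n * m n) * (d * (m n * m n) * (d * (m n * m n)) + of_int a * (d * (m n * m n)) + of_int b))"
  by (simp add: algebra_simps)
 then show ?thesis unfolding locsol_def using m t by blast
qed

end

section \<open>Local conditions at the odd primes\<close>

text \<open>The usual quartic d m^4 + a m^2 e^2 + (b / d) e^4 of a 2-descent, multiplied by d so
  that it stays integral when d does not divide b. The homogeneous space becomes n^2 = d times this
  form.\<close>

abbreviation quartic :: "int => int => int => int => int => int" where
 "quartic a b d m e \<equiv> d\<^sup>2 * m ^ 4 + a * d * m\<^sup>2 * e\<^sup>2 + b * e ^ 4"

lemma quotient_of_cases:
 fixes r :: rat
 obtains m e :: int where "r = of_int m / of_int e" "e > 0" "coprime m e"
 by (metis quotient_of_coprime quotient_of_denom_pos quotient_of_div surj_pair)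

context
 fixes p :: nat assumes p: "prime p"
begin

interpretation A: rat_abs "padic p" by (rule rat_abs_place[OF place[OF p]])

lemma prime_int: "prime (int p)" using p by simp

text \<open>The integers \<open>y n\<close> clear the denominators of a null sequence and do not
  increase p-adic size, and integers of small p-adic absolute value are divisible by high powers of
  p.\<close>

lemma null_dvd:
 assumes "null_for (padic p) x" and "\<And>n. of_int (z n) = of_int (y n) * x n"
 shows "\<exists>N. \<forall>n\<ge>N. int p ^ k dvd z n"
proof -
 have "(1::rat) / of_nat p ^ k > 0" using prime_gt_0_nat[OF p] by simp
 then obtain N where N: "\<And>n. n >= N ==> padic p (x n) < 1 / of_nat p ^ k" using assms(1) unfolding null_for_def by blast
 have "int p ^ k dvd z n" if "n >= N" for n
 proof -
  have "padic p (of_int (z n)) = padic p (of_int (y n)) * padic p (x n)" unfolding assms(2) by (rule A.mult)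
  also have "\<dots> <= 1 * padic p (x n)" by (rule mult_right_mono[OF padic_int_le_1[OF p] A.nonneg])
  finally have "padic p (of_int (z n)) <= 1 / of_nat p ^ k" using N[OF that] by linarith
  then show ?thesis by (simp only: padic_int_le_iff[OF p])
 qed
 then show ?thesis by blast
qed

text \<open>Clearing denominators in a local point gives an approximate solution with (m, e)
  primitive at p. The points O and (0,0) correspond to pairs (m, 0) and (0, e); in the latter case p
  does not divide e because p^2 does not divide d.\<close>

lemma locsol_approx:
 assumes l: "locsol (Finite_Place p) a b (of_int d)" and d: "~ (int p)\<^sup>2 dvd d" and k: "k >= 2"
 shows "\<exists>m e n. ~ (int p dvd m & int p dvd e) & int p ^ k dvd n\<^sup>2 - d * quartic a b d m e"
proof -
 obtain s where s: "cauchy_for (padic p) s" "~ null_for (padic p) s"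
  and cs: "null_for (padic p) (\<lambda>n. of_int d * (s n * s n) - 1) \<or> null_for (padic p) (\<lambda>n. of_int d * (s n * s n) - of_int b) \<or>
   (\<exists>t. cauchy_for (padic p) t & null_for (padic p) (\<lambda>n. t n * t n -
     of_int d * (s n * s n) * (of_int d * (s n * s n) * (of_int d * (s n * s n)) + of_int a * (of_int d * (s n * s n)) + of_int b)))"
  using l unfolding locsol_def by blast
 have "\<forall>n. \<exists>m e. s n = of_int m / of_int e & e > 0 & coprime m e" using quotient_of_cases by metis
 then obtain M E where ME: "\<And>n. s n = of_int (M n) / of_int (E n)" "\<And>n. E n > 0" "\<And>n. coprime (M n) (E n)" by metis
 have E0: "(of_int (E n) :: rat) ~= 0" for n using ME(2)[of n] by simp
 have cop: "~ (int p dvd M n & int p dvd E n)" for n using ME(3)[of n] prime_int by (metis coprime_common_divisor not_prime_unit)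
 have dvd_p: "int p dvd z" if "int p ^ k dvd z" for z using that k dvd_trans[of "int p" "int p ^ k"] by (simp add: dvd_power)
 have dvd_p2: "(int p)\<^sup>2 dvd z" if "int p ^ k dvd z" for z using that k dvd_trans[OF le_imp_power_dvd[of 2 k "int p"]] by blast
 from cs show ?thesis
 proof (elim disjE exE conjE)
  assume "null_for (padic p) (\<lambda>n. of_int d * (s n * s n) - 1)"
  from null_dvd[OF this, of "\<lambda>n. d * (M n)\<^sup>2 - (E n)\<^sup>2" "\<lambda>n. (E n)\<^sup>2" k] E0
  obtain n where n: "int p ^ k dvd d * (M n)\<^sup>2 - (E n)\<^sup>2" by (auto simp: ME(1) field_simps power2_eq_square)
  have "~ int p dvd M n"
  proof
   assume a: "int p dvd M n"
   then have "int p dvd d * (M n)\<^sup>2" by (simp add: power2_eq_square)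
   then have "int p dvd (E n)\<^sup>2" using dvd_p[OF n] by (simp add: dvd_diff_right_iff)
   then show False using a cop prime_dvd_power[OF prime_int] by blast
  qed
  moreover have "(d * M n * E n)\<^sup>2 - d * quartic a b d (M n) 0 = - (d\<^sup>2 * (M n)\<^sup>2) * (d * (M n)\<^sup>2 - (E n)\<^sup>2)"
   by (simp add: power2_eq_square power4_eq_xxxx algebra_simps)
  then have "int p ^ k dvd (d * M n * E n)\<^sup>2 - d * quartic a b d (M n) 0" using n by (metis dvd_mult)
  ultimately show ?thesis by blast
 next
  assume "null_for (padic p) (\<lambda>n. of_int d * (s n * s n) - of_int b)"
  from null_dvd[OF this, of "\<lambda>n. d * (M n)\<^sup>2 - b * (E n)\<^sup>2" "\<lambda>n. (E n)\<^sup>2" k] E0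
  obtain n where n: "int p ^ k dvd d * (M n)\<^sup>2 - b * (E n)\<^sup>2" by (auto simp: ME(1) field_simps power2_eq_square)
  have "~ int p dvd E n"
  proof
   assume a: "int p dvd E n"
   then have "(int p)\<^sup>2 dvd b * (E n)\<^sup>2" by (simp add: dvd_power_same)
   then have 2: "(int p)\<^sup>2 dvd d * (M n)\<^sup>2" using dvd_p2[OF n] by (simp add: dvd_diff_left_iff)
   have "~ int p dvd M n" using a cop by blast
   then have "coprime ((int p)\<^sup>2) ((M n)\<^sup>2)" using prime_int by (simp add: prime_imp_coprime)
   then show False using 2 d by (simp add: coprime_dvd_mult_left_iff)
  qed
  moreover have "(d * M n * E n)\<^sup>2 - d * quartic a b d 0 (E n) = d * (E n)\<^sup>2 * (d * (M n)\<^sup>2 - b * (E n)\<^sup>2)"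
   by (simp add: power2_eq_square power4_eq_xxxx algebra_simps)
  then have "int p ^ k dvd (d * M n * E n)\<^sup>2 - d * quartic a b d 0 (E n)" using n by (metis dvd_mult)
  ultimately show ?thesis by blast
 next
  fix t assume t: "cauchy_for (padic p) t" and nt: "null_for (padic p) (\<lambda>n. t n * t n -
     of_int d * (s n * s n) * (of_int d * (s n * s n) * (of_int d * (s n * s n)) + of_int a * (of_int d * (s n * s n)) + of_int b))"
  let ?g = "\<lambda>n. t n * t n -
     of_int d * (s n * s n) * (of_int d * (s n * s n) * (of_int d * (s n * s n)) + of_int a * (of_int d * (s n * s n)) + of_int b)"
  let ?i = "\<lambda>n. inverse (s n)"
  have i: "cauchy_for (padic p) ?i" by (rule A.cauchy_inverse[OF s])
  have h: "null_for (padic p) (\<lambda>n. ?i n * (?i n * ?g n))" by (intro A.null_mult[OF A.null_mult[OF nt i] i])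
  obtain dl N0 where N0: "dl > 0" "\<And>n. n >= N0 ==> dl < padic p (s n)" using A.not_null_away[OF s] by blast
  have "\<forall>n. \<exists>m e. t n * (of_int (E n))\<^sup>2 / s n = of_int m / of_int e & e > 0 & coprime m e" using quotient_of_cases by metis
  then obtain P R where PR: "\<And>n. t n * (of_int (E n))\<^sup>2 / s n = of_int (P n) / of_int (R n)" "\<And>n. R n > 0" "\<And>n. coprime (P n) (R n)" by metis
  have sn: "s n ~= 0" if "n >= N0" for n using N0(2)[OF that] N0(1) A.zero_iff[of "s n"] by auto
  \<comment> \<open>Early terms, where \<open>s n\<close> may vanish, are replaced by zero because
    \<open>null_dvd\<close> asks for its equation at every index.\<close>
  let ?z = "\<lambda>n. if n >= N0 then (P n)\<^sup>2 - d * quartic a b d (M n) (E n) * (R n)\<^sup>2 else 0"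
  let ?y = "\<lambda>n. if n >= N0 then (E n) ^ 4 * (R n)\<^sup>2 else 0"
  have "of_int (?z n) = of_int (?y n) * (?i n * (?i n * ?g n))" for n
  proof (cases "n >= N0")
   case True
   define E' R' where "E' = (of_int (E n) :: rat)" and "R' = (of_int (R n) :: rat)"
   have nz: "E' ~= 0" "R' ~= 0" "s n ~= 0" using ME(2)[of n] PR(2)[of n] sn[OF True] by (auto simp: E'_def R'_def)
   have Mn: "of_int (M n) = s n * E'" using ME(1)[of n] nz by (simp add: E'_def)
   have Pn: "of_int (P n) = t n * E'\<^sup>2 / s n * R'" using PR(1)[of n] nz by (simp add: E'_def R'_def)
   have "of_int (?z n) = (t n * E'\<^sup>2 / s n * R')\<^sup>2 - of_int d * ((of_int d)\<^sup>2 * (s n * E') ^ 4 + of_int a * of_int d * (s n * E')\<^sup>2 * E'\<^sup>2 + of_int b * E' ^ 4) * R'\<^sup>2"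
    using True by (simp add: Mn Pn flip: E'_def R'_def)
   also have "\<dots> = E' ^ 4 * R'\<^sup>2 * (?i n * (?i n * ?g n))"
    using nz(3) by (simp add: field_simps power2_eq_square power4_eq_xxxx)
   finally show ?thesis using True by (simp add: E'_def R'_def)
  qed simp
  from null_dvd[OF h this, of k] obtain N1 where N1: "\<And>n. n >= N1 ==> int p ^ k dvd ?z n" by blast
  define n where "n = max N0 N1"
  define D where "D = d * quartic a b d (M n) (E n)"
  have n: "int p ^ k dvd (P n)\<^sup>2 - D * (R n)\<^sup>2" using N1[of n] by (simp add: n_def D_def)
  have "~ int p dvd R n"
  proof
   assume a: "int p dvd R n"
   then have "int p dvd D * (R n)\<^sup>2" by (simp add: power2_eq_square)
   then have "int p dvd (P n)\<^sup>2" using dvd_p[OF n] by (simp add: dvd_diff_left_iff)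
   then have "int p dvd P n" using prime_dvd_power[OF prime_int] by blast
   then show False using a PR(3)[of n] prime_int by (metis coprime_common_divisor not_prime_unit)
  qed
  then have "coprime (R n) (int p ^ k)" using prime_int by (simp add: prime_imp_coprime coprime_commute)
  then obtain r where r: "[R n * r = 1] (mod (int p ^ k))" using cong_solve_coprime_int by blast
  have "[(P n)\<^sup>2 = D * (R n)\<^sup>2] (mod (int p ^ k))" using n by (simp add: cong_iff_dvd_diff)
  then have "[(P n)\<^sup>2 * r\<^sup>2 = D * (R n)\<^sup>2 * r\<^sup>2] (mod (int p ^ k))" by (rule cong_mult[OF _ cong_refl])
  moreover have "[D * (R n * r)\<^sup>2 = D * 1\<^sup>2] (mod (int p ^ k))" by (intro cong_mult[OF cong_refl] cong_pow r)
  ultimately have "[(P n * r)\<^sup>2 = D] (mod (int p ^ k))" by (simp add: power_mult_distrib mult.assoc) (rule cong_trans)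
  then have "int p ^ k dvd (P n * r)\<^sup>2 - D" by (simp add: cong_iff_dvd_diff)
  then show ?thesis using cop unfolding D_def by blast
 qed
qed

lemma p_dvd_pow: "int p ^ Suc i dvd z ==> int p dvd z" by (metis dvd_mult_left power_Suc)

lemma dvd_of_pow: "int p dvd z ^ i ==> int p dvd z" using prime_dvd_power[OF prime_int] by blast

text \<open>The valuation of d times the quartic would be odd. It is 1 if p does not divide e, where
  b e^4 is a unit, and 3 if p divides e, where d^2 m^4 has the least valuation. To detect valuation
  3, the approximation is taken modulo p^4.\<close>

lemma not_locsol_good:
 assumes b: "~ int p dvd b" and d: "int p dvd d" "~ (int p)\<^sup>2 dvd d"
 shows "~ locsol (Finite_Place p) a b (of_int d)"
proof
 assume "locsol (Finite_Place p) a b (of_int d)"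
 from locsol_approx[OF this d(2), of 4] obtain m e n where
  me: "~ (int p dvd m & int p dvd e)" and n: "int p ^ 4 dvd n\<^sup>2 - d * quartic a b d m e" by auto
 obtain d' where d': "d = int p * d'" using d(1) by (elim dvdE)
 have pd': "~ int p dvd d'" using d(2) unfolding d' by (auto simp: power2_eq_square)
 have p0: "int p ~= 0" using prime_gt_0_nat[OF p] by simp
 have pn: "int p dvd n\<^sup>2"
 proof -
  have "int p dvd n\<^sup>2 - d * quartic a b d m e" using p_dvd_pow[of 3] n by (simp add: numeral_eq_Suc)
  moreover have "int p dvd d * quartic a b d m e" using d(1) by simp
  ultimately show ?thesis by (simp add: dvd_diff_left_iff)
 qed
 then have "int p dvd n" by (rule dvd_of_pow)
 then obtain n' where n': "n = int p * n'" by (elim dvdE)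
 have eq: "n\<^sup>2 - d * quartic a b d m e = int p * (int p * n'\<^sup>2 - d' * quartic a b d m e)"
  unfolding n' d' by (simp add: algebra_simps power2_eq_square)
 have "int p ^ 3 dvd int p * n'\<^sup>2 - d' * quartic a b d m e" using n p0 unfolding eq by (simp add: numeral_eq_Suc)
 then have n3: "int p * (int p * int p) dvd int p * n'\<^sup>2 - d' * quartic a b d m e" by (simp only: power3_eq_cube mult.assoc)
 then have "int p dvd d' * quartic a b d m e" using dvd_mult_left[OF n3] by (simp add: dvd_diff_right_iff)
 then have "int p dvd quartic a b d m e" using pd' prime_dvd_mult_iff[OF prime_int] by blast
 moreover have "quartic a b d m e = int p * (d' * (d * m ^ 4 + a * m\<^sup>2 * e\<^sup>2)) + b * e ^ 4"
  unfolding d' by (simp add: algebra_simps power2_eq_square)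
 ultimately have "int p dvd b * e ^ 4" by (simp add: dvd_add_right_iff)
 then have "int p dvd e" using b prime_dvd_mult_iff[OF prime_int] dvd_of_pow by blast
 then obtain e' where e': "e = int p * e'" by (elim dvdE)
 have pm: "~ int p dvd m" using me \<open>int p dvd e\<close> by blast
 have q: "quartic a b d m e = (int p * int p) * (d'\<^sup>2 * m ^ 4 + int p * (a * d' * m\<^sup>2 * e'\<^sup>2) + int p * (int p * (b * e' ^ 4)))"
  unfolding d' e' by (simp add: algebra_simps power2_eq_square power4_eq_xxxx)
 let ?r = "d'\<^sup>2 * m ^ 4 + int p * (a * d' * m\<^sup>2 * e'\<^sup>2) + int p * (int p * (b * e' ^ 4))"
 have eq2: "int p * n'\<^sup>2 - d' * quartic a b d m e = int p * (n'\<^sup>2 - int p * (d' * ?r))"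
  unfolding q by (simp add: algebra_simps)
 have n4: "int p * int p dvd n'\<^sup>2 - int p * (d' * ?r)" using n3 p0 unfolding eq2 by simp
 then have "int p dvd n'\<^sup>2" using dvd_mult_left[OF n4] by (simp add: dvd_diff_left_iff)
 then have "int p dvd n'" by (rule dvd_of_pow)
 then obtain n2 where n2: "n' = int p * n2" by (elim dvdE)
 have "n'\<^sup>2 - int p * (d' * ?r) = int p * (int p * n2\<^sup>2 - d' * ?r)" unfolding n2 by (simp add: algebra_simps power2_eq_square)
 then have "int p dvd int p * n2\<^sup>2 - d' * ?r" using n4 p0 by simp
 then have "int p dvd d' * ?r" by (simp add: dvd_diff_right_iff)
 then have "int p dvd ?r" using pd' prime_dvd_mult_iff[OF prime_int] by blast
 then have "int p dvd d'\<^sup>2 * m ^ 4" by (metis dvd_add_left_iff dvd_triv_left)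
 then show False using pd' pm prime_dvd_mult_iff[OF prime_int] dvd_of_pow by blast
qed

lemma cong_square_cancel:
 assumes "int p dvd x\<^sup>2 - d * w\<^sup>2" "~ int p dvd w"
 shows "QuadRes (int p) d"
proof -
 have "coprime w (int p)" using prime_imp_coprime[OF prime_int assms(2)] by (simp only: coprime_commute)
 then obtain r where r: "[w * r = 1] (mod int p)" using cong_solve_coprime_int by blast
 have "[x\<^sup>2 = d * w\<^sup>2] (mod int p)" using assms(1) by (simp add: cong_iff_dvd_diff)
 then have "[x\<^sup>2 * r\<^sup>2 = d * w\<^sup>2 * r\<^sup>2] (mod int p)" by (rule cong_mult[OF _ cong_refl])
 moreover have "[d * (w * r)\<^sup>2 = d * 1\<^sup>2] (mod int p)" by (intro cong_mult[OF cong_refl] cong_pow r)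
 ultimately have "[(x * r)\<^sup>2 = d] (mod int p)" by (simp add: power_mult_distrib mult.assoc) (rule cong_trans)
 then show ?thesis unfolding QuadRes_def by blast
qed

end

context
 fixes p :: nat assumes p: "prime p" "odd p"
begin

lemma not_dvd_2: "~ int p dvd 2" using p by (metis dvd_refl int_dvd_int_iff of_nat_numeral primes_dvd_imp_eq two_is_prime_nat)

text \<open>Completing the square gives (2n)^2 = d w^2 - d (a^2 - 4b) e^4 modulo p^2, so d is a
  square modulo p unless p divides w. In that case p^2 divides (a^2 - 4b) e^4, which forces p to
  divide e and then m.\<close>

lemma locsol_imp_QuadRes:
 assumes D: "int p dvd a\<^sup>2 - 4 * b" "~ (int p)\<^sup>2 dvd a\<^sup>2 - 4 * b" "~ int p dvd a"
  and d: "~ (int p)\<^sup>2 dvd d" and l: "locsol (Finite_Place p) a b (of_int d)"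
 shows "~ int p dvd d & QuadRes (int p) d"
proof -
 note pI = prime_int[OF p(1)]
 note pm = prime_dvd_mult_iff[OF pI]
 have b: "~ int p dvd b"
 proof
  assume "int p dvd b"
  then have "int p dvd a\<^sup>2" using D(1) by (simp add: dvd_diff_left_iff)
  then show False using D(3) dvd_of_pow[OF p(1)] by blast
 qed
 have pd: "~ int p dvd d" using not_locsol_good[OF p(1) b _ d] l by blast
 from locsol_approx[OF p(1) l d, of 2] obtain m e n where
  me: "~ (int p dvd m & int p dvd e)" and n: "(int p)\<^sup>2 dvd n\<^sup>2 - d * quartic a b d m e" by auto
 define w where "w = 2 * d * m\<^sup>2 + a * e\<^sup>2"
 have eq: "4 * (n\<^sup>2 - d * quartic a b d m e) = (2 * n)\<^sup>2 - d * w\<^sup>2 + d * (a\<^sup>2 - 4 * b) * e ^ 4"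
  unfolding w_def by (simp add: algebra_simps power2_eq_square power4_eq_xxxx)
 have n2: "(int p)\<^sup>2 dvd (2 * n)\<^sup>2 - d * w\<^sup>2 + d * (a\<^sup>2 - 4 * b) * e ^ 4" unfolding eq[symmetric] using n by (rule dvd_mult)
 have pp: "int p dvd (int p)\<^sup>2" by (simp add: power2_eq_square)
 have "int p dvd d * (a\<^sup>2 - 4 * b) * e ^ 4" using D(1) by simp
 then have n1: "int p dvd (2 * n)\<^sup>2 - d * w\<^sup>2" using dvd_trans[OF pp n2] by (simp add: dvd_add_left_iff)
 have "~ int p dvd w"
 proof
  assume w: "int p dvd w"
  then have "int p dvd d * w\<^sup>2" by (simp add: power2_eq_square)
  then have "int p dvd (2 * n)\<^sup>2" using n1 by (simp add: dvd_diff_left_iff)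
  then have "int p dvd 2 * n" by (rule dvd_of_pow[OF p(1)])
  then have "(int p)\<^sup>2 dvd (2 * n)\<^sup>2" "(int p)\<^sup>2 dvd w\<^sup>2" using w by (simp_all only: dvd_power_same)
  then have "(int p)\<^sup>2 dvd (2 * n)\<^sup>2 - d * w\<^sup>2" by (intro dvd_diff dvd_mult)
  then have "(int p)\<^sup>2 dvd d * (a\<^sup>2 - 4 * b) * e ^ 4" using n2 by (simp add: dvd_add_right_iff)
  then have pe: "(int p)\<^sup>2 dvd (a\<^sup>2 - 4 * b) * (d * e ^ 4)" by (simp add: ac_simps)
  have "int p dvd d * e ^ 4"
  proof (rule ccontr)
   assume "~ int p dvd d * e ^ 4"
   then have "coprime ((int p)\<^sup>2) (d * e ^ 4)" using prime_imp_coprime[OF pI] by (simp del: coprime_mult_right_iff)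
   then show False using pe D(2) by (metis coprime_dvd_mult_left_iff)
  qed
  then have "int p dvd e ^ 4" using pd pm by blast
  then have e: "int p dvd e" by (rule dvd_of_pow[OF p(1)])
  then have "int p dvd a * e\<^sup>2" by (simp add: power2_eq_square)
  then have "int p dvd 2 * d * m\<^sup>2" using w unfolding w_def by (simp add: dvd_add_left_iff)
  then have "int p dvd m\<^sup>2" using pd not_dvd_2 pm by blast
  then show False using me e dvd_of_pow[OF p(1)] by blast
 qed
 then show ?thesis using cong_square_cancel[OF p(1) n1] pd by blast
qed

lemma QuadRes_dvd: "int p dvd x ==> QuadRes (int p) x" unfolding QuadRes_def by (rule exI[of _ 0]) (simp add: cong_iff_dvd_diff)

lemma QuadRes_iff: "QuadRes (int p) x \<longleftrightarrow> (\<exists>y. int p dvd y * y - x)"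
 unfolding QuadRes_def by (simp add: cong_iff_dvd_diff power2_eq_square)

lemma QuadRes_cong: "int p dvd x - y ==> QuadRes (int p) x \<longleftrightarrow> QuadRes (int p) y"
 unfolding QuadRes_def by (meson cong_iff_dvd_diff cong_sym cong_trans)

text \<open>Euler's criterion gives the congruence; the two sides differ by at most 2 < p.\<close>

lemma Legendre_mult: "Legendre (x * y) (int p) = Legendre x (int p) * Legendre y (int p)"
proof -
 have p2: "2 < int p" using p prime_ge_2_nat[OF p(1)] by (cases "p = 2") auto
 have eu: "[Legendre z (int p) = z ^ ((p - 1) div 2)] (mod int p)" for z using euler_criterion[OF p(1), of z] p2 by simp
 have "[Legendre (x * y) (int p) = Legendre x (int p) * Legendre y (int p)] (mod int p)"
  using cong_trans[OF eu[of "x * y", unfolded power_mult_distrib] cong_sym[OF cong_mult[OF eu[of x] eu[of y]]]] by simp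
 then have d: "int p dvd Legendre (x * y) (int p) - Legendre x (int p) * Legendre y (int p)" by (simp add: cong_iff_dvd_diff)
 have "\<bar>Legendre (x * y) (int p) - Legendre x (int p) * Legendre y (int p)\<bar> <= 2" by (simp add: Legendre_def)
 then show ?thesis using dvd_imp_le_int[OF _ d] p2 by linarith
qed

lemma Legendre_1_iff: "Legendre x (int p) = 1 \<longleftrightarrow> ~ int p dvd x & QuadRes (int p) x"
 unfolding Legendre_def by (simp add: cong_0_iff)

lemma not_QuadRes_iff: "~ QuadRes (int p) x \<longleftrightarrow> Legendre x (int p) = - 1"
 using QuadRes_dvd unfolding Legendre_def by (auto simp: cong_0_iff)

lemma exists_nonresidue: "\<exists>u. ~ QuadRes (int p) u"
proof (rule ccontr)
 assume "~ (\<exists>u. ~ QuadRes (int p) u)"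
 then have all: "\<exists>y. int p dvd y * y - u" for u using QuadRes_iff by blast
 have p3: "3 <= p" using p prime_ge_2_nat[OF p(1)] by (cases "p = 2") auto
 let ?f = "\<lambda>x::int. (x * x) mod int p" and ?S = "{0..<int p}"
 have "?S \<subseteq> ?f ` ?S"
 proof
  fix u assume u: "u \<in> ?S"
  obtain y where y: "int p dvd y * y - u" using all by blast
  then have "(y * y) mod int p = u mod int p" by (simp add: mod_eq_dvd_iff)
  also have "\<dots> = u" using u by simp
  finally have "?f (y mod int p) = u" by (simp add: mod_mult_eq)
  moreover have "y mod int p \<in> ?S" using p3 by simp
  ultimately show "u \<in> ?f ` ?S" by blast
 qed
 then have "inj_on ?f ?S" by (intro finite_surj_inj) auto
 moreover have "?f 1 = ?f (int p - 1)"
 proof -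
  have "(int p - 1) * (int p - 1) = 1 + int p * (int p - 2)" by (simp add: algebra_simps)
  then show ?thesis by (simp only: mod_mult_self2 mult_1)
 qed
 ultimately have "1 = int p - 1" using p3 by (elim inj_onD) auto
 then show False using p3 by simp
qed

text \<open>Otherwise the squares modulo p would be stable under adding c, and every residue, being
  a multiple of c, would be a square.\<close>

lemma exists_square_plus_nonresidue:
 assumes c: "~ int p dvd c" shows "\<exists>r. ~ QuadRes (int p) (r\<^sup>2 + c)"
proof (rule ccontr)
 assume "~ (\<exists>r. ~ QuadRes (int p) (r\<^sup>2 + c))"
 then have all: "QuadRes (int p) (r\<^sup>2 + c)" for r by blast
 have "QuadRes (int p) (int j * c)" for j
 proof (induction j)
  case (Suc j)
  then obtain y where "int p dvd y * y - int j * c" using QuadRes_iff by blast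
  then have "int p dvd (y\<^sup>2 + c) - int (Suc j) * c" by (simp add: algebra_simps power2_eq_square)
  then show ?case using QuadRes_cong all by blast
 qed (simp add: QuadRes_dvd)
 moreover obtain u where "~ QuadRes (int p) u" using exists_nonresidue by blast
 moreover have "\<exists>j. int p dvd int j * c - u"
 proof -
  have "coprime c (int p)" using prime_imp_coprime[OF prime_int[OF p(1)] c] by (simp only: coprime_commute)
  then obtain r where r: "[c * r = 1] (mod int p)" using cong_solve_coprime_int by blast
  define j where "j = nat ((r * u) mod int p)"
  have "[int j = r * u] (mod int p)" using prime_gt_0_nat[OF p(1)] by (simp add: cong_def j_def)
  then have "[int j * c = r * u * c] (mod int p)" by (rule cong_mult[OF _ cong_refl])
  moreover have "[r * u * c = u] (mod int p)" using cong_mult[OF r cong_refl[of u]] by (simp add: ac_simps)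
  ultimately have "[int j * c = u] (mod int p)" by (rule cong_trans)
  then show ?thesis by (auto simp: cong_iff_dvd_diff)
 qed
 ultimately show False using QuadRes_cong by blast
qed

lemma place_p: "Finite_Place p\<in>places" by (rule place[OF p(1)])

interpretation A: rat_abs "padic p" by (rule rat_abs_place[OF place_p])

lemma locsol_QuadRes:
 assumes d: "~ int p dvd d" "QuadRes (int p) d" shows "locsol (Finite_Place p) a b (of_int d)"
proof -
 obtain t where "int p dvd t * t - d" using d(2) QuadRes_iff by blast
 from padic_sqrt_odd[OF p d(1) this] obtain x where x: "cauchy_for (padic p) x" "null_for (padic p) (\<lambda>n. x n * x n - of_int d)" by blast
 have "(of_int d :: rat) ~= 0" using d(1) by auto
 then show ?thesis using locsol_square[OF place_p x(1), of 1] x(2) by simp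
qed

lemma locsol_QuadRes_dual:
 assumes d: "~ int p dvd b * d" "QuadRes (int p) (b * d)" shows "locsol (Finite_Place p) a b (of_int d)"
proof -
 obtain t where "int p dvd t * t - b * d" using d(2) QuadRes_iff by blast
 from padic_sqrt_odd[OF p d(1) this] obtain x where x: "cauchy_for (padic p) x" "null_for (padic p) (\<lambda>n. x n * x n - of_int (b * d))" by blast
 have "(of_int d :: rat) ~= 0" "(of_int b :: rat) ~= 0" using d(1) by auto
 then show ?thesis using locsol_square[OF place_p x(1), of "of_int b"] x(2) by simp
qed

lemma not_null_int:
 assumes "\<And>n. ~ int p dvd z n" shows "~ null_for (padic p) (\<lambda>n. of_int (z n))"
proof
 assume "null_for (padic p) (\<lambda>n. of_int (z n))"
 from null_dvd[OF p(1) this, of z "\<lambda>_. 1" 1] assms show False by auto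
qed

text \<open>The second hypothesis says that the root m is a unit and simple. Hensel lifts it to a
  solution with N = 0, a point of order two.\<close>

lemma locsol_quartic_root:
 assumes "int p dvd quartic a b d m 1" "~ int p dvd 2 * d * m * (2 * d * m\<^sup>2 + a)"
 shows "locsol (Finite_Place p) a b (of_int d)"
proof -
 let ?f = "[:b, 0, a * d, 0, d\<^sup>2:]"
 have "int p dvd poly ?f m" using assms(1) by (simp add: algebra_simps power2_eq_square power4_eq_xxxx)
 moreover have "poly (pderiv ?f) m = 2 * d * m * (2 * d * m\<^sup>2 + a)" by (simp add: pderiv_pCons algebra_simps power2_eq_square)
 ultimately obtain x where x: "cauchy_for (padic p) (\<lambda>n. of_int (x n))" "null_for (padic p) (\<lambda>n. of_int (poly ?f (x n)))"
  "\<And>n. int p dvd x n - m" using hensel_padic[OF p(1), of ?f m] assms(2) by auto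
 have "~ int p dvd m" using assms(2) by auto
 then have "~ int p dvd x n" for n using x(3)[of n] by (metis dvd_diff_right_iff)
 then have nn: "~ null_for (padic p) (\<lambda>n. of_int (x n))" by (rule not_null_int)
 have "null_for (padic p) (\<lambda>n. - of_int d * of_int (poly ?f (x n)))" by (rule A.null_mult[OF x(2) A.cauchy_const])
 then have "null_for (padic p) (\<lambda>n. 0 * 0 - of_int d * (of_int d * of_int d * (of_int (x n) * of_int (x n) * (of_int (x n) * of_int (x n))) + of_int a * of_int d * (of_int (x n) * of_int (x n)) + of_int b))"
  by (simp add: algebra_simps power2_eq_square)
 then show ?thesis using locsol_quartic[OF place_p x(1) nn A.cauchy_const[of 0]] by simp
qed

lemma locsol_quartic_QuadRes:
 assumes "~ int p dvd m" "~ int p dvd d * quartic a b d m 1" "QuadRes (int p) (d * quartic a b d m 1)"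
 shows "locsol (Finite_Place p) a b (of_int d)"
proof -
 obtain t where "int p dvd t * t - d * quartic a b d m 1" using assms(3) QuadRes_iff by blast
 from padic_sqrt_odd[OF p assms(2) this] obtain N where
  N: "cauchy_for (padic p) N" "null_for (padic p) (\<lambda>n. N n * N n - of_int (d * quartic a b d m 1))" by blast
 have nn: "~ null_for (padic p) (\<lambda>n. of_int m)" by (rule not_null_int) (rule assms(1))
 have "null_for (padic p) (\<lambda>n. N n * N n - of_int d * (of_int d * of_int d * (of_int m * of_int m * (of_int m * of_int m)) + of_int a * of_int d * (of_int m * of_int m) + of_int b))"
  using N(2) by (simp add: algebra_simps power2_eq_square power4_eq_xxxx)
 then show ?thesis by (rule locsol_quartic[OF place_p A.cauchy_const nn N(1)])
qed

lemma QuadRes_mult_nonresidues: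
 "~ QuadRes (int p) x ==> ~ QuadRes (int p) y ==> ~ int p dvd x * y & QuadRes (int p) (x * y)"
 using Legendre_mult[of x y] Legendre_1_iff[of "x * y"] by (simp add: not_QuadRes_iff)

text \<open>A point modulo p is found by counting on a conic. Without one, d would be a non-residue,
  b a residue, and the quartic would take nonzero square values at all units m. This yields the p -
  1 points (d m^2, g m) on y^2 = x^2 + a x + b, besides (0, y0). But W = 2x + a - 2y maps the points
  of this conic injectively to nonzero residues, of which there are only p - 1.\<close>

lemma locsol_good:
 assumes b: "~ int p dvd b" and D: "~ int p dvd a\<^sup>2 - 4 * b" and d: "~ int p dvd d"
 shows "locsol (Finite_Place p) a b (of_int d)"
proof (rule ccontr)
 assume nl: "~ locsol (Finite_Place p) a b (of_int d)"
 note pm = prime_dvd_mult_iff[OF prime_int[OF p(1)]]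
 have p3: "3 <= p" using p prime_ge_2_nat[OF p(1)] by (cases "p = 2") auto
 have nd: "~ QuadRes (int p) d" using nl locsol_QuadRes d by blast
 have bQ: "QuadRes (int p) b" using nl locsol_QuadRes_dual QuadRes_mult_nonresidues[OF _ nd] by blast
 let ?G = "\<lambda>m. quartic a b d m 1"
 have G0: "~ int p dvd ?G m" if m: "~ int p dvd m" for m
 proof
  assume g: "int p dvd ?G m"
  have "int p dvd 2 * d * m * (2 * d * m\<^sup>2 + a)" using locsol_quartic_root[OF g] nl by blast
  then have "int p dvd 2 * d * m\<^sup>2 + a" using pm d m not_dvd_2 by blast
  then have "int p dvd (2 * d * m\<^sup>2 + a) * (2 * d * m\<^sup>2 + a) - 4 * ?G m" using g by (intro dvd_diff dvd_mult2 dvd_mult)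
  moreover have "(2 * d * m\<^sup>2 + a) * (2 * d * m\<^sup>2 + a) - 4 * ?G m = a\<^sup>2 - 4 * b" by (simp add: algebra_simps power2_eq_square power4_eq_xxxx)
  ultimately have "int p dvd a\<^sup>2 - 4 * b" by (simp only:)
  then show False using D by blast
 qed
 have GQ: "\<exists>y. int p dvd y * y - ?G m" if m: "~ int p dvd m" for m
 proof -
  have "QuadRes (int p) (?G m)" using nl locsol_quartic_QuadRes[OF m] QuadRes_mult_nonresidues[OF nd, of "?G m"] by blast
  then show ?thesis using QuadRes_iff by blast
 qed
 define Y where "Y m = (SOME y. int p dvd y * y - ?G m)" for m
 have Y: "int p dvd Y m * Y m - ?G m" if "~ int p dvd m" for m unfolding Y_def by (rule someI_ex[OF GQ[OF that]])
 \<comment> \<open>The square roots are chosen odd in m: m and p - m share the value d m^2 and must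
   give the two opposite points over it.\<close>
 define g where "g m = (if 2 * m < int p then Y m else - Y (int p - m))" for m
 let ?S = "{1..<int p}"
 have ndS: "~ int p dvd m" if "m \<in> ?S" for m using that by (auto dest: zdvd_imp_le)
 have odd_p: "2 * m ~= int p" for m using p(2) by (metis dvd_triv_left even_of_nat)
 have gG: "int p dvd g m * g m - ?G m" if m: "m \<in> ?S" for m
 proof (cases "2 * m < int p")
  case True then show ?thesis using Y[OF ndS[OF m]] by (simp add: g_def)
 next
  case False
  have "int p - m \<in> ?S" using m by auto
  then have "int p dvd Y (int p - m) * Y (int p - m) - ?G (int p - m)" by (intro Y ndS)
  moreover have "int p dvd ?G (int p - m) - ?G m"
  proof -
   have "int p dvd (int p - m) ^ 2 - m ^ 2" by (simp add: power2_eq_square algebra_simps)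
   moreover have "?G (int p - m) - ?G m = ((int p - m) ^ 2 - m ^ 2) * (d\<^sup>2 * ((int p - m) ^ 2 + m ^ 2) + a * d)"
    by (simp add: algebra_simps power2_eq_square power4_eq_xxxx)
   ultimately show ?thesis by simp
  qed
  ultimately have "int p dvd (Y (int p - m) * Y (int p - m) - ?G (int p - m)) + (?G (int p - m) - ?G m)" by (rule dvd_add)
  moreover have "(Y (int p - m) * Y (int p - m) - ?G (int p - m)) + (?G (int p - m) - ?G m) = g m * g m - ?G m"
   using False by (simp add: g_def)
  ultimately show ?thesis by (simp only:)
 qed
 obtain y0 where y0: "int p dvd y0 * y0 - b" using bQ QuadRes_iff by blast
 \<comment> \<open>On the conic W W' = a^2 - 4b, a unit; so W is invertible and determines W', and W
   and W' together determine the point.\<close>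
 define W where "W x y = 2 * x + a - 2 * y" for x y :: int
 define W' where "W' x y = 2 * x + a + 2 * y" for x y :: int
 have WW: "int p dvd W x y * W' x y - (a\<^sup>2 - 4 * b)" if "int p dvd y * y - (x * x + a * x + b)" for x y
 proof -
  have "W x y * W' x y - (a\<^sup>2 - 4 * b) = - 4 * (y * y - (x * x + a * x + b))"
   by (simp add: W_def W'_def algebra_simps power2_eq_square)
  then show ?thesis using that by (metis dvd_mult)
 qed
 have Wnd: "~ int p dvd W x y" if "int p dvd y * y - (x * x + a * x + b)" for x y
  using WW[OF that] D by (metis dvd_mult2 dvd_diff_right_iff)
 have inj: "int p dvd x - x' & int p dvd y - y'"
  if e: "int p dvd y * y - (x * x + a * x + b)" "int p dvd y' * y' - (x' * x' + a * x' + b)" and w: "int p dvd W x y - W x' y'" for x y x' y'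
 proof -
  have "int p dvd (W x y * W' x y - (a\<^sup>2 - 4 * b)) - (W x' y' * W' x' y' - (a\<^sup>2 - 4 * b)) - (W x y - W x' y') * W' x' y'"
   by (rule dvd_diff[OF dvd_diff[OF WW[OF e(1)] WW[OF e(2)]] dvd_mult2[OF w]])
  also have "\<dots> = W x y * (W' x y - W' x' y')" by (simp add: algebra_simps)
  finally have w': "int p dvd W' x y - W' x' y'" using Wnd[OF e(1)] pm by blast
  have "int p dvd (W' x y - W' x' y') + (W x y - W x' y')" "int p dvd (W' x y - W' x' y') - (W x y - W x' y')"
   using dvd_add[OF w' w] dvd_diff[OF w' w] by auto
  moreover have "(W' x y - W' x' y') + (W x y - W x' y') = 2 * 2 * (x - x')" "(W' x y - W' x' y') - (W x y - W x' y') = 2 * 2 * (y - y')"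
   by (simp_all add: W_def W'_def)
  ultimately show ?thesis using pm not_dvd_2 by metis
 qed
 define sq where "sq m = d * m\<^sup>2" for m
 have GX: "?G m = sq m * sq m + a * sq m + b" for m by (simp add: sq_def algebra_simps power2_eq_square power4_eq_xxxx)
 let ?h = "\<lambda>m. W (sq m) (g m) mod int p"
 have e0: "int p dvd y0 * y0 - (0 * 0 + a * 0 + b)" using y0 by simp
 have maps: "?h ` ?S \<subseteq> ?S - {W 0 y0 mod int p}"
 proof
  fix z assume "z \<in> ?h ` ?S"
  then obtain m where m: "m \<in> ?S" "z = ?h m" by blast
  note em = gG[OF m(1), unfolded GX]
  have "~ int p dvd W (sq m) (g m)" by (rule Wnd[OF em])
  then have "W (sq m) (g m) mod int p ~= 0" by auto
  moreover have "0 <= W (sq m) (g m) mod int p" "W (sq m) (g m) mod int p < int p" using p3 by auto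
  ultimately have "z \<in> ?S" unfolding m(2) by auto
  moreover have "z ~= W 0 y0 mod int p"
  proof
   assume "z = W 0 y0 mod int p"
   then have "int p dvd W (sq m) (g m) - W 0 y0" unfolding m(2) by (simp add: mod_eq_dvd_iff)
   then have "int p dvd sq m" using inj[OF em e0] by simp
   then have "int p dvd m" using pm d unfolding sq_def by (auto simp: power2_eq_square)
   then show False using ndS[OF m(1)] by blast
  qed
  ultimately show "z \<in> ?S - {W 0 y0 mod int p}" by blast
 qed
 have "inj_on ?h ?S"
 proof (rule inj_onI)
  fix m m' assume m: "m \<in> ?S" "m' \<in> ?S" and eq: "?h m = ?h m'"
  have "int p dvd W (sq m) (g m) - W (sq m') (g m')" using eq by (simp add: mod_eq_dvd_iff)
  then have x: "int p dvd sq m - sq m'" and y: "int p dvd g m - g m'"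
   using inj[OF gG[OF m(1), unfolded GX] gG[OF m(2), unfolded GX]] by auto
  have "sq m - sq m' = d * ((m - m') * (m + m'))" by (simp add: sq_def algebra_simps power2_eq_square)
  then have "int p dvd m - m' \<or> int p dvd m + m'" using x pm d by auto
  then show "m = m'"
  proof
   assume "int p dvd m - m'"
   then show ?thesis using m by (metis abs_of_nonneg atLeastLessThan_iff dvd_imp_le_int zdvd_not_zless mod_eq_dvd_iff mod_pos_pos_trivial order_trans zero_le_one)
  next
   assume a: "int p dvd m + m'"
   then obtain k where k: "m + m' = int p * k" by (elim dvdE)
   have "0 < int p * k" "int p * k < int p * 2" using m unfolding k[symmetric] by auto
   then have "0 < k" "k < 2" using p3 by (simp_all only: mult_less_cancel_left_pos zero_less_mult_iff) auto
   then have "k = 1" by simp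
   then have mm: "m' = int p - m" using k by simp
   have gg: "g m' = - g m"
   proof (cases "2 * m < int p")
    case True
    then have "~ 2 * m' < int p" using mm by simp
    then show ?thesis using True mm by (simp add: g_def)
   next
    case False
    then have "2 * m' < int p" using mm odd_p[of m] by linarith
    then show ?thesis using False mm by (simp add: g_def)
   qed
   have "int p dvd 2 * g m" using y unfolding gg by simp
   then have "int p dvd g m * g m" using pm not_dvd_2 by blast
   then have "int p dvd ?G m" using gG[OF m(1)] by (simp add: dvd_diff_right_iff)
   then show ?thesis using G0[OF ndS[OF m(1)]] by blast
  qed
 qed
 then have "card (?h ` ?S) = card ?S" by (rule card_image)
 moreover have "card (?h ` ?S) <= card (?S - {W 0 y0 mod int p})" by (rule card_mono[OF _ maps]) simp
 moreover have "W 0 y0 mod int p \<in> ?S"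
 proof -
  have "W 0 y0 mod int p ~= 0" using Wnd[OF e0] by auto
  moreover have "0 <= W 0 y0 mod int p" "W 0 y0 mod int p < int p" using p3 by auto
  ultimately show ?thesis by auto
 qed
 then have "card (?S - {W 0 y0 mod int p}) < card ?S" by (rule card_Diff1_less[OF finite_atLeastLessThan_int])
 ultimately show False by linarith
qed

lemma locsol_b: assumes "b ~= 0" shows "locsol (Finite_Place p) a b (of_int b)"
proof -
 have b: "(of_int b :: rat) ~= 0" using assms by simp
 have "null_for (padic p) (\<lambda>n. 0)" unfolding null_for_def using A.zero_iff[of 0] by (auto simp del: place_abs.simps)
 then have n: "null_for (padic p) (\<lambda>n. of_int b * of_int b - of_int b * of_int b)" by (simp only: diff_self)
 show ?thesis by (rule locsol_square[OF place_p A.cauchy_const n disjI2[OF refl] b b])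
qed

text \<open>Modulo p the quartic is d m^2 (d m^2 + a). For a non-residue d choose r such that r^2 -
  a is also a non-residue; then m^2 = (r^2 - a) / d has a solution, d m^2 + a = r^2, and d times the
  quartic is the square of d m r. If p divides r, then m is a simple root of the quartic
  instead.\<close>

lemma locsol_multiplicative_unit:
 assumes b: "int p dvd b" and a: "~ int p dvd a" and d: "~ int p dvd d"
 shows "locsol (Finite_Place p) a b (of_int d)"
proof (cases "QuadRes (int p) d")
 case True
 then show ?thesis using locsol_QuadRes d by blast
next
 case False
 note pm = prime_dvd_mult_iff[OF prime_int[OF p(1)]]
 have "~ int p dvd - a" using a by simp
 then obtain r where r: "~ QuadRes (int p) (r\<^sup>2 + - a)" using exists_square_plus_nonresidue by blast
 have "coprime d (int p)" using prime_imp_coprime[OF prime_int[OF p(1)] d] by (simp only: coprime_commute)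
 then obtain e where e: "[d * e = 1] (mod int p)" using cong_solve_coprime_int by blast
 have dr: "~ int p dvd d * (r\<^sup>2 + - a)" "QuadRes (int p) (d * (r\<^sup>2 + - a))" using QuadRes_mult_nonresidues[OF False r] by auto
 then obtain t where t: "int p dvd t * t - d * (r\<^sup>2 + - a)" using QuadRes_iff by blast
 have t0: "~ int p dvd t"
 proof
  assume "int p dvd t"
  then have "int p dvd t * t" by simp
  then show False using t dr(1) by (simp add: dvd_diff_right_iff)
 qed
 define m where "m = t * e"
 have de: "int p dvd d * e - 1" using e by (simp add: cong_iff_dvd_diff)
 have e0: "~ int p dvd e" using de by (metis dvd_mult dvd_diff_right_iff not_prime_unit prime_int[OF p(1)])
 have m0: "~ int p dvd m" unfolding m_def using t0 e0 pm by blast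
 have key: "int p dvd d * m\<^sup>2 + a - r\<^sup>2"
 proof -
  have "d * m\<^sup>2 + a - r\<^sup>2 = (d * e - 1) * (t * t * e) + e * (t * t - d * (r\<^sup>2 + - a)) + (d * e - 1) * (r\<^sup>2 - a)"
   unfolding m_def by (simp add: algebra_simps power2_eq_square)
  then show ?thesis using de t by simp
 qed
 obtain c where c: "d * m\<^sup>2 + a - r\<^sup>2 = int p * c" using key by (elim dvdE)
 obtain b' where b': "b = int p * b'" using b by (elim dvdE)
 have G: "quartic a b d m 1 = d * m\<^sup>2 * r\<^sup>2 + int p * (d * m\<^sup>2 * c + b')"
 proof -
  have "quartic a b d m 1 = d * m\<^sup>2 * (d * m\<^sup>2 + a) + b" by (simp add: algebra_simps power2_eq_square power4_eq_xxxx)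
  also have "\<dots> = d * m\<^sup>2 * (r\<^sup>2 + int p * c) + int p * b'"
  proof -
   have "d * m\<^sup>2 + a = r\<^sup>2 + int p * c" using c by simp
   then show ?thesis by (simp only: b'[symmetric])
  qed
  finally show ?thesis by (simp add: algebra_simps)
 qed
 show ?thesis
 proof (cases "int p dvd r")
  case True
  then have r2: "int p dvd r\<^sup>2" by (simp add: power2_eq_square)
  then have g: "int p dvd quartic a b d m 1" unfolding G by simp
  have "d * m\<^sup>2 + a = r\<^sup>2 + int p * c" using c by simp
  then have "int p dvd d * m\<^sup>2 + a" using r2 by simp
  moreover have "~ int p dvd d * m\<^sup>2" using d m0 pm by (simp add: power2_eq_square)
  moreover have "2 * d * m\<^sup>2 + a = (d * m\<^sup>2 + a) + d * m\<^sup>2" by simp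
  ultimately have "~ int p dvd 2 * d * m\<^sup>2 + a" by (simp only: dvd_add_right_iff not_False_eq_True)
  then have "~ int p dvd 2 * d * m * (2 * d * m\<^sup>2 + a)" using pm d m0 not_dvd_2 by blast
  then show ?thesis using locsol_quartic_root[OF g] by blast
 next
  case False
  have dG: "d * quartic a b d m 1 - (d * m * r) * (d * m * r) = int p * (d * (d * m\<^sup>2 * c + b'))"
   unfolding G by (simp add: algebra_simps power2_eq_square)
  have nd: "~ int p dvd (d * m * r) * (d * m * r)" using d m0 False pm by blast
  have dd: "int p dvd d * quartic a b d m 1 - (d * m * r) * (d * m * r)" unfolding dG by simp
  have "~ int p dvd d * quartic a b d m 1" using nd dd by (metis dvd_diff_right_iff)
  moreover have "QuadRes (int p) (d * quartic a b d m 1)" unfolding QuadRes_iff using dd by (metis dvd_diff_commute)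
  ultimately show ?thesis using locsol_quartic_QuadRes[OF m0] by blast
 qed
qed

text \<open>For d = p d' and b = p b', the class of d is that of b times d' b'. The first factor is
  the class of (0,0), the second a unit, and \<open>locsol_mult\<close> combines them.\<close>

lemma locsol_multiplicative:
 assumes b: "int p dvd b" "~ (int p)\<^sup>2 dvd b" and a: "~ int p dvd a" and d: "~ (int p)\<^sup>2 dvd d"
  and D: "a\<^sup>2 - 4 * b ~= 0"
 shows "locsol (Finite_Place p) a b (of_int d)"
proof (cases "int p dvd d")
 case False then show ?thesis using locsol_multiplicative_unit[OF b(1) a] by blast
next
 case True
 then obtain d' where d': "d = int p * d'" by (elim dvdE)
 obtain b' where b': "b = int p * b'" using b(1) by (elim dvdE)
 have nd: "~ int p dvd d'" "~ int p dvd b'" using b(2) d unfolding d' b' by (auto simp: power2_eq_square)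
 then have "~ int p dvd d' * b'" using prime_dvd_mult_iff[OF prime_int[OF p(1)]] by blast
 then have l: "locsol (Finite_Place p) a b (of_int (d' * b'))" by (rule locsol_multiplicative_unit[OF b(1) a])
 have b0: "b ~= 0" using b(2) by auto
 have nz: "d' * b' ~= 0" using nd by auto
 have "locsol (Finite_Place p) a b (of_int b * of_int (d' * b'))"
  using b0 nz by (intro locsol_mult[OF place_p b0 D _ _ locsol_b[OF b0] l]) (simp_all only: of_int_0_eq_iff not_False_eq_True)
 moreover have "(of_int b * of_int (d' * b') :: rat) = of_int d * (of_int b' * of_int b')" unfolding b' d' by simp
 ultimately have "locsol (Finite_Place p) a b (of_int d * (of_int b' * of_int b'))" by (simp only:)
 moreover have "(of_int b' :: rat) ~= 0" using nz by simp
 ultimately show ?thesis using locsol_times_square[OF place_p] by blast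
qed

end

text \<open>Being a 2-adic square is far from necessary, but together with positivity of d it is all
  that is asked at 2 and infinity; the index lost is bounded.\<close>

lemma locsol_two: "8 dvd d - 1 ==> locsol (Finite_Place 2) a b (of_int d)"
proof -
 assume d: "8 dvd d - 1"
 have v: "Finite_Place 2\<in>places" by (simp add: places_def)
 obtain x where x: "cauchy_for (padic 2) x" "null_for (padic 2) (\<lambda>n. x n * x n - of_int d)"
  using padic_sqrt_two[OF two_is_prime_nat refl d] by blast
 have "d ~= 0" using d by auto
 then have "(of_int d :: rat) ~= 0" by simp
 then show ?thesis using locsol_square[OF v x(1), of 1] x(2) by simp
qed

lemma locsol_infinite: "d > 0 ==> locsol Infinite_Place a b (of_int d)"
proof -
 assume d: "d > 0"
 have v: "Infinite_Place\<in>places" by (simp add: places_def)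
 obtain x where x: "cauchy Infinite_Place x" "null Infinite_Place (\<lambda>n. x n * x n - of_int d)" using real_sqrt_cauchy[OF d] by blast
 have "(of_int d :: rat) ~= 0" using d by simp
 then show ?thesis using locsol_square[OF v x(1), of 1] x(2) by simp
qed

section \<open>Comparing the two Selmer groups\<close>

abbreviation symd :: "'a set => 'a set => 'a set" where "symd A B \<equiv> (A - B) \<union> (B - A)"

lemma prod_symd:
 fixes f :: "'a => 'b::comm_monoid_mult"
 assumes "finite A" "finite B"
 shows "(\<Prod>x\<in>A. f x) * (\<Prod>x\<in>B. f x) = (\<Prod>x\<in>symd A B. f x) * ((\<Prod>x\<in>A \<inter> B. f x) * (\<Prod>x\<in>A \<inter> B. f x))"
proof -
 have "(\<Prod>x\<in>symd A B. f x) = (\<Prod>x\<in>A - B. f x) * (\<Prod>x\<in>B - A. f x)"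
  by (rule prod.union_disjoint) (use assms in auto)
 moreover have "(\<Prod>x\<in>A. f x) = (\<Prod>x\<in>A - B. f x) * (\<Prod>x\<in>A \<inter> B. f x)"
  by (rule prod.Int_Diff[OF assms(1), of f B, unfolded mult.commute[of "prod f (A \<inter> B)"]])
 moreover have "(\<Prod>x\<in>B. f x) = (\<Prod>x\<in>B - A. f x) * (\<Prod>x\<in>A \<inter> B. f x)"
  using prod.Int_Diff[OF assms(2), of f A] by (simp add: Int_commute mult.commute)
 ultimately show ?thesis by (simp add: ac_simps)
qed

lemma symd_cancel: "symd D E = symd D' E ==> D = D'" by blast

text \<open>\<open>V\<close> is an F_2-subspace of \<open>Pow U\<close>. Translation by a member
  containing x exchanges the members with and without x.\<close>

lemma card_power_of_two:
 assumes "finite U" "V \<subseteq> Pow U" "{} \<in> V" "\<And>D D'. D\<in>V ==> D'\<in>V ==> symd D D'\<in>V"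
 shows "\<exists>k. card V = 2 ^ k" using assms
proof (induction U arbitrary: V rule: finite_induct)
 case empty
 then have "V = {{}}" by auto
 then show ?case by (intro exI[of _ 0]) simp
next
 case (insert x U)
 define V0 where "V0 = {D\<in>V. x\<notin>D}"
 have "V0 \<subseteq> Pow U" "{} \<in> V0" using insert.prems by (auto simp: V0_def)
 moreover have "symd D D'\<in>V0" if "D\<in>V0" "D'\<in>V0" for D D' using insert.prems(3)[of D D'] that by (auto simp: V0_def)
 ultimately obtain k where k: "card V0 = 2 ^ k" using insert.IH[of V0] by blast
 show ?case
 proof (cases "V0 = V")
  case True then show ?thesis using k by blast
 next
  case False
  then obtain E where E: "E\<in>V" "x\<in>E" by (auto simp: V0_def)
  have "bij_betw (\<lambda>D. symd D E) V0 (V - V0)"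
  proof (rule bij_betw_byWitness[of _ "\<lambda>D. symd D E"])
   show "\<forall>D\<in>V0. symd (symd D E) E = D" "\<forall>D\<in>V - V0. symd (symd D E) E = D" by blast+
   show "(\<lambda>D. symd D E) ` V0 \<subseteq> V - V0" "(\<lambda>D. symd D E) ` (V - V0) \<subseteq> V0"
    using insert.prems(3)[OF _ E(1)] E(2) unfolding V0_def by auto
  qed
  then have c: "card (V - V0) = card V0" by (simp add: bij_betw_same_card)
  have fin: "finite V" using insert.hyps(1) insert.prems(1) by (meson finite.insertI finite_Pow_iff finite_subset)
  have "V0 \<subseteq> V" by (auto simp: V0_def)
  then have "card V = card V0 + card (V - V0)" using fin by (metis card_Diff_subset card_mono finite_subset le_add_diff_inverse)
  then show ?thesis using c k by (intro exI[of _ "Suc k"]) simp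
 qed
qed

lemma card_le_fibers:
 assumes "finite B" "f ` A \<subseteq> B" "\<And>b. b\<in>B ==> card {a\<in>A. f a = b} <= n"
 shows "card A <= card B * n"
proof -
 have "A = (\<Union>b\<in>B. {a\<in>A. f a = b})" using assms(2) by blast
 then have "card A = card (\<Union>b\<in>B. {a\<in>A. f a = b})" by simp
 also have "\<dots> <= (\<Sum>b\<in>B. card {a\<in>A. f a = b})" by (rule card_UN_le[OF assms(1)])
 also have "\<dots> <= card B * n" using sum_bounded_above[of B "\<lambda>b. card {a\<in>A. f a = b}" n] assms(3) by simp
 finally show ?thesis .
qed

text \<open>An index bound in counting form: elements of one fibre differ by members of
  \<open>V\<close>, so translation by one of them embeds the fibre into \<open>V\<close>.\<close>

lemma card_le_symd_fibers:
 assumes "finite T" "f ` S \<subseteq> T" "finite V" "\<And>D E. D\<in>S ==> E\<in>S ==> f D = f E ==> symd D E\<in>V"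
 shows "card S <= card T * card V"
proof (rule card_le_fibers[OF assms(1,2)])
 fix t
 show "card {D\<in>S. f D = t} <= card V"
 proof (cases "{D\<in>S. f D = t} = {}")
  case True
  then show ?thesis by (simp only: card.empty le0)
 next
  case False
  then obtain E where "E\<in>S" "f E = t" by blast
  then have "(\<lambda>D. symd D E) ` {D\<in>S. f D = t} \<subseteq> V" using assms(4) by (intro image_subsetI) simp
  moreover have "inj_on (\<lambda>D. symd D E) {D\<in>S. f D = t}" by (rule inj_onI) (rule symd_cancel)
  ultimately show ?thesis using card_inj_on_le assms(3) by blast
 qed
qed

lemma sum_Pow_prod:
 fixes g :: "'a => 'b::comm_semiring_1"
 assumes "finite P" shows "(\<Sum>D\<in>Pow P. \<Prod>p\<in>D. g p) = (\<Prod>p\<in>P. 1 + g p)" using assms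
proof (induction P rule: finite_induct)
 case (insert x P)
 have inj: "inj_on (insert x) (Pow P)" using insert.hyps by (auto simp: inj_on_def)
 have "(\<Sum>D\<in>Pow (insert x P). \<Prod>p\<in>D. g p) = (\<Sum>D\<in>Pow P. \<Prod>p\<in>D. g p) + (\<Sum>D\<in>insert x ` Pow P. \<Prod>p\<in>D. g p)"
  unfolding Pow_insert by (rule sum.union_disjoint) (use insert.hyps in auto)
 also have "(\<Sum>D\<in>insert x ` Pow P. \<Prod>p\<in>D. g p) = (\<Sum>D\<in>Pow P. g x * (\<Prod>p\<in>D. g p))"
  unfolding sum.reindex[OF inj] o_def
 proof (rule sum.cong[OF refl])
  fix D assume "D\<in>Pow P"
  then have "finite D" "x\<notin>D" using insert.hyps finite_subset by auto
  then show "(\<Prod>p\<in>insert x D. g p) = g x * (\<Prod>p\<in>D. g p)" by simp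
 qed
 finally show ?case using insert by (simp add: sum_distrib_left[symmetric] distrib_right)
qed simp

text \<open>Both sides count the pairs \<open>(D, D')\<close> weighted by \<open>\<Prod>q\<in>D. \<Prod>p\<in>D'. h q p\<close>.\<close>

lemma card_character_kernels:
 fixes h :: "'a => 'b => int"
 assumes fin: "finite P" "finite Q" and h: "\<And>q p. q\<in>Q ==> p\<in>P ==> h q p = 1 \<or> h q p = - 1"
 shows "2 ^ card P * card {D\<in>Pow Q. \<forall>p\<in>P. (\<Prod>q\<in>D. h q p) = 1} =
  2 ^ card Q * card {D\<in>Pow P. \<forall>q\<in>Q. (\<Prod>p\<in>D. h q p) = 1}"
proof -
 have count: "(\<Sum>D\<in>Pow Q. \<Sum>D'\<in>Pow P. \<Prod>p\<in>D'. \<Prod>q\<in>D. h q p) = 2 ^ card P * int (card {D\<in>Pow Q. \<forall>p\<in>P. (\<Prod>q\<in>D. h q p) = 1})"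
  if fin: "finite P" "finite Q" and h: "\<And>q p. q\<in>Q ==> p\<in>P ==> h q p = 1 \<or> h q p = - 1"
  for P :: "'c set" and Q :: "'d set" and h :: "'d => 'c => int"
 proof -
  have pm: "(\<Prod>q\<in>D. h q p) = 1 \<or> (\<Prod>q\<in>D. h q p) = - 1" if "D \<subseteq> Q" "p\<in>P" for D p
   using finite_subset[OF that(1) fin(2)] that(1)
  proof (induction D rule: finite_induct)
   case (insert q D) then show ?case using h[of q p] that(2) by auto
  qed simp
  \<comment> \<open>Orthogonality: the sum over D' factors into terms 1 + (the value at p), and a
    single value -1 makes the product vanish.\<close>
  have one: "(\<Sum>D'\<in>Pow P. \<Prod>p\<in>D'. \<Prod>q\<in>D. h q p) = (if \<forall>p\<in>P. (\<Prod>q\<in>D. h q p) = 1 then 2 ^ card P else 0)" if D: "D\<in>Pow Q" for D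
  proof (cases "\<forall>p\<in>P. (\<Prod>q\<in>D. h q p) = 1")
   case True
   then show ?thesis unfolding sum_Pow_prod[OF fin(1)] by simp
  next
   case False
   then obtain p where "p\<in>P" "(\<Prod>q\<in>D. h q p) = - 1" using pm[of D] D by auto
   then have "1 + (\<Prod>q\<in>D. h q p) = 0" by linarith
   with \<open>p\<in>P\<close> have "(\<Prod>p\<in>P. 1 + (\<Prod>q\<in>D. h q p)) = 0" by (intro prod_zero[OF fin(1)]) blast
   then show ?thesis unfolding sum_Pow_prod[OF fin(1)] using False by (simp only: if_False)
  qed
  have "(\<Sum>D\<in>Pow Q. \<Sum>D'\<in>Pow P. \<Prod>p\<in>D'. \<Prod>q\<in>D. h q p) = (\<Sum>D\<in>Pow Q. if \<forall>p\<in>P. (\<Prod>q\<in>D. h q p) = 1 then 2 ^ card P else 0)"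
   by (rule sum.cong[OF refl one])
  also have "\<dots> = (\<Sum>D\<in>{D\<in>Pow Q. \<forall>p\<in>P. (\<Prod>q\<in>D. h q p) = 1}. 2 ^ card P)"
   by (rule sum.inter_filter[symmetric]) (use fin in simp)
  also have "\<dots> = 2 ^ card P * int (card {D\<in>Pow Q. \<forall>p\<in>P. (\<Prod>q\<in>D. h q p) = 1})" by simp
  finally show ?thesis .
 qed
 have "2 ^ card P * int (card {D\<in>Pow Q. \<forall>p\<in>P. (\<Prod>q\<in>D. h q p) = 1}) = (\<Sum>D\<in>Pow Q. \<Sum>D'\<in>Pow P. \<Prod>p\<in>D'. \<Prod>q\<in>D. h q p)"
  using count[OF fin h] by simp
 also have "\<dots> = (\<Sum>D'\<in>Pow P. \<Sum>D\<in>Pow Q. \<Prod>q\<in>D. \<Prod>p\<in>D'. h q p)"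
  by (subst sum.swap) (intro sum.cong[OF refl] prod.swap)
 also have "\<dots> = 2 ^ card Q * int (card {D\<in>Pow P. \<forall>q\<in>Q. (\<Prod>p\<in>D. h q p) = 1})"
  using count[OF fin(2,1), of "\<lambda>p q. h q p"] h by blast
 finally have "int (2 ^ card P * card {D\<in>Pow Q. \<forall>p\<in>P. (\<Prod>q\<in>D. h q p) = 1}) = int (2 ^ card Q * card {D\<in>Pow P. \<forall>q\<in>Q. (\<Prod>p\<in>D. h q p) = 1})"
  by simp
 then show ?thesis by (simp only: of_nat_eq_iff)
qed

section \<open>Legendre symbols and reciprocity\<close>

definition odd_prime :: "int => bool" where "odd_prime p \<longleftrightarrow> prime p & odd p"

lemma odd_prime_nat:
 assumes "odd_prime p" obtains q where "p = int q" "prime q" "odd q"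
proof -
 have "p >= 0" using assms prime_ge_0_int by (auto simp: odd_prime_def)
 then have e: "p = int (nat p)" by simp
 have "prime (nat p)" using assms prime_int_nat_transfer[of p] unfolding odd_prime_def by blast
 moreover have "odd (nat p)" using assms \<open>p >= 0\<close> unfolding odd_prime_def by (simp add: even_nat_iff)
 ultimately show ?thesis by (rule that[OF e])
qed

lemma odd_prime_gt_2: "odd_prime p ==> p > 2" using prime_ge_2_int[of p] unfolding odd_prime_def by (cases "p = 2") auto

lemma Legendre_mult_odd_prime: "odd_prime p ==> Legendre (x * y) p = Legendre x p * Legendre y p"
 by (elim odd_prime_nat) (simp add: Legendre_mult)

lemma Legendre_one: "odd_prime p ==> Legendre 1 p = 1" by (elim odd_prime_nat) (auto simp: Legendre_1_iff QuadRes_iff intro: exI[of _ 1])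

lemma Legendre_prod:
 assumes "odd_prime p" shows "Legendre (\<Prod>x\<in>D. f x) p = (\<Prod>x\<in>D. Legendre (f x) p)"
 by (induction D rule: infinite_finite_induct) (simp_all add: Legendre_one[OF assms] Legendre_mult_odd_prime[OF assms])

lemma Legendre_eq_0_iff: "Legendre x p = 0 \<longleftrightarrow> p dvd x" by (simp add: Legendre_def cong_0_iff)

lemma Legendre_cases: "~ p dvd x ==> Legendre x p = 1 \<or> Legendre x p = - 1" by (simp add: Legendre_def cong_0_iff)

lemma Legendre_square: "~ p dvd x ==> odd_prime p ==> Legendre (x * x) p = 1"
 using Legendre_cases[of p x] by (auto simp: Legendre_mult_odd_prime)

abbreviation star :: "int => int" where "star q \<equiv> (if q mod 4 = 1 then 1 else - 1)"

text \<open>Quadratic reciprocity without sign: q is replaced by whichever of q and -q is 1 modulo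
  4.\<close>

lemma Legendre_star:
 assumes p: "odd_prime p" and q: "odd_prime q" and pq: "p ~= q"
 shows "Legendre (star q * q) p = Legendre p q"
proof -
 obtain p' where p': "p = int p'" "prime p'" "odd p'" using odd_prime_nat[OF p] .
 obtain q' where q': "q = int q'" "prime q'" "odd q'" using odd_prime_nat[OF q] .
 have g: "2 < p'" "2 < q'" using odd_prime_gt_2[OF p] odd_prime_gt_2[OF q] p'(1) q'(1) by auto
 have ndvd: "~ p dvd q" "~ q dvd p" using p q pq unfolding odd_prime_def by (metis primes_dvd_imp_eq)+
 have qr: "Legendre p q * Legendre q p = (- 1) ^ ((p' - 1) div 2 * ((q' - 1) div 2))"
  using Quadratic_Reciprocity[OF p'(2) g(1) q'(2) g(2)] pq p'(1) q'(1) by simp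
 have m1: "Legendre (- 1) p = (- 1) ^ ((p' - 1) div 2)"
 proof -
  have d: "p dvd Legendre (- 1) p - (- 1) ^ ((p' - 1) div 2)"
   using euler_criterion[OF p'(2) g(1), of "- 1"] p'(1) by (simp add: cong_iff_dvd_diff)
  have "\<bar>Legendre (- 1) p\<bar> <= 1" by (simp add: Legendre_def)
  moreover have "\<bar>(- 1 :: int) ^ ((p' - 1) div 2)\<bar> = 1" by (simp add: power_abs)
  ultimately show ?thesis using dvd_imp_le_int[OF _ d] odd_prime_gt_2[OF p] by linarith
 qed
 have c: "Legendre p q = 1 \<or> Legendre p q = - 1" "Legendre q p = 1 \<or> Legendre q p = - 1" using Legendre_cases ndvd by auto
 show ?thesis
 proof (cases "q mod 4 = 1")
  case True
  then have "q' mod 4 = 1" using q'(1) by presburger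
  then have "even ((q' - 1) div 2)" by presburger
  then have "Legendre p q * Legendre q p = 1" unfolding qr by simp
  then show ?thesis using True c by auto
 next
  case False
  then have "q' mod 4 = 3" using q'(1,3) by presburger
  then have "odd ((q' - 1) div 2)" by presburger
  then have "Legendre p q * Legendre q p = Legendre (- 1) p" unfolding qr m1 by (simp add: minus_one_power_iff)
  moreover have "Legendre (- q) p = Legendre (- 1) p * Legendre q p" using Legendre_mult_odd_prime[OF p, of "- 1" q] by simp
  ultimately show ?thesis using False c by auto
 qed
qed

text \<open>Modulo 4 each \<open>star q\<close> equals q, so the signs multiply to the product of
  the set. This makes the reciprocity twist invisible on sets whose product is 1 modulo 8.\<close>

lemma star_prod:
 assumes "finite D" "\<And>q. q\<in>D ==> odd q" "8 dvd \<Prod>D - 1" shows "(\<Prod>q\<in>D. star q) = 1"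
proof -
 have "[\<Prod>D = (\<Prod>q\<in>D. star q)] (mod 4)"
 proof (rule cong_prod)
  fix q assume "q\<in>D"
  then have "odd q" by (rule assms(2))
  show "[q = star q] (mod 4)"
  proof (cases "q mod 4 = 1")
   case False
   then have "q mod 4 = 3" using \<open>odd q\<close> by presburger
   then show ?thesis by (simp add: cong_def)
  qed (simp add: cong_def)
 qed
 then have d1: "4 dvd \<Prod>D - (\<Prod>q\<in>D. star q)" by (simp only: cong_iff_dvd_diff)
 have d2: "4 dvd \<Prod>D - 1" using assms(3) by (rule dvd_trans[rotated]) simp
 have d: "4 dvd (\<Prod>q\<in>D. star q) - 1" using dvd_diff[OF d2 d1] by simp
 have "(\<Prod>q\<in>D. star q) = 1 \<or> (\<Prod>q\<in>D. star q) = - 1" using assms(1) by (induction D rule: finite_induct) auto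
 then show ?thesis using d by auto
qed

section \<open>Both Selmer groups up to bounded index\<close>

definition mult_primes :: "int => int => int set" where
 "mult_primes a b = {p. odd_prime p & p dvd b & ~ p\<^sup>2 dvd b & ~ p dvd a}"

definition other_primes :: "int => int => int set" where
 "other_primes a b = {p. odd_prime p & p dvd b * (a\<^sup>2 - 4 * b)} - mult_primes a b - mult_primes a (a\<^sup>2 - 4 * b)"

lemma finite_odd_primes: "n ~= 0 ==> finite {p. odd_prime p & p dvd n}"
 using finite_divisors_int[of n] by (rule finite_subset[rotated]) (auto simp: odd_prime_def)

text \<open>At the primes of \<open>Ev\<close> every squarefree d is locally soluble, at those of
  \<open>Tr\<close> d must be a unit square, and at \<open>Ot\<close> the local condition is left
  open. Passing to the other isogeny exchanges \<open>Ev\<close> and \<open>Tr\<close>.\<close>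

locale selmer_bound =
 fixes a b :: int assumes b0: "b ~= 0" and D0: "a\<^sup>2 - 4 * b ~= 0"
begin

abbreviation "Ev \<equiv> mult_primes a b"
abbreviation "Tr \<equiv> mult_primes a (a\<^sup>2 - 4 * b)"
abbreviation "Ot \<equiv> other_primes a b"

lemma finite_sets: "finite Ev" "finite Tr" "finite Ot"
proof -
 have "finite {p. odd_prime p & p dvd b * (a\<^sup>2 - 4 * b)}" using b0 D0 by (intro finite_odd_primes) simp
 then show "finite Ev" "finite Tr" "finite Ot" by (auto simp: mult_primes_def other_primes_def elim: finite_subset[rotated])
qed

lemma Ev_Tr: "Ev \<inter> Tr = {}"
proof -
 have False if "odd_prime p" "p dvd b" "p dvd a\<^sup>2 - 4 * b" "~ p dvd a" for p
 proof -
  have "p dvd a\<^sup>2" using that(2,3) by (simp add: dvd_diff_left_iff)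
  then show False using that(1,4) prime_dvd_power[of p a 2] by (simp add: odd_prime_def)
 qed
 then show ?thesis by (auto simp: mult_primes_def)
qed

lemma sqf_square_free:
 assumes D: "D\<in>sqf_sets" and p: "prime p" shows "~ p\<^sup>2 dvd \<Prod>D" "p dvd \<Prod>D \<longleftrightarrow> p\<in>D"
proof -
 have nu: "~ is_unit p" using p not_prime_unit by blast
 have m: "multiplicity p (\<Prod>D) = (if p\<in>D then 1 else 0)" by (rule sqf_sets_prod(2)[OF D p])
 have "p ^ n dvd \<Prod>D \<longleftrightarrow> n <= multiplicity p (\<Prod>D)" for n
  by (rule power_dvd_iff_le_multiplicity[OF sqf_sets_prod(1)[OF D] nu])
 from this[of 2] this[of 1] show "~ p\<^sup>2 dvd \<Prod>D" "p dvd \<Prod>D \<longleftrightarrow> p\<in>D" unfolding m by auto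
qed

text \<open>These necessary conditions and the sufficient ones of \<open>sel_intro\<close> differ
  only in what they say about the sign, the prime 2 and the primes in \<open>Ot\<close>.\<close>

lemma sel_subset:
 assumes D: "D\<in>sel a b"
 shows "D \<subseteq> {- 1, 2} \<union> Ot \<union> Ev" "p\<in>Tr ==> Legendre (\<Prod>D) p = 1"
proof -
 have sq: "D\<in>sqf_sets" and l: "\<And>v. v\<in>places ==> locsol v a b (of_int (\<Prod>D))" using D by (auto simp: sel_def)
 show tr: "Legendre (\<Prod>D) p = 1" if p: "p\<in>Tr" for p
 proof -
  have op: "odd_prime p" and h: "p dvd a\<^sup>2 - 4 * b" "~ p\<^sup>2 dvd a\<^sup>2 - 4 * b" "~ p dvd a" using p by (auto simp: mult_primes_def)
  obtain q where q: "p = int q" "prime q" "odd q" using odd_prime_nat[OF op] .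
  have "~ p\<^sup>2 dvd \<Prod>D" using sqf_square_free(1)[OF sq] op by (simp add: odd_prime_def)
  then show ?thesis using locsol_imp_QuadRes[OF q(2,3) h[unfolded q(1)] _ l[OF place[OF q(2)]]]
   by (simp add: Legendre_1_iff[OF q(2,3)] q(1))
 qed
 show "D \<subseteq> {- 1, 2} \<union> Ot \<union> Ev"
 proof
  fix p assume p: "p\<in>D"
  show "p\<in>{- 1, 2} \<union> Ot \<union> Ev"
  proof (cases "p = - 1 \<or> p = 2")
   case False
   then have pp: "prime p" using p sq by (auto simp: sqf_sets_def)
   then have op: "odd_prime p" using False primes_dvd_imp_eq[of 2 p] by (auto simp: odd_prime_def)
   obtain q where q: "p = int q" "prime q" "odd q" using odd_prime_nat[OF op] .
   have d: "p dvd \<Prod>D" "~ p\<^sup>2 dvd \<Prod>D" using sqf_square_free[OF sq pp] p by auto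
   have "p dvd b" using not_locsol_good[OF q(2) _ d[unfolded q(1)], of b a] l[OF place[OF q(2)]] q(1) by blast
   moreover have "p\<notin>Tr" using tr[of p] d(1) Legendre_eq_0_iff[of "\<Prod>D" p] by auto
   ultimately show ?thesis using op by (auto simp: other_primes_def)
  qed auto
 qed
qed

lemma sel_intro:
 assumes D: "D \<subseteq> Ev" "8 dvd \<Prod>D - 1" "\<And>p. p\<in>Tr \<union> Ot ==> Legendre (\<Prod>D) p = 1"
 shows "D\<in>sel a b"
proof -
 have fin: "finite D" using D(1) finite_sets finite_subset by blast
 have sq: "D\<in>sqf_sets" using D(1) fin by (auto simp: sqf_sets_def mult_primes_def odd_prime_def)
 have pos: "\<Prod>D > 0" using D(1) by (intro prod_pos) (auto simp: mult_primes_def odd_prime_def prime_gt_0_int)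
 have "locsol v a b (of_int (\<Prod>D))" if v: "v\<in>places" for v
 proof (cases v)
  case Infinite_Place then show ?thesis using locsol_infinite[OF pos] by simp
 next
  case (Finite_Place q)
  then have q: "prime q" using v by (auto simp: places_def)
  show ?thesis
  proof (cases "q = 2")
   case True then show ?thesis using locsol_two[OF D(2)] Finite_Place by simp
  next
   case False
   then have oq: "odd q" using q primes_dvd_imp_eq[of 2 q] by auto
   have op: "odd_prime (int q)" using q oq by (simp add: odd_prime_def)
   have nd: "~ (int q)\<^sup>2 dvd \<Prod>D" using sqf_square_free(1)[OF sq] op by (simp add: odd_prime_def)
   consider "int q\<in>Ev" | "int q\<in>Tr \<union> Ot" | "~ int q dvd b * (a\<^sup>2 - 4 * b)" "int q\<notin>Ev"
    using op by (auto simp: other_primes_def)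
   then show ?thesis
   proof cases
    case 1
    then show ?thesis unfolding Finite_Place mult_primes_def using locsol_multiplicative[OF q oq _ _ _ nd D0] by blast
   next
    case 2
    from D(3)[OF this] show ?thesis unfolding Finite_Place Legendre_1_iff[OF q oq] using locsol_QuadRes[OF q oq] by blast
   next
    case 3
    have "int q\<notin>D" using 3 D(1) by blast
    then have "~ int q dvd \<Prod>D" using sqf_square_free(2)[OF sq] op by (simp add: odd_prime_def)
    moreover have "~ int q dvd b" "~ int q dvd a\<^sup>2 - 4 * b" using 3(1) by auto
    ultimately show ?thesis unfolding Finite_Place by (intro locsol_good[OF q oq])
   qed
  qed
 qed
 then show ?thesis using sq by (simp add: sel_def)
qed

lemma sel_symd: assumes "D\<in>sel a b" "D'\<in>sel a b" shows "symd D D'\<in>sel a b"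
proof -
 have sq: "D\<in>sqf_sets" "D'\<in>sqf_sets" and l: "\<And>v. v\<in>places ==> locsol v a b (of_int (\<Prod>D))" "\<And>v. v\<in>places ==> locsol v a b (of_int (\<Prod>D'))"
  using assms by (auto simp: sel_def)
 have fin: "finite D" "finite D'" using sq by (auto simp: sqf_sets_def)
 have nz: "\<Prod>D ~= 0" "\<Prod>D' ~= 0" using sqf_sets_prod(1) sq by auto
 have sq2: "symd D D'\<in>sqf_sets" using sq by (auto simp: sqf_sets_def)
 define k where "k = \<Prod>(D \<inter> D')"
 have e: "\<Prod>D * \<Prod>D' = \<Prod>(symd D D') * (k * k)" using prod_symd[OF fin, of "\<lambda>x. x"] by (simp add: k_def)
 have k0: "k ~= 0" using nz e by auto
 have "locsol v a b (of_int (\<Prod>(symd D D')))" if v: "v\<in>places" for v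
 proof -
  have "locsol v a b (of_int (\<Prod>D) * of_int (\<Prod>D'))"
   using nz by (intro locsol_mult[OF v b0 D0 _ _ l(1)[OF v] l(2)[OF v]]) (simp_all only: of_int_0_eq_iff not_False_eq_True)
  moreover have "(of_int (\<Prod>D) * of_int (\<Prod>D') :: rat) = of_int (\<Prod>(symd D D')) * (of_int k * of_int k)"
   unfolding of_int_mult[symmetric] e ..
  ultimately have "locsol v a b (of_int (\<Prod>(symd D D')) * (of_int k * of_int k))" by (simp only:)
  moreover have "(of_int k :: rat) ~= 0" using k0 by simp
  ultimately show ?thesis using locsol_times_square[OF v] by blast
 qed
 then show ?thesis using sq2 by (simp add: sel_def)
qed

lemma finite_sel: "finite (sel a b)"
 by (rule finite_subset[of _ "Pow ({- 1, 2} \<union> Ot \<union> Ev)"]) (use sel_subset(1) finite_sets in auto)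

lemma card_sel_power: "\<exists>k. card (sel a b) = 2 ^ k"
proof (rule card_power_of_two)
 show "finite ({- 1, 2} \<union> Ot \<union> Ev)" using finite_sets by simp
 show "sel a b \<subseteq> Pow ({- 1, 2} \<union> Ot \<union> Ev)" using sel_subset(1) by blast
 show "{} \<in> sel a b" by (rule sel_intro) (auto simp: Legendre_one mult_primes_def other_primes_def)
qed (rule sel_symd)

lemma Legendre_symd:
 assumes p: "odd_prime p" and D: "finite D" "finite D'" and L: "Legendre (\<Prod>D) p * Legendre (\<Prod>D') p = 1"
 shows "Legendre (\<Prod>(symd D D')) p = 1"
proof -
 define k where "k = \<Prod>(D \<inter> D')"
 have "\<Prod>D * \<Prod>D' = \<Prod>(symd D D') * (k * k)" using prod_symd[OF D, of "\<lambda>x. x"] by (simp add: k_def)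
 then have e: "Legendre (\<Prod>(symd D D')) p * Legendre (k * k) p = 1"
  using L Legendre_mult_odd_prime[OF p, of "\<Prod>(symd D D')" "k * k"] Legendre_mult_odd_prime[OF p, of "\<Prod>D" "\<Prod>D'"] by simp
 then have "~ p dvd k" using Legendre_eq_0_iff[of "k * k" p] by auto
 then show ?thesis using e Legendre_square[OF _ p] by simp
qed

text \<open>\<open>S\<close> is the kernel of the matrix of symbols of f(q) q at the primes of
  \<open>Tr\<close>. For each bound, one group is mapped to invariants such that elements with equal
  invariants differ by a member of the other: the part at -1, 2 and \<open>Ot\<close> with the sign
  of the twist in one direction, the product modulo 8 with the symbols at \<open>Ot\<close> in the
  other. Either way there are at most 2^(card Ot + 3) values.\<close>

lemma sel_card_bounds:
 fixes f :: "int => int"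
 assumes f: "\<And>q. f q = 1 \<or> f q = - 1" and f8: "\<And>D. D \<subseteq> Ev ==> 8 dvd \<Prod>D - 1 ==> (\<Prod>q\<in>D. f q) = 1"
 defines "S \<equiv> {D\<in>Pow Ev. \<forall>p\<in>Tr. (\<Prod>q\<in>D. Legendre (f q * q) p) = 1}"
 shows "card (sel a b) <= 2 ^ (card Ot + 3) * card S" "card S <= 2 ^ (card Ot + 3) * card (sel a b)"
proof -
 have fin: "finite D" if "D \<subseteq> Ev" for D using that finite_sets(1) finite_subset by blast
 have opTr: "odd_prime p" if "p\<in>Tr \<union> Ot" for p using that by (auto simp: mult_primes_def other_primes_def)
 have fpm: "(\<Prod>q\<in>D. f q) = 1 \<or> (\<Prod>q\<in>D. f q) = - 1" for D
  by (induction D rule: infinite_finite_induct) (use f in force)+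
 have twist: "(\<Prod>q\<in>D. Legendre (f q * q) p) = Legendre (\<Prod>q\<in>D. f q) p * Legendre (\<Prod>D) p" if "odd_prime p" for p D
  by (simp add: Legendre_prod[OF that] Legendre_mult_odd_prime[OF that] prod.distrib)
 let ?B = "{- 1, 2} \<union> Ot"
 let ?T = "Pow ?B \<times> {1, - 1 :: int}"
 have sel_fin: "finite D" if "D\<in>sel a b" for D using that by (auto simp: sel_def sqf_sets_def)
 have finS: "finite S" using finite_sets(1) by (auto simp: S_def)
 have disj: "?B \<inter> Ev = {}" by (auto simp: other_primes_def mult_primes_def odd_prime_def)
 have "card (sel a b) <= card ?T * card S"
 proof (rule card_le_symd_fibers[where f = "\<lambda>D. (D \<inter> ?B, \<Prod>q\<in>D \<inter> Ev. f q)"])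
  show "finite ?T" using finite_sets by simp
  show "(\<lambda>D. (D \<inter> ?B, \<Prod>q\<in>D \<inter> Ev. f q)) ` sel a b \<subseteq> ?T" using fpm by auto
  fix D E assume ds0: "D\<in>sel a b" "E\<in>sel a b" "(D \<inter> ?B, \<Prod>q\<in>D \<inter> Ev. f q) = (E \<inter> ?B, \<Prod>q\<in>E \<inter> Ev. f q)"
  then have ds: "D\<in>sel a b" "E\<in>sel a b" "D \<inter> ?B = E \<inter> ?B" "(\<Prod>q\<in>D \<inter> Ev. f q) = (\<Prod>q\<in>E \<inter> Ev. f q)" by simp_all
  define D' where "D' = symd D E"
  note D = ds(1) D'_def
    have sub: "D' \<subseteq> Ev" using sel_subset(1)[OF ds(1)] sel_subset(1)[OF ds(2)] ds(3) unfolding D(2) by blast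
    have D'e: "D' = symd (D \<inter> Ev) (E \<inter> Ev)" using sub unfolding D(2) by blast
    \<comment> \<open>Equal twist signs cancel in the symmetric difference, so for it the twisted
      and the plain symbols coincide.\<close>
    have ff: "(\<Prod>q\<in>D'. f q) = 1"
    proof -
     have "(\<Prod>q\<in>D \<inter> Ev. f q) * (\<Prod>q\<in>E \<inter> Ev. f q) = (\<Prod>q\<in>D'. f q) * ((\<Prod>q\<in>(D \<inter> Ev) \<inter> (E \<inter> Ev). f q) * (\<Prod>q\<in>(D \<inter> Ev) \<inter> (E \<inter> Ev). f q))"
      unfolding D'e by (rule prod_symd) (use finite_sets(1) in auto)
     then show ?thesis using fpm[of "D \<inter> Ev"] fpm[of "(D \<inter> Ev) \<inter> (E \<inter> Ev)"] ds(4) by auto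
    qed
    have "(\<Prod>q\<in>D'. Legendre (f q * q) p) = 1" if p: "p\<in>Tr" for p
    proof -
     have op: "odd_prime p" using opTr p by blast
     have "Legendre (\<Prod>D') p = 1" unfolding D(2) by (rule Legendre_symd[OF op]) (use ds sel_fin sel_subset(2)[OF _ p] in auto)
     then show ?thesis unfolding twist[OF op] ff by (simp add: Legendre_one[OF op])
    qed
    then show "symd D E\<in>S" using sub unfolding D(2) by (simp add: S_def)
 qed (rule finS)
 also have "card ?T = 2 ^ card ?B * 2" using finite_sets(3) by (simp add: card_cartesian_product card_Pow)
 also have "\<dots> * card S <= 2 ^ (card Ot + 3) * card S"
 proof -
  have "card ?B <= card {- 1, 2 :: int} + card Ot" by (rule card_Un_le)
  then have "card ?B <= card Ot + 2" by simp
  then have "(2::nat) ^ card ?B <= 2 ^ (card Ot + 2)" by (intro power_increasing) auto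
  then show ?thesis by (intro mult_right_mono) (simp_all add: power_add)
 qed
 finally show "card (sel a b) <= 2 ^ (card Ot + 3) * card S" .
 let ?g = "\<lambda>D. (\<Prod>D mod 8, {p\<in>Ot. Legendre (\<Prod>D) p = 1})"
 let ?T2 = "{0..<8::int} \<times> Pow Ot"
 have "card S <= card ?T2 * card (sel a b)"
 proof (rule card_le_symd_fibers[where f = ?g])
  show "finite ?T2" using finite_sets by simp
  show "?g ` S \<subseteq> ?T2" by auto
  fix D E assume "D\<in>S" "E\<in>S" "?g D = ?g E"
  then have ds: "D \<subseteq> Ev" "E \<subseteq> Ev" "D\<in>S" "E\<in>S" "\<Prod>D mod 8 = \<Prod>E mod 8"
   and dL: "{p\<in>Ot. Legendre (\<Prod>D) p = 1} = {p\<in>Ot. Legendre (\<Prod>E) p = 1}" by (auto simp: S_def)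
  define D' where "D' = symd D E"
  note D = ds(1) D'_def
    have sub: "D' \<subseteq> Ev" using ds unfolding D(2) by blast
    have oddP: "odd (\<Prod>A)" if "A \<subseteq> Ev" for A
     using fin[OF that] that by (induction A rule: finite_induct) (auto simp: mult_primes_def odd_prime_def)
    define k where "k = \<Prod>(D \<inter> E)"
    have e: "\<Prod>D * \<Prod>E = \<Prod>D' * (k * k)" unfolding D(2) k_def by (rule prod_symd[OF fin[OF ds(1)] fin[OF ds(2)]])
    have k8: "8 dvd x * x - 1" if ox: "odd x" for x :: int
    proof -
     obtain y where y: "x = 2 * y + 1" using ox by (elim oddE)
     have "even (y * (y + 1))" by simp
     then obtain z where "y * (y + 1) = 2 * z" by (elim evenE)
     then have "x * x - 1 = 8 * z" unfolding y by (simp add: algebra_simps)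
     then show ?thesis by simp
    qed
    have "8 dvd \<Prod>D' - 1"
    proof -
     have "8 dvd \<Prod>D - \<Prod>E" using ds(5) by (simp only: mod_eq_dvd_iff)
     then have 1: "8 dvd (\<Prod>D - \<Prod>E) * \<Prod>E" by (rule dvd_mult2)
     have 2: "8 dvd \<Prod>E * \<Prod>E - 1" by (rule k8[OF oddP[OF ds(2)]])
     have "D \<inter> E \<subseteq> Ev" using ds(1) by blast
     then have "odd k" unfolding k_def by (rule oddP)
     then have 3: "8 dvd \<Prod>D' * (k * k - 1)" by (rule dvd_mult[OF k8])
     have "8 dvd ((\<Prod>D - \<Prod>E) * \<Prod>E + (\<Prod>E * \<Prod>E - 1)) - \<Prod>D' * (k * k - 1)" by (rule dvd_diff[OF dvd_add[OF 1 2] 3])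
     also have "\<dots> = \<Prod>D' - 1" using e by (simp only: left_diff_distrib right_diff_distrib)
     finally show ?thesis .
    qed
    moreover have "Legendre (\<Prod>D') p = 1" if p: "p\<in>Tr \<union> Ot" for p
    proof (rule UnE[OF p])
     assume p: "p\<in>Tr"
     have op: "odd_prime p" using opTr p by blast
     have ff: "(\<Prod>q\<in>D'. f q) = 1" by (rule f8[OF sub \<open>8 dvd \<Prod>D' - 1\<close>])
     let ?h = "\<lambda>A. \<Prod>q\<in>A. Legendre (f q * q) p"
     have "?h D * ?h E = ?h D' * (?h (D \<inter> E) * ?h (D \<inter> E))" unfolding D(2) by (rule prod_symd[OF fin[OF ds(1)] fin[OF ds(2)]])
     moreover have "?h D = 1" "?h E = 1" using ds(3,4) p by (auto simp: S_def)
     ultimately have h1: "?h D' * (?h (D \<inter> E) * ?h (D \<inter> E)) = 1" by simp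
     then have "?h D' dvd 1" by (intro dvdI) (rule sym)
     have "?h D' = 1 \<or> ?h D' = - 1" using \<open>?h D' dvd 1\<close> by (simp add: zdvd1_eq) linarith
     moreover have "u = 1" if "u = 1 \<or> u = - 1" "u * (v * v) = 1" for u v :: int
     proof (rule ccontr)
      assume "u ~= 1"
      then have "u = - 1" using that(1) by blast
      then have "v * v = - 1" using that(2) by simp
      then show False using zero_le_square[of v] by linarith
     qed
     ultimately have "?h D' = 1" using h1 by blast
     then show ?thesis unfolding twist[OF op] ff by (simp add: Legendre_one[OF op])
    next
     assume p: "p\<in>Ot"
     have op: "odd_prime p" using opTr p by blast
     have nd: "~ p dvd \<Prod>A" if sA: "A \<subseteq> Ev" for A
     proof
      assume "p dvd \<Prod>A"
      then obtain q where q: "q\<in>A" "p dvd q" using prime_dvd_prod_iff[OF fin[OF sA], of p "\<lambda>x. x"] op by (auto simp: odd_prime_def)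
      then have "p = q" using sA op primes_dvd_imp_eq[of p q] by (auto simp: mult_primes_def odd_prime_def)
      then show False using q(1) sA p by (auto simp: other_primes_def)
     qed
     have "Legendre (\<Prod>D) p = 1 \<longleftrightarrow> Legendre (\<Prod>E) p = 1" using dL p by blast
     then have "Legendre (\<Prod>D) p = Legendre (\<Prod>E) p"
      using Legendre_cases[OF nd[OF ds(1)]] Legendre_cases[OF nd[OF ds(2)]] by auto
     then have "Legendre (\<Prod>D) p * Legendre (\<Prod>E) p = 1" using Legendre_cases[OF nd[OF ds(2)]] by auto
     then show ?thesis unfolding D(2) by (rule Legendre_symd[OF op fin[OF ds(1)] fin[OF ds(2)]])
    qed
    ultimately show "symd D E\<in>sel a b" unfolding D(2)[symmetric] by (intro sel_intro[OF sub])
 qed (rule finite_sel)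
 also have "card ?T2 = 2 ^ (card Ot + 3)" using finite_sets(3) by (simp add: card_cartesian_product card_Pow power_add)
 finally show "card S <= 2 ^ (card Ot + 3) * card (sel a b)" .
qed

end

lemma rat_ord_two_powers: "rat_ord 2 (of_nat (2 ^ m) / of_nat (2 ^ n)) = int m - int n"
proof -
 have mu: "multiplicity (2::int) (2 ^ k) = k" for k by (rule multiplicity_same_power) auto
 have "rat_ord 2 (of_int (2 ^ m) / of_int (2 ^ n)) = int (multiplicity (int 2) (2 ^ m)) - int (multiplicity (int 2) (2 ^ n))"
  by (rule rat_ord_fraction[OF two_is_prime_nat]) auto
 then show ?thesis using mu by simp
qed

lemma odd_prime_dvd_power_two_mult:
 assumes "odd_prime p" shows "p dvd 2 ^ k * n \<longleftrightarrow> p dvd n" "p\<^sup>2 dvd 2 ^ k * n \<longleftrightarrow> p\<^sup>2 dvd n"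
proof -
 have "coprime p 2" using assms prime_imp_coprime[of p 2] odd_prime_gt_2[OF assms] by (auto simp: odd_prime_def dest: zdvd_imp_le)
 then have "coprime p (2 ^ k)" "coprime (p\<^sup>2) (2 ^ k)" by auto
 then show "p dvd 2 ^ k * n \<longleftrightarrow> p dvd n" "p\<^sup>2 dvd 2 ^ k * n \<longleftrightarrow> p\<^sup>2 dvd n"
  by (simp_all only: coprime_dvd_mult_right_iff)
qed

text \<open>For the isogenous curve the quadratic factor has discriminant 16 B, so at odd primes it
  has the same sets with \<open>Ev\<close> and \<open>Tr\<close> exchanged. Twisting one side only,
  by \<open>star\<close>, makes its matrix the transpose of the other, and
  \<open>card_character_kernels\<close> gives 2^(card P) Z1 = 2^(card Q) Z2. Each of the two
  comparisons costs a factor 2^k.\<close>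

lemma selmer_ratio_bound:
 assumes B0: "B ~= 0" and D0: "A\<^sup>2 - 4 * B ~= 0"
 shows "\<bar>selmer_ratio_ord A B - (int (card (mult_primes A (A\<^sup>2 - 4 * B))) - int (card (mult_primes A B)))\<bar> <= 2 * int (card (other_primes A B)) + 6"
proof -
 define P where "P = mult_primes A B"
 define Q where "Q = mult_primes A (A\<^sup>2 - 4 * B)"
 define k where "k = card (other_primes A B) + 3"
 let ?a = "- 2 * A" and ?b = "A\<^sup>2 - 4 * B"
 have disc: "?a\<^sup>2 - 4 * ?b = 2 ^ 4 * B" by (simp add: power2_eq_square)
 interpret E: selmer_bound A B by unfold_locales (use assms in auto)
 interpret F: selmer_bound ?a ?b by unfold_locales (use assms in "auto simp: disc")
 have two: "p dvd - 2 * A \<longleftrightarrow> p dvd A" if "odd_prime p" for p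
  using odd_prime_dvd_power_two_mult(1)[OF that, of 1 A] by simp
 have Q: "mult_primes ?a ?b = Q" using two by (auto simp: mult_primes_def Q_def)
 have P: "mult_primes ?a (?a\<^sup>2 - 4 * ?b) = P" unfolding disc
  using two odd_prime_dvd_power_two_mult[of _ 4 B] by (auto simp: mult_primes_def P_def)
 have "p dvd ?b * (2 ^ 4 * B) \<longleftrightarrow> p dvd B * ?b" if "odd_prime p" for p
  using odd_prime_dvd_power_two_mult(1)[OF that, of 4 "B * ?b"] by (simp only: ac_simps)
 then have O: "other_primes ?a ?b = other_primes A B" unfolding other_primes_def P Q unfolding disc P_def Q_def by blast
 have op: "odd_prime p" if "p\<in>P \<union> Q" for p using that by (auto simp: P_def Q_def mult_primes_def)
 have PQ: "p ~= q" if "p\<in>P" "q\<in>Q" for p q using E.Ev_Tr that by (auto simp: P_def Q_def)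
 have fin: "finite P" "finite Q" using E.finite_sets by (auto simp: P_def Q_def)
 define Z1 where "Z1 = card {D\<in>Pow Q. \<forall>p\<in>P. (\<Prod>q\<in>D. Legendre (star q * q) p) = 1}"
 define Z2 where "Z2 = card {D\<in>Pow P. \<forall>q\<in>Q. (\<Prod>p\<in>D. Legendre (1 * p) q) = 1}"
 have Z: "2 ^ card P * Z1 = 2 ^ card Q * Z2"
 proof -
  have "2 ^ card P * Z1 = 2 ^ card Q * card {D\<in>Pow P. \<forall>q\<in>Q. (\<Prod>p\<in>D. Legendre (star q * q) p) = 1}"
   unfolding Z1_def
  proof (rule card_character_kernels[OF fin])
   fix q p assume "q\<in>Q" "p\<in>P"
   then have "Legendre (star q * q) p = Legendre p q" "~ q dvd p"
    using Legendre_star[of p q] op PQ primes_dvd_imp_eq[of q p] unfolding odd_prime_def by blast+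
   then show "Legendre (star q * q) p = 1 \<or> Legendre (star q * q) p = - 1" using Legendre_cases by simp
  qed
  also have "{D\<in>Pow P. \<forall>q\<in>Q. (\<Prod>p\<in>D. Legendre (star q * q) p) = 1} = {D\<in>Pow P. \<forall>q\<in>Q. (\<Prod>p\<in>D. Legendre (1 * p) q) = 1}"
  proof (rule Collect_cong)
   fix D
   have "(\<Prod>p\<in>D. Legendre (star q * q) p) = (\<Prod>p\<in>D. Legendre (1 * p) q)" if "D \<subseteq> P" "q\<in>Q" for q
   proof (rule prod.cong[OF refl])
    fix p assume "p\<in>D"
    then have "odd_prime p" "odd_prime q" "p ~= q" using that op PQ by blast+
    then show "Legendre (star q * q) p = Legendre (1 * p) q" unfolding mult_1 by (rule Legendre_star)
   qed
   then show "D\<in>Pow P & (\<forall>q\<in>Q. (\<Prod>p\<in>D. Legendre (star q * q) p) = 1) \<longleftrightarrow> D\<in>Pow P & (\<forall>q\<in>Q. (\<Prod>p\<in>D. Legendre (1 * p) q) = 1)"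
    by (simp only: Pow_iff) (metis (no_types, lifting))
  qed
  finally show ?thesis by (simp add: Z2_def)
 qed
 have st: "(\<Prod>q\<in>D. star q) = 1" if D: "D \<subseteq> mult_primes ?a ?b" "8 dvd \<Prod>D - 1" for D
  by (rule star_prod[OF _ _ D(2)]) (use D(1) F.finite_sets(1) finite_subset in "auto simp: mult_primes_def odd_prime_def")
 have b1: "card (sel ?a ?b) <= 2 ^ k * Z1" "Z1 <= 2 ^ k * card (sel ?a ?b)"
  using F.sel_card_bounds[of star, OF _ st] unfolding P Q O k_def Z1_def by auto
 have b2: "card (sel A B) <= 2 ^ k * Z2" "Z2 <= 2 ^ k * card (sel A B)"
  using E.sel_card_bounds[of "\<lambda>_. 1"] unfolding k_def Z2_def P_def Q_def by auto
 obtain i where i: "card (sel ?a ?b) = 2 ^ i" using F.card_sel_power by blast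
 obtain j where j: "card (sel A B) = 2 ^ j" using E.card_sel_power by blast
 have pow: "x <= y" if "(2::nat) ^ x <= 2 ^ y" for x y using that by simp
 have "2 ^ (i + card P) = card (sel ?a ?b) * 2 ^ card P" by (simp only: i power_add)
 also have "\<dots> <= 2 ^ k * Z1 * 2 ^ card P" using b1(1) by (rule mult_right_mono) simp
 also have "\<dots> = 2 ^ k * (2 ^ card P * Z1)" by simp
 also have "\<dots> <= 2 ^ k * (2 ^ card Q * (2 ^ k * 2 ^ j))" unfolding Z using b2(2) j by simp
 also have "\<dots> = 2 ^ (2 * k + card Q + j)" by (simp add: mult_2 ac_simps flip: power_add)
 finally have u: "i + card P <= 2 * k + card Q + j" by (rule pow)
 have "2 ^ (j + card Q) = card (sel A B) * 2 ^ card Q" by (simp only: j power_add)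
 also have "\<dots> <= 2 ^ k * Z2 * 2 ^ card Q" using b2(1) by (rule mult_right_mono) simp
 also have "\<dots> = 2 ^ k * (2 ^ card Q * Z2)" by simp
 also have "\<dots> <= 2 ^ k * (2 ^ card P * (2 ^ k * 2 ^ i))" unfolding Z[symmetric] using b1(2) i by simp
 also have "\<dots> = 2 ^ (2 * k + card P + i)" by (simp add: mult_2 ac_simps flip: power_add)
 finally have l: "j + card Q <= 2 * k + card P + i" by (rule pow)
 have "selmer_ratio_ord A B = int i - int j" unfolding selmer_ratio_ord_def card_Sel[OF assms] i j by (rule rat_ord_two_powers)
 moreover have "int i + int (card P) <= 2 * int k + int (card Q) + int j" "int j + int (card Q) <= 2 * int k + int (card P) + int i"
  using u l by linarith+
 ultimately have "\<bar>selmer_ratio_ord A B - (int (card Q) - int (card P))\<bar> <= 2 * int k" by linarith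
 then show ?thesis by (simp add: k_def P_def Q_def)
qed

abbreviation odd_divisors :: "int => nat set" where
 "odd_divisors n \<equiv> {p. prime p & odd p & int p dvd n}"

abbreviation exceptional :: "int => int => nat set" where
 "exceptional A B \<equiv> {p. prime p & odd p & (int p dvd A & int p dvd B \<or> (int p)\<^sup>2 dvd B \<or> (int p)\<^sup>2 dvd A\<^sup>2 - 4 * B)}"

lemma card_int_image: "card {p. odd_prime p & R p} = card {p. prime p & odd p & R (int p)}"
proof -
 have "{p. odd_prime p & R p} = int ` {p. prime p & odd p & R (int p)}"
 proof (intro equalityI subsetI)
  fix p assume "p\<in>{p. odd_prime p & R p}"
  then have p: "odd_prime p" "R p" by auto
  obtain q where "p = int q" "prime q" "odd q" using odd_prime_nat[OF p(1)] .
  then show "p\<in>int ` {p. prime p & odd p & R (int p)}" using p(2) by blast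
 qed (auto simp: odd_prime_def)
 then show ?thesis by (simp add: card_image)
qed

text \<open>An odd prime divisor of B or of A^2 - 4B outside the corresponding
  \<open>mult_primes\<close> is exceptional. The coefficient 3 is 2 from
  \<open>selmer_ratio_bound\<close> and 1 for replacing \<open>mult_primes\<close> by all odd prime
  divisors.\<close>

theorem selmer_ratio_prime_divisors:
 assumes B0: "B ~= 0" and D0: "A\<^sup>2 - 4 * B ~= 0"
 shows "\<bar>selmer_ratio_ord A B - (int (card (odd_divisors (A\<^sup>2 - 4 * B))) - int (card (odd_divisors B)))\<bar> <= 3 * int (card (exceptional A B)) + 6"
proof -
 let ?D = "A\<^sup>2 - 4 * B"
 let ?O = "{p. odd_prime p & p dvd B}"
 interpret E: selmer_bound A B by unfold_locales (use assms in auto)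
 have fin: "finite ?O" "finite {p. odd_prime p & p dvd ?D}" using assms by (auto intro: finite_odd_primes)
 \<comment> \<open>So a divisor of A^2 - 4B that also divides A is a common divisor of A and B,
   which is how exceptional primes are described.\<close>
 have DB: "p dvd A \<longleftrightarrow> p dvd B" if "odd_prime p" "p dvd ?D" for p
 proof
  assume "p dvd A"
  then have "p dvd A\<^sup>2" by (simp add: power2_eq_square)
  from dvd_diff[OF this that(2)] have "p dvd 2\<^sup>2 * B" by simp
  then show "p dvd B" using odd_prime_dvd_power_two_mult(1)[OF that(1), of 2 B] by simp
 next
  assume "p dvd B"
  then have "p dvd A\<^sup>2" using that(2) by (simp add: dvd_diff_left_iff)
  then show "p dvd A" using prime_dvd_power[of p A 2] that(1) by (simp add: odd_prime_def)
 qed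
 let ?X = "{p. odd_prime p & (p dvd A & p dvd B \<or> p\<^sup>2 dvd B \<or> p\<^sup>2 dvd ?D)}"
 have sq: "p dvd n" if "p\<^sup>2 dvd n" for p n :: int using that by (metis dvd_mult_left power2_eq_square)
 have "?X \<subseteq> ?O \<union> {p. odd_prime p & p dvd ?D}" using sq by auto
 then have finX: "finite ?X" using fin finite_subset by blast
 have dm: "p dvd B * ?D \<longleftrightarrow> p dvd B \<or> p dvd ?D" if "odd_prime p" for p
  using that prime_dvd_mult_iff by (auto simp: odd_prime_def)
 have "other_primes A B \<subseteq> ?X" using dm DB unfolding other_primes_def mult_primes_def by auto
 then have o: "card (other_primes A B) <= card ?X" by (rule card_mono[OF finX])
 have "?O = mult_primes A B \<union> (?O - mult_primes A B)" by (auto simp: mult_primes_def)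
 have part: "card (mult_primes A n) <= card {p. odd_prime p & p dvd n} & card {p. odd_prime p & p dvd n} <= card (mult_primes A n) + card ?X"
  if "n = B \<or> n = ?D" for n
 proof
  have fn: "finite {p. odd_prime p & p dvd n}" using fin that by auto
  have sub: "mult_primes A n \<subseteq> {p. odd_prime p & p dvd n}" by (auto simp: mult_primes_def)
  show "card (mult_primes A n) <= card {p. odd_prime p & p dvd n}" by (rule card_mono[OF fn sub])
  have "{p. odd_prime p & p dvd n} \<subseteq> mult_primes A n \<union> ?X" using that DB by (auto simp: mult_primes_def)
  then have "card {p. odd_prime p & p dvd n} <= card (mult_primes A n \<union> ?X)"
   by (rule card_mono[rotated]) (use finX fn sub finite_subset in auto)
  also have "\<dots> <= card (mult_primes A n) + card ?X" by (rule card_Un_le)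
  finally show "card {p. odd_prime p & p dvd n} <= card (mult_primes A n) + card ?X" .
 qed
 have "\<bar>selmer_ratio_ord A B - (int (card {p. odd_prime p & p dvd ?D}) - int (card ?O))\<bar> <= 3 * int (card ?X) + 6"
  using selmer_ratio_bound[OF assms] part[of B] part[of ?D] o by simp linarith
 then show ?thesis unfolding card_int_image .
qed

section \<open>Sums of reciprocals of primes\<close>

abbreviation primes_upto :: "real => nat set" where
 "primes_upto x \<equiv> {p. prime p & real p <= x}"

definition prime_recip :: "real => real" where
 "prime_recip x = (\<Sum>p\<in>primes_upto x. 1 / real p)"

lemma finite_primes_upto [simp]: "finite (primes_upto x)" by (rule finite_subset[of _ "{..nat \<lceil>x\<rceil>}"]) (auto, linarith)

lemma sum_inverse_squares_le: "(\<Sum>n\<in>{m<..N}. 1 / real n ^ 2) <= 1 / real m" if "m >= 1" for m N :: nat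
proof -
 have "(\<Sum>n\<in>{m<..N}. 1 / real n ^ 2) <= 1 / real m - 1 / real N" if "m <= N" for N using that
 proof (induction N rule: dec_induct)
  case (step N)
  have "{m<..Suc N} = insert (Suc N) {m<..N}" using step.hyps by auto
  then have "(\<Sum>n\<in>{m<..Suc N}. 1 / real n ^ 2) = 1 / real (Suc N) ^ 2 + (\<Sum>n\<in>{m<..N}. 1 / real n ^ 2)" by simp
  also have "\<dots> <= 1 / real (Suc N) ^ 2 + (1 / real m - 1 / real N)" using step.IH by simp
  also have "1 / real (Suc N) ^ 2 <= 1 / (real N * real (Suc N))"
   unfolding power2_eq_square using step.hyps \<open>m >= 1\<close> by (intro divide_left_mono mult_right_mono mult_pos_pos) auto
  also have "\<dots> = 1 / real N - 1 / real (Suc N)" using step.hyps \<open>m >= 1\<close> by (simp add: field_simps)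
  finally show ?case by linarith
 qed simp
 note le = this
 show ?thesis
 proof (cases "m <= N")
  case True
  have "1 / real N >= 0" by simp
  then show ?thesis using le[OF True] by linarith
 qed simp
qed

lemma sum_prime_inverse_squares:
 assumes "finite P" "\<And>p. p\<in>P ==> p > 1" shows "(\<Sum>p\<in>P. 1 / real p ^ 2) <= 1"
proof -
 obtain N where N: "\<And>p. p\<in>P ==> p <= N" using assms(1) by (meson Max_ge)
 have "(\<Sum>p\<in>P. 1 / real p ^ 2) <= (\<Sum>p\<in>{1<..N}. 1 / real p ^ 2)" by (rule sum_mono2) (use N assms(2) in auto)
 also have "\<dots> <= 1" using sum_inverse_squares_le[of 1 N] by simp
 finally show ?thesis .
qed

text \<open>The factor \<open>1 - 1 / p\<close> removes the numbers divisible by \<open>p\<close>.\<close>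

lemma sum_smooth_le:
 assumes "finite P" "\<And>p. p\<in>P ==> prime p"
 shows "(\<Sum>n | n\<in>{1..N} & (\<forall>q. prime q --> q dvd n --> q\<in>P). 1 / real n) * (\<Prod>p\<in>P. 1 - 1 / real p) <= 1"
 using assms
proof (induction P rule: finite_induct)
 case empty
 have "{n. n\<in>{1..N} & (\<forall>q. prime q --> ~ q dvd n)} \<subseteq> {1}" using prime_factor_nat by blast
 then have "(\<Sum>n | n\<in>{1..N} & (\<forall>q. prime q --> ~ q dvd n). 1 / real n) <= (\<Sum>n\<in>{1}. 1 / real n)"
  by (intro sum_mono2) auto
 then show ?case by simp
next
 case (insert p P)
 let ?S = "\<lambda>P. {n. n\<in>{1..N} & (\<forall>q. prime q --> q dvd n --> q\<in>P)}"
 let ?Y = "(\<Sum>n\<in>?S (insert p P). 1 / real n)"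
 have fin: "finite (?S P)" for P by simp
 have pp: "prime p" using insert.prems by simp
 have p0: "p > 0" using pp prime_gt_0_nat by blast
 have un: "(\<Sum>n\<in>A \<union> B. 1 / real n) <= (\<Sum>n\<in>A. 1 / real n) + (\<Sum>n\<in>B. 1 / real n)" if "finite A" "finite B" for A B
  using sum.union_inter[OF that, of "\<lambda>n. 1 / real n"] sum_nonneg[of "A \<inter> B" "\<lambda>n. 1 / real n"] by simp
 have inj: "inj_on (\<lambda>n. p * n) A" for A using p0 by (simp add: inj_on_def)
 have "?S (insert p P) \<subseteq> ?S P \<union> (\<lambda>n. p * n) ` ?S (insert p P)"
 proof
  fix n assume n: "n \<in> ?S (insert p P)"
  show "n \<in> ?S P \<union> (\<lambda>n. p * n) ` ?S (insert p P)"
  proof (cases "p dvd n")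
   case True
   then obtain m where m: "n = p * m" by (elim dvdE)
   have "m \<in> ?S (insert p P)" using n p0 unfolding m by (auto simp: Suc_le_eq intro: order_trans[rotated])
   then show ?thesis using m by blast
  next
   case False then show ?thesis using n by auto
  qed
 qed
 then have "?Y <= (\<Sum>n\<in>?S P \<union> (\<lambda>n. p * n) ` ?S (insert p P). 1 / real n)" by (intro sum_mono2) auto
 also have "\<dots> <= (\<Sum>n\<in>?S P. 1 / real n) + (\<Sum>n\<in>(\<lambda>n. p * n) ` ?S (insert p P). 1 / real n)"
  by (rule un) (use fin in blast)+
 also have "(\<Sum>n\<in>(\<lambda>n. p * n) ` ?S (insert p P). 1 / real n) = (\<Sum>n\<in>?S (insert p P). 1 / real p * (1 / real n))"
  unfolding sum.reindex[OF inj] o_def by (rule sum.cong[OF refl]) simp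
 also have "\<dots> = 1 / real p * ?Y" by (rule sum_distrib_left[symmetric])
 finally have q: "?Y <= (\<Sum>n\<in>?S P. 1 / real n) + 1 / real p * ?Y" .
 have "x * (1 - 1 / real p) <= y" if "x <= y + 1 / real p * x" for x y using that by (simp add: right_diff_distrib)
 from this[OF q] have le: "?Y * (1 - 1 / real p) <= (\<Sum>n\<in>?S P. 1 / real n)" .
 have nn: "0 <= (\<Prod>p\<in>P. 1 - 1 / real p)"
  
 proof (rule prod_nonneg)
  fix q assume "q\<in>P"
  then have "q >= 1" using insert.prems prime_ge_1_nat by simp
  then show "0 <= 1 - 1 / real q" by simp
 qed
 have "?Y * (\<Prod>p\<in>insert p P. 1 - 1 / real p) = ?Y * (1 - 1 / real p) * (\<Prod>p\<in>P. 1 - 1 / real p)" using insert.hyps by simp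
 also have "\<dots> <= (\<Sum>n\<in>?S P. 1 / real n) * (\<Prod>p\<in>P. 1 - 1 / real p)" by (rule mult_right_mono[OF le nn])
 also have "\<dots> <= 1" by (rule insert.IH) (use insert.prems in simp)
 finally show ?case .
qed

text \<open>All integers up to x are products of primes up to x, so the Euler product over these
  primes dominates the harmonic sum, which is at least ln x. Taking logarithms with ln(1 - u) >= -u
  - 2 u^2 costs at most 2, the sum of 1 / p^2 being at most 1.\<close>

lemma prime_recip_lower:
 assumes x: "x >= 2" shows "ln (ln x) - 2 <= prime_recip x"
proof -
 define N where "N = nat \<lfloor>x\<rfloor>"
 have N: "real N <= x" "x < real N + 1" "N >= 2" using x by (auto simp: N_def) linarith+
 let ?P = "primes_upto x"
 let ?Q = "\<Prod>p\<in>?P. 1 - 1 / real p"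
 have p2: "real p >= 2" if "p \<in> ?P" for p using that prime_ge_2_nat by auto
 have half: "1 / real p <= 1 / 2" if "p \<in> ?P" for p using p2[OF that] by (simp add: field_simps)
 then have sub1: "0 < 1 - 1 / real p" if "p \<in> ?P" for p using half[OF that] by linarith
 have all: "{n. n\<in>{1..N} & (\<forall>q. prime q --> q dvd n --> q \<in> ?P)} = {1..N}"
 proof -
  have "real q <= x" if "n\<in>{1..N}" "q dvd n" for q n
  proof -
   have "q <= n" using that by (intro dvd_imp_le) auto
   then show ?thesis using that N(1) by (auto intro: order_trans[of _ "real N"])
  qed
  then show ?thesis by auto
 qed
 have "harm N * ?Q <= 1" using sum_smooth_le[OF finite_primes_upto, of x N] unfolding all by (auto simp: harm_def inverse_eq_divide)
 moreover have pos: "?Q > 0" by (rule prod_pos) (rule sub1)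
 moreover have "ln x <= harm N"
 proof -
  have "ln x <= ln (real N + 1)" using N x by simp
  then show ?thesis using ln_le_harm[of N] by (simp add: add.commute)
 qed
 ultimately have "ln x * ?Q <= 1" by (smt (verit) mult_right_mono)
 moreover have "ln x > 0" using x by simp
 ultimately have "ln (ln x * ?Q) <= 0" using pos by simp
 then have "ln (ln x) + ln ?Q <= 0" using pos \<open>ln x > 0\<close> by (simp add: ln_mult)
 moreover have "ln ?Q = (\<Sum>p\<in>?P. ln (1 - 1 / real p))"
  by (rule ln_prod[OF finite_primes_upto]) (rule less_imp_neq[OF sub1, symmetric])
 moreover have "(\<Sum>p\<in>?P. - (1 / real p) - 2 * (1 / real p) ^ 2) <= (\<Sum>p\<in>?P. ln (1 - 1 / real p))"
  by (intro sum_mono ln_one_minus_pos_lower_bound half) simp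
 moreover have "(\<Sum>p\<in>?P. - (1 / real p) - 2 * (1 / real p) ^ 2) = - prime_recip x - 2 * (\<Sum>p\<in>?P. 1 / real p ^ 2)"
  unfolding prime_recip_def by (simp add: sum_subtractf sum_negf sum_distrib_left power_divide)
 moreover have "(\<Sum>p\<in>?P. 1 / real p ^ 2) <= 1" by (rule sum_prime_inverse_squares) (use prime_gt_1_nat in auto)
 ultimately show ?thesis by linarith
qed

text \<open>By 1 + s / m <= (1 - 1 / m)^(-s), the term m^(-1-s) is at most ((m-1)^(-s) - m^(-s)) /
  s, and these bounds telescope.\<close>

lemma zeta_partial_le:
 assumes s: "s > 0" shows "(\<Sum>n\<in>{1..N}. real n powr (- 1 - s)) <= 1 + 1 / s"
proof (cases "N >= 1")
 case True
 then have "(\<Sum>n\<in>{1..N}. real n powr (- 1 - s)) <= 1 + 1 / s - real N powr (- s) / s"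
 proof (induction N rule: dec_induct)
  case (step n)
  have n: "real n > 0" using step.hyps by simp
  define m where "m = real (Suc n)"
  have m: "m > 1" "real n = m * (1 - 1 / m)" using n by (auto simp: m_def field_simps)
  have l: "ln (1 - 1 / m) <= - (1 / m)" using ln_add_one_self_le_self2[of "- (1 / m)"] m by (simp add: field_simps)
  have "1 + s / m <= exp (s / m)" by (rule exp_ge_add_one_self)
  also have "\<dots> <= exp (- s * ln (1 - 1 / m))" using mult_left_mono[OF l, of s] s by simp
  also have "\<dots> = (1 - 1 / m) powr (- s)" using m by (simp add: powr_def)
  finally have "m powr (- s) * (1 + s / m) <= m powr (- s) * (1 - 1 / m) powr (- s)" by (intro mult_left_mono) auto
  also have "\<dots> = real n powr (- s)" using m by (simp add: powr_mult)
  finally have "m powr (- s) + s * (m powr (- s) / m) <= real n powr (- s)" by (simp add: distrib_left mult.commute)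
  moreover have "m powr (- 1 - s) = m powr (- s) / m" using m by (simp add: powr_diff powr_minus divide_inverse mult.commute)
  ultimately have "m powr (- 1 - s) <= real n powr (- s) / s - m powr (- s) / s" using s by (simp add: field_simps)
  then show ?case using step.IH step.hyps by (simp add: m_def)
 qed simp
 moreover have "real N powr (- s) / s >= 0" using s by simp
 ultimately show ?thesis by linarith
qed (use s in simp)

lemma prime_dvd_prod_set:
 assumes "finite D" "\<And>p. p\<in>D ==> prime p" "prime (q::nat)"
 shows "q dvd \<Prod>D \<longleftrightarrow> q\<in>D"
proof
 assume "q dvd \<Prod>D"
 then obtain p where "p\<in>D" "q dvd p" using prime_dvd_prod_iff[OF assms(1,3), of "\<lambda>x. x"] by auto
 then show "q\<in>D" using assms(2,3) primes_dvd_imp_eq by metis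
qed (use assms(1) in "auto intro: dvd_prodI")

text \<open>Rankin's method with s = e / ln x. Squarefree products of primes are distinct integers,
  so the product of the factors 1 + p^(-1-s) is at most 1 + 1 / s; on the other hand p^(-s) >= 1 - e
  for p <= x.\<close>

lemma prime_recip_upper:
 assumes x: "x >= 3" and e: "0 < e" "e < 1"
 shows "prime_recip x * (1 - e) <= ln (ln x) + ln (2 / e) + 1"
proof -
 have lx: "ln x >= 1" using x exp_le by (simp add: ln_ge_iff)
 define s where "s = e / ln x"
 have s: "s > 0" using e lx by (simp add: s_def)
 let ?P = "primes_upto x"
 have p2: "real p >= 2" if "p \<in> ?P" for p using that prime_ge_2_nat by auto
 have "(\<Prod>p\<in>?P. 1 + real p powr (- 1 - s)) = (\<Sum>D\<in>Pow ?P. \<Prod>p\<in>D. real p powr (- 1 - s))"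
  by (rule sum_Pow_prod[symmetric]) simp
 also have "\<dots> = (\<Sum>D\<in>Pow ?P. real (\<Prod>D) powr (- 1 - s))"
 proof (rule sum.cong[OF refl])
  fix D assume "D\<in>Pow ?P"
  then have "finite D" "\<forall>p\<in>D. real p >= 0" using finite_subset[of D ?P] by auto
  then show "(\<Prod>p\<in>D. real p powr (- 1 - s)) = real (\<Prod>D) powr (- 1 - s)"
   by (induction D rule: finite_induct) (auto simp: powr_mult prod_nonneg)
 qed
 also have "\<dots> = (\<Sum>n\<in>Prod ` Pow ?P. real n powr (- 1 - s))"
 proof (subst sum.reindex)
  show "inj_on Prod (Pow ?P)"
  proof (rule inj_onI)
   fix D D' assume D: "D\<in>Pow ?P" "D'\<in>Pow ?P" and eq: "\<Prod>D = \<Prod>D'"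
   have "finite D" "finite D'" using D finite_subset[of _ ?P] by auto
   then have "q\<in>D \<longleftrightarrow> q\<in>D'" if "prime q" for q
    using prime_dvd_prod_set[of D q] prime_dvd_prod_set[of D' q] D eq that by auto
   then show "D = D'" using D by blast
  qed
 qed (simp add: o_def)
 also have "\<dots> <= (\<Sum>n\<in>{1..Max (insert 1 (Prod ` Pow ?P))}. real n powr (- 1 - s))"
 proof (rule sum_mono2)
  show "Prod ` Pow ?P \<subseteq> {1..Max (insert 1 (Prod ` Pow ?P))}"
  proof
   fix n assume n: "n\<in>Prod ` Pow ?P"
   then obtain D where D: "D \<subseteq> ?P" "n = \<Prod>D" by auto
   have "\<Prod>D > 0" by (rule prod_pos) (use D(1) prime_gt_0_nat in auto)
   moreover have "n <= Max (insert 1 (Prod ` Pow ?P))" using n by (intro Max_ge) auto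
   ultimately show "n\<in>{1..Max (insert 1 (Prod ` Pow ?P))}" using D(2) by auto
  qed
 qed auto
 also have "\<dots> <= 1 + 1 / s" by (rule zeta_partial_le[OF s])
 also have "\<dots> <= ln x * (2 / e)" using e lx s by (simp add: s_def field_simps)
 finally have "ln (\<Prod>p\<in>?P. 1 + real p powr (- 1 - s)) <= ln (ln x * (2 / e))"
  by (intro ln_mono prod_pos) (auto intro: add_pos_nonneg)
 also have "\<dots> = ln (ln x) + ln (2 / e)" using lx e by (subst ln_mult) auto
 also have "ln (\<Prod>p\<in>?P. 1 + real p powr (- 1 - s)) = (\<Sum>p\<in>?P. ln (1 + real p powr (- 1 - s)))"
  by (rule ln_prod[OF finite_primes_upto]) (simp add: add_nonneg_eq_0_iff)
 finally have 1: "(\<Sum>p\<in>?P. ln (1 + real p powr (- 1 - s))) <= ln (ln x) + ln (2 / e)" .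
 have 2: "1 / real p * (1 - e) - 1 / real p ^ 2 <= ln (1 + real p powr (- 1 - s))" if p: "p \<in> ?P" for p
 proof -
  have pp: "real p >= 2" "real p <= x" using p2[OF p] p by auto
  have eq: "real p powr (- 1 - s) = 1 / real p * exp (- (s * ln (real p)))"
   using pp by (simp add: powr_def exp_diff exp_minus left_diff_distrib inverse_eq_divide)
  have "s * ln (real p) <= e" using pp lx e by (simp add: s_def field_simps)
  then have "1 - e <= exp (- (s * ln (real p)))" using exp_ge_add_one_self[of "- (s * ln (real p))"] by linarith
  then have l: "1 / real p * (1 - e) <= real p powr (- 1 - s)" unfolding eq by (intro mult_left_mono) auto
  have "exp (- (s * ln (real p))) <= 1" using s pp by simp
  then have u: "real p powr (- 1 - s) <= 1 / real p" unfolding eq using pp by (simp add: field_simps)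
  then have u1: "real p powr (- 1 - s) <= 1" using order_trans[OF u, of 1] pp by simp
  have "(real p powr (- 1 - s)) ^ 2 <= (1 / real p) ^ 2" by (intro power_mono u) simp
  moreover have "real p powr (- 1 - s) - (real p powr (- 1 - s)) ^ 2 <= ln (1 + real p powr (- 1 - s))"
   by (rule ln_one_plus_pos_lower_bound) (use u1 in auto)
  ultimately show ?thesis using l by (simp add: power_divide)
 qed
 have "(\<Sum>p\<in>?P. 1 / real p * (1 - e) - 1 / real p ^ 2) <= (\<Sum>p\<in>?P. ln (1 + real p powr (- 1 - s)))"
  by (rule sum_mono[OF 2])
 moreover have "(\<Sum>p\<in>?P. 1 / real p * (1 - e) - 1 / real p ^ 2) = prime_recip x * (1 - e) - (\<Sum>p\<in>?P. 1 / real p ^ 2)"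
  unfolding prime_recip_def by (simp add: sum_subtractf sum_distrib_right)
 moreover have "(\<Sum>p\<in>?P. 1 / real p ^ 2) <= 1" by (rule sum_prime_inverse_squares) (use prime_gt_1_nat in auto)
 ultimately show ?thesis using 1 by linarith
qed

theorem prime_recip_asymp: "((\<lambda>x. prime_recip x / ln (ln x)) \<longlongrightarrow> 1) at_top"
proof (rule tendstoI)
 fix d :: real assume d: "d > 0"
 \<comment> \<open>For e <= 1 / 2 one has (1 + e) / (1 - e) <= 1 + 4 e, so both bounds on the
   quotient lie within d of 1.\<close>
 define e where "e = min (1/2) (d / 8)"
 have e: "0 < e" "e < 1" "e <= 1/2" "8 * e <= d" using d by (auto simp: e_def)
 have ev: "eventually (\<lambda>x::real. ln (ln x) > c) at_top" for c by real_asymp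
 have "eventually (\<lambda>x::real. x >= 3) at_top" by (rule eventually_ge_at_top)
 then show "eventually (\<lambda>x. dist (prime_recip x / ln (ln x)) 1 < d) at_top"
  using ev[of "(ln (2 / e) + 1) / e"] ev[of "2 / e"] ev[of 1]
 proof eventually_elim
  case (elim x)
  let ?l = "ln (ln x)"
  have l: "?l > 1" using elim by simp
  have a: "ln (2 / e) + 1 <= e * ?l" "2 <= e * ?l" using elim e by (simp_all add: field_simps)
  have "prime_recip x >= ?l - 2" using prime_recip_lower[of x] elim by simp
  then have lo: "prime_recip x >= (1 - e) * ?l" using a by (simp add: left_diff_distrib)
  have "prime_recip x * (1 - e) <= (1 + e) * ?l" using prime_recip_upper[OF elim(1) e(1,2)] a by (simp add: distrib_right)
  also have "\<dots> <= (1 + 4 * e) * (1 - e) * ?l"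
  proof -
   have "e * e <= 1/2 * e" using e by (intro mult_right_mono) auto
   then have "1 + e <= (1 + 4 * e) * (1 - e)" by (simp add: algebra_simps)
   then show ?thesis using l by (intro mult_right_mono) auto
  qed
  also have "\<dots> = ((1 + 4 * e) * ?l) * (1 - e)" by simp
  finally have hi: "prime_recip x <= (1 + 4 * e) * ?l" using e by (simp only: mult_le_cancel_right)
  have "1 - e <= prime_recip x / ?l" "prime_recip x / ?l <= 1 + 4 * e" using lo hi l by (simp_all add: pos_le_divide_eq pos_divide_le_eq)
  then show ?case using e d by (simp add: dist_real_def abs_less_iff)
 qed
qed

section \<open>Means of periodic functions\<close>

definition per :: "int => (int => int => 'a) => bool" where
 "per M g \<longleftrightarrow> (\<forall>a b. g (a mod M) (b mod M) = g a b)"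

definition pmean :: "int => (int => int => 'a::real_normed_field) => 'a" where
 "pmean M g = (\<Sum>a\<in>{0..<M}. \<Sum>b\<in>{0..<M}. g a b) / of_int M ^ 2"

lemma per_dvd: "per M g ==> M dvd N ==> per N g" unfolding per_def by (metis mod_mod_cancel)

lemma per_const: "per M (\<lambda>a b. c)" by (simp add: per_def)

lemma per_comp2: "per M g ==> per M h ==> per M (\<lambda>a b. F (g a b) (h a b))" by (simp add: per_def)

lemma per_dvd_pred:
 assumes "\<And>a b a' b'. [a = a'] (mod M) ==> [b = b'] (mod M) ==> Q a b \<longleftrightarrow> Q a' b'"
 shows "per M (\<lambda>a b. of_bool (Q a b))"
proof -
 have "Q (a mod M) (b mod M) \<longleftrightarrow> Q a b" for a b by (rule assms) (simp_all add: cong_def)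
 then show ?thesis by (simp add: per_def)
qed

lemma dvd_diff_imp_eq:
 fixes x y :: int
 assumes "M dvd x - y" "c <= x" "x < c + M" "c <= y" "y < c + M" shows "x = y"
proof (rule ccontr)
 assume "x ~= y"
 then have "\<bar>M\<bar> <= \<bar>x - y\<bar>" using dvd_imp_le_int[OF _ assms(1)] by simp
 then show False using assms(2-) by linarith
qed

lemma sum_block:
 fixes f :: "int => 'a::comm_monoid_add"
 assumes M: "M > 0" and f: "\<And>x. f (x mod M) = f x"
 shows "(\<Sum>x\<in>{c..<c + M}. f x) = (\<Sum>x\<in>{0..<M}. f x)"
proof -
 have inj: "inj_on (\<lambda>x. x mod M) {c..<c + M}"
 proof (rule inj_onI)
  fix x y assume xy: "x\<in>{c..<c + M}" "y\<in>{c..<c + M}" "x mod M = y mod M"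
  then have "M dvd x - y" by (simp add: mod_eq_dvd_iff)
  then show "x = y" using xy(1,2) by (intro dvd_diff_imp_eq[of M x y c]) auto
 qed
 have "(\<lambda>x. x mod M) ` {c..<c + M} = {0..<M}" by (rule card_subset_eq) (use M in "auto simp: card_image[OF inj]")
 then have "(\<Sum>x\<in>{0..<M}. f x) = (\<Sum>x\<in>{c..<c + M}. f (x mod M))" using sum.reindex[OF inj, of f] by (simp add: o_def)
 then show ?thesis by (simp add: f)
qed

lemma sum_blocks:
 fixes f :: "int => 'a::comm_semiring_1"
 assumes M: "M > 0" and f: "\<And>x. f (x mod M) = f x"
 shows "(\<Sum>x\<in>{c..<c + int q * M}. f x) = of_nat q * (\<Sum>x\<in>{0..<M}. f x)"
proof (induction q)
 case (Suc q)
 have le: "c <= c + int q * M" "c + int q * M <= c + int q * M + M" using M by simp_all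
 have "c + int (Suc q) * M = c + int q * M + M" by (simp add: distrib_right)
 then have "{c..<c + int (Suc q) * M} = {c..<c + int q * M} \<union> {c + int q * M..<c + int q * M + M}"
  by (simp only: ivl_disj_un_two(3)[OF le])
 then have "(\<Sum>x\<in>{c..<c + int (Suc q) * M}. f x) = (\<Sum>x\<in>{c..<c + int q * M}. f x) + (\<Sum>x\<in>{c + int q * M..<c + int q * M + M}. f x)"
  by (simp only:) (rule sum.union_disjoint, auto)
 then show ?case unfolding sum_block[of M f, OF M f] Suc.IH by (simp add: distrib_right add.commute)
qed simp

text \<open>Complete periods cancel; the incomplete one and the matching fraction of the full sum
  contribute at most M K each.\<close>

lemma sum_interval_approx:
 fixes f :: "int => 'a::real_normed_field"
 assumes M: "M > 0" and f: "\<And>x. f (x mod M) = f x" and K: "\<And>x. norm (f x) <= K" and L: "L >= 0"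
 shows "norm ((\<Sum>x\<in>{c..<c + L}. f x) - of_int L / of_int M * (\<Sum>x\<in>{0..<M}. f x)) <= 2 * of_int M * K"
proof -
 define q where "q = nat (L div M)"
 define r where "r = L mod M"
 define S where "S = (\<Sum>x\<in>{0..<M}. f x)"
 have r: "0 <= r" "r < M" and Lq: "L = int q * M + r" using M L by (auto simp: q_def r_def pos_imp_zdiv_nonneg_iff)
 have K0: "K >= 0" using K[of 0] norm_ge_zero order_trans by blast
 have MM: "(of_int M :: 'a) ~= 0" using M by simp
 have le: "c <= c + int q * M" "c + int q * M <= c + L" using M Lq r by simp_all
 have "{c..<c + L} = {c..<c + int q * M} \<union> {c + int q * M..<c + L}" by (rule ivl_disj_un_two(3)[OF le, symmetric])
 then have "(\<Sum>x\<in>{c..<c + L}. f x) = (\<Sum>x\<in>{c..<c + int q * M}. f x) + (\<Sum>x\<in>{c + int q * M..<c + L}. f x)"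
  by (simp only:) (rule sum.union_disjoint, auto)
 then have e: "(\<Sum>x\<in>{c..<c + L}. f x) - of_int L / of_int M * S = (\<Sum>x\<in>{c + int q * M..<c + L}. f x) - of_int r / of_int M * S"
  unfolding sum_blocks[of M f, OF M f] S_def[symmetric] using MM Lq by (simp add: field_simps)
 have 1: "norm (\<Sum>x\<in>{c + int q * M..<c + L}. f x) <= of_int M * K"
 proof -
  have "norm (\<Sum>x\<in>{c + int q * M..<c + L}. f x) <= (\<Sum>x\<in>{c + int q * M..<c + L}. K)"
   by (rule order_trans[OF norm_sum sum_mono]) (rule K)
  also have "\<dots> = of_int r * K" using Lq r by simp
  also have "\<dots> <= of_int M * K" using r K0 by (intro mult_right_mono) auto
  finally show ?thesis .
 qed
 have S: "norm S <= of_int M * K"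
 proof -
  have "norm S <= (\<Sum>x\<in>{0..<M}. K)" unfolding S_def by (rule order_trans[OF norm_sum sum_mono]) (rule K)
  then show ?thesis using M by simp
 qed
 have "norm (of_int r / of_int M * S) <= 1 * norm S"
  unfolding norm_mult norm_divide norm_of_int using r M by (intro mult_right_mono) (auto simp: divide_le_eq)
 then show ?thesis unfolding S_def[symmetric] e using norm_triangle_ineq4[of "\<Sum>x\<in>{c + int q * M..<c + L}. f x" "of_int r / of_int M * S"] 1 S
  by linarith
qed

lemma pmean_mult_period:
 fixes g :: "int => int => 'a::real_normed_field"
 assumes M: "M > 0" and N: "N > 0" "M dvd N" and g: "per M g" shows "pmean N g = pmean M g"
proof -
 obtain k where k: "N = M * k" using N(2) by (elim dvdE)
 have kp: "k > 0" using N(1) M k by (simp add: zero_less_mult_iff)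
 define q where "q = nat k"
 have q: "N = int q * M" using k kp by (simp add: q_def)
 have gg: "g (a mod M) b = g a b" "g a (b mod M) = g a b" for a b using g unfolding per_def by (metis mod_mod_trivial)+
 have 1: "(\<Sum>b\<in>{0..<N}. g a b) = of_nat q * (\<Sum>b\<in>{0..<M}. g a b)" for a using sum_blocks[of M "g a" 0 q] M gg(2) q by simp
 have 2: "(\<Sum>a\<in>{0..<N}. \<Sum>b\<in>{0..<M}. g a b) = of_nat q * (\<Sum>a\<in>{0..<M}. \<Sum>b\<in>{0..<M}. g a b)"
  using sum_blocks[of M "\<lambda>a. \<Sum>b\<in>{0..<M}. g a b" 0 q] M gg(1) q by simp
 have q0: "(of_nat q :: 'a) ~= 0" using kp by (simp add: q_def)
 have "(\<Sum>a\<in>{0..<N}. \<Sum>b\<in>{0..<N}. g a b) = of_nat q ^ 2 * (\<Sum>a\<in>{0..<M}. \<Sum>b\<in>{0..<M}. g a b)"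
  unfolding 1 sum_distrib_left[symmetric] 2 by (simp add: power2_eq_square)
 moreover have "(of_int N :: 'a) ^ 2 = of_nat q ^ 2 * of_int M ^ 2" unfolding q by (simp add: power_mult_distrib)
 ultimately show ?thesis unfolding pmean_def using q0 by simp
qed

definition box :: "int => int => (int \<times> int) set" where
 "box n1 n2 = {- n1..n1} \<times> {- n2..n2}"

definition bmean :: "int => int => (int => int => 'a::real_normed_field) => 'a" where
 "bmean n1 n2 g = (\<Sum>(a, b)\<in>box n1 n2. g a b) / of_int ((2 * n1 + 1) * (2 * n2 + 1))"

text \<open>The incomplete periods are estimated first in b, then in a. Since n2 <= n1, the shorter
  side decides the relative error.\<close>

lemma bmean_pmean:
 fixes g :: "int => int => 'a::real_normed_field"
 assumes M: "M > 0" and g: "per M g" and K: "\<And>a b. norm (g a b) <= K" and n: "0 <= n2" "n2 <= n1"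
 shows "norm (bmean n1 n2 g - pmean M g) <= 4 * of_int M * K / of_int (2 * n2 + 1)"
proof -
 define N1 N2 where "N1 = 2 * n1 + 1" and "N2 = 2 * n2 + 1"
 have N: "N1 > 0" "N2 > 0" "N2 <= N1" using n by (auto simp: N1_def N2_def)
 have gg: "g (a mod M) b = g a b" "g a (b mod M) = g a b" for a b using g unfolding per_def by (metis mod_mod_trivial)+
 have K0: "K >= 0" using K[of 0 0] norm_ge_zero order_trans by blast
 define F where "F a = (\<Sum>b\<in>{0..<M}. g a b)" for a
 define S where "S = (\<Sum>a\<in>{0..<M}. F a)"
 let ?U = "((\<Sum>a\<in>{- n1..n1}. F a) - of_int N1 / of_int M * S)"
 let ?V = "(\<Sum>a\<in>{- n1..n1}. (\<Sum>b\<in>{- n2..n2}. g a b) - of_int N2 / of_int M * F a)"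
 let ?X = "((\<Sum>(a, b)\<in>box n1 n2. g a b) - of_int N1 * of_int N2 * (S / of_int M ^ 2))"
 have i: "{- n1..n1} = {- n1..<- n1 + N1}" "{- n2..n2} = {- n2..<- n2 + N2}" by (auto simp: N1_def N2_def)
 have 1: "norm ((\<Sum>b\<in>{- n2..n2}. g a b) - of_int N2 / of_int M * F a) <= 2 * of_int M * K" for a
  unfolding i F_def by (rule sum_interval_approx) (use M gg K N in auto)
 have Fb: "norm (F a) <= of_int M * K" for a
 proof -
  have "norm (F a) <= (\<Sum>b\<in>{0..<M}. K)" unfolding F_def by (rule order_trans[OF norm_sum sum_mono]) (rule K)
  then show ?thesis using M by simp
 qed
 have 2: "norm ?U <= 2 * of_int M * (of_int M * K)" unfolding i S_def by (rule sum_interval_approx) (use M gg Fb N in "auto simp: F_def")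
 have "(\<Sum>(a, b)\<in>box n1 n2. g a b) = (\<Sum>a\<in>{- n1..n1}. \<Sum>b\<in>{- n2..n2}. g a b)"
  unfolding box_def by (rule sum.cartesian_product[symmetric])
 then have e: "(\<Sum>(a, b)\<in>box n1 n2. g a b) - of_int N1 * of_int N2 * (S / of_int M ^ 2) =
  ?V +
  of_int N2 / of_int M * ?U"
  by (simp add: sum_subtractf sum_distrib_left algebra_simps power2_eq_square)
 have "norm ?V <= (\<Sum>a\<in>{- n1..n1}. 2 * of_int M * K)" by (rule order_trans[OF norm_sum sum_mono]) (rule 1)
 also have "\<dots> = of_int N1 * (2 * of_int M * K)" using n by (simp add: N1_def algebra_simps)
 finally have 3: "norm ?V <= of_int N1 * (2 * of_int M * K)" .
 have "norm (of_int N2 / of_int M * ?U) <= of_int N2 / of_int M * (2 * of_int M * (of_int M * K))"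
  unfolding norm_mult[of "of_int N2 / of_int M"] norm_divide norm_of_int using N M 2 by (intro mult_mono) auto
 also have "\<dots> = of_int N2 * (2 * of_int M * K)" using M by simp
 also have "\<dots> <= of_int N1 * (2 * of_int M * K)" using N M K0 by (intro mult_right_mono) auto
 finally have 4: "norm (of_int N2 / of_int M * ?U) <= of_int N1 * (2 * of_int M * K)" .
 have 4: "norm ?X <= of_int N1 * (4 * of_int M * K)"
  unfolding e by (rule order_trans[OF norm_triangle_ineq]) (use add_mono[OF 3 4] in "simp add: ac_simps")
 have NN: "(of_int N1 * of_int N2 :: 'a) ~= 0" using N by simp
 have "bmean n1 n2 g - pmean M g = ?X / (of_int N1 * of_int N2)"
  unfolding bmean_def pmean_def N1_def[symmetric] N2_def[symmetric] of_int_mult diff_divide_distrib S_def F_def using NN by simp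
 then have "norm (bmean n1 n2 g - pmean M g) = norm ?X / (of_int N1 * of_int N2)" using N by (simp add: norm_divide norm_mult)
 also have "\<dots> <= of_int N1 * (4 * of_int M * K) / (of_int N1 * of_int N2)" using 4 N by (intro divide_right_mono) auto
 also have "\<dots> = 4 * of_int M * K / of_int N2" using N by simp
 finally show ?thesis unfolding N2_def .
qed

lemma sum_crt:
 fixes F :: "int => int => 'a::comm_monoid_add"
 assumes M: "M > 0" and N: "N > 0" and c: "coprime M N"
 shows "(\<Sum>x\<in>{0..<M * N}. F (x mod M) (x mod N)) = (\<Sum>x\<in>{0..<M}. \<Sum>y\<in>{0..<N}. F x y)"
proof -
 let ?h = "\<lambda>x. (x mod M, x mod N)"
 have inj: "inj_on ?h {0..<M * N}"
 proof (rule inj_onI)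
  fix x y assume xy: "x\<in>{0..<M * N}" "y\<in>{0..<M * N}" "?h x = ?h y"
  then have "M dvd x - y" "N dvd x - y" by (simp_all add: mod_eq_dvd_iff)
  then have "M * N dvd x - y" using c divides_mult by blast
  then show "x = y" using xy(1,2) by (intro dvd_diff_imp_eq[of "M * N" x y 0]) auto
 qed
 have "?h ` {0..<M * N} = {0..<M} \<times> {0..<N}"
  by (rule card_subset_eq) (use M N in "auto simp: card_image[OF inj] card_cartesian_product nat_mult_distrib")
 then have "(\<Sum>z\<in>{0..<M} \<times> {0..<N}. case z of (x, y) => F x y) = (\<Sum>x\<in>{0..<M * N}. F (x mod M) (x mod N))"
  using sum.reindex[OF inj, of "\<lambda>(x, y). F x y"] by (simp add: o_def)
 then show ?thesis by (simp add: sum.cartesian_product)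
qed

text \<open>Conditions to coprime moduli are independent, by the Chinese remainder theorem in each
  coordinate.\<close>

lemma pmean_mult:
 fixes g h :: "int => int => 'a::real_normed_field"
 assumes M: "M > 0" and N: "N > 0" and c: "coprime M N" and g: "per M g" and h: "per N h"
 shows "pmean (M * N) (\<lambda>a b. g a b * h a b) = pmean M g * pmean N h"
proof -
 have "(\<Sum>a\<in>{0..<M * N}. \<Sum>b\<in>{0..<M * N}. g a b * h a b)
  = (\<Sum>a\<in>{0..<M * N}. \<Sum>b\<in>{0..<M * N}. g (a mod M) (b mod M) * h (a mod N) (b mod N))"
  using g h by (simp add: per_def)
 also have "\<dots> = (\<Sum>a\<in>{0..<M * N}. \<Sum>x\<in>{0..<M}. \<Sum>y\<in>{0..<N}. g (a mod M) x * h (a mod N) y)"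
  by (rule sum.cong[OF refl]) (rule sum_crt[OF M N c])
 also have "\<dots> = (\<Sum>u\<in>{0..<M}. \<Sum>v\<in>{0..<N}. \<Sum>x\<in>{0..<M}. \<Sum>y\<in>{0..<N}. g u x * h v y)"
  by (rule sum_crt[OF M N c, of "\<lambda>u v. \<Sum>x\<in>{0..<M}. \<Sum>y\<in>{0..<N}. g u x * h v y"])
 also have "\<dots> = (\<Sum>u\<in>{0..<M}. \<Sum>v\<in>{0..<N}. (\<Sum>x\<in>{0..<M}. g u x) * (\<Sum>y\<in>{0..<N}. h v y))"
  by (simp add: sum_product)
 also have "\<dots> = (\<Sum>u\<in>{0..<M}. \<Sum>x\<in>{0..<M}. g u x) * (\<Sum>v\<in>{0..<N}. \<Sum>y\<in>{0..<N}. h v y)"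
  by (simp add: sum_product)
 finally show ?thesis unfolding pmean_def by (simp add: power_mult_distrib)
qed

lemma pmean_prod:
 fixes h :: "int => int => 'a::real_normed_field"
 assumes W: "W > 0" "per W h" and P: "finite P" "\<And>p. p\<in>P ==> prime p" "\<And>p. p\<in>P ==> coprime W (int p)"
  and g: "\<And>p. p\<in>P ==> per (int p) (g p)"
 shows "per (W * int (\<Prod>P)) (\<lambda>a b. h a b * (\<Prod>p\<in>P. g p a b)) \<and>
  pmean (W * int (\<Prod>P)) (\<lambda>a b. h a b * (\<Prod>p\<in>P. g p a b)) = pmean W h * (\<Prod>p\<in>P. pmean (int p) (g p))"
 using P g
proof (induction P rule: finite_induct)
 case empty
 then show ?case using W by simp
next
 case (insert p P)
 let ?M = "W * int (\<Prod>P)"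
 let ?h = "\<lambda>a b. h a b * (\<Prod>p\<in>P. g p a b)"
 have IH: "per ?M ?h" "pmean ?M ?h = pmean W h * (\<Prod>p\<in>P. pmean (int p) (g p))" using insert.IH insert.prems by auto
 have M0: "?M > 0" using W(1) insert.prems prime_gt_0_nat by (auto intro!: mult_pos_pos prod_pos)
 have pp: "prime p" using insert.prems by simp
 have p0: "int p > 0" using pp prime_gt_0_nat by simp
 have "coprime (int (\<Prod>P)) (int p)"
 proof -
  have "coprime p q" if "q\<in>P" for q using that insert.prems(1) insert.hyps by (intro primes_coprime) auto
  then have "coprime (\<Prod>P) p" by (intro prod_coprime_left) (simp add: coprime_commute)
  then show ?thesis by (simp only: coprime_int_iff)
 qed
 then have cop: "coprime ?M (int p)" using insert.prems(2) by simp
 have eqM: "W * int (\<Prod>(insert p P)) = ?M * int p" using insert.hyps by simp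
 have eqh: "(\<lambda>a b. h a b * (\<Prod>p\<in>insert p P. g p a b)) = (\<lambda>a b. ?h a b * g p a b)" using insert.hyps by (auto simp: ac_simps)
 have gp: "per (int p) (g p)" using insert.prems by simp
 have "per (?M * int p) (\<lambda>a b. ?h a b * g p a b)" by (rule per_comp2) (auto intro: per_dvd[OF IH(1)] per_dvd[OF gp])
 moreover have "pmean (?M * int p) (\<lambda>a b. ?h a b * g p a b) = pmean W h * (\<Prod>p\<in>insert p P. pmean (int p) (g p))"
  unfolding pmean_mult[OF M0 p0 cop IH(1) gp] IH(2) using insert.hyps by simp
 ultimately show ?case unfolding eqM eqh by blast
qed

section \<open>The model at a single prime\<close>

definition fp :: "nat => int => int => real" where
 "fp p a b = of_bool (int p dvd a\<^sup>2 - 4 * b) - of_bool (int p dvd b)"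

lemma per_fp: "per (int p) (fp p)"
proof -
 have "int p dvd (a mod int p)\<^sup>2 - 4 * (b mod int p) \<longleftrightarrow> int p dvd a\<^sup>2 - 4 * b" for a b
  by (rule cong_dvd_iff) (intro cong_diff cong_pow cong_mult cong_refl, simp_all)
 moreover have "int p dvd b mod int p \<longleftrightarrow> int p dvd b" for b by (simp add: dvd_mod_iff)
 ultimately show ?thesis by (simp add: per_def fp_def)
qed

lemma abs_fp: "\<bar>fp p a b\<bar> <= 1" by (simp add: fp_def)

lemma sum_unique_residue:
 fixes m c :: int
 assumes m: "m > 0" "odd m" shows "(\<Sum>b\<in>{0..<m}. of_bool (m dvd c - 4 * b)) = (1::real)"
proof -
 have "coprime m 4"
 proof -
  have "coprime m 2" using m(2) by simp
  then have "coprime m (2 ^ 2)" by (subst coprime_power_right_iff) simp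
  then show ?thesis by simp
 qed
 then obtain r where r: "[4 * r = 1] (mod m)" using cong_solve_coprime_int[of 4 m] by (auto simp: coprime_commute)
 define b0 where "b0 = (r * c) mod m"
 have b0: "m dvd 4 * b0 - c"
 proof -
  have "[4 * b0 = 4 * (r * c)] (mod m)" unfolding b0_def by (intro cong_mult cong_refl) simp
  moreover have "[4 * r * c = 1 * c] (mod m)" by (rule cong_mult[OF r cong_refl])
  ultimately have "[4 * b0 = c] (mod m)" by (simp add: mult.assoc) (rule cong_trans)
  then show ?thesis by (simp add: cong_iff_dvd_diff)
 qed
 have "m dvd c - 4 * b \<longleftrightarrow> b = b0" if b: "b\<in>{0..<m}" for b
 proof
  assume "m dvd c - 4 * b"
  then have "m dvd (c - 4 * b) + (4 * b0 - c)" using b0 by (rule dvd_add)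
  then have "m dvd 4 * (b0 - b)" by (simp add: algebra_simps)
  then have "m dvd b0 - b" by (simp only: coprime_dvd_mult_right_iff[OF \<open>coprime m 4\<close>])
  moreover have "b0\<in>{0..<m}" using m by (simp add: b0_def)
  ultimately have "b0 = b" using b by (intro dvd_diff_imp_eq[of m b0 b 0]) auto
  then show "b = b0" ..
 next
  assume "b = b0"
  then show "m dvd c - 4 * b" using b0 by (simp add: dvd_diff_commute)
 qed
 then have "(\<Sum>b\<in>{0..<m}. of_bool (m dvd c - 4 * b)) = (\<Sum>b\<in>{0..<m}. if b = b0 then 1 else (0::real))"
  by (intro sum.cong[OF refl]) auto
 also have "\<dots> = 1" using m by (simp add: b0_def)
 finally show ?thesis .
qed

lemma sum_dvd_residue: "m > 0 ==> (\<Sum>b\<in>{0..<m}. of_bool (m dvd b)) = (1::real)" for m :: int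
proof -
 assume m: "m > 0"
 have "m dvd b \<longleftrightarrow> b = 0" if "b\<in>{0..<m}" for b using that zdvd_not_zless[of b m] by (cases "b = 0") auto
 then have "(\<Sum>b\<in>{0..<m}. of_bool (m dvd b)) = (\<Sum>b\<in>{0..<m}. if b = 0 then 1 else (0::real))"
  by (intro sum.cong[OF refl]) auto
 then show ?thesis using m by simp
qed

text \<open>Of the p^2 residue pairs, p satisfy the condition on a^2 - 4b and p the one on b; both
  hold only at (0,0), where \<open>fp\<close> vanishes. So 1 and -1 occur with probability (p - 1) /
  p^2 each, which is where mean 0 and the factor 2 in the variance come from.\<close>

lemma pmean_fp:
 fixes f :: "real => 'a::real_normed_field"
 assumes p: "prime p" "odd p"
 shows "pmean (int p) (\<lambda>a b. f (fp p a b)) = f 0 + of_real ((real p - 1) / real p ^ 2) * (f 1 + f (- 1) - 2 * f 0)"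
proof -
 let ?I = "{0..<int p}"
 have p0: "int p > 0" using p(1) prime_gt_0_nat by simp
 define U where "U a b = (of_bool (int p dvd a\<^sup>2 - 4 * b) :: real)" for a b
 define V where "V b = (of_bool (int p dvd b) :: real)" for b
 have cop: "coprime (int p) 4"
 proof -
  have "coprime (int p) 2" using p(2) by simp
  then have "coprime (int p) (2 ^ 2)" by (subst coprime_power_right_iff) simp
  then show ?thesis by simp
 qed
 have pt: "f (fp p a b) = f 0 + of_real (U a b - V a * V b) * (f 1 - f 0) + of_real (V b - V a * V b) * (f (- 1) - f 0)" for a b
 proof -
  have *: "int p dvd a\<^sup>2 - 4 * b \<longleftrightarrow> int p dvd a" if "int p dvd b"
  proof -
   have "int p dvd a\<^sup>2 - 4 * b \<longleftrightarrow> int p dvd a\<^sup>2" using that by (simp add: dvd_diff_left_iff)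
   also have "\<dots> \<longleftrightarrow> int p dvd a" using p(1) by (simp add: prime_dvd_power_iff)
   finally show ?thesis .
  qed
  have **: "int p dvd b" if "int p dvd a\<^sup>2 - 4 * b" "int p dvd a"
  proof -
   have "int p dvd a\<^sup>2" using that(2) by (simp add: power2_eq_square)
   from dvd_diff[OF this that(1)] have "int p dvd 4 * b" by simp
   then show ?thesis using cop by (simp add: coprime_dvd_mult_right_iff)
  qed
  show ?thesis unfolding fp_def U_def V_def using * **
   by (cases "int p dvd b"; cases "int p dvd a"; cases "int p dvd a\<^sup>2 - 4 * b") auto
 qed
 have sU: "(\<Sum>a\<in>?I. \<Sum>b\<in>?I. U a b) = real p" unfolding U_def using sum_unique_residue[of "int p"] p0 p(2) by simp
 have sV: "(\<Sum>a\<in>?I. \<Sum>b\<in>?I. V b) = real p" unfolding V_def using sum_dvd_residue[OF p0] by simp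
 have sVV: "(\<Sum>a\<in>?I. \<Sum>b\<in>?I. V a * V b) = 1" unfolding V_def using sum_dvd_residue[OF p0] by (simp flip: sum_distrib_left)
 have "(\<Sum>a\<in>?I. \<Sum>b\<in>?I. f (fp p a b)) = of_int (int p * int p) * f 0
   + of_real (\<Sum>a\<in>?I. \<Sum>b\<in>?I. U a b - V a * V b) * (f 1 - f 0) + of_real (\<Sum>a\<in>?I. \<Sum>b\<in>?I. V b - V a * V b) * (f (- 1) - f 0)"
  unfolding pt using p0 by (simp add: sum.distrib sum_distrib_right)
 also have "\<dots> = of_real (real p ^ 2) * f 0 + of_real (real p - 1) * (f 1 + f (- 1) - 2 * f 0)"
  unfolding sum_subtractf sU sV sVV by (simp add: algebra_simps power2_eq_square)
 finally have s: "(\<Sum>a\<in>?I. \<Sum>b\<in>?I. f (fp p a b)) = of_real (real p ^ 2) * f 0 + of_real (real p - 1) * (f 1 + f (- 1) - 2 * f 0)" .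
 have "(of_nat p :: 'a) ~= 0" using p0 by simp
 then show ?thesis unfolding pmean_def s by (simp add: field_simps power2_eq_square)
qed

section \<open>Comparison with the model\<close>

lemma bmean_sum: "bmean n1 n2 (\<lambda>a b. \<Sum>i\<in>I. g i a b) = (\<Sum>i\<in>I. bmean n1 n2 (g i))"
 unfolding bmean_def case_prod_unfold by (subst sum.swap) (simp add: sum_divide_distrib)

lemma pmean_sum: "pmean M (\<lambda>a b. \<Sum>i\<in>I. g i a b) = (\<Sum>i\<in>I. pmean M (g i))"
proof -
 have "(\<Sum>a\<in>{0..<M}. \<Sum>b\<in>{0..<M}. \<Sum>i\<in>I. g i a b) = (\<Sum>i\<in>I. \<Sum>a\<in>{0..<M}. \<Sum>b\<in>{0..<M}. g i a b)"
  by (subst sum.swap[of _ I], subst sum.swap[of _ I]) (rule refl)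
 then show ?thesis by (simp add: pmean_def sum_divide_distrib)
qed

lemma bmean_cmult: "bmean n1 n2 (\<lambda>a b. c * g a b) = c * bmean n1 n2 g" by (simp add: bmean_def case_prod_unfold sum_distrib_left)

lemma pmean_cmult: "pmean M (\<lambda>a b. c * g a b) = c * pmean M g" by (simp add: pmean_def sum_distrib_left)

lemma bmean_add: "bmean n1 n2 (\<lambda>a b. f a b + g a b) = bmean n1 n2 f + bmean n1 n2 g"
 by (simp add: bmean_def case_prod_unfold sum.distrib add_divide_distrib)

lemma pmean_add: "pmean M (\<lambda>a b. f a b + g a b) = pmean M f + pmean M g" by (simp add: pmean_def sum.distrib add_divide_distrib)

lemma bmean_of_real: "bmean n1 n2 (\<lambda>a b. of_real (g a b)) = (of_real (bmean n1 n2 g) :: complex)"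
 by (simp add: bmean_def case_prod_unfold)

lemma pmean_of_real: "pmean M (\<lambda>a b. of_real (g a b)) = (of_real (pmean M g) :: complex)" by (simp add: pmean_def)

lemma bmean_mono:
 fixes f g :: "int => int => real"
 assumes "0 <= n2" "n2 <= n1" "\<And>a b. f a b <= g a b" shows "bmean n1 n2 f <= bmean n1 n2 g" unfolding bmean_def case_prod_unfold
 by (intro divide_right_mono sum_mono assms(3)) (use assms in "simp del: of_int_mult")

lemma pmean_mono:
 fixes f g :: "int => int => real"
 assumes "\<And>a b. f a b <= g a b" shows "pmean M f <= pmean M g" unfolding pmean_def by (intro divide_right_mono sum_mono assms) simp

lemma norm_bmean_le:
 fixes f :: "int => int => 'a::real_normed_field"
 assumes n: "0 <= n2" "n2 <= n1" and fg: "\<And>a b. norm (f a b) <= g a b" shows "norm (bmean n1 n2 f) <= bmean n1 n2 g"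
proof -
 have "norm (\<Sum>z\<in>box n1 n2. f (fst z) (snd z)) <= (\<Sum>z\<in>box n1 n2. g (fst z) (snd z))"
  by (rule order_trans[OF norm_sum sum_mono]) (rule fg)
 moreover have "real_of_int ((2 * n1 + 1) * (2 * n2 + 1)) > 0" using n by (simp del: of_int_mult)
 ultimately show ?thesis unfolding bmean_def case_prod_unfold norm_divide norm_of_int
  by (intro frac_le) (simp_all add: sum_nonneg order_trans[OF norm_ge_zero fg] del: of_int_mult)
qed

lemma norm_pmean_le:
 fixes f :: "int => int => 'a::real_normed_field"
 assumes fg: "\<And>a b. norm (f a b) <= g a b" shows "norm (pmean M f) <= pmean M g"
proof -
 have "norm (\<Sum>a\<in>{0..<M}. \<Sum>b\<in>{0..<M}. f a b) <= (\<Sum>a\<in>{0..<M}. \<Sum>b\<in>{0..<M}. g a b)"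
  by (intro order_trans[OF norm_sum] sum_mono fg)
 then show ?thesis unfolding pmean_def by (simp add: norm_divide norm_power divide_right_mono)
qed

definition fsum :: "nat set => int => int => real" where
 "fsum P a b = (\<Sum>p\<in>P. fp p a b)"

text \<open>Each induction step expands one factor of the power and absorbs its \<open>fp p\<close>
  into \<open>h\<close>, whose period becomes lcm(M, p) <= m y; with the lcm, repeated primes cause
  no trouble. Every step branches over \<open>card P\<close> primes, which explains the power of
  \<open>card P\<close> times y.\<close>

lemma moment_compare:
 assumes n: "0 <= n2" "n2 <= n1" and P: "finite P" "\<And>p. p\<in>P ==> p > 0" "\<And>p. p\<in>P ==> real p <= y" and y: "y >= 0"
  and Mt: "Mt > 0" "\<And>p. p\<in>P ==> int p dvd Mt"
  and h: "per M h" "M > 0" "M dvd Mt" "of_int M <= m" "\<And>a b. \<bar>h a b\<bar> <= 1"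
 shows "\<bar>bmean n1 n2 (\<lambda>a b. h a b * fsum P a b ^ i) - pmean Mt (\<lambda>a b. h a b * fsum P a b ^ i)\<bar>
  <= 4 * m * (real (card P) * y) ^ i / of_int (2 * n2 + 1)"
 using h
proof (induction i arbitrary: h M m)
 case 0
 have n0: "real_of_int (2 * n2 + 1) > 0" using n by simp
 have "\<bar>bmean n1 n2 h - pmean M h\<bar> <= 4 * of_int M * 1 / of_int (2 * n2 + 1)" using bmean_pmean[OF 0(2,1) _ n, of 1] 0(5) by simp
 also have "\<dots> <= 4 * m * 1 / of_int (2 * n2 + 1)" using 0(4) n0 by (intro divide_right_mono) auto
 finally show ?case using pmean_mult_period[OF 0(2) Mt(1) 0(3) 0(1)] by simp
next
 case (Suc i)
 have eq: "h a b * fsum P a b ^ Suc i = (\<Sum>p\<in>P. (h a b * fp p a b) * fsum P a b ^ i)" for a b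
  by (simp add: fsum_def sum_distrib_left sum_distrib_right ac_simps)
 have one: "\<bar>bmean n1 n2 (\<lambda>a b. (h a b * fp p a b) * fsum P a b ^ i) - pmean Mt (\<lambda>a b. (h a b * fp p a b) * fsum P a b ^ i)\<bar>
  <= 4 * (m * y) * (real (card P) * y) ^ i / of_int (2 * n2 + 1)" if p: "p\<in>P" for p
 proof (rule Suc.IH)
  let ?M = "lcm M (int p)"
  have p0: "int p > 0" using P(2)[OF p] by simp
  show "per ?M (\<lambda>a b. h a b * fp p a b)" by (rule per_comp2[OF per_dvd[OF Suc.prems(1)] per_dvd[OF per_fp]]) auto
  show "?M > 0" using Suc.prems(2) p0 by (simp add: lcm_pos_int)
  show "?M dvd Mt" using Suc.prems(3) Mt(2)[OF p] by simp
  have "?M <= M * int p" using Suc.prems(2) p0 by (intro zdvd_imp_le) auto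
  then have "real_of_int ?M <= of_int M * real p" by (metis of_int_le_iff of_int_mult of_int_of_nat_eq)
  also have "\<dots> <= m * y" using Suc.prems(2,4) P(3)[OF p] y by (intro mult_mono) auto
  finally show "real_of_int ?M <= m * y" .
  show "\<bar>h a b * fp p a b\<bar> <= 1" for a b using mult_mono[OF Suc.prems(5)[of a b] abs_fp[of p a b]] by (simp add: abs_mult)
 qed
 have "\<bar>bmean n1 n2 (\<lambda>a b. h a b * fsum P a b ^ Suc i) - pmean Mt (\<lambda>a b. h a b * fsum P a b ^ Suc i)\<bar>
  = \<bar>\<Sum>p\<in>P. bmean n1 n2 (\<lambda>a b. (h a b * fp p a b) * fsum P a b ^ i) - pmean Mt (\<lambda>a b. (h a b * fp p a b) * fsum P a b ^ i)\<bar>"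
  unfolding eq bmean_sum pmean_sum sum_subtractf ..
 also have "\<dots> <= (\<Sum>p\<in>P. 4 * (m * y) * (real (card P) * y) ^ i / of_int (2 * n2 + 1))"
  by (rule order_trans[OF sum_abs sum_mono]) (rule one)
 also have "\<dots> = 4 * m * (real (card P) * y) ^ Suc i / of_int (2 * n2 + 1)" by simp
 finally show ?case .
qed

text \<open>The generating function of the model, factored by independence. Real \<open>z\<close>
  serves for moment bounds, imaginary \<open>z\<close> for the characteristic function; the weight
  \<open>h\<close> of coprime period is the sieve in the application.\<close>

lemma pmean_exp_fsum:
 fixes z :: "'a::{real_normed_field, banach}"
 assumes W: "W > 0" "per W h" and P: "finite P" "\<And>p. p\<in>P ==> prime p" "\<And>p. p\<in>P ==> odd p" "\<And>p. p\<in>P ==> coprime W (int p)"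
 shows "pmean (W * int (\<Prod>P)) (\<lambda>a b. h a b * exp (z * of_real (fsum P a b))) =
  pmean W h * (\<Prod>p\<in>P. 1 + of_real ((real p - 1) / real p ^ 2) * (exp z + exp (- z) - 2))"
proof -
 have "exp (z * of_real (fsum P a b)) = (\<Prod>p\<in>P. exp (z * of_real (fp p a b)))" for a b
  unfolding fsum_def by (simp add: sum_distrib_left exp_sum[OF P(1)])
 then have "pmean (W * int (\<Prod>P)) (\<lambda>a b. h a b * exp (z * of_real (fsum P a b))) = pmean W h * (\<Prod>p\<in>P. pmean (int p) (\<lambda>a b. exp (z * of_real (fp p a b))))"
  using pmean_prod[OF W P(1,2,4), of "\<lambda>p a b. exp (z * of_real (fp p a b))"] per_fp by (simp add: per_def)
 also have "(\<Prod>p\<in>P. pmean (int p) (\<lambda>a b. exp (z * of_real (fp p a b)))) = (\<Prod>p\<in>P. 1 + of_real ((real p - 1) / real p ^ 2) * (exp z + exp (- z) - 2))"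
  by (rule prod.cong[OF refl]) (simp add: pmean_fp[OF P(2,3), of _ "\<lambda>x. exp (z * of_real x)"])
 finally show ?thesis .
qed

lemma sum_power_div_fact_le_exp: "finite I ==> x >= 0 ==> (\<Sum>n\<in>I. x ^ n / fact n) <= exp x" for x :: real
 unfolding exp_def using sum_le_suminf[OF summable_exp_generic[of x], of I] by (simp add: divide_inverse mult.commute)

lemma exp_minus_le: "exp (- u) <= 1 - u + u ^ 2" if "0 <= u" for u :: real
proof -
 have "exp (- u) <= 1 / (1 + u)" using exp_ge_add_one_self[of u] that by (simp add: exp_minus inverse_eq_divide frac_le)
 also have "(1 - u + u ^ 2) * (1 + u) = 1 + u ^ 3" by (simp add: algebra_simps power2_eq_square power3_eq_cube)
 then have "1 / (1 + u) <= 1 - u + u ^ 2" using that by (simp add: pos_divide_le_eq)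
 finally show ?thesis .
qed

lemma exp_plus_exp_minus_le: "exp u + exp (- u) - 2 <= 2 * u ^ 2" if "0 <= u" "u <= 1" for u :: real
 using exp_bound[OF that] exp_minus_le[OF that(1)] by simp

lemma prod_one_plus_le_exp:
 fixes g :: "'a => real"
 assumes "\<And>p. p\<in>P ==> 0 <= g p" shows "(\<Prod>p\<in>P. 1 + g p) <= exp (\<Sum>p\<in>P. g p)"
proof (cases "finite P")
 case True
 have "(\<Prod>p\<in>P. 1 + g p) <= (\<Prod>p\<in>P. exp (g p))"
  by (rule prod_mono) (use assms exp_ge_add_one_self in "auto simp: add_nonneg_nonneg")
 then show ?thesis by (simp add: exp_sum[OF True])
qed simp

text \<open>For even k the quantity (u S)^k / k! is at most exp(u S) + exp(-u S), and the means of
  these exponentials are products of factors 1 + O(u^2 / p).\<close>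

lemma model_moment_bound:
 assumes P: "finite P" "\<And>p. p\<in>P ==> prime p" "\<And>p. p\<in>P ==> odd p"
  and k: "even k" and u: "0 <= u" "u <= 1"
 shows "u ^ k / fact k * pmean (int (\<Prod>P)) (\<lambda>a b. fsum P a b ^ k) <= 2 * exp (2 * u ^ 2 * (\<Sum>p\<in>P. 1 / real p))"
proof -
 let ?M = "int (\<Prod>P)"
 let ?c = "exp u + exp (- u) - 2"
 have c0: "?c >= 0" using exp_ge_add_one_self[of u] exp_ge_add_one_self[of "- u"] by linarith
 have m: "pmean ?M (\<lambda>a b. exp (v * fsum P a b)) = (\<Prod>p\<in>P. 1 + (real p - 1) / real p ^ 2 * (exp v + exp (- v) - 2))" for v :: real
 proof -
  have "pmean 1 (\<lambda>a b. 1 :: real) = 1" by (simp add: pmean_def)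
  then show ?thesis using pmean_exp_fsum[of 1 "\<lambda>a b. 1 :: real" P v] P by (simp add: per_const)
 qed
 have b: "(\<Prod>p\<in>P. 1 + (real p - 1) / real p ^ 2 * ?c) <= exp (2 * u ^ 2 * (\<Sum>p\<in>P. 1 / real p))"
 proof -
  have nn: "0 <= (real p - 1) / real p ^ 2 * ?c & (real p - 1) / real p ^ 2 * ?c <= 1 / real p * (2 * u ^ 2)" if "p\<in>P" for p
  proof -
   have p: "real p >= 1" using P(2)[OF that] prime_ge_1_nat by simp
   then have "(real p - 1) / real p ^ 2 <= 1 / real p" by (simp add: field_simps power2_eq_square)
   then show ?thesis using c0 p exp_plus_exp_minus_le[OF u] by (intro conjI mult_mono) auto
  qed
  have "(\<Prod>p\<in>P. 1 + (real p - 1) / real p ^ 2 * ?c) <= exp (\<Sum>p\<in>P. (real p - 1) / real p ^ 2 * ?c)"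
   by (rule prod_one_plus_le_exp) (use nn in blast)
  also have "(\<Sum>p\<in>P. (real p - 1) / real p ^ 2 * ?c) <= (\<Sum>p\<in>P. 1 / real p * (2 * u ^ 2))"
   by (rule sum_mono) (use nn in blast)
  also have "\<dots> = 2 * u ^ 2 * (\<Sum>p\<in>P. 1 / real p)" by (simp only: sum_distrib_right[symmetric]) (rule mult.commute)
  finally show ?thesis by simp
 qed
 have pt: "u ^ k / fact k * fsum P a b ^ k <= exp (u * fsum P a b) + exp (- u * fsum P a b)" for a b
 proof -
  have "u ^ k / fact k * fsum P a b ^ k = \<bar>u * fsum P a b\<bar> ^ k / fact k"
   using k by (simp add: power_mult_distrib power_even_abs)
  also have "\<dots> <= exp \<bar>u * fsum P a b\<bar>" using sum_power_div_fact_le_exp[of "{k}" "\<bar>u * fsum P a b\<bar>"] by simp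
  also have "\<dots> <= exp (u * fsum P a b) + exp (- u * fsum P a b)" by (auto simp: abs_if)
  finally show ?thesis .
 qed
 have "u ^ k / fact k * pmean ?M (\<lambda>a b. fsum P a b ^ k) <= pmean ?M (\<lambda>a b. exp (u * fsum P a b) + exp (- u * fsum P a b))"
  unfolding pmean_cmult[symmetric] by (rule pmean_mono) (rule pt)
 also have "\<dots> = 2 * (\<Prod>p\<in>P. 1 + (real p - 1) / real p ^ 2 * ?c)" unfolding pmean_add m by (simp add: add.commute)
 finally show ?thesis using b by simp
qed

text \<open>Taylor expansion of order k: the lower moments are compared by
  \<open>moment_compare\<close>, and the remainder is bounded by the k-th moment, known in the model
  from \<open>model_moment_bound\<close> at u = l / s. Increasing the free parameter l shrinks the
  power of |t| / l at the price of a larger exponential.\<close>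

lemma char_compare:
 fixes h :: "int => int => real"
 assumes n: "0 <= n2" "n2 <= n1"
  and P: "finite P" "\<And>p. p\<in>P ==> prime p" "\<And>p. p\<in>P ==> odd p" "\<And>p. p\<in>P ==> real p <= y"
  and W: "W > 0" "per W h" "\<And>p. p\<in>P ==> coprime W (int p)" and h: "\<And>a b. 0 <= h a b & h a b <= 1"
  and k: "even k" and s: "s >= 1" and l: "0 < l" "l <= s" and y: "y >= 0" and Y: "Y >= 1" "real (card P) * y <= Y"
 shows "norm (bmean n1 n2 (\<lambda>a b. of_real (h a b) * iexp (t * fsum P a b / s)) - pmean (W * int (\<Prod>P)) (\<lambda>a b. of_real (h a b) * iexp (t * fsum P a b / s)))
  <= exp \<bar>t\<bar> * (4 * of_int W * Y ^ k / of_int (2 * n2 + 1)) + 4 * (\<bar>t\<bar> / l) ^ k * exp (2 * (l / s) ^ 2 * (\<Sum>p\<in>P. 1 / real p))"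
proof -
 define Mt where "Mt = W * int (\<Prod>P)"
 define err where "err = 4 * of_int W * Y ^ k / of_int (2 * n2 + 1)"
 define T where "T a b = (\<Sum>i<k. (\<i> * (t * fsum P a b / s)) ^ i / fact i)" for a b
 let ?D = "\<lambda>a b. of_real (h a b) * (iexp (t * fsum P a b / s) - T a b)"
 let ?F = "\<lambda>a b. of_real (h a b) * iexp (t * fsum P a b / s)"
 let ?S = "\<lambda>a b. fsum P a b ^ k"
 let ?m = "\<lambda>i. bmean n1 n2 (\<lambda>a b. h a b * fsum P a b ^ i) - pmean Mt (\<lambda>a b. h a b * fsum P a b ^ i)"
 have Ppos: "p > 0" if "p\<in>P" for p using P(2)[OF that] prime_gt_0_nat by blast
 have M0: "int (\<Prod>P) > 0" using Ppos by (auto intro!: prod_pos)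
 have Mt: "Mt > 0" using W(1) M0 by (simp add: Mt_def)
 have pd: "int p dvd Mt" if "p\<in>P" for p
  unfolding Mt_def using dvd_prodI[OF P(1) that, of "\<lambda>x. x"] by (intro dvd_mult) (simp del: of_nat_prod)
 have n0: "real_of_int (2 * n2 + 1) > 0" using n by simp
 have W1: "real_of_int W >= 1" using W(1) by simp
 have mom: "\<bar>bmean n1 n2 (\<lambda>a b. g a b * fsum P a b ^ i) - pmean Mt (\<lambda>a b. g a b * fsum P a b ^ i)\<bar> <= err"
  if g: "per W g" "\<And>a b. \<bar>g a b\<bar> <= 1" and i: "i <= k" for g i
 proof -
  have "\<bar>bmean n1 n2 (\<lambda>a b. g a b * fsum P a b ^ i) - pmean Mt (\<lambda>a b. g a b * fsum P a b ^ i)\<bar> <= 4 * of_int W * (real (card P) * y) ^ i / of_int (2 * n2 + 1)"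
   by (rule moment_compare[OF n P(1) Ppos P(4) y Mt pd g(1) W(1) _ order_refl g(2)]) (auto simp: Mt_def)
  also have "\<dots> <= err"
  proof -
   have "(real (card P) * y) ^ i <= Y ^ i" using y Y by (intro power_mono) auto
   also have "\<dots> <= Y ^ k" using Y i by (intro power_increasing)
   finally show ?thesis unfolding err_def using W1 n0 by (intro divide_right_mono mult_left_mono) auto
  qed
  finally show ?thesis .
 qed
 have err0: "err >= 0" unfolding err_def using W1 n0 Y by simp
 have hb: "\<bar>h a b\<bar> <= 1" for a b using h[of a b] by simp
 have tay: "norm (of_real (h a b) * (iexp (t * fsum P a b / s) - T a b)) <= (\<bar>t\<bar> / s) ^ k / fact k * fsum P a b ^ k" for a b
 proof -
  have "norm (iexp (t * fsum P a b / s) - T a b) <= \<bar>t * fsum P a b / s\<bar> ^ k / fact k"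
  proof (cases k)
   case 0 then show ?thesis by (simp add: T_def)
  next
   case (Suc n)
   then show ?thesis using iexp_approx1[of "t * fsum P a b / s" n] by (simp add: T_def lessThan_Suc_atMost)
  qed
  also have "\<dots> = (\<bar>t\<bar> / s) ^ k / fact k * fsum P a b ^ k"
   using s k by (simp add: abs_mult power_mult_distrib power_divide power_even_abs)
  finally have "1 * norm (iexp (t * fsum P a b / s) - T a b) <= (\<bar>t\<bar> / s) ^ k / fact k * fsum P a b ^ k" by simp
  moreover have "\<bar>h a b\<bar> * norm (iexp (t * fsum P a b / s) - T a b) <= 1 * norm (iexp (t * fsum P a b / s) - T a b)"
   by (intro mult_right_mono hb) simp
  ultimately show ?thesis by (simp add: norm_mult)
 qed
 define c where "c = (\<bar>t\<bar> / s) ^ k / fact k"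
 have c0: "c >= 0" using s by (simp add: c_def)
 have split: "?F = (\<lambda>a b. of_real (h a b) * (iexp (t * fsum P a b / s) - T a b) +
   (\<Sum>i<k. (\<i> * (t / s)) ^ i / fact i * of_real (h a b * fsum P a b ^ i)))"
  unfolding T_def by (intro ext) (simp add: right_diff_distrib sum_distrib_left power_mult_distrib power_divide ac_simps)
 have d: "bmean n1 n2 ?F - pmean Mt ?F =
  bmean n1 n2 ?D - pmean Mt ?D
  + (\<Sum>i<k. (\<i> * (t / s)) ^ i / fact i * of_real (?m i))"
  unfolding split bmean_add pmean_add bmean_sum pmean_sum bmean_cmult pmean_cmult bmean_of_real pmean_of_real
  by (simp add: sum_subtractf right_diff_distrib)
 have 1: "norm (bmean n1 n2 ?D) <= c * bmean n1 n2 ?S" unfolding bmean_cmult[symmetric] c_def by (rule norm_bmean_le[OF n tay])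
 have 2: "norm (pmean Mt ?D) <= c * pmean Mt ?S" unfolding pmean_cmult[symmetric] c_def by (rule norm_pmean_le[OF tay])
 have 3: "norm (\<Sum>i<k. (\<i> * (t / s)) ^ i / fact i * of_real (?m i))
   <= (\<Sum>i<k. (\<bar>t\<bar> / s) ^ i / fact i) * err"
  unfolding sum_distrib_right
 proof (rule order_trans[OF norm_sum sum_mono])
  fix i assume "i\<in>{..<k}"
  then have m: "\<bar>?m i\<bar> <= err" by (intro mom[OF W(2) hb]) auto
  have "norm ((\<i> * (t / s)) ^ i / fact i) = (\<bar>t\<bar> / s) ^ i / fact i" using s by (simp add: norm_divide norm_power norm_mult)
  then have nm: "norm ((\<i> * (t / s)) ^ i / fact i * of_real d) = (\<bar>t\<bar> / s) ^ i / fact i * \<bar>d\<bar>" for d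
   by (simp only: norm_mult norm_of_real)
  show "norm ((\<i> * (t / s)) ^ i / fact i * of_real (?m i)) <= (\<bar>t\<bar> / s) ^ i / fact i * err"
   unfolding nm by (rule mult_left_mono[OF m]) (use s in simp)
 qed
 have pm: "pmean Mt ?S = pmean (int (\<Prod>P)) ?S"
 proof (rule pmean_mult_period[OF M0 Mt])
  have "fp p (a mod int (\<Prod>P)) (b mod int (\<Prod>P)) = fp p a b" if "p\<in>P" for p a b
   using per_dvd[OF per_fp, of p "int (\<Prod>P)"] dvd_prodI[OF P(1) that, of "\<lambda>x. x"] unfolding per_def by (simp del: of_nat_prod)
  then show "per (int (\<Prod>P)) ?S" unfolding per_def fsum_def by simp
 qed (simp add: Mt_def)
 \<comment> \<open>As k is even, the k-th absolute moment is an ordinary moment, so it passes from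
   the box to the model like the lower ones.\<close>
 have bk: "bmean n1 n2 ?S <= pmean Mt ?S + err" using mom[of "\<lambda>a b. 1" k] by (simp add: per_const)
 have bd: "(l / s) ^ k / fact k * pmean Mt ?S <= 2 * exp (2 * (l / s) ^ 2 * (\<Sum>p\<in>P. 1 / real p))"
  unfolding pm by (rule model_moment_bound[OF P(1-3) k]) (use s l in auto)
 have cl: "c = (\<bar>t\<bar> / l) ^ k * ((l / s) ^ k / fact k)" using l s by (simp add: c_def power_divide)
 have cpm: "c * pmean Mt ?S <= (\<bar>t\<bar> / l) ^ k * (2 * exp (2 * (l / s) ^ 2 * (\<Sum>p\<in>P. 1 / real p)))"
  unfolding cl mult.assoc using bd l by (intro mult_left_mono) (auto simp: mult.assoc)
 have "c * bmean n1 n2 ?S <= c * (pmean Mt ?S + err)" using bk c0 by (rule mult_left_mono)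
 then have "norm (bmean n1 n2 ?F - pmean Mt ?F)
  <= (c + (\<Sum>i<k. (\<bar>t\<bar> / s) ^ i / fact i)) * err + 2 * (c * pmean Mt ?S)"
  unfolding d using norm_triangle_ineq4[of "bmean n1 n2 ?D" "pmean Mt ?D"] 1 2
  by (intro order_trans[OF norm_triangle_ineq]) (use 3 in "simp add: distrib_left distrib_right")
 \<comment> \<open>The error of the k-th moment joins those of the lower ones, and all coefficients
   together form a partial sum of the exponential series.\<close>
 also have "c + (\<Sum>i<k. (\<bar>t\<bar> / s) ^ i / fact i) = (\<Sum>i<Suc k. (\<bar>t\<bar> / s) ^ i / fact i)" by (simp add: c_def)
 also have "\<dots> * err <= exp \<bar>t\<bar> * err"
 proof (rule mult_right_mono[OF _ err0])
  have "(\<Sum>i<Suc k. (\<bar>t\<bar> / s) ^ i / fact i) <= exp (\<bar>t\<bar> / s)" by (rule sum_power_div_fact_le_exp) (use s in simp_all)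
  also have "\<dots> <= exp \<bar>t\<bar>" using s by (simp add: divide_le_eq mult_le_cancel_left1)
  finally show "(\<Sum>i<Suc k. (\<bar>t\<bar> / s) ^ i / fact i) <= exp \<bar>t\<bar>" .
 qed
 finally show ?thesis using cpm unfolding Mt_def err_def by simp
qed

section \<open>The limit law for the truncated sum\<close>

text \<open>This is x^(1 / ln ln x). Fixed powers of it are negligible against sqrt x, as
  \<open>power_asymp\<close> shows, while the logarithm of its logarithm is still asymptotic to ln
  ln x.\<close>

definition cut :: "real => real" where "cut x = exp (ln x / ln (ln x))"

definition dev :: "real => real" where "dev x = sqrt (2 * ln (ln x))"

text \<open>The primes up to w are left to the sieve, whose modulus is therefore coprime to all
  primes here.\<close>

definition mid_primes :: "nat => real => nat set" where
 "mid_primes w x = {p. prime p & odd p & w < p & real p <= cut x}"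

text \<open>The minimality condition of \<open>curve_family\<close>, imposed only at primes up to w
  so as to be periodic.\<close>

definition sieve :: "nat => int => int => real" where
 "sieve w a b = of_bool (\<forall>p\<in>{p. prime p & p <= w}. ~ (int p ^ 4 dvd b & int p ^ 2 dvd a))"

definition sieve_modulus :: "nat => int" where
 "sieve_modulus w = (\<Prod>p | prime p & p <= w. int p ^ 4)"

definition xmean :: "real => (int => int => 'a::real_normed_field) => 'a" where
 "xmean x g = bmean \<lfloor>x\<rfloor> \<lfloor>sqrt x\<rfloor> g"

lemma sieve_modulus_pos: "sieve_modulus w > 0" unfolding sieve_modulus_def by (rule prod_pos) (use prime_gt_0_nat in auto)

lemma per_sieve: "per (sieve_modulus w) (sieve w)" unfolding per_def
proof (intro allI)
 fix a b
 have "(\<forall>p\<in>{p. prime p & p <= w}. ~ (int p ^ 4 dvd b mod sieve_modulus w & int p ^ 2 dvd a mod sieve_modulus w))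
  \<longleftrightarrow> (\<forall>p\<in>{p. prime p & p <= w}. ~ (int p ^ 4 dvd b & int p ^ 2 dvd a))"
 proof (rule ball_cong[OF refl])
  fix p assume p: "p\<in>{p. prime p & p <= w}"
  have d4: "int p ^ 4 dvd sieve_modulus w" unfolding sieve_modulus_def by (rule dvd_prodI) (use p in auto)
  have "int p ^ 2 dvd int p ^ 4" by (rule le_imp_power_dvd) simp
  then have d2: "int p ^ 2 dvd sieve_modulus w" using d4 by (rule dvd_trans)
  show "~ (int p ^ 4 dvd b mod sieve_modulus w & int p ^ 2 dvd a mod sieve_modulus w) \<longleftrightarrow> ~ (int p ^ 4 dvd b & int p ^ 2 dvd a)"
   by (simp only: dvd_mod_iff[OF d4] dvd_mod_iff[OF d2])
 qed
 then show "sieve w (a mod sieve_modulus w) (b mod sieve_modulus w) = sieve w a b" by (simp only: sieve_def)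
qed

lemma coprime_sieve_modulus:
 assumes "prime p" "w < p" shows "coprime (sieve_modulus w) (int p)" unfolding sieve_modulus_def
proof (rule prod_coprime_left)
 fix q assume q: "q\<in>{q. prime q & q <= w}"
 then have "coprime q p" using assms by (intro primes_coprime) auto
 then show "coprime (int q ^ 4) (int p)" by simp
qed

lemma sieve_bounds: "0 <= sieve w a b & sieve w a b <= 1" by (simp add: sieve_def)

lemma finite_mid_primes: "finite (mid_primes w x)" by (rule finite_subset[OF _ finite_primes_upto[of "cut x"]]) (auto simp: mid_primes_def)

lemma eventually_lnln_gt: "eventually (\<lambda>x::real. ln (ln x) > c) at_top" by real_asymp

lemma filterlim_dev: "filterlim dev at_top at_top" unfolding dev_def by real_asymp

lemma filterlim_cut: "filterlim cut at_top at_top" unfolding cut_def by real_asymp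

lemma cut_recip_asymp: "((\<lambda>x. prime_recip (cut x) / ln (ln x)) \<longlongrightarrow> 1) at_top"
proof -
 have 1: "((\<lambda>x. prime_recip (cut x) / ln (ln (cut x))) \<longlongrightarrow> 1) at_top"
  by (rule filterlim_compose[OF prime_recip_asymp filterlim_cut])
 have 2: "((\<lambda>x::real. ln (ln x / ln (ln x)) / ln (ln x)) \<longlongrightarrow> 1) at_top" by real_asymp
 have "((\<lambda>x. prime_recip (cut x) / ln (ln (cut x)) * (ln (ln x / ln (ln x)) / ln (ln x))) \<longlongrightarrow> 1 * 1) at_top"
  by (rule tendsto_mult[OF 1 2])
 moreover have "eventually (\<lambda>x::real. ln (ln x / ln (ln x)) > 0) at_top" by real_asymp
 then have "eventually (\<lambda>x. prime_recip (cut x) / ln (ln (cut x)) * (ln (ln x / ln (ln x)) / ln (ln x)) = prime_recip (cut x) / ln (ln x)) at_top"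
  by eventually_elim (simp add: cut_def)
 ultimately show ?thesis by (simp add: tendsto_cong)
qed

lemma power_asymp: "((\<lambda>x. c * (cut x * cut x) ^ k / sqrt x) \<longlongrightarrow> 0) at_top"
proof -
 have "((\<lambda>x. exp (2 * r * (ln x / ln (ln x)) - ln x / 2)) \<longlongrightarrow> 0) at_top" for r :: real
 proof (cases "r > 0")
  case True
  then show ?thesis by real_asymp
 next
  case False
  show ?thesis
  proof (rule tendsto_sandwich[OF always_eventually _ tendsto_const])
   show "((\<lambda>x::real. exp (- ln x / 2)) \<longlongrightarrow> 0) at_top" by real_asymp
   have "eventually (\<lambda>x::real. ln x / ln (ln x) > 0) at_top" by real_asymp
   then show "eventually (\<lambda>x. exp (2 * r * (ln x / ln (ln x)) - ln x / 2) <= exp (- ln x / 2)) at_top"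
   proof eventually_elim
    case (elim x)
    have "2 * r * q <= 0" if "q > 0" for q using False that by (simp add: mult_nonpos_nonneg)
    from this[OF elim] have "2 * r * (ln x / ln (ln x)) - ln x / 2 <= - ln x / 2" by linarith
    then show ?case by (simp only: exp_le_cancel_iff)
   qed
  qed simp
 qed
 then have "((\<lambda>x. c * exp (2 * real k * (ln x / ln (ln x)) - ln x / 2)) \<longlongrightarrow> c * 0) at_top" by (intro tendsto_mult tendsto_const)
 moreover have "eventually (\<lambda>x. c * exp (2 * real k * (ln x / ln (ln x)) - ln x / 2) = c * (cut x * cut x) ^ k / sqrt x) at_top"
  using eventually_gt_at_top[of 0]
 proof eventually_elim
  case (elim x)
  have "sqrt x = exp (ln x / 2)" using elim by (metis exp_ln exp_half_le2 powr_half_sqrt powr_def order_less_imp_le mult.commute times_divide_eq_left mult_1 order_less_irrefl)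
  moreover have "(cut x * cut x) ^ k = exp (2 * real k * (ln x / ln (ln x)))"
   unfolding cut_def exp_add[symmetric] exp_of_nat_mult[symmetric] by (simp add: algebra_simps)
  ultimately show ?case by (simp add: exp_diff)
 qed
 ultimately show ?thesis by (simp add: tendsto_cong)
qed

lemma exp_minus_approx: "\<bar>1 - u - exp (- u)\<bar> <= u ^ 2" if "0 <= u" for u :: real
 using exp_minus_le[OF that] exp_ge_add_one_self[of "- u"] by linarith

abbreviation midv :: "nat => real => real" where
 "midv w x \<equiv> (\<Sum>p\<in>mid_primes w x. (real p - 1) / real p ^ 2)"

lemma mid_recip_le: "(\<Sum>p\<in>mid_primes w x. 1 / real p) <= prime_recip (cut x)"
 unfolding prime_recip_def by (rule sum_mono2) (auto simp: mid_primes_def)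

text \<open>This sum is half the variance of the model. It differs by a bounded amount from the sum
  of reciprocals of the primes up to \<open>cut x\<close>.\<close>

lemma midv_asymp: "((\<lambda>x. midv w x / ln (ln x)) \<longlongrightarrow> 1) at_top"
proof (rule tendsto_sandwich)
 have eq: "midv w x = (\<Sum>p\<in>mid_primes w x. 1 / real p) - (\<Sum>p\<in>mid_primes w x. 1 / real p ^ 2)" for x
  unfolding sum_subtractf[symmetric]
 proof (rule sum.cong[OF refl])
  fix p assume "p\<in>mid_primes w x"
  then have "real p > 0" using prime_gt_0_nat by (auto simp: mid_primes_def)
  then show "(real p - 1) / real p ^ 2 = 1 / real p - 1 / real p ^ 2" by (simp add: field_simps power2_eq_square)
 qed
 have up: "midv w x <= prime_recip (cut x)" for x
  unfolding eq using mid_recip_le[of w x] sum_nonneg[of "mid_primes w x" "\<lambda>p. 1 / real p ^ 2"] by simp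
 \<comment> \<open>The primes left out are at most max w 2; w + 3 bounds their reciprocals and 1 the
   sum of 1 / p^2.\<close>
 have lo: "prime_recip (cut x) - (real w + 4) <= midv w x" for x
 proof -
  have "primes_upto (cut x) \<subseteq> mid_primes w x \<union> {..max w 2}"
  proof
   fix p assume p: "p\<in>primes_upto (cut x)"
   show "p\<in>mid_primes w x \<union> {..max w 2}" using p primes_dvd_imp_eq[of 2 p] by (cases "p <= w") (auto simp: mid_primes_def)
  qed
  then have "prime_recip (cut x) <= (\<Sum>p\<in>mid_primes w x \<union> {..max w 2}. 1 / real p)"
   unfolding prime_recip_def by (intro sum_mono2) (auto simp: finite_mid_primes)
  also have "\<dots> <= (\<Sum>p\<in>mid_primes w x. 1 / real p) + (\<Sum>p\<in>{..max w 2}. 1 / real p)"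
   using sum.union_inter[OF finite_mid_primes, of "{..max w 2}" "\<lambda>p. 1 / real p" w x]
    sum_nonneg[of "mid_primes w x \<inter> {..max w 2}" "\<lambda>p. 1 / real p"] by simp
  also have "(\<Sum>p\<in>{..max w 2}. 1 / real p) <= (\<Sum>p\<in>{..max w 2}. 1)" by (rule sum_mono) (auto simp: divide_le_eq_1)
  also have "\<dots> <= real w + 3" by simp
  finally have "prime_recip (cut x) <= (\<Sum>p\<in>mid_primes w x. 1 / real p) + (real w + 3)" by simp
  moreover have "(\<Sum>p\<in>mid_primes w x. 1 / real p ^ 2) <= 1"
   by (rule sum_prime_inverse_squares[OF finite_mid_primes]) (use prime_gt_1_nat in "auto simp: mid_primes_def")
  ultimately show ?thesis unfolding eq by linarith
 qed
 show "eventually (\<lambda>x. prime_recip (cut x) / ln (ln x) - (real w + 4) / ln (ln x) <= midv w x / ln (ln x)) at_top"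
  using eventually_lnln_gt[of 0] by eventually_elim (use lo in "simp add: divide_right_mono flip: diff_divide_distrib")
 show "eventually (\<lambda>x. midv w x / ln (ln x) <= prime_recip (cut x) / ln (ln x)) at_top"
  using eventually_lnln_gt[of 0] by eventually_elim (use up in "simp add: divide_right_mono")
 have "((\<lambda>x::real. c / ln (ln x)) \<longlongrightarrow> 0) at_top" for c :: real
  by (rule tendsto_divide_0[OF tendsto_const filterlim_at_top_imp_at_infinity]) real_asymp
 from tendsto_diff[OF cut_recip_asymp this]
 show "((\<lambda>x. prime_recip (cut x) / ln (ln x) - (real w + 4) / ln (ln x)) \<longlongrightarrow> 1) at_top" by simp
qed (rule cut_recip_asymp)

lemma exp_plus_exp_minus_iexp: "iexp \<theta> + exp (- (\<i> * complex_of_real \<theta>)) - 2 = complex_of_real (- (2 - 2 * cos \<theta>))"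
proof -
 have "iexp \<theta> + exp (- (\<i> * complex_of_real \<theta>)) = 2 * cos (complex_of_real \<theta>)" by (simp add: cos_exp_eq)
 then show ?thesis by (simp add: cos_of_real)
qed

text \<open>With r = 2 - 2 cos(t / dev x), the product r ln ln x tends to t^2 / 2. A factor 1 - u
  differs from exp(-u) by at most u^2 <= r^2 / p^2, so the whole product differs from exp(-r midv)
  by at most r^2, which tends to 0.\<close>

lemma model_char_limit:
 "((\<lambda>x. \<Prod>p\<in>mid_primes w x. 1 - (real p - 1) / real p ^ 2 * (2 - 2 * cos (t / dev x))) \<longlongrightarrow> exp (- (t ^ 2) / 2)) at_top"
proof -
 define r where "r x = 2 - 2 * cos (t / dev x)" for x
 have r0: "(r \<longlongrightarrow> 0) at_top"
 proof -
  have "((\<lambda>x. t / dev x) \<longlongrightarrow> 0) at_top"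
   by (rule tendsto_divide_0[OF tendsto_const filterlim_at_top_imp_at_infinity[OF filterlim_dev]])
  then have "((\<lambda>x. 2 - 2 * cos (t / dev x)) \<longlongrightarrow> 2 - 2 * cos 0) at_top" by (intro tendsto_intros)
  then show ?thesis by (simp add: r_def[abs_def])
 qed
 have rn: "0 <= r x" "r x <= 4" for x using cos_le_one[of "t / dev x"] cos_ge_minus_one[of "t / dev x"] unfolding r_def by linarith+
 have rl: "((\<lambda>x. r x * ln (ln x)) \<longlongrightarrow> t ^ 2 / 2) at_top"
 proof (cases "t = 0")
  case True then show ?thesis by (simp add: r_def)
 next
  case False
  have 1: "((\<lambda>u::real. (2 - 2 * cos u) / u ^ 2) \<longlongrightarrow> 1) (at 0)" by real_asymp
  have "filterlim (\<lambda>x. t / dev x) (at 0) at_top"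
  proof (rule filterlim_atI)
   show "((\<lambda>x. t / dev x) \<longlongrightarrow> 0) at_top"
    by (rule tendsto_divide_0[OF tendsto_const filterlim_at_top_imp_at_infinity[OF filterlim_dev]])
   show "eventually (\<lambda>x. t / dev x ~= 0) at_top"
    using filterlim_dev[unfolded filterlim_at_top_dense, rule_format, of 0] by eventually_elim (use False in simp)
  qed
  from filterlim_compose[OF 1 this] have "((\<lambda>x. (2 - 2 * cos (t / dev x)) / (t / dev x) ^ 2 * (t ^ 2 / 2)) \<longlongrightarrow> 1 * (t ^ 2 / 2)) at_top"
   by (intro tendsto_mult tendsto_const)
  moreover have "eventually (\<lambda>x. (2 - 2 * cos (t / dev x)) / (t / dev x) ^ 2 * (t ^ 2 / 2) = r x * ln (ln x)) at_top"
   using eventually_lnln_gt[of 0]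
  proof eventually_elim
   case (elim x)
   then have "dev x ^ 2 = 2 * ln (ln x)" by (simp add: dev_def)
   then have d: "(t / dev x) ^ 2 = t ^ 2 / (2 * ln (ln x))" by (simp only: power_divide)
   show ?case unfolding r_def d using False elim by simp
  qed
  ultimately show ?thesis by (simp add: tendsto_cong)
 qed
 have "((\<lambda>x. exp (- (r x * ln (ln x) * (midv w x / ln (ln x))))) \<longlongrightarrow> exp (- (t ^ 2 / 2 * 1))) at_top"
  by (intro tendsto_intros rl midv_asymp)
 moreover have "eventually (\<lambda>x. exp (- (r x * ln (ln x) * (midv w x / ln (ln x)))) = exp (- (r x * midv w x))) at_top"
  using eventually_lnln_gt[of 0] by eventually_elim simp
 ultimately have "((\<lambda>x. exp (- (r x * midv w x))) \<longlongrightarrow> exp (- (t ^ 2 / 2 * 1))) at_top"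
  by (rule Lim_transform_eventually)
 then have e: "((\<lambda>x. exp (- (r x * midv w x))) \<longlongrightarrow> exp (- (t ^ 2) / 2)) at_top" by simp
 have b: "norm ((\<Prod>p\<in>mid_primes w x. 1 - (real p - 1) / real p ^ 2 * r x) - exp (- (r x * midv w x))) <= r x ^ 2" for x
 proof -
  define u where "u p = (real p - 1) / real p ^ 2 * r x" for p :: nat
  have u: "0 <= u p & u p <= 1 & u p ^ 2 <= 1 / real p ^ 2 * r x ^ 2" if p: "p\<in>mid_primes w x" for p
  proof -
   have p2: "real p >= 2" using p prime_ge_2_nat by (auto simp: mid_primes_def)
   have c: "0 <= (real p - 1) / real p ^ 2" "(real p - 1) / real p ^ 2 <= 1 / real p"
    using p2 by (simp_all add: field_simps power2_eq_square)
   have "0 <= (real p - 2) ^ 2" by simp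
   then have "(real p - 1) * 4 <= real p ^ 2" by (simp add: power2_eq_square algebra_simps)
   then have c4: "(real p - 1) / real p ^ 2 <= 1 / 4" using p2 by (simp add: field_simps)
   have "u p <= 1 / 4 * 4" unfolding u_def by (rule mult_mono[OF c4]) (use rn in auto)
   moreover have "((real p - 1) / real p ^ 2) ^ 2 <= (1 / real p) ^ 2" by (rule power_mono[OF c(2,1)])
   then have "((real p - 1) / real p ^ 2) ^ 2 * r x ^ 2 <= (1 / real p) ^ 2 * r x ^ 2" by (rule mult_right_mono) simp
   then have "u p ^ 2 <= 1 / real p ^ 2 * r x ^ 2" unfolding u_def by (simp only: power_mult_distrib power_one_over)
   moreover have "0 <= u p" unfolding u_def using c(1) rn(1) by (rule mult_nonneg_nonneg)
   ultimately show ?thesis by simp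
  qed
  have ex: "exp (- (r x * midv w x)) = (\<Prod>p\<in>mid_primes w x. exp (- u p))"
   unfolding exp_sum[OF finite_mid_primes, symmetric] u_def by (simp add: sum_negf sum_distrib_left mult.commute)
  have "norm ((\<Prod>p\<in>mid_primes w x. 1 - u p) - (\<Prod>p\<in>mid_primes w x. exp (- u p))) <= (\<Sum>p\<in>mid_primes w x. norm (1 - u p - exp (- u p)))"
   by (rule norm_prod_diff) (use u in "fastforce+")
  also have "\<dots> <= (\<Sum>p\<in>mid_primes w x. 1 / real p ^ 2 * r x ^ 2)"
  proof (rule sum_mono)
   fix p assume "p\<in>mid_primes w x"
   from u[OF this] show "norm (1 - u p - exp (- u p)) <= 1 / real p ^ 2 * r x ^ 2"
    using exp_minus_approx[of "u p"] by (simp del: times_divide_eq_left)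
  qed
  also have "\<dots> = (\<Sum>p\<in>mid_primes w x. 1 / real p ^ 2) * r x ^ 2" by (rule sum_distrib_right[symmetric])
  also have "\<dots> <= 1 * r x ^ 2"
   by (intro mult_right_mono sum_prime_inverse_squares[OF finite_mid_primes]) (use prime_gt_1_nat in "auto simp: mid_primes_def")
  finally show ?thesis unfolding ex u_def by simp
 qed
 have "((\<lambda>x. (\<Prod>p\<in>mid_primes w x. 1 - (real p - 1) / real p ^ 2 * r x) - exp (- (r x * midv w x))) \<longlongrightarrow> 0) at_top"
 proof (rule Lim_null_comparison)
  show "((\<lambda>x. r x ^ 2) \<longlongrightarrow> 0) at_top" using tendsto_power[OF r0, of 2] by simp
 qed (rule always_eventually, rule allI, rule b)
 from tendsto_add[OF this e] show ?thesis by (simp add: r_def)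
qed

definition sieve_density :: "nat => real" where
 "sieve_density w = pmean (sieve_modulus w) (sieve w)"

text \<open>The order k of the expansion depends on the desired accuracy but not on x: the
  exponential in the tail of \<open>char_compare\<close> is bounded by exp(2 l^2), because the sum
  of 1 / p over the primes in use is eventually at most dev^2.\<close>

theorem char_limit:
 "((\<lambda>x. xmean x (\<lambda>a b. of_real (sieve w a b) * iexp (t * fsum (mid_primes w x) a b / dev x)))
  \<longlongrightarrow> complex_of_real (sieve_density w * exp (- (t ^ 2) / 2))) at_top"
proof -
 define W where "W = sieve_modulus w"
 define F where "F x a b = of_real (sieve w a b) * iexp (t * fsum (mid_primes w x) a b / dev x)" for x a b
 define G where "G x = pmean (W * int (\<Prod>(mid_primes w x))) (F x)" for x
 have Wp: "W > 0" "per W (sieve w)" unfolding W_def by (rule sieve_modulus_pos per_sieve)+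
 have mp: "prime p" "odd p" "real p <= cut x" "coprime W (int p)" if "p\<in>mid_primes w x" for p x
  using that coprime_sieve_modulus unfolding W_def by (auto simp: mid_primes_def)
 have Gx: "G x = complex_of_real (sieve_density w * (\<Prod>p\<in>mid_primes w x. 1 - (real p - 1) / real p ^ 2 * (2 - 2 * cos (t / dev x))))" for x
 proof -
  have perW: "per W (\<lambda>a b. complex_of_real (sieve w a b))" using Wp(2) by (simp add: per_def)
  have "F x = (\<lambda>a b. of_real (sieve w a b) * exp (\<i> * of_real (t / dev x) * of_real (fsum (mid_primes w x) a b)))"
   by (simp add: F_def fun_eq_iff mult.assoc)
  then have "G x = pmean W (\<lambda>a b. of_real (sieve w a b)) * (\<Prod>p\<in>mid_primes w x. 1 + of_real ((real p - 1) / real p ^ 2) * (iexp (t / dev x) + exp (- (\<i> * complex_of_real (t / dev x))) - 2))"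
   unfolding G_def using pmean_exp_fsum[where P = "mid_primes w x" and z = "\<i> * complex_of_real (t / dev x)", OF Wp(1) perW finite_mid_primes mp(1,2,4)] by simp
  moreover have "(\<Prod>p\<in>mid_primes w x. 1 + of_real ((real p - 1) / real p ^ 2) * complex_of_real (- (2 - 2 * cos (t / dev x)))) =
    complex_of_real (\<Prod>p\<in>mid_primes w x. 1 - (real p - 1) / real p ^ 2 * (2 - 2 * cos (t / dev x)))"
   unfolding of_real_prod of_real_mult[symmetric] by (rule prod.cong[OF refl]) (simp only: mult_minus_right of_real_minus of_real_diff of_real_1 add_uminus_conv_diff)
  ultimately show ?thesis by (simp only: pmean_of_real exp_plus_exp_minus_iexp sieve_density_def W_def of_real_mult)
 qed
 have lim: "(G \<longlongrightarrow> complex_of_real (sieve_density w * exp (- (t ^ 2) / 2))) at_top"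
  unfolding Gx[abs_def] by (intro tendsto_of_real tendsto_mult tendsto_const model_char_limit)
 have "((\<lambda>x. xmean x (F x) - G x) \<longlongrightarrow> 0) at_top"
 proof (rule tendstoI)
  fix e :: real assume e: "e > 0"
  \<comment> \<open>Chosen so that |t| / l is at most 1 / 2 and the tail decays geometrically in
    k.\<close>
  define l where "l = 2 * \<bar>t\<bar> + 1"
  have l: "l > 0" "\<bar>t\<bar> / l <= 1 / 2" by (auto simp: l_def field_simps)
  have "((\<lambda>i. 4 * (1 / 2) ^ i * exp (2 * l ^ 2)) \<longlonglongrightarrow> 4 * 0 * exp (2 * l ^ 2)) "
   by (intro tendsto_mult tendsto_const LIMSEQ_power_zero) simp
  then have "eventually (\<lambda>i. 4 * (1 / 2) ^ i * exp (2 * l ^ 2) < e / 2) sequentially"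
   using e by (intro order_tendstoD(2)[of _ 0]) auto
  then obtain i0 where i0: "\<And>i. i >= i0 ==> 4 * (1 / 2) ^ i * exp (2 * l ^ 2) < e / 2" unfolding eventually_sequentially by blast
  define k where "k = 2 * i0"
  have k: "even k" "4 * (1 / 2) ^ k * exp (2 * l ^ 2) < e / 2" using i0[of k] by (auto simp: k_def)
  have "eventually (\<lambda>x. exp \<bar>t\<bar> * 4 * of_int W * (cut x * cut x) ^ k / sqrt x < e / 2) at_top"
   by (rule order_tendstoD(2)[OF power_asymp]) (use e in simp)
  moreover have "eventually (\<lambda>x. dev x > max l 1) at_top" using filterlim_dev by (simp only: filterlim_at_top_dense)
  moreover have "eventually (\<lambda>x. prime_recip (cut x) / ln (ln x) < 2) at_top" by (rule order_tendstoD(2)[OF cut_recip_asymp]) simp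
  moreover have "eventually (\<lambda>x. cut x >= 1) at_top" using filterlim_cut by (simp only: filterlim_at_top)
  moreover note eventually_lnln_gt[of 0] eventually_ge_at_top[of 1]
  ultimately show "eventually (\<lambda>x. dist (xmean x (F x) - G x) 0 < e) at_top"
  proof eventually_elim
   case (elim x)
   let ?P = "mid_primes w x"
   have sx: "sqrt x <= x" using elim(6) by (simp add: real_sqrt_le_iff' real_le_lsqrt power2_eq_square) 
   have n: "0 <= \<lfloor>sqrt x\<rfloor>" "\<lfloor>sqrt x\<rfloor> <= \<lfloor>x\<rfloor>" using elim(6) sx by (auto intro: floor_mono)
   have card: "real (card ?P) <= cut x"
   proof -
    have "?P \<subseteq> {1..nat \<lfloor>cut x\<rfloor>}" using prime_ge_1_nat by (auto simp: mid_primes_def le_nat_floor)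
    then have "card ?P <= card {1..nat \<lfloor>cut x\<rfloor>}" by (rule card_mono[rotated]) simp
    then show ?thesis using elim(4) by (simp add: le_nat_iff) linarith
   qed
   have Y: "cut x * cut x >= 1" "real (card ?P) * cut x <= cut x * cut x"
    using elim(4) card mult_mono[of 1 "cut x" 1 "cut x"] by (auto intro!: mult_right_mono)
   have main: "norm (xmean x (F x) - G x) <= exp \<bar>t\<bar> * (4 * of_int W * (cut x * cut x) ^ k / of_int (2 * \<lfloor>sqrt x\<rfloor> + 1)) + 4 * (\<bar>t\<bar> / l) ^ k * exp (2 * (l / dev x) ^ 2 * (\<Sum>p\<in>?P. 1 / real p))"
    unfolding xmean_def G_def F_def
    by (rule char_compare[OF n finite_mid_primes mp(1,2,3) Wp mp(4) sieve_bounds k(1) _ l(1) _ _ Y]) (use elim in auto)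
   have d1: "exp \<bar>t\<bar> * (4 * of_int W * (cut x * cut x) ^ k / of_int (2 * \<lfloor>sqrt x\<rfloor> + 1)) <= exp \<bar>t\<bar> * 4 * of_int W * (cut x * cut x) ^ k / sqrt x"
   proof -
    have "sqrt x <= of_int (2 * \<lfloor>sqrt x\<rfloor> + 1)" using n(1) by linarith
    moreover have "sqrt x > 0" using elim(6) by simp
    moreover have "0 <= exp \<bar>t\<bar> * (4 * of_int W * (cut x * cut x) ^ k)" using Wp(1) Y by simp
    ultimately have "exp \<bar>t\<bar> * (4 * of_int W * (cut x * cut x) ^ k) / of_int (2 * \<lfloor>sqrt x\<rfloor> + 1) <= exp \<bar>t\<bar> * (4 * of_int W * (cut x * cut x) ^ k) / sqrt x"
     by (intro divide_left_mono mult_pos_pos) linarith+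
    then show ?thesis by (simp add: mult.assoc)
   qed
   have "4 * (\<bar>t\<bar> / l) ^ k * exp (2 * (l / dev x) ^ 2 * (\<Sum>p\<in>?P. 1 / real p)) <= 4 * (1 / 2) ^ k * exp (2 * l ^ 2)"
   proof (intro mult_mono power_mono)
    have d2: "dev x ^ 2 = 2 * ln (ln x)" using elim(5) by (simp add: dev_def)
    have "(\<Sum>p\<in>?P. 1 / real p) <= dev x ^ 2" unfolding d2 using mid_recip_le[of w x] elim(3,5) by (simp add: divide_less_eq)
    then have "(l / dev x) ^ 2 * (\<Sum>p\<in>?P. 1 / real p) <= (l / dev x) ^ 2 * dev x ^ 2" by (rule mult_left_mono) simp
    also have "\<dots> = l ^ 2" using elim(2) by (simp add: power_divide)
    finally show "exp (2 * (l / dev x) ^ 2 * (\<Sum>p\<in>?P. 1 / real p)) <= exp (2 * l ^ 2)" by simp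
   qed (use l in auto)
   then show ?case using main d1 elim(1) k(2) by (simp add: dist_norm)
  qed
 qed
 from tendsto_add[OF this lim] have "((\<lambda>x. xmean x (F x)) \<longlongrightarrow> complex_of_real (sieve_density w * exp (- (t ^ 2) / 2))) at_top" by simp
 then show ?thesis by (simp only: F_def[abs_def])
qed

lemma sieve_mean_limit: "((\<lambda>x. xmean x (sieve w)) \<longlongrightarrow> sieve_density w) at_top"
proof -
 have "((\<lambda>x. complex_of_real (xmean x (sieve w))) \<longlongrightarrow> complex_of_real (sieve_density w)) at_top"
  using char_limit[of w 0] by (simp add: xmean_def bmean_of_real)
 then show ?thesis by (simp only: tendsto_of_real_iff)
qed

abbreviation xbox :: "real => (int \<times> int) set" where
 "xbox x \<equiv> box \<lfloor>x\<rfloor> \<lfloor>sqrt x\<rfloor>"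

definition sifted :: "nat => real => (int \<times> int) set" where
 "sifted w x = {(a, b)\<in>xbox x. sieve w a b = 1}"

lemma finite_box [simp]: "finite (box n1 n2)" by (simp add: box_def)

lemma card_box: "0 <= n2 ==> 0 <= n1 ==> real (card (box n1 n2)) = of_int ((2 * n1 + 1) * (2 * n2 + 1))"
 by (simp add: box_def card_cartesian_product)

lemma sifted_subset: "sifted w x \<subseteq> xbox x" by (auto simp: sifted_def)

lemma finite_sifted [simp]: "finite (sifted w x)" by (rule finite_subset[OF sifted_subset]) simp

lemma sum_sieve:
 fixes f :: "int => int => 'a::real_normed_field"
 shows "(\<Sum>(a, b)\<in>xbox x. of_real (sieve w a b) * f a b) = (\<Sum>(a, b)\<in>sifted w x. f a b)"
proof -
 have "(\<Sum>(a, b)\<in>xbox x. of_real (sieve w a b) * f a b) = (\<Sum>z\<in>xbox x. if z\<in>sifted w x then (case z of (a, b) => f a b) else 0)"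
  by (rule sum.cong[OF refl]) (auto simp: sifted_def sieve_def)
 also have "\<dots> = (\<Sum>z\<in>xbox x \<inter> sifted w x. case z of (a, b) => f a b)" by (rule sum.inter_restrict[symmetric]) simp
 also have "xbox x \<inter> sifted w x = sifted w x" using sifted_subset by blast
 finally show ?thesis .
qed

lemma isCont_cdf_std_normal: "isCont (cdf std_normal_distribution) u"
proof -
 interpret real_distribution std_normal_distribution by (rule real_dist_normal_dist)
 have "emeasure std_normal_distribution {u} = (\<integral>\<^sup>+ t. ennreal (std_normal_density t) * indicator {u} t \<partial>lborel)"
  by (rule emeasure_density) auto
 also have "\<dots> = (\<integral>\<^sup>+ (t::real). 0 \<partial>lborel)"
 proof (rule nn_integral_cong_AE)
  show "AE t in lborel. ennreal (std_normal_density t) * indicator {u} t = 0" using AE_lborel_singleton[of u] by eventually_elim simp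
 qed
 finally show ?thesis by (simp add: isCont_cdf measure_def)
qed

text \<open>The characteristic function of the uniform law on the sifted pairs is the weighted mean
  of \<open>char_limit\<close> divided by the mean of the sieve, so the density cancels. Levy's
  theorem concerns sequences, hence the detour through arbitrary sequences tending to
  infinity.\<close>

theorem normal_limit_sifted:
 assumes w: "sieve_density w > 0"
 shows "((\<lambda>x. real (card {(a, b)\<in>sifted w x. fsum (mid_primes w x) a b <= u * dev x}) / real (card (sifted w x)))
  \<longlongrightarrow> cdf std_normal_distribution u) at_top"
proof (rule tendsto_at_topI_sequentially)
 fix xs :: "nat => real" assume xs: "filterlim xs at_top sequentially"
 let ?G = "\<lambda>x t. xmean x (\<lambda>a b. of_real (sieve w a b) * iexp (t * fsum (mid_primes w x) a b / dev x))"
 define T where "T x = (\<lambda>(a, b). fsum (mid_primes w x) a b / dev x)" for x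
 define M where "M x = distr (measure_pmf (pmf_of_set (sifted w x))) borel (T x)" for x
 have Mrd: "real_distribution (M x)" for x unfolding M_def
  by (rule prob_space.real_distribution_distr[OF measure_pmf.prob_space_axioms]) simp
 have ev: "eventually (\<lambda>x. xmean x (sieve w) > 0) at_top" by (rule order_tendstoD(1)[OF sieve_mean_limit w])
 have ne: "sifted w x ~= {}" if "xmean x (sieve w) > 0" for x
 proof
  assume "sifted w x = {}"
  then have "(\<Sum>(a, b)\<in>xbox x. of_real (sieve w a b) * (1::real)) = 0" unfolding sum_sieve by simp
  then show False using that by (simp add: xmean_def bmean_def)
 qed
 have c0: "(of_int ((2 * \<lfloor>x\<rfloor> + 1) * (2 * \<lfloor>sqrt x\<rfloor> + 1)) :: complex) ~= 0" for x :: real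
 proof -
  have "2 * m + 1 ~= 0" for m :: int by presburger
  then show ?thesis by (simp only: of_int_eq_0_iff mult_eq_0_iff simp_thms)
 qed
 have char_eq: "char (M x) t = ?G x t / of_real (xmean x (sieve w))"
  if pos: "xmean x (sieve w) > 0" for x t
 proof -
  let ?H = "sifted w x"
  let ?c = "of_int ((2 * \<lfloor>x\<rfloor> + 1) * (2 * \<lfloor>sqrt x\<rfloor> + 1))"
  have "char (M x) t = (LINT z|measure_pmf (pmf_of_set ?H). iexp (t * T x z))" unfolding char_def M_def by (subst integral_distr) auto
  also have "\<dots> = (\<Sum>z\<in>?H. pmf (pmf_of_set ?H) z *\<^sub>R iexp (t * T x z))"
   by (rule integral_measure_pmf) (use ne[OF pos] in auto)
  also have "\<dots> = (\<Sum>z\<in>?H. iexp (t * T x z) / of_nat (card ?H))"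
   by (rule sum.cong[OF refl]) (use ne[OF pos] in "simp add: pmf_of_set scaleR_conv_of_real divide_inverse mult.commute")
  also have "\<dots> = (\<Sum>(a, b)\<in>?H. iexp (t * fsum (mid_primes w x) a b / dev x)) / of_nat (card ?H)"
   unfolding sum_divide_distrib[symmetric] T_def by (simp add: case_prod_unfold)
  also have "(\<Sum>(a, b)\<in>?H. iexp (t * fsum (mid_primes w x) a b / dev x)) = ?c * ?G x t"
  proof -
   have "(?c::complex) ~= 0" by (rule c0)
   then show ?thesis unfolding xmean_def bmean_def sum_sieve by (simp del: of_int_mult)
  qed
  also have "(of_nat (card ?H) :: complex) = ?c * of_real (xmean x (sieve w))"
  proof -
   have "(\<Sum>(a, b)\<in>xbox x. of_real (sieve w a b) * (1::real)) = real (card ?H)" unfolding sum_sieve by simp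
   then have "real (card ?H) = ?c * xmean x (sieve w)" using pos by (auto simp: xmean_def bmean_def simp del: of_int_mult)
   then have "complex_of_real (real (card ?H)) = complex_of_real (?c * xmean x (sieve w))" by (simp only:)
   then show ?thesis by simp
  qed
  finally have q: "char (M x) t = ?c * ?G x t / (?c * of_real (xmean x (sieve w)))" .
  have "(?c::complex) ~= 0" by (rule c0)
  then show ?thesis unfolding q by (simp del: of_int_mult)
 qed
 have char_lim: "((\<lambda>x. char (M x) t) \<longlongrightarrow> char std_normal_distribution t) at_top" for t
 proof -
  have "((\<lambda>x. ?G x t / of_real (xmean x (sieve w)))
    \<longlongrightarrow> complex_of_real (sieve_density w * exp (- (t ^ 2) / 2)) / complex_of_real (sieve_density w)) at_top"
   by (intro tendsto_divide char_limit tendsto_of_real sieve_mean_limit) (use w in simp)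
  moreover have "eventually (\<lambda>x. ?G x t / of_real (xmean x (sieve w)) = char (M x) t) at_top"
   using ev by eventually_elim (rule char_eq[symmetric])
  ultimately show ?thesis unfolding char_std_normal_distribution using w by (simp add: tendsto_cong)
 qed
 have "weak_conv_m (\<lambda>n. M (xs n)) std_normal_distribution"
  by (rule levy_continuity[OF Mrd real_dist_normal_dist]) (rule filterlim_compose[OF char_lim xs])
 moreover note isCont_cdf_std_normal[of u]
 ultimately have "(\<lambda>n. cdf (M (xs n)) u) \<longlonglongrightarrow> cdf std_normal_distribution u"
  unfolding weak_conv_m_def weak_conv_def by blast
 moreover have "eventually (\<lambda>n. cdf (M (xs n)) u = real (card {(a, b)\<in>sifted w (xs n). fsum (mid_primes w (xs n)) a b <= u * dev (xs n)}) / real (card (sifted w (xs n)))) sequentially"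
 proof -
  have "eventually (\<lambda>x. cdf (M x) u = real (card {(a, b)\<in>sifted w x. fsum (mid_primes w x) a b <= u * dev x}) / real (card (sifted w x))) at_top"
   using ev filterlim_dev[unfolded filterlim_at_top_dense, rule_format, of 0]
  proof eventually_elim
   case (elim x)
   have "cdf (M x) u = measure (measure_pmf (pmf_of_set (sifted w x))) (T x -` {..u})"
    unfolding cdf_def M_def by (subst measure_distr) auto
   also have "\<dots> = real (card (sifted w x \<inter> T x -` {..u})) / real (card (sifted w x))"
    by (rule measure_pmf_of_set) (use ne[OF elim(1)] in auto)
   also have "sifted w x \<inter> T x -` {..u} = {(a, b)\<in>sifted w x. fsum (mid_primes w x) a b <= u * dev x}"
    using elim(2) by (auto simp: T_def pos_divide_le_eq)
   finally show ?case .
  qed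
  then show ?thesis using xs by (rule eventually_compose_filterlim)
 qed
 ultimately show "(\<lambda>n. real (card {(a, b)\<in>sifted w (xs n). fsum (mid_primes w (xs n)) a b <= u * dev (xs n)}) / real (card (sifted w (xs n)))) \<longlonglongrightarrow> cdf std_normal_distribution u"
  by (rule Lim_transform_eventually)
qed

section \<open>The exceptional pairs\<close>

lemma xmean_card:
 assumes "x >= 1"
 shows "xmean x (\<lambda>a b. of_bool (Q a b)) = real (card {(a, b)\<in>xbox x. Q a b}) / real (card (xbox x))"
proof -
 have n: "0 <= \<lfloor>x\<rfloor>" "0 <= \<lfloor>sqrt x\<rfloor>" using assms by simp_all
 have "(\<Sum>(a, b)\<in>xbox x. of_bool (Q a b)) = (\<Sum>z\<in>xbox x. if z\<in>{(a, b). Q a b} then 1 else (0::real))"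
  by (rule sum.cong[OF refl]) auto
 also have "\<dots> = (\<Sum>z\<in>xbox x \<inter> {(a, b). Q a b}. 1)" by (rule sum.inter_restrict[symmetric]) simp
 also have "xbox x \<inter> {(a, b). Q a b} = {(a, b)\<in>xbox x. Q a b}" by auto
 finally show ?thesis unfolding xmean_def bmean_def card_box[OF n(2,1)] by simp
qed

lemma sqrt_le_self: "x >= 1 ==> sqrt x <= x" by (rule real_le_lsqrt) (auto simp: power2_eq_square)

lemma xbox_bounds:
 assumes "x >= 1" shows "0 <= \<lfloor>sqrt x\<rfloor>" "\<lfloor>sqrt x\<rfloor> <= \<lfloor>x\<rfloor>" "sqrt x <= of_int (2 * \<lfloor>sqrt x\<rfloor> + 1)"
proof -
 show n: "0 <= \<lfloor>sqrt x\<rfloor>" using assms by simp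
 show "\<lfloor>sqrt x\<rfloor> <= \<lfloor>x\<rfloor>" using sqrt_le_self[OF assms] by (rule floor_mono)
 have "sqrt x < of_int \<lfloor>sqrt x\<rfloor> + 1" by linarith
 moreover have "0 <= real_of_int \<lfloor>sqrt x\<rfloor>" using n by (simp only: of_int_0_le_iff)
 ultimately show "sqrt x <= of_int (2 * \<lfloor>sqrt x\<rfloor> + 1)" unfolding of_int_add of_int_mult of_int_numeral of_int_1 by linarith
qed

lemma xbox_sides:
 assumes "x >= 1" shows "real_of_int (2 * \<lfloor>x\<rfloor> + 1) > 0" "real_of_int (2 * \<lfloor>sqrt x\<rfloor> + 1) > 0"
 using xbox_bounds(1,2)[OF assms] by (simp_all only: of_int_0_less_iff)

lemma card_xbox_pos: assumes x: "x >= 1" shows "real (card (xbox x)) > 0"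
proof -
 have "real (card (xbox x)) = of_int ((2 * \<lfloor>x\<rfloor> + 1) * (2 * \<lfloor>sqrt x\<rfloor> + 1))"
  by (rule card_box) (use xbox_bounds[OF x] in linarith)+
 then show ?thesis using mult_pos_pos[OF xbox_sides[OF x]] by (simp only: of_int_mult)
qed

lemma family_subset: assumes x: "x >= 1" shows "curve_family x \<subseteq> sifted w x"
proof
 fix z assume z: "z\<in>curve_family x"
 obtain A B where AB: "z = (A, B)" by fastforce
 have h: "real_of_int \<bar>A\<bar> <= x" "real_of_int (B\<^sup>2) <= x" and s: "\<And>p::int. prime p ==> p ^ 4 dvd B ==> ~ p\<^sup>2 dvd A"
  using z unfolding AB curve_family_def by auto
 have "real_of_int \<bar>B\<bar> <= sqrt x" using h(2) by (intro real_le_rsqrt) simp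
 then have "\<bar>B\<bar> <= \<lfloor>sqrt x\<rfloor>" "\<bar>A\<bar> <= \<lfloor>x\<rfloor>" using h(1) by (simp_all only: le_floor_iff)
 moreover have "sieve w A B = 1" unfolding sieve_def using s[of "int _"] by auto
 ultimately show "z\<in>sifted w x" unfolding AB sifted_def box_def by auto
qed

lemma card_multiples:
 assumes "m > 0" "n >= 0"
 shows "real (card {b::int. \<bar>b\<bar> <= n & b ~= 0 & m dvd b}) <= 2 * of_int n / of_int m"
proof -
 define q where "q = n div m"
 let ?M = "{b. \<bar>b\<bar> <= n & b ~= 0 & m dvd b}"
 have q0: "q >= 0" using assms by (simp add: q_def pos_imp_zdiv_nonneg_iff)
 have "?M \<subseteq> (\<lambda>c. m * c) ` ({- q..q} - {0})"
 proof
  fix b assume b: "b \<in> ?M"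
  then obtain c where c: "b = m * c" by (auto elim: dvdE)
  have "\<bar>c\<bar> * m <= n" using b assms unfolding c by (simp add: abs_mult mult.commute)
  then have "\<bar>c\<bar> <= q" using assms zdiv_mono1[of "\<bar>c\<bar> * m" n m] by (simp add: q_def)
  then show "b\<in>(\<lambda>c. m * c) ` ({- q..q} - {0})" using b c by (intro image_eqI[of _ _ c]) (auto simp: abs_le_iff)
 qed
 then have "card ?M <= card ({- q..q} - {0})" by (rule surj_card_le[rotated]) simp
 also have "\<dots> = nat (2 * q)" using q0 by (subst card_Diff_singleton) auto
 finally have "real (card ?M) <= 2 * of_int q" using q0 by linarith
 moreover have "of_int q <= of_int n / (of_int m :: real)" unfolding q_def by (rule real_of_int_div4)
 ultimately show ?thesis by simp
qed

text \<open>A sifted pair outside the family has B = 0 or A^2 = 4B, each leaving at most one B for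
  every A, or has B divisible by p^4 with a prime p > w. The last case is summed over all integers k
  > w, using k^4 >= (w + 1)^2 k^2; the first two account for 2 / sqrt x.\<close>

lemma card_sifted_diff:
 assumes x: "x >= 1" and w: "w >= 1"
 shows "real (card (sifted w x - curve_family x)) / real (card (xbox x)) <= 1 / ((real w + 1) ^ 2 * real w) + 2 / sqrt x"
proof -
 let ?n1 = "\<lfloor>x\<rfloor>" and ?n2 = "\<lfloor>sqrt x\<rfloor>"
 have n: "0 <= ?n2" "?n2 <= ?n1" "sqrt x <= of_int (2 * ?n2 + 1)" by (rule xbox_bounds[OF x])+
 define N1 N2 where "N1 = real_of_int (2 * ?n1 + 1)" and "N2 = real_of_int (2 * ?n2 + 1)"
 have N: "N1 > 0" "N2 > 0" "sqrt x <= N2" "real (card (xbox x)) = N1 * N2"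
  using n card_box[of ?n2 ?n1] xbox_sides[OF x] unfolding N1_def N2_def by (simp_all only: of_int_mult)
 let ?I = "{- ?n1..?n1}"
 let ?K = "{w<..nat ?n2}"
 let ?M = "\<lambda>k. {b::int. \<bar>b\<bar> <= ?n2 & b ~= 0 & int k ^ 4 dvd b}"
 have "sifted w x - curve_family x \<subseteq> (\<lambda>a. (a, 0)) ` ?I \<union> (\<lambda>a. (a, a\<^sup>2 div 4)) ` ?I \<union> ?I \<times> (\<Union>k\<in>?K. ?M k)"
 proof
  fix z assume z: "z\<in>sifted w x - curve_family x"
  obtain A B where AB: "z = (A, B)" by fastforce
  have bx: "\<bar>A\<bar> <= ?n1" "\<bar>B\<bar> <= ?n2" and sv: "\<And>p. prime p ==> p <= w ==> int p ^ 4 dvd B ==> ~ int p ^ 2 dvd A"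
   and nf: "(A, B)\<notin>curve_family x" using z unfolding AB sifted_def box_def sieve_def by auto
  have Ax: "real_of_int \<bar>A\<bar> <= x" using bx(1) by (simp only: le_floor_iff)
  have Bx: "real_of_int \<bar>B\<bar> <= sqrt x" using bx(2) by (simp only: le_floor_iff)
  have "(real_of_int \<bar>B\<bar>) ^ 2 <= (sqrt x) ^ 2" using Bx by (rule power_mono) simp
  then have B2: "real_of_int (B\<^sup>2) <= x" using x by simp
  have AI: "A \<in> ?I" using bx(1) by auto
  show "z\<in>(\<lambda>a. (a, 0)) ` ?I \<union> (\<lambda>a. (a, a\<^sup>2 div 4)) ` ?I \<union> ?I \<times> (\<Union>k\<in>?K. ?M k)"
  proof (cases "B = 0 \<or> A\<^sup>2 - 4 * B = 0")
   case True
   then show ?thesis using AI unfolding AB by auto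
  next
   case False
   then obtain p :: int where p: "prime p" "p ^ 4 dvd B" "p\<^sup>2 dvd A" using nf Ax B2 unfolding curve_family_def by auto
   define k where "k = nat p"
   have k: "p = int k" using prime_ge_0_int[OF p(1)] by (simp add: k_def)
   have pk: "prime k" using p(1) unfolding k by simp
   have "w < k" using sv[OF pk] p(2,3) unfolding k by (meson not_le)
   moreover have "k <= nat ?n2"
   proof -
    have "int k ^ 4 <= \<bar>B\<bar>" using p(2) False unfolding k by (auto dest: dvd_imp_le_int)
    moreover have "int k <= int k ^ 4" using prime_ge_1_nat[OF pk] power_increasing[of 1 4 "int k"] by simp
    ultimately have "int k <= ?n2" using bx(2) by linarith
    then show ?thesis using n(1) by (simp add: le_nat_iff)
   qed
   ultimately have "B\<in>(\<Union>k\<in>?K. ?M k)" using bx(2) False p(2) unfolding k by auto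
   then show ?thesis using AI unfolding AB by blast
  qed
 qed
 then have "card (sifted w x - curve_family x) <= card ((\<lambda>a. (a, 0::int)) ` ?I \<union> (\<lambda>a. (a, a\<^sup>2 div 4)) ` ?I \<union> ?I \<times> (\<Union>k\<in>?K. ?M k))"
 proof (rule card_mono[rotated])
  have "finite (?M k)" for k by (rule finite_subset[of _ "{- ?n2..?n2}"]) auto
  then show "finite ((\<lambda>a. (a, 0::int)) ` ?I \<union> (\<lambda>a. (a, a\<^sup>2 div 4)) ` ?I \<union> ?I \<times> (\<Union>k\<in>?K. ?M k))" by auto
 qed
 also have "\<dots> <= card ?I + card ?I + card ?I * (\<Sum>k\<in>?K. card (?M k))"
 proof (intro order_trans[OF card_Un_le] add_mono card_image_le)
  show "card (?I \<times> (\<Union>k\<in>?K. ?M k)) <= card ?I * (\<Sum>k\<in>?K. card (?M k))"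
   unfolding card_cartesian_product by (intro mult_left_mono card_UN_le) auto
 qed auto
 finally have "real (card (sifted w x - curve_family x)) <= real (card ?I + card ?I + card ?I * (\<Sum>k\<in>?K. card (?M k)))"
  by (simp only: of_nat_le_iff)
 also have "\<dots> = 2 * N1 + N1 * (\<Sum>k\<in>?K. real (card (?M k)))" using n by (simp add: N1_def)
 also have "(\<Sum>k\<in>?K. real (card (?M k))) <= (\<Sum>k\<in>?K. N2 / (real w + 1) ^ 2 * (1 / real k ^ 2))"
 proof (rule sum_mono)
  fix k assume k: "k \<in> ?K"
  have kw: "real w + 1 <= real k" using k by auto
  have "real (card (?M k)) <= 2 * of_int ?n2 / of_int (int k ^ 4)" by (rule card_multiples) (use k n in auto)
  also have "\<dots> <= N2 / of_int (int k ^ 4)" by (intro divide_right_mono) (simp_all add: N2_def)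
  also have "\<dots> = N2 / (real k ^ 2 * real k ^ 2)" by (simp flip: power_add)
  also have "\<dots> <= N2 / ((real w + 1) ^ 2 * real k ^ 2)" using kw N(2) by (intro divide_left_mono mult_right_mono power_mono) auto
  finally show "real (card (?M k)) <= N2 / (real w + 1) ^ 2 * (1 / real k ^ 2)" by simp
 qed
 also have "\<dots> = N2 / (real w + 1) ^ 2 * (\<Sum>k\<in>?K. 1 / real k ^ 2)" by (rule sum_distrib_left[symmetric])
 also have "\<dots> <= N2 / (real w + 1) ^ 2 * (1 / real w)" using N(2) w by (intro mult_left_mono sum_inverse_squares_le) auto
 finally have "real (card (sifted w x - curve_family x)) <= 2 * N1 + N1 * (N2 / (real w + 1) ^ 2 * (1 / real w))" using N(1) by simp
 then have "real (card (sifted w x - curve_family x)) / real (card (xbox x)) <= (2 * N1 + N1 * (N2 / (real w + 1) ^ 2 * (1 / real w))) / (N1 * N2)"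
  unfolding N(4) using N(1,2) by (intro divide_right_mono) auto
 also have "\<dots> = 2 / N2 + 1 / ((real w + 1) ^ 2 * real w)" using N(1,2) by (simp add: add_divide_distrib)
 also have "2 / N2 <= 2 / sqrt x" using N(2,3) x by (intro divide_left_mono mult_pos_pos) auto
 finally show ?thesis by simp
qed

text \<open>No prime is at most 1, so \<open>sifted 1 x\<close> is the whole box. The general bound
  is then 1 / 4 + 2 / sqrt x, at most 1 / 2 from x = 64 on.\<close>

lemma card_family_lower:
 assumes x: "x >= 64" shows "real (card (xbox x)) <= 2 * real (card (curve_family x))"
proof -
 have x1: "x >= 1" using x by simp
 have s1: "sifted 1 x = xbox x"
 proof -
  have "~ prime p" if "p <= 1" for p :: nat using that prime_gt_1_nat[of p] by auto
  then show ?thesis by (auto simp: sifted_def sieve_def)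
 qed
 have "sqrt x >= 8" using x by (intro real_le_rsqrt) simp
 moreover from this have "sqrt x > 0" by linarith
 ultimately have "2 / sqrt x <= 1 / 4" by (simp only: pos_divide_le_eq)
 then have d: "real (card (xbox x - curve_family x)) / real (card (xbox x)) <= 1 / 2"
  using card_sifted_diff[OF x1, of 1] unfolding s1 by simp
 have "real (card (xbox x)) = real (card (xbox x - curve_family x)) + real (card (curve_family x))"
  using family_subset[OF x1, of 1] unfolding s1
  by (metis card_Diff_subset card_mono finite_box finite_subset le_add_diff_inverse2 of_nat_add)
 then show ?thesis using d card_xbox_pos[OF x1] by (simp add: divide_le_eq)
qed

lemma finite_family: "x >= 1 ==> finite (curve_family x)" using family_subset finite_sifted finite_subset by blast

text \<open>The density is the limit of the proportions of sifted pairs, and these contain the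
  family, which fills at least half of the box.\<close>

lemma sieve_density_pos: "sieve_density w > 0"
proof -
 have "1 / 2 <= sieve_density w"
 proof (rule tendsto_lowerbound[OF sieve_mean_limit])
  show "eventually (\<lambda>x. 1 / 2 <= xmean x (sieve w)) at_top" using eventually_ge_at_top[of 64]
  proof eventually_elim
   case (elim x)
   have "sieve w = (\<lambda>a b. of_bool (sieve w a b = 1))" by (auto simp: sieve_def fun_eq_iff)
   then have "xmean x (sieve w) = real (card (sifted w x)) / real (card (xbox x))"
    using xmean_card[of x "\<lambda>a b. sieve w a b = 1"] elim by (simp add: sifted_def)
   moreover have "real (card (curve_family x)) <= real (card (sifted w x))" using family_subset[of x w] elim by (simp add: card_mono)
   ultimately show ?case using card_family_lower[OF elim] card_xbox_pos[of x] elim by (simp add: le_divide_eq)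
  qed
 qed simp
 then show ?thesis by simp
qed

section \<open>Discarding the exceptional and the large primes\<close>

lemma card_large_prime_divisors:
 assumes n: "n ~= 0" "real_of_int \<bar>n\<bar> <= Z ^ k" and Z: "Z > 1"
 shows "finite (odd_divisors n)" "card {p\<in>odd_divisors n. real p > Z} <= k"
proof -
 have "odd_divisors n \<subseteq> nat ` {d. d dvd n}"
 proof
  fix p assume "p\<in>odd_divisors n"
  then have "nat (int p)\<in>nat ` {d. d dvd n}" by (intro imageI) simp
  then show "p\<in>nat ` {d. d dvd n}" by (simp only: nat_int)
 qed
 then show fin: "finite (odd_divisors n)" using finite_divisors_int[OF n(1)] finite_subset by blast
 let ?L = "{p\<in>odd_divisors n. real p > Z}"
 have finL: "finite ?L" by (rule finite_subset[OF _ fin]) auto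
 have sub: "int (\<Prod>L) dvd n" if "finite L" "L \<subseteq> odd_divisors n" for L using that
 proof (induction L rule: finite_induct)
  case (insert p L)
  have "coprime p q" if "q\<in>L" for q
  proof -
   have "prime p" "prime q" "p ~= q" using that insert.prems insert.hyps by auto
   then show ?thesis by (rule primes_coprime)
  qed
  then have "coprime (\<Prod>L) p" by (intro prod_coprime_left) (simp add: coprime_commute)
  then have "coprime (int (\<Prod>L)) (int p)" by (simp only: coprime_int_iff)
  then have "int (\<Prod>L) * int p dvd n" using insert by (intro divides_mult) auto
  then show ?case using insert.hyps by (simp add: mult.commute)
 qed simp
 have "Z ^ card ?L <= (\<Prod>p\<in>?L. real p)" using Z by (subst prod_constant[symmetric]) (intro prod_mono, auto)
 also have "\<dots> = real_of_int (int (\<Prod>?L))" by simp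
 also have "\<dots> <= real_of_int \<bar>n\<bar>"
 proof -
  have "int (\<Prod>?L) dvd n" by (rule sub[OF finL]) auto
  then have "\<bar>int (\<Prod>?L)\<bar> <= \<bar>n\<bar>" by (rule dvd_imp_le_int[OF n(1)])
  then show ?thesis by linarith
 qed
 also have "\<dots> <= Z ^ k" by (rule n(2))
 finally show "card ?L <= k" using Z by (simp add: power_increasing_iff)
qed

text \<open>The exponent 1 / 8 makes the fourth power equal to sqrt x, the room available for the
  error of a second moment, and still leaves only boundedly many larger prime divisors.\<close>

definition zcut :: "real => real" where "zcut x = x powr (1 / 8)"

definition small_odd :: "real => nat set" where
 "small_odd x = {p. prime p & odd p & real p <= zcut x}"

definition high_primes :: "nat => real => nat set" where
 "high_primes w x = {p\<in>small_odd x. w < p & cut x < real p}"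

definition exc_count :: "real => int => int => real" where
 "exc_count x a b = (\<Sum>p\<in>small_odd x. of_bool (p\<in>exceptional a b))"

lemma finite_small_odd: "finite (small_odd x)" by (rule finite_subset[OF _ finite_primes_upto[of "zcut x"]]) (auto simp: small_odd_def)

lemma card_small_odd: "x >= 1 ==> real (card (small_odd x)) <= zcut x"
proof -
 assume x: "x >= 1"
 have z: "zcut x >= 1" using x by (simp add: zcut_def ge_one_powr_ge_zero)
 have "small_odd x \<subseteq> {1..nat \<lfloor>zcut x\<rfloor>}" using prime_ge_1_nat by (auto simp: small_odd_def le_nat_floor)
 then have "card (small_odd x) <= card {1..nat \<lfloor>zcut x\<rfloor>}" by (rule card_mono[rotated]) simp
 then show ?thesis using z by (simp add: le_nat_iff) linarith
qed

lemma zcut_power: "x > 0 ==> zcut x ^ k = x powr (real k / 8)" by (simp add: zcut_def powr_powr flip: powr_realpow)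

text \<open>Both B and A^2 - 4B are at most x^3, the 24th power of \<open>zcut x\<close>, so each
  has at most 24 prime divisors beyond it. That costs 24 in the difference and 3 times 48 among the
  exceptional primes; with the 6 of \<open>selmer_ratio_prime_divisors\<close> this makes 174. The
  primes up to w contribute at most w.\<close>

lemma ratio_remainder:
 assumes x: "x >= 3" and cz: "cut x <= zcut x" and z: "zcut x >= real w" and AB: "(A, B)\<in>curve_family x"
 shows "\<bar>real_of_int (selmer_ratio_ord A B) - fsum (mid_primes w x) A B\<bar> <= 3 * exc_count x A B + \<bar>fsum (high_primes w x) A B\<bar> + (174 + real w)"
proof -
 define Z where "Z = zcut x"
 let ?LB = "{p\<in>odd_divisors B. real p > Z}"
 let ?D = "A\<^sup>2 - 4 * B"
 let ?LD = "{p\<in>odd_divisors ?D. real p > Z}"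
 let ?E = "small_odd x \<inter> exceptional A B"
 let ?lo = "{p\<in>small_odd x. p <= w}"
 let ?mh = "mid_primes w x \<union> high_primes w x"
 have nz: "B ~= 0" "?D ~= 0" and bd: "real_of_int \<bar>A\<bar> <= x" "real_of_int (B\<^sup>2) <= x"
  using AB by (auto simp: curve_family_def)
 have Z1: "Z > 1" using x by (simp add: Z_def zcut_def)
 have Z24: "Z ^ 24 = x ^ 3" using zcut_power[of x 24] x by (simp add: Z_def)
 have Bs: "real_of_int \<bar>B\<bar> <= x"
 proof -
  have "real_of_int \<bar>B\<bar> <= sqrt x" using bd(2) by (intro real_le_rsqrt) simp
  then show ?thesis using sqrt_le_self[of x] x by simp
 qed
 have x3: "x + x <= x ^ 3" "x ^ 2 + 4 * x <= x ^ 3"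
 proof -
  have "3 * x <= x * x" using x by (intro mult_right_mono) auto
  moreover have "3 * (x * x) <= x * (x * x)" using x by (intro mult_right_mono) auto
  ultimately show "x + x <= x ^ 3" "x ^ 2 + 4 * x <= x ^ 3" using x unfolding power2_eq_square power3_eq_cube mult.assoc by linarith+
 qed
 have B24: "real_of_int \<bar>B\<bar> <= Z ^ 24" unfolding Z24 using Bs x3(1) x by linarith
 have D24: "real_of_int \<bar>?D\<bar> <= Z ^ 24"
 proof -
  have "(real_of_int \<bar>A\<bar>) ^ 2 <= x ^ 2" by (rule power_mono[OF bd(1)]) simp
  then have "real_of_int (A\<^sup>2) <= x ^ 2" by simp
  moreover have "\<bar>?D\<bar> <= A\<^sup>2 + 4 * \<bar>B\<bar>" using abs_triangle_ineq4[of "A\<^sup>2" "4 * B"] by (simp add: abs_mult)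
  then have "real_of_int \<bar>?D\<bar> <= real_of_int (A\<^sup>2 + 4 * \<bar>B\<bar>)" by (simp only: of_int_le_iff)
  then have "real_of_int \<bar>?D\<bar> <= real_of_int (A\<^sup>2) + 4 * real_of_int \<bar>B\<bar>" by simp
  ultimately show ?thesis unfolding Z24 using Bs x3(2) by linarith
 qed
 note LB = card_large_prime_divisors[OF nz(1) B24 Z1]
 note LD = card_large_prime_divisors[OF nz(2) D24 Z1]
 have om: "real (card (odd_divisors n)) = (\<Sum>p\<in>small_odd x. of_bool (int p dvd n)) + real (card {p\<in>odd_divisors n. real p > Z})"
  if "finite (odd_divisors n)" for n
 proof -
  have f1: "finite {p\<in>small_odd x. int p dvd n}" by (rule finite_subset[OF _ finite_small_odd]) auto
  have f2: "finite {p\<in>odd_divisors n. real p > Z}" by (rule finite_subset[OF _ that]) auto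
  have "odd_divisors n = {p\<in>small_odd x. int p dvd n} \<union> {p\<in>odd_divisors n. real p > Z}" by (auto simp: small_odd_def Z_def)
  then have "card (odd_divisors n) = card ({p\<in>small_odd x. int p dvd n} \<union> {p\<in>odd_divisors n. real p > Z})" by (rule arg_cong)
  also have "\<dots> = card {p\<in>small_odd x. int p dvd n} + card {p\<in>odd_divisors n. real p > Z}"
   by (rule card_Un_disjoint[OF f1 f2]) (auto simp: small_odd_def Z_def)
  also have "card {p\<in>small_odd x. int p dvd n} = card (small_odd x \<inter> {p. int p dvd n})" by (rule arg_cong[of _ _ card]) auto
  finally show ?thesis using finite_small_odd by (simp add: sum_of_bool_eq)
 qed
 have f: "fsum (small_odd x) A B = (\<Sum>p\<in>small_odd x. of_bool (int p dvd ?D)) - (\<Sum>p\<in>small_odd x. of_bool (int p dvd B))"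
  by (simp add: fsum_def fp_def sum_subtractf)
 have main1: "\<bar>(real (card (odd_divisors ?D)) - real (card (odd_divisors B))) - fsum (small_odd x) A B\<bar> <= 24"
  unfolding f om[OF LB(1)] om[OF LD(1)] using LB(2) LD(2) by linarith
 have ex: "real (card (exceptional A B)) <= exc_count x A B + 48"
 proof -
  have sub: "exceptional A B \<subseteq> odd_divisors B \<union> odd_divisors ?D"
   by (auto intro: dvd_mult_left[of "int _" "int _"] simp: power2_eq_square)
  then have fin: "finite (exceptional A B)" using LB(1) LD(1) finite_subset by blast
  have "exceptional A B \<subseteq> ?E \<union> (?LB \<union> ?LD)" using sub by (auto simp: small_odd_def Z_def)
  then have "card (exceptional A B) <= card (?E \<union> (?LB \<union> ?LD))"
  proof (rule card_mono[rotated])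
   have "finite ?LB" by (rule finite_subset[OF _ LB(1)]) auto
   moreover have "finite ?LD" by (rule finite_subset[OF _ LD(1)]) auto
   ultimately show "finite (?E \<union> (?LB \<union> ?LD))" by (intro finite_UnI finite_Int disjI1 finite_small_odd)
  qed
  also have "\<dots> <= card ?E + (card ?LB + card ?LD)" by (intro order_trans[OF card_Un_le] add_mono card_Un_le order_refl)
  also have "\<dots> <= card ?E + (24 + 24)" using LB(2) LD(2) by (intro add_mono) auto
  finally have "real (card (exceptional A B)) <= real (card ?E) + 48" by linarith
  moreover have "exc_count x A B = real (card ?E)" unfolding exc_count_def using finite_small_odd by (simp add: sum_of_bool_eq)
  ultimately show ?thesis by linarith
 qed
 have sp: "fsum (small_odd x) A B = fsum (mid_primes w x) A B + fsum (high_primes w x) A B + fsum ?lo A B"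
 proof -
  have e: "small_odd x = ?mh \<union> ?lo" using cz by (auto simp: small_odd_def mid_primes_def high_primes_def)
  have fh: "finite (high_primes w x)" using finite_small_odd by (simp add: high_primes_def)
  have 1: "fsum ?mh A B = fsum (mid_primes w x) A B + fsum (high_primes w x) A B"
   unfolding fsum_def by (rule sum.union_disjoint) (use finite_mid_primes fh in "auto simp: mid_primes_def high_primes_def")
  have "fsum (?mh \<union> ?lo) A B = fsum ?mh A B + fsum ?lo A B"
   unfolding fsum_def by (rule sum.union_disjoint) (use finite_mid_primes fh finite_small_odd in "auto simp: mid_primes_def high_primes_def")
  then show ?thesis unfolding e[symmetric] 1 .
 qed
 have low: "\<bar>fsum ?lo A B\<bar> <= real w"
 proof -
  have "\<bar>fsum ?lo A B\<bar> <= (\<Sum>p\<in>?lo. 1)" unfolding fsum_def by (rule order_trans[OF sum_abs sum_mono]) (rule abs_fp)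
  also have "\<dots> <= (\<Sum>p\<in>{1..w}. 1)" by (rule sum_mono2) (use prime_ge_1_nat in "auto simp: small_odd_def")
  finally show ?thesis by simp
 qed
 have "\<bar>real_of_int (selmer_ratio_ord A B) - (real (card (odd_divisors ?D)) - real (card (odd_divisors B)))\<bar> <= 3 * real (card (exceptional A B)) + 6"
  using selmer_ratio_prime_divisors[OF nz] by linarith
 then show ?thesis using main1 ex sp low by linarith
qed

lemma xmean_approx:
 assumes x: "x >= 1" and M: "M > 0" "per M g" and K: "\<And>a b. \<bar>g a b\<bar> <= (1::real)"
 shows "xmean x g <= pmean M g + 4 * of_int M / sqrt x"
proof -
 note n = xbox_bounds[OF x]
 have "xmean x g <= pmean M g + 4 * of_int M * 1 / of_int (2 * \<lfloor>sqrt x\<rfloor> + 1)"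
  using bmean_pmean[OF M, of 1 "\<lfloor>sqrt x\<rfloor>" "\<lfloor>x\<rfloor>"] K n unfolding xmean_def by simp
 also have "4 * of_int M * 1 / real_of_int (2 * \<lfloor>sqrt x\<rfloor> + 1) <= 4 * of_int M * 1 / sqrt x"
  using n(3) x M xbox_sides(2)[OF x] by (intro divide_left_mono mult_pos_pos) simp_all
 finally show ?thesis by simp
qed

text \<open>Each of the three ways of being exceptional at p has density 1 / p^2, for a total of at
  most 3. The periods are at most zcut^2, so the approximation costs 12 zcut^2 / sqrt x per prime,
  at most 12 over the at most zcut primes.\<close>

lemma exceptional_mean:
 assumes x: "x >= 1" shows "xmean x (exc_count x) <= 15"
proof -
 note n = xbox_bounds[OF x]
 have one: "xmean x (\<lambda>a b. of_bool (p\<in>exceptional a b)) <= 3 * (1 / real p ^ 2) + 12 * zcut x ^ 2 / sqrt x"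
  if p: "p\<in>small_odd x" for p
 proof -
  have pp: "prime p" "odd p" "real p <= zcut x" using p by (auto simp: small_odd_def)
  have p0: "int p > 0" using prime_gt_0_nat[OF pp(1)] by simp
  define e1 e2 e3 where "e1 a b = (of_bool (int p dvd a & int p dvd b) :: real)"
   and "e2 a b = (of_bool ((int p)\<^sup>2 dvd b) :: real)" and "e3 a b = (of_bool ((int p)\<^sup>2 dvd a\<^sup>2 - 4 * b) :: real)" for a b
  have per: "per (int p) e1" "per ((int p)\<^sup>2) e2" "per ((int p)\<^sup>2) e3"
  proof -
   show "per (int p) e1" unfolding e1_def[abs_def] by (rule per_dvd_pred) (simp add: cong_dvd_iff)
   show "per ((int p)\<^sup>2) e2" unfolding e2_def[abs_def] by (rule per_dvd_pred) (simp add: cong_dvd_iff)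
   show "per ((int p)\<^sup>2) e3" unfolding e3_def[abs_def]
    by (rule per_dvd_pred) (intro cong_dvd_iff cong_diff cong_pow cong_mult cong_refl)
  qed
  have m1: "pmean (int p) e1 = 1 / real p ^ 2"
  proof -
   have "e1 a b = of_bool (int p dvd a) * of_bool (int p dvd b)" for a b by (simp add: e1_def)
   then show ?thesis unfolding pmean_def by (simp add: sum_dvd_residue[OF p0] flip: sum_distrib_left)
  qed
  have sq: "(int p)\<^sup>2 > 0" "odd ((int p)\<^sup>2)" using p0 pp(2) by auto
  have m2: "pmean ((int p)\<^sup>2) e2 = 1 / real p ^ 2"
   unfolding pmean_def e2_def using sum_dvd_residue[OF sq(1)] p0 by (simp add: power2_eq_square)
  have m3: "pmean ((int p)\<^sup>2) e3 = 1 / real p ^ 2"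
   unfolding pmean_def e3_def using sum_unique_residue[OF sq] p0 by (simp add: power2_eq_square)
  have "xmean x (\<lambda>a b. of_bool (p\<in>exceptional a b)) <= xmean x (\<lambda>a b. e1 a b + (e2 a b + e3 a b))"
   unfolding xmean_def by (rule bmean_mono[OF n(1,2)]) (auto simp: e1_def e2_def e3_def)
  also have "\<dots> = xmean x e1 + (xmean x e2 + xmean x e3)" unfolding xmean_def bmean_add ..
  also have "\<dots> <= (1 / real p ^ 2 + 4 * zcut x ^ 2 / sqrt x) + ((1 / real p ^ 2 + 4 * zcut x ^ 2 / sqrt x) + (1 / real p ^ 2 + 4 * zcut x ^ 2 / sqrt x))"
  proof (intro add_mono)
   have sx: "sqrt x > 0" using x by simp
   have p1: "1 <= real p" using prime_ge_1_nat[OF pp(1)] by simp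
   have p2: "real p ^ 2 <= zcut x ^ 2" using pp(3) by (intro power_mono) auto
   moreover have "real p <= real p ^ 2" using p1 by (simp add: power2_eq_square)
   ultimately have p3: "real p <= zcut x ^ 2" by linarith
   have le: "4 * y / sqrt x <= 4 * zcut x ^ 2 / sqrt x" if "y <= zcut x ^ 2" for y using that sx by (intro divide_right_mono) auto
   show "xmean x e1 <= 1 / real p ^ 2 + 4 * zcut x ^ 2 / sqrt x"
    using xmean_approx[OF x p0 per(1)] le[OF p3] unfolding m1 by (simp add: e1_def)
   show "xmean x e2 <= 1 / real p ^ 2 + 4 * zcut x ^ 2 / sqrt x"
    using xmean_approx[OF x sq(1) per(2)] le[OF p2] unfolding m2 by (simp add: e2_def)
   show "xmean x e3 <= 1 / real p ^ 2 + 4 * zcut x ^ 2 / sqrt x"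
    using xmean_approx[OF x sq(1) per(3)] le[OF p2] unfolding m3 by (simp add: e3_def)
  qed
  finally show ?thesis by simp
 qed
 have "xmean x (exc_count x) = (\<Sum>p\<in>small_odd x. xmean x (\<lambda>a b. of_bool (p\<in>exceptional a b)))"
  unfolding xmean_def exc_count_def[abs_def] bmean_sum ..
 also have "\<dots> <= (\<Sum>p\<in>small_odd x. 3 * (1 / real p ^ 2) + 12 * zcut x ^ 2 / sqrt x)" by (rule sum_mono[OF one])
 also have "\<dots> = 3 * (\<Sum>p\<in>small_odd x. 1 / real p ^ 2) + real (card (small_odd x)) * (12 * zcut x ^ 2 / sqrt x)"
  by (simp add: sum.distrib sum_distrib_left)
 also have "\<dots> <= 3 * 1 + zcut x * (12 * zcut x ^ 2 / sqrt x)"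
  using x by (intro add_mono mult_left_mono mult_right_mono sum_prime_inverse_squares finite_small_odd card_small_odd)
   (use prime_gt_1_nat in "auto simp: small_odd_def")
 also have "zcut x * (12 * zcut x ^ 2 / sqrt x) = 12 * (zcut x ^ 3 / sqrt x)" by (simp add: power3_eq_cube power2_eq_square)
 also have "zcut x ^ 3 / sqrt x <= 1"
 proof -
  have "zcut x ^ 3 <= x powr (1 / 2)" using x by (simp add: zcut_power powr_mono)
  then show ?thesis using x by (simp add: powr_half_sqrt divide_le_eq_1)
 qed
 finally show ?thesis by simp
qed

text \<open>The maximum with 1 makes the reciprocal of its square root an admissible u in
  \<open>model_moment_bound\<close>.\<close>

definition high_recip :: "real => real" where
 "high_recip x = max 1 (prime_recip (zcut x) - prime_recip (cut x))"

text \<open>With k = 2 and u^2 = 1 / R, \<open>model_moment_bound\<close> gives moment / (2 R) <= 2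
  exp 2 <= 18. The comparison with the model costs 4, since zcut^4 = sqrt x.\<close>

lemma high_second_moment:
 assumes x: "x >= 1" and cz: "cut x <= zcut x"
 shows "xmean x (\<lambda>a b. fsum (high_primes w x) a b ^ 2) <= 36 * high_recip x + 4"
proof -
 let ?P = "high_primes w x"
 note n = xbox_bounds[OF x]
 have fin: "finite ?P" using finite_small_odd by (simp add: high_primes_def)
 have pp: "prime p" "odd p" "real p <= zcut x" "p > 0" if "p \<in> ?P" for p
  using that prime_gt_0_nat by (auto simp: high_primes_def small_odd_def)
 define R where "R = high_recip x"
 have R1: "R >= 1" by (simp add: R_def high_recip_def)
 have z1: "zcut x >= 1" using x by (simp add: zcut_def ge_one_powr_ge_zero)
 have S: "(\<Sum>p\<in>?P. 1 / real p) <= R"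
 proof -
  have "(\<Sum>p\<in>?P. 1 / real p) + prime_recip (cut x) = (\<Sum>p\<in>?P \<union> primes_upto (cut x). 1 / real p)"
   unfolding prime_recip_def by (rule sum.union_disjoint[symmetric]) (use fin in "auto simp: high_primes_def")
  also have "\<dots> <= prime_recip (zcut x)"
   unfolding prime_recip_def by (rule sum_mono2) (use cz in "auto simp: high_primes_def small_odd_def")
  finally show ?thesis by (simp add: R_def high_recip_def)
 qed
 have M0: "int (\<Prod>?P) > 0" using pp(4) by (auto intro!: prod_pos)
 have pd: "int p dvd int (\<Prod>?P)" if "p \<in> ?P" for p using dvd_prodI[OF fin that, of "\<lambda>x. x"] by (simp del: of_nat_prod)
 have "\<bar>bmean \<lfloor>x\<rfloor> \<lfloor>sqrt x\<rfloor> (\<lambda>a b. 1 * fsum ?P a b ^ 2) - pmean (int (\<Prod>?P)) (\<lambda>a b. 1 * fsum ?P a b ^ 2)\<bar> <= 4 * 1 * (real (card ?P) * zcut x) ^ 2 / of_int (2 * \<lfloor>sqrt x\<rfloor> + 1)"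
  by (rule moment_compare[OF n(1,2) fin pp(4,3) _ M0 pd, where M = 1]) (use z1 in "auto simp: per_const")
 also have "\<dots> <= 4 * 1 * (zcut x * zcut x) ^ 2 / sqrt x"
 proof (rule frac_le)
  have "card ?P <= card (small_odd x)" by (rule card_mono[OF finite_small_odd]) (auto simp: high_primes_def)
  then have "real (card ?P) <= zcut x" using card_small_odd[OF x] by linarith
  then show "4 * 1 * (real (card ?P) * zcut x) ^ 2 <= 4 * 1 * (zcut x * zcut x) ^ 2"
   using z1 by (intro mult_left_mono power_mono mult_right_mono) auto
 qed (use n x in auto)
 also have "\<dots> = 4"
 proof -
  have "(zcut x * zcut x) ^ 2 = zcut x ^ 4" by (simp add: power2_eq_square power4_eq_xxxx)
  also have "\<dots> = sqrt x" using x by (simp add: zcut_power powr_half_sqrt)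
  finally show ?thesis using x by simp
 qed
 finally have 1: "xmean x (\<lambda>a b. fsum ?P a b ^ 2) <= pmean (int (\<Prod>?P)) (\<lambda>a b. fsum ?P a b ^ 2) + 4"
  unfolding xmean_def by simp
 have "(1 / sqrt R) ^ 2 / fact 2 * pmean (int (\<Prod>?P)) (\<lambda>a b. fsum ?P a b ^ 2) <= 2 * exp (2 * (1 / sqrt R) ^ 2 * (\<Sum>p\<in>?P. 1 / real p))"
  by (rule model_moment_bound[OF fin pp(1,2)]) (use R1 in auto)
 also have "\<dots> <= 2 * exp 2"
 proof -
  have "(1 / sqrt R) ^ 2 * (\<Sum>p\<in>?P. 1 / real p) <= (1 / sqrt R) ^ 2 * R" by (rule mult_left_mono[OF S]) simp
  also have "\<dots> = 1" using R1 by (simp add: power_divide)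
  finally show ?thesis by simp
 qed
 also have "exp 2 <= (9::real)"
 proof -
  have "exp (2::real) = exp 1 * exp 1" by (simp flip: exp_add)
  also have "\<dots> <= 3 * 3" using exp_le by (intro mult_mono) auto
  finally show ?thesis by simp
 qed
 finally have "1 / R / 2 * pmean (int (\<Prod>?P)) (\<lambda>a b. fsum ?P a b ^ 2) <= 18" using R1 by (simp add: power_divide)
 then have "pmean (int (\<Prod>?P)) (\<lambda>a b. fsum ?P a b ^ 2) <= 36 * R" using R1 by (simp add: field_simps)
 then show ?thesis using 1 unfolding R_def by linarith
qed

text \<open>The sums of reciprocals up to \<open>zcut x\<close> and up to \<open>cut x\<close> are
  both asymptotic to ln ln x, so the primes between them carry only o(ln ln x) of the
  variance.\<close>

lemma high_recip_asymp: "((\<lambda>x. high_recip x / ln (ln x)) \<longlongrightarrow> 0) at_top"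
proof -
 have zc: "filterlim zcut at_top at_top" unfolding zcut_def by real_asymp
 have 1: "((\<lambda>x. prime_recip (zcut x) / ln (ln (zcut x))) \<longlongrightarrow> 1) at_top"
  by (rule filterlim_compose[OF prime_recip_asymp zc])
 have 2: "((\<lambda>x::real. ln (ln (x powr (1 / 8))) / ln (ln x)) \<longlongrightarrow> 1) at_top" by real_asymp
 have "((\<lambda>x. prime_recip (zcut x) / ln (ln (zcut x)) * (ln (ln (x powr (1 / 8))) / ln (ln x))) \<longlongrightarrow> 1 * 1) at_top"
  by (rule tendsto_mult[OF 1 2])
 moreover have "eventually (\<lambda>x::real. ln (ln (x powr (1 / 8))) > 0) at_top" by real_asymp
 then have "eventually (\<lambda>x. prime_recip (zcut x) / ln (ln (zcut x)) * (ln (ln (x powr (1 / 8))) / ln (ln x)) = prime_recip (zcut x) / ln (ln x)) at_top"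
  by eventually_elim (simp add: zcut_def)
 ultimately have "((\<lambda>x. prime_recip (zcut x) / ln (ln x)) \<longlongrightarrow> 1) at_top" by (simp add: tendsto_cong)
 from tendsto_diff[OF this cut_recip_asymp]
 have "((\<lambda>x. (prime_recip (zcut x) - prime_recip (cut x)) / ln (ln x)) \<longlongrightarrow> 0) at_top" by (simp add: diff_divide_distrib)
 moreover have "((\<lambda>x::real. 1 / ln (ln x)) \<longlongrightarrow> 0) at_top" by real_asymp
 ultimately have "((\<lambda>x. max (1 / ln (ln x)) ((prime_recip (zcut x) - prime_recip (cut x)) / ln (ln x))) \<longlongrightarrow> max 0 0) at_top"
  by (intro tendsto_max)
 moreover have "eventually (\<lambda>x. max (1 / ln (ln x)) ((prime_recip (zcut x) - prime_recip (cut x)) / ln (ln x)) = high_recip x / ln (ln x)) at_top"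
  using eventually_lnln_gt[of 0] by eventually_elim (auto simp: high_recip_def max_def divide_le_cancel)
 ultimately show ?thesis by (simp add: tendsto_cong)
qed

definition bad_pairs :: "nat => real => real => (int \<times> int) set" where
 "bad_pairs w d x = {(A, B)\<in>curve_family x. \<bar>real_of_int (selmer_ratio_ord A B) - fsum (mid_primes w x) A B\<bar> > d * dev x}"

text \<open>The deviation d dev is split into three equal parts s: Markov's inequality for the
  exceptional primes, Chebyshev's for the high primes, and the constant of
  \<open>ratio_remainder\<close>, which is eventually below s.\<close>

lemma bad_pairs_negligible:
 assumes d: "d > 0" shows "((\<lambda>x. real (card (bad_pairs w d x)) / real (card (xbox x))) \<longlongrightarrow> 0) at_top"
proof (rule Lim_null_comparison)
 \<comment> \<open>The value of 3 times 15 / s plus (36 R + 4) / s^2, where R is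
   \<open>high_recip x\<close>, s = d dev / 3 and dev^2 = 2 ln ln x.\<close>
 let ?R = "\<lambda>x. 135 / d / dev x + 9 / d ^ 2 * (18 * (high_recip x / ln (ln x)) + 2 * (1 / ln (ln x)))"
 have "((\<lambda>x. 135 / d / dev x) \<longlongrightarrow> 0) at_top"
  by (rule tendsto_divide_0[OF tendsto_const filterlim_at_top_imp_at_infinity[OF filterlim_dev]])
 moreover have "((\<lambda>x::real. 1 / ln (ln x)) \<longlongrightarrow> 0) at_top" by real_asymp
 then have "((\<lambda>x. 9 / d ^ 2 * (18 * (high_recip x / ln (ln x)) + 2 * (1 / ln (ln x)))) \<longlongrightarrow> 9 / d ^ 2 * (18 * 0 + 2 * 0)) at_top"
  by (intro tendsto_intros high_recip_asymp)
 ultimately show "(?R \<longlongrightarrow> 0) at_top" using tendsto_add[of _ 0 at_top _ 0] by simp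
 have zc: "filterlim zcut at_top at_top" unfolding zcut_def by real_asymp
 have "eventually (\<lambda>x. cut x <= zcut x) at_top"
 proof -
  have "eventually (\<lambda>x::real. exp (ln x / ln (ln x)) <= x powr (1 / 8)) at_top" by real_asymp
  then show ?thesis by (simp add: cut_def zcut_def)
 qed
 moreover have "eventually (\<lambda>x. zcut x >= real w) at_top" using zc by (simp only: filterlim_at_top)
 moreover have "eventually (\<lambda>x. dev x > max 1 (3 * (174 + real w) / d)) at_top" using filterlim_dev by (simp only: filterlim_at_top_dense)
 moreover note eventually_ge_at_top[of 3] eventually_lnln_gt[of 0]
 ultimately show "eventually (\<lambda>x. norm (real (card (bad_pairs w d x)) / real (card (xbox x))) <= ?R x) at_top"
 proof eventually_elim
  case (elim x)
  have x1: "x >= 1" using elim by simp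
  note n = xbox_bounds[OF x1]
  define s where "s = d * dev x / 3"
  have s: "s > 0" "174 + real w <= s" using elim(3) d by (auto simp: s_def field_simps)
  let ?Y = "\<lambda>a b. fsum (high_primes w x) a b"
  let ?Q = "\<lambda>a b. 3 * exc_count x a b > s \<or> \<bar>?Y a b\<bar> > s"
  have "bad_pairs w d x \<subseteq> {(a, b)\<in>xbox x. ?Q a b}"
  proof
   fix z assume z: "z\<in>bad_pairs w d x"
   obtain A B where AB: "z = (A, B)" by fastforce
   have f: "(A, B)\<in>curve_family x" and b: "\<bar>real_of_int (selmer_ratio_ord A B) - fsum (mid_primes w x) A B\<bar> > d * dev x"
    using z by (auto simp: AB bad_pairs_def)
   have "3 * s < 3 * exc_count x A B + \<bar>?Y A B\<bar> + (174 + real w)"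
    using ratio_remainder[OF elim(4,1,2) f] b by (simp add: s_def)
   then have "?Q A B" using s(2) by linarith
   then show "z\<in>{(a, b)\<in>xbox x. ?Q a b}" using family_subset[OF x1, of w] sifted_subset f unfolding AB by blast
  qed
  then have "card (bad_pairs w d x) <= card {(a, b)\<in>xbox x. ?Q a b}"
   by (rule card_mono[rotated]) (rule finite_subset[of _ "xbox x"], auto)
  then have "real (card (bad_pairs w d x)) / real (card (xbox x)) <= xmean x (\<lambda>a b. of_bool (?Q a b))"
   unfolding xmean_card[OF x1] by (intro divide_right_mono) auto
  also have "\<dots> <= xmean x (\<lambda>a b. 3 / s * exc_count x a b + 1 / s ^ 2 * ?Y a b ^ 2)" unfolding xmean_def
  proof (rule bmean_mono[OF n(1,2)])
   fix a b
   have nn: "0 <= exc_count x a b" by (simp add: exc_count_def sum_nonneg)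
   show "of_bool (?Q a b) <= 3 / s * exc_count x a b + 1 / s ^ 2 * ?Y a b ^ 2"
   proof (cases "?Q a b")
    case True
    then show ?thesis
    proof
     assume "3 * exc_count x a b > s"
     then have "1 <= 3 / s * exc_count x a b" using s(1) by (simp add: field_simps)
     moreover have "0 <= 1 / s ^ 2 * ?Y a b ^ 2" by simp
     moreover have "of_bool (?Q a b) <= (1::real)" by (simp add: of_bool_def)
     ultimately show ?thesis by linarith
    next
     assume "\<bar>?Y a b\<bar> > s"
     then have "s ^ 2 <= \<bar>?Y a b\<bar> ^ 2" using s(1) by (intro power_mono) auto
     then have "1 <= 1 / s ^ 2 * ?Y a b ^ 2" using s(1) by (simp add: field_simps)
     moreover have "0 <= 3 / s * exc_count x a b" using s(1) nn by simp
     moreover have "of_bool (?Q a b) <= (1::real)" by (simp add: of_bool_def)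
     ultimately show ?thesis by linarith
    qed
   next
    case False
    have "0 <= 3 / s * exc_count x a b" using s(1) nn by simp
    then show ?thesis using False by simp
   qed
  qed
  also have "\<dots> = 3 / s * xmean x (exc_count x) + 1 / s ^ 2 * xmean x (\<lambda>a b. ?Y a b ^ 2)"
   unfolding xmean_def bmean_add bmean_cmult ..
  also have "\<dots> <= 3 / s * 15 + 1 / s ^ 2 * (36 * high_recip x + 4)"
   using s(1) by (intro add_mono mult_left_mono exceptional_mean[OF x1] high_second_moment[OF x1 elim(1)]) auto
  also have "\<dots> = ?R x"
  proof -
   have "dev x ^ 2 = 2 * ln (ln x)" using elim(5) by (simp add: dev_def)
   then have s2: "s ^ 2 = d ^ 2 * (2 * ln (ln x)) / 9" by (simp add: s_def power_mult_distrib power_divide)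
   have "3 / s * 15 = 135 / d / dev x" using d elim(3) by (simp add: s_def field_simps)
   moreover have "1 / s ^ 2 * (36 * high_recip x + 4) = 9 / d ^ 2 * (18 * (high_recip x / ln (ln x)) + 2 * (1 / ln (ln x)))"
    unfolding s2 using d elim(5) by (simp add: field_simps)
   ultimately show ?thesis by simp
  qed
  finally show ?case by simp
 qed
qed

section \<open>The limit theorem\<close>

lemma cdf_std_normal:
 "cdf std_normal_distribution z = 1 / sqrt (2 * pi) * (LBINT t:{..z}. exp (- (t\<^sup>2 / 2)))"
proof -
 interpret real_distribution std_normal_distribution by (rule real_dist_normal_dist)
 have "cdf std_normal_distribution z = (LINT t|std_normal_distribution. indicator {..z} t)" by (simp add: cdf_def)
 also have "\<dots> = (LINT t|lborel. std_normal_density t *\<^sub>R indicator {..z} t)" by (rule integral_density) auto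
 also have "\<dots> = (LINT t|lborel. 1 / sqrt (2 * pi) * (indicator {..z} t *\<^sub>R exp (- (t\<^sup>2 / 2))))"
  by (rule Bochner_Integration.integral_cong) (auto simp: std_normal_density_def)
 finally show ?thesis by (simp add: set_lebesgue_integral_def)
qed

theorem theorem1p1:
 fixes z :: real
 shows "((\<lambda>x::real.
   real (card {(A, B)\<in>curve_family x.
          real_of_int (selmer_ratio_ord A B) <= z * sqrt (2 * ln (ln x))})
    / real (card (curve_family x)))
  \<longlongrightarrow> 1 / sqrt (2 * pi) * (LBINT t:{..z}. exp (- (t\<^sup>2 / 2)))) at_top"
 unfolding cdf_std_normal[symmetric]
proof (rule tendstoI)
 let ?F = "cdf std_normal_distribution"
 let ?S = "\<lambda>x. {(A, B)\<in>curve_family x. real_of_int (selmer_ratio_ord A B) <= z * sqrt (2 * ln (ln x))}"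
 fix e :: real assume "e > 0"
 \<comment> \<open>One share covers the limit at a shifted threshold together with the continuity of
   the normal law, one the bad pairs and two the sifted pairs outside the family; the fifth is
   margin.\<close>
 define ep where "ep = e / 5"
 have e: "ep > 0" "e = 5 * ep" using \<open>e > 0\<close> by (auto simp: ep_def)
 obtain dl where dl: "dl > 0" "\<And>u. \<bar>u - z\<bar> < 2 * dl ==> \<bar>?F u - ?F z\<bar> < ep"
 proof -
  obtain s where s: "s > 0" "\<And>u. \<bar>u - z\<bar> < s ==> \<bar>?F u - ?F z\<bar> < ep"
   using isCont_cdf_std_normal[of z] e(1) unfolding continuous_at_eps_delta dist_real_def by blast
  show ?thesis by (rule that[of "s / 2"]) (use s in auto)
 qed
 have Fz: "?F (z + dl) < ?F z + ep" "?F (z - dl) > ?F z - ep" using dl(2)[of "z + dl"] dl(2)[of "z - dl"] dl(1) by auto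
 \<comment> \<open>The level of the sieve depends on the accuracy only: it bounds the proportion of
   sifted pairs outside the family and stays fixed while x grows.\<close>
 obtain w :: nat where w: "w >= 1" "2 / real w < ep"
 proof -
  obtain n :: nat where "real n > 2 / ep" using reals_Archimedean2 by blast
  then have "real (Suc n) > 2 / ep" by simp
  then have "2 / real (Suc n) < ep" using e(1) by (simp add: field_simps)
  then show ?thesis by (intro that[of "Suc n"]) auto
 qed
 define G where "G u x = real (card {(a, b)\<in>sifted w x. fsum (mid_primes w x) a b <= u * dev x}) / real (card (sifted w x))" for u x
 have G: "(G u \<longlongrightarrow> ?F u) at_top" for u unfolding G_def[abs_def] by (rule normal_limit_sifted[OF sieve_density_pos])
 have "eventually (\<lambda>x. G (z + dl) x < ?F z + ep) at_top" by (rule order_tendstoD(2)[OF G Fz(1)])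
 moreover have "eventually (\<lambda>x. G (z - dl) x > ?F z - ep) at_top" by (rule order_tendstoD(1)[OF G Fz(2)])
 moreover have "eventually (\<lambda>x. real (card (bad_pairs w dl x)) / real (card (xbox x)) < ep / 2) at_top"
  by (rule order_tendstoD(2)[OF bad_pairs_negligible[OF dl(1)]]) (use e in simp)
 moreover have "((\<lambda>x. 4 / sqrt x) \<longlongrightarrow> 0) at_top" by real_asymp
 then have "eventually (\<lambda>x. 4 / sqrt x < ep) at_top" by (rule order_tendstoD(2)) (rule e(1))
 moreover note eventually_ge_at_top[of 64]
 ultimately show "eventually (\<lambda>x. dist (real (card (?S x)) / real (card (curve_family x))) (?F z) < e) at_top"
 proof eventually_elim
  case (elim x)
  have x1: "x >= 1" using elim by simp
  let ?K = "real (card (curve_family x))" and ?H = "real (card (sifted w x))" and ?N = "real (card (xbox x))"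
  let ?bad = "real (card (bad_pairs w dl x))" and ?d = "real (card (sifted w x - curve_family x))"
  let ?T = "\<lambda>u. {(a, b)\<in>sifted w x. fsum (mid_primes w x) a b <= u * dev x}"
  have N: "?N > 0" "?N <= 2 * ?K" by (rule card_xbox_pos[OF x1], rule card_family_lower[OF elim(5)])
  then have K: "?K > 0" by linarith
  have sub: "curve_family x \<subseteq> sifted w x" by (rule family_subset[OF x1])
  have fin: "finite (curve_family x)" by (rule finite_family[OF x1])
  have finbad: "finite (bad_pairs w dl x)" by (rule finite_subset[OF _ fin]) (auto simp: bad_pairs_def)
  have HK: "?H = ?K + ?d" using sub fin by (metis card_Diff_subset card_mono finite_sifted le_add_diff_inverse of_nat_add)
  have dN: "?d / ?N < ep"
  proof -
   have "(1 + 1) ^ 2 * real w <= (real w + 1) ^ 2 * real w" using w(1) by (intro mult_right_mono power_mono) auto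
   then have "1 / ((real w + 1) ^ 2 * real w) <= 1 / (4 * real w)" using w(1) by (intro divide_left_mono) auto
   also have "\<dots> < ep / 4" using w e(1) by (simp add: field_simps)
   finally show ?thesis using card_sifted_diff[OF x1 w(1)] elim(4) e(1) by simp
  qed
  have Hpos: "?H > 0" unfolding HK using K by (simp add: add_pos_nonneg)
  have finT: "finite (?T u)" for u by (rule finite_subset[of _ "sifted w x"]) auto
  have TG: "real (card (?T u)) = G u x * ?H" for u unfolding G_def using HK K by simp
  have G1: "G u x <= 1" for u
  proof -
   have "card (?T u) <= card (sifted w x)" by (rule card_mono) auto
   then show ?thesis unfolding G_def using Hpos by (simp add: divide_le_eq_1)
  qed
  have G0: "G u x >= 0" for u unfolding G_def by simp
  \<comment> \<open>Outside the bad pairs the Selmer ratio and the truncated sum differ by at most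
    dl dev, so thresholds shifted by dl bracket the one for z.\<close>
  have "?S x \<subseteq> ?T (z + dl) \<union> bad_pairs w dl x" using sub by (auto simp: bad_pairs_def dev_def[symmetric] distrib_right)
  then have "card (?S x) <= card (?T (z + dl) \<union> bad_pairs w dl x)" by (rule card_mono[rotated]) (use finT finbad in blast)
  then have "real (card (?S x)) <= real (card (?T (z + dl))) + ?bad" using card_Un_le[of "?T (z + dl)" "bad_pairs w dl x"] by linarith
  also have "\<dots> = G (z + dl) x * ?K + G (z + dl) x * ?d + ?bad" unfolding TG HK by (simp add: distrib_left)
  also have "\<dots> <= G (z + dl) x * ?K + 1 * ?d + ?bad" using G1[of "z + dl"] by (intro add_mono mult_right_mono order_refl) auto
  finally have "real (card (?S x)) / ?K <= (G (z + dl) x * ?K + 1 * ?d + ?bad) / ?K" using K by (intro divide_right_mono) auto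
  then have up: "real (card (?S x)) / ?K <= G (z + dl) x + ?d / ?K + ?bad / ?K" using K by (simp add: add_divide_distrib)
  have "?T (z - dl) \<subseteq> ?S x \<union> bad_pairs w dl x \<union> (sifted w x - curve_family x)"
   by (auto simp: bad_pairs_def dev_def[symmetric] left_diff_distrib)
  then have "card (?T (z - dl)) <= card (?S x \<union> bad_pairs w dl x \<union> (sifted w x - curve_family x))"
  proof (rule card_mono[rotated])
   have "finite (?S x)" by (rule finite_subset[OF _ fin]) auto
   then show "finite (?S x \<union> bad_pairs w dl x \<union> (sifted w x - curve_family x))" using finbad by simp
  qed
  then have "real (card (?T (z - dl))) <= real (card (?S x)) + ?bad + ?d"
   using card_Un_le[of "?S x \<union> bad_pairs w dl x" "sifted w x - curve_family x"] card_Un_le[of "?S x" "bad_pairs w dl x"] by linarith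
  then have "G (z - dl) x * ?K <= real (card (?S x)) + ?bad + ?d"
   unfolding TG HK distrib_left using mult_nonneg_nonneg[OF G0[of "z - dl"], of ?d] by linarith
  then have "G (z - dl) x * ?K / ?K <= (real (card (?S x)) + ?bad + ?d) / ?K" using K by (intro divide_right_mono) auto
  then have lo: "G (z - dl) x <= real (card (?S x)) / ?K + ?bad / ?K + ?d / ?K" using K by (simp add: add_divide_distrib)
  \<comment> \<open>Proportions were measured in the box, of which the family is at least
    half.\<close>
  have conv: "y / ?K <= 2 * (y / ?N)" if "y >= 0" for y
  proof -
   have "y / ?K <= y / (?N / 2)" using that N K by (intro divide_left_mono) auto
   then show ?thesis by (simp add: mult.commute)
  qed
  have "?bad / ?K < ep" "?d / ?K < 2 * ep" using conv[of ?bad] conv[of ?d] elim(3) dN by linarith+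
  then show ?case using up lo elim(1,2) e by (simp add: dist_real_def abs_less_iff)
 qed
qed

end
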